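(* Let $f\in L^2(\mathbb R^2)$ with $J(f)<+\infty$ and $\partial J(f)\ne\emptyset$. Let $(w_n)\subset L^2(\mathbb R^2)$ and $(\lambda_n)\subset(0,\infty)$ with $\lambda_n\to0^+$ and $\|w_n\|_{L^2}/\lambda_n\le\sqrt{4\pi}/4$ for all $n$. Let $u_n=u_{\lambda_n,w_n}$ and $U_n^{(t)}$ its level sets. Then, up to a subsequence, for a.e. $t\in\mathbb R$, $$\lim_{n\to\infty}|U_n^{(t)}\triangle F^{(t)}|=0\quad\text{and}\quad\lim_{n\to\infty}\partial U_n^{(t)}=\partial F^{(t)},$$ the last limit in the sense of Painlevé–Kuratowski (equivalently Hausdorff) convergence. If in addition $\|w_n\|_{L^2}/\lambda_n\to0$, then the full sequence satisfies $$\mathrm{supp}(Df)\subseteq\liminf_{n\to\infty}\mathrm{supp}(Du_n)\subseteq\limsup_{n\to\infty}\mathrm{supp}(Du_n)\subseteq\mathrm{Ext}(Df).$$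
   Context: $J$ total variation on $\mathbb R^2$, $P$ perimeter, $|\cdot|$ Lebesgue measure, $\partial J$ subdifferential on $L^2(\mathbb R^2)$. For $\lambda>0$, $w\in L^2$, $u_{\lambda,w}$ is the unique minimizer of $\lambda J(u)+\frac12\|u-f-w\|^2_{L^2}$. $v_{0,0}$ is the minimal $L^2$-norm element of $\partial J(f)$; $\mathrm{Ext}(Df)=\overline{\bigcup\{\mathrm{supp}(Dg): g\in L^2,\ v_{0,0}\in\partial J(g)\}}$. Level sets of a function $g$: $G^{(t)}=\{g\ge t\}$ for $t>0$, $\{g\le t\}$ for $t<0$; $F^{(t)}$ are those of $f$. Each set of finite perimeter is identified with the representative such that every $x$ in its topological boundary $\partial E$ satisfies $0<|E\cap B(x,r)|<|B(x,r)|$ for all $r>0$. Painlevé–Kuratowski limits: $\liminf_n S_n=\{x:\limsup_n\mathrm{dist}(x,S_n)=0\}$, $\limsup_nS_n=\{x:\liminf_n\mathrm{dist}(x,S_n)=0\}$, and $\lim_nS_n=S$ means both equal $S$. *)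

theory Defs
  imports "HOL-Analysis.Analysis"
begin

type_synonym R2 = "real^2"

definition L2 :: "(R2 \<Rightarrow> real) \<Rightarrow> bool" where
  "L2 g \<longleftrightarrow> g \<in> borel_measurable lebesgue \<and> integrable lebesgue (\<lambda>x. (g x)^2)"

definition L2norm :: "(R2 \<Rightarrow> real) \<Rightarrow> real" where
  "L2norm g = sqrt (integral\<^sup>L lebesgue (\<lambda>x. (g x)^2))"

definition tsupp :: "(R2 \<Rightarrow> R2) \<Rightarrow> R2 set" where
  "tsupp \<phi> = closure {x. \<phi> x \<noteq> 0}"

definition testfield :: "(R2 \<Rightarrow> R2) \<Rightarrow> bool" where
  "testfield \<phi> \<longleftrightarrow> (\<forall>x. \<phi> differentiable (at x))
     \<and> (\<forall>v. continuous_on UNIV (\<lambda>x. frechet_derivative \<phi> (at x) v))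
     \<and> compact (tsupp \<phi>)"

definition divg :: "(R2 \<Rightarrow> R2) \<Rightarrow> R2 \<Rightarrow> real" where
  "divg \<phi> x = (\<Sum>i\<in>UNIV. (frechet_derivative \<phi> (at x) (axis i 1)) $ i)"

definition TV :: "(R2 \<Rightarrow> real) \<Rightarrow> ereal" where
  "TV u = (SUP \<phi> \<in> {\<phi>. testfield \<phi> \<and> (\<forall>x. norm (\<phi> x) \<le> 1)}.
              ereal (integral\<^sup>L lebesgue (\<lambda>x. u x * divg \<phi> x)))"

definition subdiffJ :: "(R2 \<Rightarrow> real) \<Rightarrow> (R2 \<Rightarrow> real) set" where
  "subdiffJ u = {v. L2 v \<and> TV u < \<infinity> \<and>
     (\<forall>g. L2 g \<longrightarrow> TV u + ereal (integral\<^sup>L lebesgue (\<lambda>x. v x * (g x - u x))) \<le> TV g)}"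

definition suppD :: "(R2 \<Rightarrow> real) \<Rightarrow> R2 set" where
  "suppD g = {x. \<forall>r>0. \<exists>\<phi>. testfield \<phi> \<and> tsupp \<phi> \<subseteq> ball x r \<and>
                  integral\<^sup>L lebesgue (\<lambda>y. g y * divg \<phi> y) \<noteq> 0}"

text \<open>Minimal L^2-norm elements of the subdifferential (v_{0,0}; unique up to a.e. equality).\<close>
definition minsub :: "(R2 \<Rightarrow> real) \<Rightarrow> (R2 \<Rightarrow> real) set" where
  "minsub f = {v. v \<in> subdiffJ f \<and> (\<forall>v'\<in>subdiffJ f. L2norm v \<le> L2norm v')}"

definition Ext :: "(R2 \<Rightarrow> real) \<Rightarrow> R2 set" where
  "Ext f = closure (\<Union> {suppD g | g. L2 g \<and> (\<exists>v\<in>minsub f. v \<in> subdiffJ g)})"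

definition is_minimizer :: "real \<Rightarrow> (R2 \<Rightarrow> real) \<Rightarrow> (R2 \<Rightarrow> real) \<Rightarrow> bool" where
  "is_minimizer lam h u \<longleftrightarrow> L2 u \<and>
     (\<forall>v. L2 v \<longrightarrow> ereal lam * TV u + ereal ((L2norm (\<lambda>x. u x - h x))^2 / 2)
                 \<le> ereal lam * TV v + ereal ((L2norm (\<lambda>x. v x - h x))^2 / 2))"

text \<open>Level sets (the value at t = 0 is irrelevant, statements are for a.e. t).\<close>
definition lev :: "(R2 \<Rightarrow> real) \<Rightarrow> real \<Rightarrow> R2 set" where
  "lev g t = (if t > 0 then {x. g x \<ge> t} else {x. g x \<le> t})"

definition good_rep :: "R2 set \<Rightarrow> R2 set \<Rightarrow> bool" where
  "good_rep E' E \<longleftrightarrow> E' \<in> sets lebesgue \<and> emeasure lebesgue ((E' - E) \<union> (E - E')) = 0 \<and>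
     (\<forall>x\<in>frontier E'. \<forall>r>0. 0 < emeasure lebesgue (E' \<inter> ball x r)
                                \<and> emeasure lebesgue (E' \<inter> ball x r) < emeasure lebesgue (ball x r))"

definition sdist :: "R2 \<Rightarrow> R2 set \<Rightarrow> ereal" where
  "sdist x S = (if S = {} then \<infinity> else ereal (infdist x S))"

definition pk_liminf :: "(nat \<Rightarrow> R2 set) \<Rightarrow> R2 set" where
  "pk_liminf S = {x. limsup (\<lambda>n. sdist x (S n)) = 0}"

definition pk_limsup :: "(nat \<Rightarrow> R2 set) \<Rightarrow> R2 set" where
  "pk_limsup S = {x. liminf (\<lambda>n. sdist x (S n)) = 0}"

definition pk_lim :: "(nat \<Rightarrow> R2 set) \<Rightarrow> R2 set \<Rightarrow> bool" where
  "pk_lim S T \<longleftrightarrow> pk_liminf S = T \<and> pk_limsup S = T"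

end

theory Submission
  imports Defs "HOL-Analysis.Analysis"
begin

text \<open>The dual variables \<open>v\<^sub>n = (f + w\<^sub>n - u\<^sub>n) / \<lambda>\<^sub>n\<close> are projections of \<open>(f + w\<^sub>n) / \<lambda>\<^sub>n\<close> onto the closed
  convex hull of the divergences of unit test fields. The noiseless projections converge strongly to
  \<open>v\<^sub>0\<^sub>,\<^sub>0\<close>, and projections are nonexpansive, so on small balls the \<open>v\<^sub>n\<close> have norm below \<open>3/5 \<surd>\<pi>\<close>,
  uniformly in the centre. Each level set \<open>E\<close> of \<open>u\<^sub>n\<close> is calibrated by \<open>\<plusminus>v\<^sub>n\<close>; comparing \<open>E\<close> with
  itself cut off near a boundary point, the isoperimetric inequality forces \<open>E\<close> and its complement to
  occupy a definite fraction of every small disc centred there. Boundaries of the \<open>U\<^sub>n\<^sup>(\<^sup>t\<^sup>)\<close> can therefore only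
  accumulate on \<open>\<partial>F\<^sup>(\<^sup>t\<^sup>)\<close>, for every \<open>t \<noteq> 0\<close> with \<open>|{f = t}| = 0\<close> and without passing to a subsequence.

  For the outer bound on the supports, convex combinations of level set indicators converge strongly
  to some \<open>h\<close> with \<open>v\<^sub>0\<^sub>,\<^sub>0 \<in> \<partial>J(h)\<close>. No variation is lost in the limit, so if \<open>Dh\<close> vanished near a limit
  of boundary points, some level set would have tiny variation there, against the density estimate.\<close>

section \<open>Convex sets in Hilbert space\<close>

text \<open>Variation is read only through pairings with divergences of unit fields. Sets are
  therefore cut by C^1 cutoffs, and the length of a circle in the classical comparison becomes the
  area of a ring divided by its width. A level set inherits the calibration because smooth steps of
  \<open>u\<close> split its variation. The isoperimetric inequality is obtained by averaging
  translations: area M forces variation at least 3/4 sqrt(pi M), against the sharp 2 sqrt(pi M).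
  This suffices because the noise contributes sqrt(4 pi)/4 = 1/2 sqrt pi to the dual variable; the
  threshold 3/5 sqrt pi lies between 1/2 and 3/4 and leaves room for the local mass of
  \<open>v0\<close> and for the distance of the noiseless projections from it. For the outer bound
  the chosen levels may tend to 0, so Chebyshev does not bound the areas of the level sets; the
  calibration has to. Strong limits come from nearly minimal elements of the convex hulls of tails:
  an upper bound on a linear functional that holds along a tail passes to convex combinations and to
  their limit.\<close>

text \<open>The squared distance of 0 from \<open>C n\<close> increases with \<open>n\<close> and is
  bounded by B^2, so it converges; the parallelogram law then makes every nearly minimal choice
  Cauchy. A constant family yields the projection onto a closed convex set, the convex hulls of
  tails yield strong limits where only weak ones could be expected.\<close>

lemma near_minimal_sequence:
  fixes C :: "nat \<Rightarrow> 'a::{real_inner,complete_space} set"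
  assumes conv: "\<And>n. convex (C n)" and anti: "\<And>m n. m \<le> n \<Longrightarrow> C n \<subseteq> C m"
    and bdd: "\<And>n. \<exists>x\<in>C n. norm x \<le> B"
  obtains h p where "\<And>n. h n \<in> C n" "h \<longlonglongrightarrow> p"
    "\<And>n x. x \<in> C n \<Longrightarrow> (norm (h n))\<^sup>2 \<le> (norm x)\<^sup>2 + inverse (real (Suc n))"
proof -
  define q where "q n = inverse (real (Suc n))" for n
  have qpos: "q n > 0" for n by (simp add: q_def)
  have qanti: "q m \<le> q n" if "n \<le> m" for m n using that by (simp add: q_def le_imp_inverse_le)
  define d where "d n = Inf ((\<lambda>x. (norm x)\<^sup>2) ` C n)" for n
  have ne: "C n \<noteq> {}" for n using bdd[of n] by blast
  have bb: "bdd_below ((\<lambda>x. (norm x)\<^sup>2) ` C n)" for n by (rule bdd_belowI[of _ 0]) auto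
  have dle: "d n \<le> (norm x)\<^sup>2" if "x \<in> C n" for n x
    unfolding d_def by (rule cInf_lower[OF _ bb]) (use that in auto)
  have "\<exists>h. h \<in> C n \<and> (norm h)\<^sup>2 \<le> d n + q n" for n
  proof -
    have "d n < d n + q n" using qpos by simp
    then obtain y where "y \<in> (\<lambda>x. (norm x)\<^sup>2) ` C n" "y < d n + q n"
      unfolding d_def using cInf_lessD ne by (metis image_is_empty)
    thus ?thesis by force
  qed
  then obtain h where h: "\<And>n. h n \<in> C n" "\<And>n. (norm (h n))\<^sup>2 \<le> d n + q n" by metis
  have dmono: "d m \<le> d n" if "m \<le> n" for m n
    unfolding d_def by (rule cInf_superset_mono) (use ne anti[OF that] bb in auto)
  have dB: "d n \<le> B\<^sup>2" for n
  proof -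
    obtain x where "x \<in> C n" "norm x \<le> B" using bdd by blast
    with dle[of x n] power_mono[of "norm x" B 2] show ?thesis by simp
  qed
  have "Bseq d"
  proof (rule BseqI')
    fix n show "norm (d n) \<le> \<bar>d 0\<bar> + B\<^sup>2"
      using dmono[of 0 n] dB[of n] zero_le_power2[of B] unfolding real_norm_def by linarith
  qed
  hence "convergent d" using dmono by (intro Bseq_monoseq_convergent) (auto simp: monoseq_def)
  hence cd: "Cauchy d" by (rule convergent_Cauchy)
  \<comment> \<open>The midpoint of \<open>h n\<close> and \<open>h m\<close> lies in the larger set
    \<open>C n\<close>, so its squared norm is at least the infimum \<open>d n\<close>; the
    parallelogram law turns this into a bound on the distance.\<close>
  have key: "(norm (h n - h m))\<^sup>2 \<le> 2 * (d m - d n) + 4 * q n" if "n \<le> m" for n m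
  proof -
    have "h m \<in> C n" using h(1)[of m] anti[OF that] by blast
    hence "(1/2) *\<^sub>R h n + (1/2) *\<^sub>R h m \<in> C n"
      using convexD[OF conv h(1)[of n], of "h m" "1/2" "1/2"] by simp
    from dle[OF this] have "4 * d n \<le> (norm (h n + h m))\<^sup>2"
      by (simp add: scaleR_add_right[symmetric] power_mult_distrib power2_eq_square)
    moreover have "(norm (h n - h m))\<^sup>2 + (norm (h n + h m))\<^sup>2 = 2 * (norm (h n))\<^sup>2 + 2 * (norm (h m))\<^sup>2"
      by (simp add: power2_norm_eq_inner algebra_simps inner_commute)
    moreover have "q m \<le> q n" using qanti that by simp
    moreover have "D \<le> 2 * (d m - d n) + 4 * q n"
      if "4 * d n \<le> S" "D + S = 2 * a + 2 * b" "q m \<le> q n" "a \<le> d n + q n" "b \<le> d m + q m" for D S a b :: real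
      using that by argo
    ultimately show ?thesis using h(2)[of n] h(2)[of m] by blast
  qed
  have "Cauchy h"
  proof (rule CauchyI)
    fix e :: real assume e: "e > 0"
    hence e2: "e\<^sup>2 / 8 > 0" by simp
    obtain N1 where N1: "\<And>m n. m \<ge> N1 \<Longrightarrow> n \<ge> N1 \<Longrightarrow> norm (d m - d n) < e\<^sup>2 / 8"
      using CauchyD[OF cd e2] by blast
    obtain N2 where N2: "q N2 < e\<^sup>2 / 8" using reals_Archimedean[OF e2] by (auto simp: q_def)
    have le: "norm (h n - h m) < e" if "n \<le> m" "n \<ge> max N1 N2" for n m
    proof -
      have "q n \<le> q N2" using qanti that by simp
      moreover have "d m - d n < e\<^sup>2 / 8" using order_le_less_trans[OF abs_ge_self N1[of m n, unfolded real_norm_def]] that by simp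
      ultimately have "(norm (h n - h m))\<^sup>2 < e\<^sup>2"
        using key[OF that(1)] N2 e2 by argo
      thus ?thesis using e by (simp add: power_less_imp_less_base)
    qed
    show "\<exists>M. \<forall>m\<ge>M. \<forall>n\<ge>M. norm (h m - h n) < e"
    proof (intro exI[of _ "max N1 N2"] allI impI)
      fix m n assume "max N1 N2 \<le> m" "max N1 N2 \<le> n"
      thus "norm (h m - h n) < e" using le[of m n] le[of n m] by (cases "m \<le> n") (auto simp: norm_minus_commute)
    qed
  qed
  then obtain p where "h \<longlonglongrightarrow> p" using Cauchy_convergent convergent_def by blast
  moreover have "(norm (h n))\<^sup>2 \<le> (norm x)\<^sup>2 + q n" if "x \<in> C n" for n x
    using h(2)[of n] dle[OF that] by simp
  ultimately show ?thesis using that h(1) unfolding q_def by blast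
qed

text \<open>The element of least norm in \<open>K - x\<close> is the limit of a near-minimal
  sequence of the constant family; the obtuse angle condition is the first-order condition at a
  closest point.\<close>

lemma closed_convex_projection:
  fixes K :: "'a::{real_inner,complete_space} set"
  assumes "convex K" "closed K" "K \<noteq> {}"
  obtains p where "p \<in> K" "\<And>d. d \<in> K \<Longrightarrow> inner (x - p) (d - p) \<le> 0"
proof -
  obtain k where k: "k \<in> K" using assms by blast
  define C where "C = (\<lambda>y. y - x) ` K"
  have cC: "convex C" using assms(1) convex_translation_subtract unfolding C_def by blast
  have clC: "closed C" using assms(2) closed_translation_subtract unfolding C_def by blast
  obtain h q where h: "\<And>n::nat. h n \<in> C" "h \<longlonglongrightarrow> q"
    "\<And>n y. y \<in> C \<Longrightarrow> (norm (h n))\<^sup>2 \<le> (norm y)\<^sup>2 + inverse (real (Suc n))"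
    by (rule near_minimal_sequence[of "\<lambda>_. C" "norm (k - x)"]) (use cC k in \<open>auto simp: C_def\<close>)
  have qC: "q \<in> C" using clC h(1,2) closed_sequentially by blast
  have qmin: "(norm q)\<^sup>2 \<le> (norm y)\<^sup>2" if "y \<in> C" for y
  proof (rule LIMSEQ_le)
    show "(\<lambda>n. (norm (h n))\<^sup>2) \<longlonglongrightarrow> (norm q)\<^sup>2" by (intro tendsto_intros h)
    show "(\<lambda>n. (norm y)\<^sup>2 + inverse (real (Suc n))) \<longlonglongrightarrow> (norm y)\<^sup>2"
      using tendsto_add[OF tendsto_const LIMSEQ_inverse_real_of_nat] by (simp only: add_0_right)
  qed (use h(3)[OF that] in auto)
  obtain p where p: "p \<in> K" "q = p - x" using qC by (auto simp: C_def)
  have "inner (x - p) (d - p) \<le> 0" if d: "d \<in> K" for d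
  proof (rule any_closest_point_dot[OF assms(1,2) p(1) d])
    show "\<forall>z\<in>K. dist x p \<le> dist x z"
    proof
      fix z assume "z \<in> K"
      hence "(norm q)\<^sup>2 \<le> (norm (z - x))\<^sup>2" by (intro qmin) (auto simp: C_def)
      hence "norm q \<le> norm (z - x)" by (simp add: power_mono_iff)
      thus "dist x p \<le> dist x z" by (simp add: p dist_norm norm_minus_commute)
    qed
  qed
  with p(1) that show ?thesis by blast
qed

text \<open>Adding the two obtuse angle conditions gives |p - q|^2 <= <x - y, p - q>. Stated for
  points satisfying these conditions, it applies to the dual variables, which are recognised as
  projections without having been constructed as such.\<close>

lemma projection_nonexpansive:
  fixes p q :: "'a::real_inner"
  assumes "inner (x - p) (q - p) \<le> 0" "inner (y - q) (p - q) \<le> 0"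
  shows "norm (p - q) \<le> norm (x - y)"
proof -
  have "(norm (p - q))\<^sup>2 \<le> inner (x - y) (p - q)"
    using assms by (simp add: power2_norm_eq_inner algebra_simps inner_commute)
  also have "\<dots> \<le> norm (x - y) * norm (p - q)" by (rule norm_cauchy_schwarz)
  finally show ?thesis by (cases "norm (p - q) = 0") (auto simp: power2_eq_square)
qed

text \<open>The assumption on \<open>z n\<close> says that it is the projection of f / lam n onto
  \<open>K\<close>. As the weight falls, maximising <f, .> takes precedence, and among the
  maximisers the projection selects the one of least norm. The norms do not decrease as
  \<open>lam\<close> falls and are bounded by that of any maximiser; this makes the sequence Cauchy
  although \<open>lam\<close> need not be monotone.\<close>

lemma scaled_projection_limit:
  fixes K :: "'a::{real_inner,complete_space} set" and f v :: 'a
  assumes K: "closed K" and v: "v \<in> K" "\<And>d. d \<in> K \<Longrightarrow> inner f d \<le> inner f v"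
    and lam: "\<And>n. lam n > 0" "lam \<longlonglongrightarrow> 0"
    and z: "\<And>n. z n \<in> K" "\<And>n d. d \<in> K \<Longrightarrow> inner (f - lam n *\<^sub>R z n) (d - z n) \<le> 0"
  obtains v0 where "v0 \<in> K" "z \<longlonglongrightarrow> v0" "\<And>d. d \<in> K \<Longrightarrow> inner f d \<le> inner f v0"
    "\<And>v'. v' \<in> K \<Longrightarrow> (\<And>d. d \<in> K \<Longrightarrow> inner f d \<le> inner f v') \<Longrightarrow> norm v0 \<le> norm v'"
proof -
  have nb: "norm (z n) \<le> norm v'" if v': "v' \<in> K" "\<And>d. d \<in> K \<Longrightarrow> inner f d \<le> inner f v'" for v' n
  proof -
    have "lam n * (norm (z n))\<^sup>2 \<le> lam n * inner (z n) v'"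
      using z(2)[OF v'(1), of n] v'(2)[OF z(1)[of n]]
      by (simp add: power2_norm_eq_inner algebra_simps)
    hence "(norm (z n))\<^sup>2 \<le> inner (z n) v'" using lam(1)[of n] by simp
    also have "\<dots> \<le> norm (z n) * norm v'" by (rule norm_cauchy_schwarz)
    finally show ?thesis by (cases "norm (z n) = 0") (auto simp: power2_eq_square)
  qed
  \<comment> \<open>Adding the variational inequalities at \<open>z n\<close> and \<open>z m\<close>
    shows <z n, z m> >= |z n|^2 when \<open>lam m \<le> lam n\<close>; the squared distance is then
    at most the difference of the squared norms.\<close>
  have key: "(norm (z n - z m))\<^sup>2 \<le> (norm (z m))\<^sup>2 - (norm (z n))\<^sup>2" if le: "lam m \<le> lam n" for n m
  proof -
    define A B P where "A = (norm (z n))\<^sup>2" and "B = (norm (z m))\<^sup>2" and "P = inner (z n) (z m)"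
    have e: "(norm (z n - z m))\<^sup>2 = A + B - 2 * P"
      by (simp add: A_def B_def P_def power2_norm_eq_inner algebra_simps inner_commute)
    hence 1: "A + B - 2 * P \<ge> 0" by (metis zero_le_power2)
    have 2: "lam n * A + lam m * B \<le> (lam n + lam m) * P"
      using z(2)[OF z(1)[of m], of n] z(2)[OF z(1)[of n], of m]
      by (simp add: A_def B_def P_def power2_norm_eq_inner algebra_simps inner_commute)
    show ?thesis
    proof (cases "lam m = lam n")
      case True
      hence "lam n * (A + B) \<le> lam n * (2 * P)" using 2 by (simp add: algebra_simps)
      hence "A + B \<le> 2 * P" using lam(1)[of n] by simp
      hence "(norm (z n - z m))\<^sup>2 \<le> 0" using e by simp
      hence "z n = z m" by simp
      thus ?thesis by simp
    next
      case False
      \<comment> \<open>\<open>B\<close> is replaced by its lower bound 2P - A, which expresses |z n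
        - z m|^2 >= 0. What remains is divided by lam n - lam m, hence the separate treatment of
        equality.\<close>
      have "lam m * (2 * P - A) \<le> lam m * B" using 1 lam(1)[of m] by simp
      hence "(lam n - lam m) * A \<le> (lam n - lam m) * P" using 2 by (simp add: algebra_simps)
      hence "A \<le> P" using False le by simp
      thus ?thesis unfolding e by (simp add: A_def[symmetric] B_def[symmetric])
    qed
  qed
  have bd: "bdd_above (range (\<lambda>n. (norm (z n))\<^sup>2))"
    by (rule bdd_aboveI[of _ "(norm v)\<^sup>2"]) (use nb[OF v] in \<open>auto intro: power_mono\<close>)
  define L where "L = (SUP n. (norm (z n))\<^sup>2)"
  have leL: "(norm (z n))\<^sup>2 \<le> L" for n unfolding L_def by (rule cSUP_upper[OF _ bd]) simp
  have "Cauchy z"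
  proof (rule CauchyI)
    fix e :: real assume e: "e > 0"
    \<comment> \<open>The norm at one index \<open>N\<close> is close to the supremum; once
      \<open>lam\<close> has dropped below \<open>lam N\<close>, all norms are at least as
      close.\<close>
    have "L - e\<^sup>2 < L" using e by simp
    then obtain N where N: "L - e\<^sup>2 < (norm (z N))\<^sup>2"
      unfolding L_def using less_cSUP_iff[OF _ bd] by auto
    from order_tendstoD(2)[OF lam(2) lam(1)[of N]]
    obtain M where M: "\<And>n. n \<ge> M \<Longrightarrow> lam n < lam N" by (auto simp: eventually_sequentially)
    have big: "L - e\<^sup>2 < (norm (z n))\<^sup>2" if "n \<ge> M" for n
    proof -
      have "0 \<le> (norm (z n))\<^sup>2 - (norm (z N))\<^sup>2"
        using key[of n N] M[OF that] by (smt (verit) zero_le_power2)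
      thus ?thesis using N by linarith
    qed
    have le: "norm (z n - z m) < e" if "n \<ge> M" "m \<ge> M" "lam m \<le> lam n" for n m
    proof -
      have "(norm (z n - z m))\<^sup>2 < e\<^sup>2" using key[OF that(3)] big[OF that(1)] leL[of m] by simp
      thus ?thesis using e by (simp add: power_less_imp_less_base)
    qed
    show "\<exists>M. \<forall>m\<ge>M. \<forall>n\<ge>M. norm (z m - z n) < e"
      using le by (metis linear norm_minus_commute)
  qed
  then obtain v0 where v0: "z \<longlonglongrightarrow> v0" using Cauchy_convergent convergent_def by blast
  have v0K: "v0 \<in> K" using K z(1) v0 closed_sequentially by blast
  have "inner f d \<le> inner f v0" if d: "d \<in> K" for d
  proof -
    have "(\<lambda>n. inner (f - lam n *\<^sub>R z n) (d - z n)) \<longlonglongrightarrow> inner (f - 0 *\<^sub>R v0) (d - v0)"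
      by (intro tendsto_intros lam v0)
    hence "inner (f - 0 *\<^sub>R v0) (d - v0) \<le> 0" by (rule LIMSEQ_le_const2) (use z(2)[OF d] in auto)
    thus ?thesis by (simp add: inner_diff_right)
  qed
  moreover have "norm v0 \<le> norm v'" if "v' \<in> K" "\<And>d. d \<in> K \<Longrightarrow> inner f d \<le> inner f v'" for v'
    by (rule LIMSEQ_le_const2[OF tendsto_norm[OF v0]]) (use nb[OF that] in auto)
  ultimately show ?thesis using that v0K v0 by blast
qed

text \<open>The closed convex hull of \<open>D\<close>, written as the intersection of the closed
  half-spaces containing it. Closedness and convexity are then immediate, and membership is
  literally the dual inequality required of a calibration.\<close>

definition polar_hull :: "'a::real_inner set \<Rightarrow> 'a set" where
  "polar_hull D = {v. \<forall>g c. (\<forall>d\<in>D. inner g d \<le> c) \<longrightarrow> inner g v \<le> c}"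

lemma polar_hull_eq: "polar_hull D = (\<Inter>(g,c)\<in>{(g,c). \<forall>d\<in>D. inner g d \<le> c}. {v. inner g v \<le> c})"
  by (auto simp: polar_hull_def)

lemma closed_polar_hull: "closed (polar_hull D)"
  unfolding polar_hull_eq by (intro closed_INT) (auto intro: closed_halfspace_le)

lemma convex_polar_hull: "convex (polar_hull D)"
  unfolding polar_hull_eq by (intro convex_INT) (auto intro: convex_halfspace_le)

lemma polar_hull_superset: "D \<subseteq> polar_hull D"
  by (auto simp: polar_hull_def)

lemma polar_hullD: "v \<in> polar_hull D \<Longrightarrow> (\<And>d. d \<in> D \<Longrightarrow> inner g d \<le> c) \<Longrightarrow> inner g v \<le> c"
  by (auto simp: polar_hull_def)

section \<open>The Hilbert space of square-integrable functions\<close>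

lemma L2_measurable: "L2 f \<Longrightarrow> f \<in> borel_measurable lebesgue"
  by (simp add: L2_def)

lemma L2_integrable_sq: "L2 f \<Longrightarrow> integrable lebesgue (\<lambda>x. (f x)\<^sup>2)"
  by (simp add: L2_def)

lemma L2_integrable_mult:
  assumes "L2 f" "L2 g" shows "integrable lebesgue (\<lambda>x. f x * g x)"
proof (rule Bochner_Integration.integrable_bound)
  show "integrable lebesgue (\<lambda>x. (f x)\<^sup>2 + (g x)\<^sup>2)" using assms by (simp add: L2_def)
  show "(\<lambda>x. f x * g x) \<in> borel_measurable lebesgue"
    using assms L2_measurable by (intro borel_measurable_times) auto
  have "\<bar>a * b\<bar> \<le> a\<^sup>2 + b\<^sup>2" for a b :: real
  proof -
    have "2 * \<bar>a\<bar> * \<bar>b\<bar> \<le> \<bar>a\<bar>\<^sup>2 + \<bar>b\<bar>\<^sup>2" by (rule sum_squares_bound)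
    moreover have "0 \<le> \<bar>a\<bar> * \<bar>b\<bar>" by simp
    ultimately show ?thesis by (simp only: power2_abs abs_mult)
  qed
  thus "AE x in lebesgue. norm (f x * g x) \<le> norm ((f x)\<^sup>2 + (g x)\<^sup>2)" by simp
qed

lemma L2_add: assumes "L2 f" "L2 g" shows "L2 (\<lambda>x. f x + g x)"
proof -
  have "integrable lebesgue (\<lambda>x. (f x)\<^sup>2 + 2 * (f x * g x) + (g x)\<^sup>2)"
    using assms L2_integrable_mult[OF assms] by (simp add: L2_def)
  moreover have "(\<lambda>x. (f x)\<^sup>2 + 2 * (f x * g x) + (g x)\<^sup>2) = (\<lambda>x. (f x + g x)\<^sup>2)"
    by (auto simp: power2_sum)
  ultimately show ?thesis using assms by (auto simp: L2_def intro: borel_measurable_add)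
qed

lemma L2_cmult: "L2 f \<Longrightarrow> L2 (\<lambda>x. c * f x)"
  by (auto simp: L2_def power_mult_distrib intro: borel_measurable_times)

lemma L2_uminus: "L2 f \<Longrightarrow> L2 (\<lambda>x. - f x)"
  by (simp add: L2_def)

lemma L2_diff: "L2 f \<Longrightarrow> L2 g \<Longrightarrow> L2 (\<lambda>x. f x - g x)"
  using L2_add[OF _ L2_uminus] by simp

lemma L2_zero: "L2 (\<lambda>x. 0)" by (simp add: L2_def)

lemma L2_bound:
  assumes "L2 f" "g \<in> borel_measurable lebesgue" "\<And>x. \<bar>g x\<bar> \<le> c * \<bar>f x\<bar>"
  shows "L2 g"
  unfolding L2_def
proof
  show "integrable lebesgue (\<lambda>x. (g x)\<^sup>2)"
  proof (rule Bochner_Integration.integrable_bound)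
    show "integrable lebesgue (\<lambda>x. c\<^sup>2 * (f x)\<^sup>2)" using assms(1) by (simp add: L2_def)
    show "(\<lambda>x. (g x)\<^sup>2) \<in> borel_measurable lebesgue" using assms(2) by simp
    have "(g x)\<^sup>2 \<le> c\<^sup>2 * (f x)\<^sup>2" for x
      using power_mono[OF assms(3)[of x], of 2] by (simp add: power_mult_distrib)
    thus "AE x in lebesgue. norm ((g x)\<^sup>2) \<le> norm (c\<^sup>2 * (f x)\<^sup>2)" by simp
  qed
qed (rule assms)

lemma L2_AE_cong:
  assumes "L2 f" "AE x in lebesgue. f x = g x" "g \<in> borel_measurable lebesgue"
  shows "L2 g"
proof -
  have "integrable lebesgue (\<lambda>x. (g x)\<^sup>2)"
    by (rule integrable_cong_AE_imp[OF L2_integrable_sq[OF assms(1)]]) (use assms in auto)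
  thus ?thesis using assms by (simp add: L2_def)
qed

text \<open>A partial equivalence: reflexive on square-integrable functions only, so the quotient
  discards all others.\<close>

definition ae_rel :: "(R2 \<Rightarrow> real) \<Rightarrow> (R2 \<Rightarrow> real) \<Rightarrow> bool" where
  "ae_rel f g \<longleftrightarrow> L2 f \<and> L2 g \<and> (AE x in lebesgue. f x = g x)"

quotient_type l2 = "R2 \<Rightarrow> real" / partial: ae_rel
proof (rule part_equivpI)
  show "\<exists>f. ae_rel f f" using L2_zero by (auto simp: ae_rel_def)
  show "symp ae_rel"
    by (rule sympI) (auto simp: ae_rel_def eq_commute)
  show "transp ae_rel"
  proof (rule transpI)
    fix f g h assume a: "ae_rel f g" "ae_rel g h"
    hence "AE x in lebesgue. f x = g x" "AE x in lebesgue. g x = h x" by (auto simp: ae_rel_def)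
    hence "AE x in lebesgue. f x = h x" by eventually_elim simp
    thus "ae_rel f h" using a by (auto simp: ae_rel_def)
  qed
qed

instantiation l2 :: real_inner
begin

lift_definition zero_l2 :: l2 is "\<lambda>x. 0" by (simp add: ae_rel_def L2_zero)
lift_definition plus_l2 :: "l2 \<Rightarrow> l2 \<Rightarrow> l2" is "\<lambda>f g x. f x + g x"
  by (auto simp: ae_rel_def L2_add)
lift_definition minus_l2 :: "l2 \<Rightarrow> l2 \<Rightarrow> l2" is "\<lambda>f g x. f x - g x"
  by (auto simp: ae_rel_def L2_diff)
lift_definition uminus_l2 :: "l2 \<Rightarrow> l2" is "\<lambda>f x. - f x"
  by (auto simp: ae_rel_def L2_uminus)
lift_definition scaleR_l2 :: "real \<Rightarrow> l2 \<Rightarrow> l2" is "\<lambda>c f x. c * f x"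
  by (auto simp: ae_rel_def L2_cmult)
lift_definition inner_l2 :: "l2 \<Rightarrow> l2 \<Rightarrow> real" is "\<lambda>f g. \<integral>x. f x * g x \<partial>lebesgue"
proof -
  fix f f' g g' assume "ae_rel f f'" "ae_rel g g'"
  hence m: "f \<in> borel_measurable lebesgue" "f' \<in> borel_measurable lebesgue" "g \<in> borel_measurable lebesgue" "g' \<in> borel_measurable lebesgue"
   and ae: "AE x in lebesgue. f x = f' x" "AE x in lebesgue. g x = g' x"
    by (auto simp: ae_rel_def L2_def)
  show "(\<integral>x. f x * g x \<partial>lebesgue) = (\<integral>x. f' x * g' x \<partial>lebesgue)"
    by (rule integral_cong_AE) (use m ae in auto)
qed

definition norm_l2 :: "l2 \<Rightarrow> real" where "norm_l2 x = sqrt (inner x x)"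
definition dist_l2 :: "l2 \<Rightarrow> l2 \<Rightarrow> real" where "dist_l2 x y = norm (x - y)"
definition sgn_l2 :: "l2 \<Rightarrow> l2" where "sgn_l2 x = inverse (norm x) *\<^sub>R x"
definition uniformity_l2 :: "(l2 \<times> l2) filter"
  where "uniformity_l2 = (INF e\<in>{0 <..}. principal {(x, y). dist x y < e})"
definition open_l2 :: "l2 set \<Rightarrow> bool"
  where "open_l2 U \<longleftrightarrow> (\<forall>x\<in>U. eventually (\<lambda>(x', y). x' = x \<longrightarrow> y \<in> U) uniformity)"

instance
proof
  fix x y z :: l2 and r s :: real
  show "dist x y = norm (x - y)" by (fact dist_l2_def)
  show "sgn x = inverse (norm x) *\<^sub>R x" by (fact sgn_l2_def)
  show "uniformity = (INF e\<in>{0 <..}. principal {(x::l2, y). dist x y < e})" by (fact uniformity_l2_def)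
  show "open U \<longleftrightarrow> (\<forall>x\<in>U. eventually (\<lambda>(x', y). x' = x \<longrightarrow> y \<in> U) uniformity)" for U :: "l2 set"
    by (fact open_l2_def)
  show "x + y + z = x + (y + z)"
    by transfer (auto simp: ae_rel_def intro!: L2_add simp: add.assoc)
  show "x + y = y + x"
    by transfer (auto simp: ae_rel_def intro!: L2_add simp: add.commute)
  show "0 + x = x" by transfer (auto simp: ae_rel_def)
  show "- x + x = 0" by transfer (auto simp: ae_rel_def L2_zero)
  show "x - y = x + - y" by transfer (auto simp: ae_rel_def L2_diff)
  show "r *\<^sub>R (x + y) = r *\<^sub>R x + r *\<^sub>R y"
    by transfer (auto simp: ae_rel_def algebra_simps intro!: L2_add L2_cmult)
  show "(r + s) *\<^sub>R x = r *\<^sub>R x + s *\<^sub>R x"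
    by transfer (auto simp: ae_rel_def algebra_simps intro!: L2_add L2_cmult)
  show "r *\<^sub>R s *\<^sub>R x = (r * s) *\<^sub>R x"
    by transfer (use L2_cmult in \<open>auto simp: ae_rel_def mult.assoc\<close>)
  show "1 *\<^sub>R x = x" by transfer (auto simp: ae_rel_def)
  show "inner x y = inner y x" by transfer (simp add: mult.commute)
  show "inner (x + y) z = inner x z + inner y z"
    by transfer (auto simp: ae_rel_def distrib_right L2_integrable_mult)
  show "inner (r *\<^sub>R x) y = r * inner x y"
    by transfer (simp add: mult.assoc)
  show "0 \<le> inner x x" by transfer simp
  show "inner x x = 0 \<longleftrightarrow> x = 0"
  proof (transfer, unfold ae_rel_def)
    fix f assume f: "L2 f \<and> L2 f \<and> (AE x in lebesgue. f x = f x)"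
    hence "integrable lebesgue (\<lambda>x. f x * f x)" by (simp add: L2_integrable_mult)
    hence "((\<integral>x. f x * f x \<partial>lebesgue) = 0) \<longleftrightarrow> (AE x in lebesgue. f x * f x = 0)"
      by (rule integral_nonneg_eq_0_iff_AE) simp
    thus "((\<integral>x. f x * f x \<partial>lebesgue) = 0) \<longleftrightarrow> L2 f \<and> L2 (\<lambda>x. 0) \<and> (AE x in lebesgue. f x = 0)"
      using f L2_zero by simp
  qed
  show "norm x = sqrt (inner x x)" by (fact norm_l2_def)
qed

end

text \<open>Functions outside L2 are sent to 0, which makes the map total; the arithmetic rules
  below assume \<open>L2\<close> for this reason.\<close>

lift_definition to_l2 :: "(R2 \<Rightarrow> real) \<Rightarrow> l2" is "\<lambda>f. if L2 f then f else (\<lambda>x. 0)"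
  by (simp add: ae_rel_def L2_zero)

definition of_l2 :: "l2 \<Rightarrow> R2 \<Rightarrow> real" where "of_l2 x = rep_l2 x"

lemma ae_rel_rep: "ae_rel (rep_l2 x) (rep_l2 x)"
  using Quotient_l2 by (simp add: Quotient_rep_reflp)

lemma L2_of_l2: "L2 (of_l2 x)"
  using ae_rel_rep[of x] by (simp add: of_l2_def ae_rel_def)

lemma to_l2_of_l2: "to_l2 (of_l2 x) = x"
proof -
  have "to_l2 (of_l2 x) = abs_l2 (of_l2 x)" by (simp add: to_l2_def L2_of_l2)
  thus ?thesis using Quotient_abs_rep[OF Quotient_l2] by (simp add: of_l2_def)
qed

lemma to_l2_add: "L2 f \<Longrightarrow> L2 g \<Longrightarrow> to_l2 (\<lambda>x. f x + g x) = to_l2 f + to_l2 g"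
  by transfer (auto simp: ae_rel_def L2_add)

lemma to_l2_diff: "L2 f \<Longrightarrow> L2 g \<Longrightarrow> to_l2 (\<lambda>x. f x - g x) = to_l2 f - to_l2 g"
  by transfer (auto simp: ae_rel_def L2_diff)

lemma to_l2_uminus: "L2 f \<Longrightarrow> to_l2 (\<lambda>x. - f x) = - to_l2 f"
  by transfer (auto simp: ae_rel_def L2_uminus)

lemma to_l2_cmult: "L2 f \<Longrightarrow> to_l2 (\<lambda>x. c * f x) = c *\<^sub>R to_l2 f"
  by transfer (auto simp: ae_rel_def L2_cmult)

lemma inner_to_l2: "L2 f \<Longrightarrow> L2 g \<Longrightarrow> inner (to_l2 f) (to_l2 g) = (\<integral>x. f x * g x \<partial>lebesgue)"
  by transfer simp

lemma norm_to_l2: "L2 f \<Longrightarrow> norm (to_l2 f) = L2norm f"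
  by (simp add: norm_eq_sqrt_inner inner_to_l2 L2norm_def power2_eq_square)

lemma norm_sq_to_l2: "L2 f \<Longrightarrow> (norm (to_l2 f))\<^sup>2 = (\<integral>x. (f x)\<^sup>2 \<partial>lebesgue)"
  by (simp add: norm_eq_sqrt_inner inner_to_l2 power2_eq_square[symmetric])

lemma L2_Cauchy_Schwarz:
  assumes "L2 f" "L2 g" shows "(\<integral>x. f x * g x \<partial>lebesgue) \<le> L2norm f * L2norm g"
  using norm_cauchy_schwarz[of "to_l2 f" "to_l2 g"] assms by (simp add: inner_to_l2 norm_to_l2)

text \<open>Riesz--Fischer: a subsequence with summable increments converges a.e. (Fatou applied to the
  partial sums of the increments) and, again by Fatou, in norm.\<close>

instance l2 :: complete_space
proof
  fix X :: "nat \<Rightarrow> l2" assume C: "Cauchy X"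
  obtain r where r: "strict_mono r" "\<And>k. norm (X (r (Suc k)) - X (r k)) < (1/2)^k"
  proof -
    have "\<exists>N. \<forall>m\<ge>N. \<forall>n\<ge>N. norm (X m - X n) < (1/2)^k" for k
      using CauchyD[OF C, of "(1/2)^k"] by simp
    then obtain N where N: "\<And>k m n. m \<ge> N k \<Longrightarrow> n \<ge> N k \<Longrightarrow> norm (X m - X n) < (1/2)^k" by metis
    define r where "r = rec_nat (N 0) (\<lambda>k p. max (Suc p) (N (Suc k)))"
    have rS: "r (Suc k) = max (Suc (r k)) (N (Suc k))" for k by (simp add: r_def)
    have rN: "r k \<ge> N k" for k by (cases k) (auto simp: rS r_def)
    have "strict_mono r" by (rule strict_monoI_Suc) (simp add: rS)
    moreover have "norm (X (r (Suc k)) - X (r k)) < (1/2)^k" for k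
      using N[of k "r (Suc k)" "r k"] rN[of k] rS[of k] by simp
    ultimately show ?thesis using that by blast
  qed
  define f where "f k = of_l2 (X (r k))" for k
  have fL: "L2 (f k)" for k by (simp add: f_def L2_of_l2)
  have Xf: "X (r k) = to_l2 (f k)" for k by (simp add: f_def to_l2_of_l2)
  have m[measurable]: "f k \<in> borel_measurable lebesgue" for k using fL by (rule L2_measurable)
  define g where "g k x = \<bar>f (Suc k) x - f k x\<bar>" for k x
  have gm[measurable]: "g k \<in> borel_measurable lebesgue" for k unfolding g_def by measurable
  have gL: "L2 (g k)" for k
    by (rule L2_bound[OF L2_diff[OF fL[of "Suc k"] fL[of k]], of _ 1]) (auto simp: g_def)
  have gn: "norm (to_l2 (g k)) < (1/2)^k" for k
  proof -
    have "norm (to_l2 (g k)) = norm (to_l2 (\<lambda>x. f (Suc k) x - f k x))"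
      using gL L2_diff[OF fL fL] by (simp add: norm_to_l2 L2norm_def g_def)
    thus ?thesis using r(2)[of k] by (simp add: Xf to_l2_diff fL)
  qed
  define s where "s n x = (\<Sum>k<n. g k x)" for n x
  have sL: "L2 (s n) \<and> to_l2 (s n) = (\<Sum>k<n. to_l2 (g k))" for n
  proof (induction n)
    case 0 have "to_l2 (\<lambda>x. 0) = 0" by (metis diff_self to_l2_diff[OF L2_zero L2_zero] cancel_comm_monoid_add_class.diff_cancel)
    thus ?case by (simp add: s_def L2_zero)
  next
    case (Suc n)
    have "s (Suc n) = (\<lambda>x. s n x + g n x)" by (auto simp: s_def)
    thus ?case using Suc gL by (auto simp: L2_add to_l2_add)
  qed
  have sb: "(\<integral>x. (s n x)\<^sup>2 \<partial>lebesgue) \<le> 4" for n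
  proof -
    have "norm (to_l2 (s n)) \<le> (\<Sum>k<n. (1/2)^k)"
      using sL[of n] order_trans[OF norm_sum sum_mono, of "{..<n}" "\<lambda>k. to_l2 (g k)" "\<lambda>k. (1/2)^k"] gn
      by (simp add: less_imp_le)
    also have "\<dots> \<le> (\<Sum>k. (1/2)^k)" by (rule sum_le_suminf) auto
    also have "\<dots> = 2" by (subst suminf_geometric) auto
    finally have "(norm (to_l2 (s n)))\<^sup>2 \<le> 2\<^sup>2" by (intro power_mono) auto
    thus ?thesis using norm_sq_to_l2[of "s n"] sL[of n] by simp
  qed
  have g0: "0 \<le> g k x" for k x by (simp add: g_def)
  have "(\<integral>\<^sup>+x. (SUP n. ennreal ((s n x)\<^sup>2)) \<partial>lebesgue) = (SUP n. \<integral>\<^sup>+x. ennreal ((s n x)\<^sup>2) \<partial>lebesgue)"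
  proof (rule nn_integral_monotone_convergence_SUP)
    show "incseq (\<lambda>n x. ennreal ((s n x)\<^sup>2))"
      by (intro monoI le_funI ennreal_leI power_mono) (auto simp: s_def g0 intro!: sum_mono2 sum_nonneg)
    show "(\<lambda>x. ennreal ((s n x)\<^sup>2)) \<in> borel_measurable lebesgue" for n unfolding s_def by measurable
  qed
  also have "\<dots> \<le> ennreal 4"
  proof (rule SUP_least)
    fix n
    have "(\<integral>\<^sup>+x. ennreal ((s n x)\<^sup>2) \<partial>lebesgue) = ennreal (\<integral>x. (s n x)\<^sup>2 \<partial>lebesgue)"
      by (rule nn_integral_eq_integral) (use sL in \<open>auto intro: L2_integrable_sq\<close>)
    thus "(\<integral>\<^sup>+x. ennreal ((s n x)\<^sup>2) \<partial>lebesgue) \<le> ennreal 4" using ennreal_leI[OF sb[of n]] by (simp only:)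
  qed
  finally have "(\<integral>\<^sup>+x. (SUP n. ennreal ((s n x)\<^sup>2)) \<partial>lebesgue) \<noteq> \<infinity>"
    by (auto simp: top_unique)
  hence "AE x in lebesgue. (SUP n. ennreal ((s n x)\<^sup>2)) \<noteq> \<infinity>"
    by (intro nn_integral_PInf_AE) (auto simp: s_def)
  hence conv: "AE x in lebesgue. convergent (\<lambda>n. f n x)"
  proof eventually_elim
    fix x assume "(SUP n. ennreal ((s n x)\<^sup>2)) \<noteq> \<infinity>"
    then obtain c where c: "c \<ge> 0" "(SUP n. ennreal ((s n x)\<^sup>2)) = ennreal c"
      by (cases "SUP n. ennreal ((s n x)\<^sup>2)") auto
    have sq: "(s n x)\<^sup>2 \<le> c" for n
    proof -
      have "ennreal ((s n x)\<^sup>2) \<le> ennreal c" unfolding c(2)[symmetric] by (rule SUP_upper) simp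
      thus ?thesis using c(1) by simp
    qed
    have sle: "s n x \<le> sqrt c" for n using real_le_rsqrt sq by blast
    have "summable (\<lambda>k. g k x)"
      by (rule summableI_nonneg_bounded[of _ "sqrt c"]) (use g0 sle in \<open>auto simp: s_def\<close>)
    hence "summable (\<lambda>k. f (Suc k) x - f k x)" unfolding g_def by (rule summable_rabs_cancel)
    hence "convergent (\<lambda>n. \<Sum>k<n. f (Suc k) x - f k x)" by (simp only: summable_iff_convergent)
    moreover have "(\<lambda>n. \<Sum>k<n. f (Suc k) x - f k x) = (\<lambda>n. f n x - f 0 x)"
      by (rule ext) (rule sum_lessThan_telescope)
    ultimately have "convergent (\<lambda>n. f n x - f 0 x)" by (simp only:)
    thus "convergent (\<lambda>n. f n x)" by (simp only: convergent_diff_const_right_iff)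
  qed
  define F where "F x = lim (\<lambda>n. f n x)" for x
  have Fm[measurable]: "F \<in> borel_measurable lebesgue" unfolding F_def by measurable
  have Fl: "AE x in lebesgue. (\<lambda>n. f n x) \<longlonglongrightarrow> F x"
    using conv by eventually_elim (simp add: F_def convergent_LIMSEQ_iff)
  \<comment> \<open>The same bound serves twice: with c = 1 it puts \<open>F\<close> in L2, with c =
    (e/2)^2 it gives convergence in norm.\<close>
  have fat: "L2 (\<lambda>x. F x - f k x) \<and> (\<integral>x. (F x - f k x)\<^sup>2 \<partial>lebesgue) \<le> c"
    if c: "\<And>j. j \<ge> k \<Longrightarrow> norm (X (r j) - X (r k)) ^ 2 \<le> c" for k c
  proof -
    have c0: "c \<ge> 0" using c[of k] by simp
    have "AE x in lebesgue. ennreal ((F x - f k x)\<^sup>2) \<le> liminf (\<lambda>j. ennreal ((f j x - f k x)\<^sup>2))"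
      using Fl
    proof eventually_elim
      fix x assume "(\<lambda>n. f n x) \<longlonglongrightarrow> F x"
      hence "(\<lambda>j. ennreal ((f j x - f k x)\<^sup>2)) \<longlonglongrightarrow> ennreal ((F x - f k x)\<^sup>2)"
        by (intro tendsto_intros tendsto_ennrealI)
      thus "ennreal ((F x - f k x)\<^sup>2) \<le> liminf (\<lambda>j. ennreal ((f j x - f k x)\<^sup>2))"
        by (simp only: lim_imp_Liminf[OF sequentially_bot] order_refl)
    qed
    hence "(\<integral>\<^sup>+x. ennreal ((F x - f k x)\<^sup>2) \<partial>lebesgue) \<le> (\<integral>\<^sup>+x. liminf (\<lambda>j. ennreal ((f j x - f k x)\<^sup>2)) \<partial>lebesgue)"
      by (rule nn_integral_mono_AE)
    also have "\<dots> \<le> liminf (\<lambda>j. \<integral>\<^sup>+x. ennreal ((f j x - f k x)\<^sup>2) \<partial>lebesgue)"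
      by (rule nn_integral_liminf) measurable
    also have "\<dots> \<le> ennreal c"
    proof (rule Liminf_le)
      show "\<forall>\<^sub>F j in sequentially. (\<integral>\<^sup>+x. ennreal ((f j x - f k x)\<^sup>2) \<partial>lebesgue) \<le> ennreal c"
      proof (rule eventually_sequentiallyI[of k])
        fix j assume "k \<le> j"
        have "(\<integral>\<^sup>+x. ennreal ((f j x - f k x)\<^sup>2) \<partial>lebesgue) = ennreal (\<integral>x. (f j x - f k x)\<^sup>2 \<partial>lebesgue)"
          by (rule nn_integral_eq_integral) (auto intro: L2_integrable_sq[OF L2_diff[OF fL fL]])
        also have "\<dots> = ennreal (norm (X (r j) - X (r k)) ^ 2)"
          by (simp add: Xf to_l2_diff[symmetric] fL norm_sq_to_l2 L2_diff)
        finally show "(\<integral>\<^sup>+x. ennreal ((f j x - f k x)\<^sup>2) \<partial>lebesgue) \<le> ennreal c"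
          using ennreal_leI[OF c[OF \<open>k \<le> j\<close>]] by (simp only:)
      qed
    qed simp
    finally have le: "(\<integral>\<^sup>+x. ennreal ((F x - f k x)\<^sup>2) \<partial>lebesgue) \<le> ennreal c" .
    have int: "integrable lebesgue (\<lambda>x. (F x - f k x)\<^sup>2)"
      by (rule integrableI_bounded) (use le in \<open>auto intro: le_less_trans\<close>)
    hence "ennreal (\<integral>x. (F x - f k x)\<^sup>2 \<partial>lebesgue) \<le> ennreal c"
      using le by (simp add: nn_integral_eq_integral)
    thus ?thesis using int c0 by (simp add: L2_def)
  qed
  have Cr: "Cauchy (\<lambda>k. X (r k))" using Cauchy_subseq_Cauchy[OF C r(1)] by (simp only: comp_def)
  have FL: "L2 F"
  proof -
    obtain N where N: "\<And>m n. m \<ge> N \<Longrightarrow> n \<ge> N \<Longrightarrow> norm (X (r m) - X (r n)) < 1"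
      using CauchyD[OF Cr, of 1] by auto
    have "norm (X (r j) - X (r N)) ^ 2 \<le> 1" if "j \<ge> N" for j
      using N[of j N] that by (simp add: power_le_one less_imp_le)
    hence "L2 (\<lambda>x. F x - f N x)" using fat by blast
    from L2_add[OF this fL[of N]] show ?thesis by simp
  qed
  have "(\<lambda>k. X (r k)) \<longlonglongrightarrow> to_l2 F"
  proof (rule LIMSEQ_I)
    fix e :: real assume e: "0 < e"
    obtain N where N: "\<And>m n. m \<ge> N \<Longrightarrow> n \<ge> N \<Longrightarrow> norm (X (r m) - X (r n)) < e / 2"
      using CauchyD[OF Cr, of "e/2"] e by auto
    have "norm (X (r k) - to_l2 F) < e" if k: "k \<ge> N" for k
    proof -
      have "norm (X (r j) - X (r k)) ^ 2 \<le> (e/2)^2" if "j \<ge> k" for j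
        using N[of j k] that k by (intro power_mono) auto
      hence "(\<integral>x. (F x - f k x)\<^sup>2 \<partial>lebesgue) \<le> (e/2)\<^sup>2" using fat[of k "(e/2)\<^sup>2"] by blast
      hence "(norm (to_l2 F - X (r k)))\<^sup>2 \<le> (e/2)\<^sup>2"
        by (simp add: Xf to_l2_diff[symmetric] fL FL norm_sq_to_l2 L2_diff)
      hence "norm (to_l2 F - X (r k)) \<le> e/2" by (rule power2_le_imp_le) (use e in auto)
      thus ?thesis using e by (simp add: norm_minus_commute)
    qed
    thus "\<exists>no. \<forall>n\<ge>no. norm (X (r n) - to_l2 F) < e" by blast
  qed
  hence "X \<longlonglongrightarrow> to_l2 F"
    by (intro Cauchy_converges_subseq[OF C r(1)]) (simp only: comp_def)
  thus "convergent X" unfolding convergent_def by blast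
qed

section \<open>Continuously differentiable functions and test fields\<close>

text \<open>The gradient is a named argument because divergences of rescaled fields have to be
  computed, not merely known to exist.\<close>

definition C1grad :: "(R2 \<Rightarrow> real) \<Rightarrow> (R2 \<Rightarrow> R2) \<Rightarrow> bool" where
  "C1grad \<eta> G \<longleftrightarrow> (\<forall>x. (\<eta> has_derivative (\<lambda>v. G x \<bullet> v)) (at x)) \<and> continuous_on UNIV G"

lemma C1grad_continuous: "C1grad \<eta> G \<Longrightarrow> continuous_on UNIV \<eta>"
  unfolding C1grad_def by (meson continuous_at_imp_continuous_on has_derivative_continuous)

lemma C1grad_mult:
  assumes "C1grad a A" "C1grad b B"
  shows "C1grad (\<lambda>x. a x * b x) (\<lambda>x. a x *\<^sub>R B x + b x *\<^sub>R A x)"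
  unfolding C1grad_def
proof (intro conjI allI)
  fix x
  have "((\<lambda>x. a x * b x) has_derivative (\<lambda>v. a x * (B x \<bullet> v) + (A x \<bullet> v) * b x)) (at x)"
    using assms by (intro has_derivative_mult) (auto simp: C1grad_def)
  thus "((\<lambda>x. a x * b x) has_derivative (\<lambda>v. (a x *\<^sub>R B x + b x *\<^sub>R A x) \<bullet> v)) (at x)"
    by (rule has_derivative_eq_rhs) (auto simp: inner_add_left)
  show "continuous_on UNIV (\<lambda>x. a x *\<^sub>R B x + b x *\<^sub>R A x)"
    using assms C1grad_continuous unfolding C1grad_def by (intro continuous_intros) auto
qed

lemma C1grad_diff:
  assumes "C1grad a A" "C1grad b B"
  shows "C1grad (\<lambda>x. a x - b x) (\<lambda>x. A x - B x)"
  using assms unfolding C1grad_def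
  by (auto intro!: continuous_intros has_derivative_eq_rhs[OF has_derivative_diff] simp: inner_diff_left)

lemma C1grad_const: "C1grad (\<lambda>x. c) (\<lambda>x. 0)"
  by (auto simp: C1grad_def)

lemma C1grad_one_minus: "C1grad a A \<Longrightarrow> C1grad (\<lambda>x. 1 - a x) (\<lambda>x. - A x)"
  using C1grad_diff[OF C1grad_const, of a A 1] by simp

lemma C1grad_compose:
  assumes h: "\<And>s. (h has_real_derivative h' s) (at s)" "continuous_on UNIV h'" and a: "C1grad a A"
  shows "C1grad (\<lambda>x. h (a x)) (\<lambda>x. h' (a x) *\<^sub>R A x)"
  unfolding C1grad_def
proof (intro conjI allI)
  fix x
  have "((\<lambda>x. h (a x)) has_derivative (\<lambda>v. h' (a x) * (A x \<bullet> v))) (at x)"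
    using has_derivative_compose[of a "\<lambda>v. A x \<bullet> v" x UNIV h "\<lambda>v. h' (a x) * v"] a h(1)[of "a x"]
    by (auto simp: C1grad_def has_field_derivative_def)
  thus "((\<lambda>x. h (a x)) has_derivative (\<lambda>v. (h' (a x) *\<^sub>R A x) \<bullet> v)) (at x)"
    by simp
  show "continuous_on UNIV (\<lambda>x. h' (a x) *\<^sub>R A x)"
    using a C1grad_continuous[OF a] unfolding C1grad_def
    by (intro continuous_intros continuous_on_compose2[OF h(2)]) auto
qed

lemma C1grad_shift: "C1grad a A \<Longrightarrow> C1grad (\<lambda>x. a (x + h)) (\<lambda>x. A (x + h))"
  unfolding C1grad_def
proof (intro conjI allI)
  fix x assume a: "(\<forall>x. (a has_derivative (\<lambda>v. A x \<bullet> v)) (at x)) \<and> continuous_on UNIV A"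
  have "((\<lambda>x. x + h) has_derivative (\<lambda>v. v)) (at x)" by (auto intro!: derivative_eq_intros)
  from has_derivative_compose[OF this, of a "\<lambda>v. A (x + h) \<bullet> v"] a
  show "((\<lambda>x. a (x + h)) has_derivative (\<lambda>v. A (x + h) \<bullet> v)) (at x)" by simp
  show "continuous_on UNIV (\<lambda>x. A (x + h))"
    by (rule continuous_on_compose2[of UNIV A]) (use a in \<open>auto intro!: continuous_intros\<close>)
qed

lemma C1grad_lipschitz:
  assumes "C1grad a A" "\<And>x. norm (A x) \<le> B"
  shows "\<bar>a x - a y\<bar> \<le> B * norm (x - y)"
proof -
  have "norm (a x - a y) \<le> B * norm (x - y)"
  proof (rule differentiable_bound[of UNIV a "\<lambda>x v. A x \<bullet> v"])
    fix x show "(a has_derivative (\<bullet>) (A x)) (at x within UNIV)" using assms by (simp add: C1grad_def)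
    have "\<bar>A x \<bullet> v\<bar> \<le> B * norm v" for v
      using order_trans[OF Cauchy_Schwarz_ineq2 mult_right_mono[OF assms(2)]] by simp
    thus "onorm ((\<bullet>) (A x)) \<le> B" by (intro onorm_le) simp
  qed auto
  thus ?thesis by simp
qed

section \<open>Compactly supported vector fields and their divergence\<close>

lemma tsupp_subset: "closed S \<Longrightarrow> (\<And>x. x \<notin> S \<Longrightarrow> \<phi> x = 0) \<Longrightarrow> tsupp \<phi> \<subseteq> S"
  unfolding tsupp_def by (rule closure_minimal) auto

lemma zero_off_tsupp: "x \<notin> tsupp \<phi> \<Longrightarrow> \<phi> x = 0"
  using closure_subset[of "{x. \<phi> x \<noteq> 0}"] unfolding tsupp_def by auto

lemma compact_tsupp: "(\<And>x. x \<notin> cball y R \<Longrightarrow> \<phi> x = 0) \<Longrightarrow> compact (tsupp \<phi>)"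
  using compact_Int_closed[OF compact_cball, of "tsupp \<phi>" y R] tsupp_subset[of "cball y R" \<phi>]
  by (simp add: inf_absorb2) (simp add: tsupp_def)

text \<open>\<open>frechet_derivative\<close> is given by choice; uniqueness of the derivative lets
  an explicit candidate certify the field and compute its divergence at the same time.\<close>

lemma testfieldI:
  assumes d: "\<And>x. (\<phi> has_derivative \<phi>' x) (at x)" and c: "\<And>v. continuous_on UNIV (\<lambda>x. \<phi>' x v)"
    and s: "compact (tsupp \<phi>)"
  shows "testfield \<phi>" "divg \<phi> x = (\<Sum>i\<in>UNIV. \<phi>' x (axis i 1) $ i)"
proof -
  have e: "frechet_derivative \<phi> (at x) = \<phi>' x" for x
    using frechet_derivative_at[OF d] by simp
  show "testfield \<phi>"
    unfolding testfield_def e using d c s by (auto simp: differentiable_def)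
  show "divg \<phi> x = (\<Sum>i\<in>UNIV. \<phi>' x (axis i 1) $ i)"
    by (simp add: divg_def e)
qed

lemma testfieldD:
  assumes "testfield \<phi>"
  shows "(\<phi> has_derivative frechet_derivative \<phi> (at x)) (at x)"
    "continuous_on UNIV (\<lambda>x. frechet_derivative \<phi> (at x) v)" "compact (tsupp \<phi>)"
  using assms frechet_derivative_works by (auto simp: testfield_def)

lemma testfield_continuous: "testfield \<phi> \<Longrightarrow> continuous_on UNIV \<phi>"
  by (meson testfieldD(1) continuous_at_imp_continuous_on has_derivative_continuous)

lemma testfield_zero_outside:
  assumes "testfield \<phi>"
  obtains R where "R > 0" "\<And>x. x \<notin> cball 0 R \<Longrightarrow> \<phi> x = 0"
proof -
  obtain R where "R > 0" "tsupp \<phi> \<subseteq> cball 0 R"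
    using bounded_subset_ballD[OF compact_imp_bounded[OF testfieldD(3)[OF assms]], of 0] ball_subset_cball by blast
  thus ?thesis using that zero_off_tsupp by blast
qed

lemma testfield_add:
  assumes "testfield \<phi>" "testfield \<psi>"
  shows "testfield (\<lambda>x. \<phi> x + \<psi> x)" "divg (\<lambda>x. \<phi> x + \<psi> x) x = divg \<phi> x + divg \<psi> x"
proof -
  obtain R where R: "R > 0" "\<And>x. x \<notin> cball 0 R \<Longrightarrow> \<phi> x = 0" using testfield_zero_outside[OF assms(1)] by blast
  obtain T where T: "T > 0" "\<And>x. x \<notin> cball 0 T \<Longrightarrow> \<psi> x = 0" using testfield_zero_outside[OF assms(2)] by blast
  have s: "compact (tsupp (\<lambda>x. \<phi> x + \<psi> x))"
    by (rule compact_tsupp[of 0 "max R T"]) (use R T in auto)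
  note I = testfieldI[of "\<lambda>x. \<phi> x + \<psi> x" "\<lambda>x v. frechet_derivative \<phi> (at x) v + frechet_derivative \<psi> (at x) v", OF _ _ s]
  show "testfield (\<lambda>x. \<phi> x + \<psi> x)"
    by (rule I) (use assms in \<open>auto intro!: has_derivative_add continuous_intros testfieldD\<close>)
  show "divg (\<lambda>x. \<phi> x + \<psi> x) x = divg \<phi> x + divg \<psi> x"
    by (subst I(2)) (use assms in \<open>auto intro!: has_derivative_add continuous_intros testfieldD simp: divg_def sum.distrib\<close>)
qed

text \<open>The product rule for the divergence. The term \<open>G x \<bullet> \<phi> x\<close> is
  the source of the error terms whenever a set is cut by \<eta>.\<close>

lemma testfield_scale:
  assumes "testfield \<phi>" "C1grad \<eta> G"
  shows "testfield (\<lambda>x. \<eta> x *\<^sub>R \<phi> x)" "divg (\<lambda>x. \<eta> x *\<^sub>R \<phi> x) x = \<eta> x * divg \<phi> x + G x \<bullet> \<phi> x"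
proof -
  obtain R where R: "R > 0" "\<And>x. x \<notin> cball 0 R \<Longrightarrow> \<phi> x = 0" using testfield_zero_outside[OF assms(1)] by blast
  have s: "compact (tsupp (\<lambda>x. \<eta> x *\<^sub>R \<phi> x))"
    by (rule compact_tsupp[of 0 R]) (use R in auto)
  note I = testfieldI[of "\<lambda>x. \<eta> x *\<^sub>R \<phi> x" "\<lambda>x v. \<eta> x *\<^sub>R frechet_derivative \<phi> (at x) v + (G x \<bullet> v) *\<^sub>R \<phi> x", OF _ _ s]
  have d: "((\<lambda>x. \<eta> x *\<^sub>R \<phi> x) has_derivative (\<lambda>v. \<eta> x *\<^sub>R frechet_derivative \<phi> (at x) v + (G x \<bullet> v) *\<^sub>R \<phi> x)) (at x)" for x
    using has_derivative_scaleR[of \<eta> "\<lambda>v. G x \<bullet> v" x UNIV \<phi> "frechet_derivative \<phi> (at x)"] assms testfieldD(1)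
    by (auto simp: C1grad_def)
  have c: "continuous_on UNIV (\<lambda>x. \<eta> x *\<^sub>R frechet_derivative \<phi> (at x) v + (G x \<bullet> v) *\<^sub>R \<phi> x)" for v
    using assms C1grad_continuous testfield_continuous
    by (auto intro!: continuous_intros testfieldD simp: C1grad_def)
  show "testfield (\<lambda>x. \<eta> x *\<^sub>R \<phi> x)" by (rule I(1)[OF d c])
  have "divg (\<lambda>x. \<eta> x *\<^sub>R \<phi> x) x = (\<Sum>i\<in>UNIV. \<eta> x * (frechet_derivative \<phi> (at x) (axis i 1) $ i) + (G x \<bullet> axis i 1) * \<phi> x $ i)"
    by (subst I(2)[OF d c]) (simp add: vector_add_component)
  also have "\<dots> = \<eta> x * divg \<phi> x + (\<Sum>i\<in>UNIV. (G x \<bullet> axis i 1) * \<phi> x $ i)"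
    by (simp add: divg_def sum.distrib sum_distrib_left)
  also have "(\<Sum>i\<in>UNIV. (G x \<bullet> axis i 1) * \<phi> x $ i) = G x \<bullet> \<phi> x"
    by (simp add: inner_axis inner_vec_def[of "G x" "\<phi> x"])
  finally show "divg (\<lambda>x. \<eta> x *\<^sub>R \<phi> x) x = \<eta> x * divg \<phi> x + G x \<bullet> \<phi> x" .
qed

lemma testfield_cmult:
  assumes "testfield \<phi>"
  shows "testfield (\<lambda>x. c *\<^sub>R \<phi> x)" "divg (\<lambda>x. c *\<^sub>R \<phi> x) x = c * divg \<phi> x"
  using testfield_scale[OF assms C1grad_const, of c] by auto

lemma testfield_uminus:
  assumes "testfield \<phi>"
  shows "testfield (\<lambda>x. - \<phi> x)" "divg (\<lambda>x. - \<phi> x) x = - divg \<phi> x"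
  using testfield_cmult[OF assms, of "-1"] by auto

lemma testfield_diff:
  assumes "testfield \<phi>" "testfield \<psi>"
  shows "testfield (\<lambda>x. \<phi> x - \<psi> x)" "divg (\<lambda>x. \<phi> x - \<psi> x) x = divg \<phi> x - divg \<psi> x"
  using testfield_add[OF assms(1) testfield_uminus(1)[OF assms(2)]] testfield_uminus(2)[OF assms(2)] by auto

lemma testfield_shift:
  assumes "testfield \<phi>"
  shows "testfield (\<lambda>x. \<phi> (x + h))" "divg (\<lambda>x. \<phi> (x + h)) x = divg \<phi> (x + h)"
proof -
  obtain R where R: "R > 0" "\<And>x. x \<notin> cball 0 R \<Longrightarrow> \<phi> x = 0" using testfield_zero_outside[OF assms] by blast
  have s: "compact (tsupp (\<lambda>x. \<phi> (x + h)))"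
    by (rule compact_tsupp[of "-h" R]) (use R in \<open>auto simp: dist_norm add.commute norm_minus_commute\<close>)
  note I = testfieldI[of "\<lambda>x. \<phi> (x + h)" "\<lambda>x. frechet_derivative \<phi> (at (x + h))", OF _ _ s]
  have d: "((\<lambda>x. \<phi> (x + h)) has_derivative frechet_derivative \<phi> (at (x + h))) (at x)" for x
  proof -
    have "((\<lambda>x. x + h) has_derivative (\<lambda>v. v)) (at x)" by (auto intro!: derivative_eq_intros)
    from has_derivative_compose[OF this, of \<phi> "frechet_derivative \<phi> (at (x + h))"] testfieldD(1)[OF assms]
    show ?thesis by simp
  qed
  have c: "continuous_on UNIV (\<lambda>x. frechet_derivative \<phi> (at (x + h)) v)" for v
    by (rule continuous_on_compose2[OF testfieldD(2)[OF assms]]) (auto intro!: continuous_intros)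
  show "testfield (\<lambda>x. \<phi> (x + h))" by (rule I(1)[OF d c])
  show "divg (\<lambda>x. \<phi> (x + h)) x = divg \<phi> (x + h)" by (subst I(2)[OF d c]) (simp add: divg_def)
qed

lemma testfield_scalar:
  assumes "C1grad \<psi> G" "\<And>x. x \<notin> cball y R \<Longrightarrow> \<psi> x = 0"
  shows "testfield (\<lambda>x. \<psi> x *\<^sub>R a)" "divg (\<lambda>x. \<psi> x *\<^sub>R a) x = G x \<bullet> a"
proof -
  have s: "compact (tsupp (\<lambda>x. \<psi> x *\<^sub>R a))"
    by (rule compact_tsupp[of y R]) (use assms in auto)
  note I = testfieldI[of "\<lambda>x. \<psi> x *\<^sub>R a" "\<lambda>x v. (G x \<bullet> v) *\<^sub>R a", OF _ _ s]
  have d: "((\<lambda>x. \<psi> x *\<^sub>R a) has_derivative (\<lambda>v. (G x \<bullet> v) *\<^sub>R a)) (at x)" for x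
    using assms(1) by (intro has_derivative_scaleR_left) (auto simp: C1grad_def)
  have c: "continuous_on UNIV (\<lambda>x. (G x \<bullet> v) *\<^sub>R a)" for v
    using assms(1) by (auto intro!: continuous_intros simp: C1grad_def)
  show "testfield (\<lambda>x. \<psi> x *\<^sub>R a)" by (rule I(1)[OF d c])
  show "divg (\<lambda>x. \<psi> x *\<^sub>R a) x = G x \<bullet> a"
    by (subst I(2)[OF d c]) (simp add: inner_axis inner_vec_def[of "G x" a])
qed

lemma continuous_divg: "testfield \<phi> \<Longrightarrow> continuous_on UNIV (divg \<phi>)"
  unfolding divg_def by (intro continuous_intros testfieldD)

lemma divg_zero_outside:
  assumes "testfield \<phi>" "closed S" "\<And>x. x \<notin> S \<Longrightarrow> \<phi> x = 0" "x \<notin> S"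
  shows "divg \<phi> x = 0"
proof -
  have "(\<phi> has_derivative (\<lambda>v. 0)) (at x)"
  proof (rule has_derivative_transform_within_open[of "\<lambda>x. 0"])
    show "open (- S)" using assms by auto
  qed (use assms in auto)
  hence "frechet_derivative \<phi> (at x) = (\<lambda>v. 0)" using frechet_derivative_at by metis
  thus ?thesis by (simp add: divg_def)
qed

lemma C1grad_zero_outside:
  assumes "C1grad \<phi> G" "closed S" "\<And>x. x \<notin> S \<Longrightarrow> \<phi> x = 0" "x \<notin> S"
  shows "G x = 0"
proof -
  have "(\<phi> has_derivative (\<lambda>v. 0)) (at x)"
  proof (rule has_derivative_transform_within_open[of "\<lambda>x. 0"])
    show "open (- S)" using assms by auto
  qed (use assms in auto)
  hence "(\<lambda>v. G x \<bullet> v) = (\<lambda>v. 0)" using assms(1) has_derivative_unique unfolding C1grad_def by blast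
  thus ?thesis by (metis inner_eq_zero_iff)
qed

lemma bounded_if_compact_support:
  fixes k :: "R2 \<Rightarrow> 'b::real_normed_vector"
  assumes "continuous_on UNIV k" "\<And>x. x \<notin> cball y R \<Longrightarrow> k x = 0"
  obtains B where "B > 0" "\<And>x. norm (k x) \<le> B"
proof -
  have "compact (k ` cball y R)"
    using assms(1) by (intro compact_continuous_image) (auto intro: continuous_on_subset)
  then obtain B where B: "B > 0" "\<And>z. z \<in> k ` cball y R \<Longrightarrow> norm z \<le> B"
    using compact_imp_bounded bounded_pos by metis
  have "norm (k x) \<le> B" for x
    by (cases "x \<in> cball y R") (use B assms(2) in auto)
  with B(1) that show ?thesis by blast
qed

section \<open>Locally integrable functions and differentiation under the integral\<close>

text \<open>Constants, compositions such as \<open>H (u x)\<close> and indicators of sets of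
  infinite measure need not be in L2; local integrability is what a pairing with a compactly
  supported field requires.\<close>

definition loc_int :: "(R2 \<Rightarrow> real) \<Rightarrow> bool" where
  "loc_int g \<longleftrightarrow> g \<in> borel_measurable lebesgue \<and>
     (\<forall>R. integrable lebesgue (\<lambda>x. indicator (cball 0 R) x * g x))"

lemma continuous_measurable_lebesgue:
  fixes k :: "R2 \<Rightarrow> 'b::{real_normed_vector,second_countable_topology}"
  shows "continuous_on UNIV k \<Longrightarrow> k \<in> borel_measurable lebesgue"
  by (intro measurable_completion) (simp add: borel_measurable_continuous_onI)

lemma loc_int_mult:
  fixes k :: "R2 \<Rightarrow> real"
  assumes g: "loc_int g" and k: "k \<in> borel_measurable lebesgue" "\<And>x. \<bar>k x\<bar> \<le> B" "\<And>x. x \<notin> cball 0 R \<Longrightarrow> k x = 0"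
  shows "integrable lebesgue (\<lambda>x. g x * k x)"
proof (rule Bochner_Integration.integrable_bound)
  show "integrable lebesgue (\<lambda>x. B * (indicator (cball 0 R) x * g x))" using g by (simp add: loc_int_def)
  show "(\<lambda>x. g x * k x) \<in> borel_measurable lebesgue"
    using g k by (auto simp: loc_int_def intro: borel_measurable_times)
  have B0: "B \<ge> 0" using k(2)[of 0] by linarith
  have "\<bar>g x * k x\<bar> \<le> B * \<bar>indicator (cball 0 R) x * g x\<bar>" for x
    using k(2)[of x] k(3)[of x] mult_right_mono[OF k(2)[of x], of "\<bar>g x\<bar>"]
    by (cases "x \<in> cball 0 R") (auto simp: abs_mult mult.commute)
  thus "AE x in lebesgue. norm (g x * k x) \<le> norm (B * (indicator (cball 0 R) x * g x))"
    using B0 by (simp add: abs_mult)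
qed

lemma loc_int_mult_cont:
  fixes k :: "R2 \<Rightarrow> real"
  assumes g: "loc_int g" and k: "continuous_on UNIV k" "\<And>x. x \<notin> cball y R \<Longrightarrow> k x = 0"
  shows "integrable lebesgue (\<lambda>x. g x * k x)"
proof -
  obtain B where "\<And>x. norm (k x) \<le> B" using bounded_if_compact_support[OF k] by blast
  moreover have "k x = 0" if "x \<notin> cball 0 (R + norm y)" for x
  proof (rule k(2))
    show "x \<notin> cball y R" using that norm_triangle_ineq[of y "x - y"]
      by (auto simp: dist_norm norm_minus_commute)
  qed
  ultimately show ?thesis using loc_int_mult[OF g continuous_measurable_lebesgue[OF k(1)]] by force
qed

lemma loc_int_bounded:
  assumes "g \<in> borel_measurable lebesgue" "\<And>x. \<bar>g x\<bar> \<le> B"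
  shows "loc_int g"
  unfolding loc_int_def
proof (intro conjI allI)
  fix R
  show "integrable lebesgue (\<lambda>x. indicator (cball 0 R) x * g x)"
  proof (rule Bochner_Integration.integrable_bound[of _ "\<lambda>x. B * indicator (cball 0 R) x"])
    show "integrable lebesgue (\<lambda>x. B * indicator (cball (0::R2) R) x)"
      by (intro integrable_mult_right integrable_real_indicator) (use emeasure_lborel_cball_finite in auto)
    show "AE x in lebesgue. norm (indicator (cball 0 R) x * g x) \<le> norm (B * indicator (cball 0 R) x :: real)"
      by (intro AE_I2) (use order_trans[OF assms(2) abs_ge_self] in \<open>auto simp: indicator_def\<close>)
    show "(\<lambda>x. indicator (cball 0 R) x * g x) \<in> borel_measurable lebesgue"
      by (intro borel_measurable_times borel_measurable_indicator assms(1)) auto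
  qed
qed (rule assms)

lemma L2_indicator_mult:
  assumes "L2 g" "S \<in> sets lebesgue" shows "L2 (\<lambda>x. indicator S x * g x)"
proof (rule L2_bound[OF assms(1), of _ 1])
  show "(\<lambda>x. indicator S x * g x) \<in> borel_measurable lebesgue"
    using assms L2_measurable by (auto intro: borel_measurable_times borel_measurable_indicator)
qed (auto simp: indicator_def)

lemma L2_indicator:
  assumes "S \<in> sets lebesgue" "emeasure lebesgue S < \<infinity>"
  shows "L2 (indicator S)"
proof -
  have "(indicator S x)\<^sup>2 = (indicator S x :: real)" for x :: R2 by (auto simp: indicator_def)
  thus ?thesis unfolding L2_def
    using integrable_real_indicator[OF assms] assms(1) by (auto intro: borel_measurable_indicator)
qed

lemma L2_loc_int:
  assumes "L2 g" shows "loc_int g"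
  unfolding loc_int_def
proof (intro conjI allI)
  fix R
  have "L2 (indicator (cball (0::R2) R) :: R2 \<Rightarrow> real)"
    by (rule L2_indicator) (use emeasure_lborel_cball_finite in auto)
  from L2_integrable_mult[OF this assms]
  show "integrable lebesgue (\<lambda>x. indicator (cball 0 R) x * g x)" .
qed (use assms L2_measurable in auto)

lemma loc_int_divg:
  assumes "loc_int g" "testfield \<phi>"
  shows "integrable lebesgue (\<lambda>x. g x * divg \<phi> x)"
proof -
  obtain R where "R > 0" "\<And>x. x \<notin> cball 0 R \<Longrightarrow> \<phi> x = 0" using testfield_zero_outside[OF assms(2)] by blast
  thus ?thesis
    using divg_zero_outside[OF assms(2) closed_cball] by (intro loc_int_mult_cont[OF assms(1) continuous_divg[OF assms(2)]]) blast
qed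

lemma L2_divg: "testfield \<phi> \<Longrightarrow> L2 (divg \<phi>)"
proof -
  assume a: "testfield \<phi>"
  have m: "divg \<phi> \<in> borel_measurable lebesgue" by (rule continuous_measurable_lebesgue[OF continuous_divg[OF a]])
  obtain R where R: "R > 0" "\<And>x. x \<notin> cball 0 R \<Longrightarrow> \<phi> x = 0" using testfield_zero_outside[OF a] by blast
  have z: "x \<notin> cball 0 R \<Longrightarrow> divg \<phi> x = 0" for x by (rule divg_zero_outside[OF a closed_cball R(2)])
  obtain B where B: "\<And>x. norm (divg \<phi> x) \<le> B" using bounded_if_compact_support[OF continuous_divg[OF a] z] by blast
  have "loc_int (divg \<phi>)" by (rule loc_int_bounded[OF m]) (use B in auto)
  from loc_int_divg[OF this a] m show "L2 (divg \<phi>)" by (simp add: L2_def power2_eq_square)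
qed

lemma integral_shift:
  fixes k :: "R2 \<Rightarrow> real"
  assumes "k \<in> borel_measurable borel"
  shows "(\<integral>x. k (x + h) \<partial>lborel) = (\<integral>x. k x \<partial>lborel)"
proof -
  have "(\<integral>x. k x \<partial>lborel) = (\<integral>x. k x \<partial>distr lborel borel ((+) h))" by (simp only: lborel_distr_plus)
  also have "\<dots> = (\<integral>x. k (h + x) \<partial>lborel)" by (rule integral_distr) (use assms in auto)
  finally show ?thesis by (simp add: add.commute)
qed

text \<open>Dominated convergence along an arbitrary null sequence of increments. The gradient bound
  keeps the difference quotients below \<open>B * norm h\<close>, and all of them vanish off one
  ball, on which \<open>g\<close> is integrable.\<close>

lemma conv_has_derivative:
  assumes g: "loc_int g" and \<psi>: "C1grad \<psi> G" "\<And>x. x \<notin> cball 0 R \<Longrightarrow> \<psi> x = 0"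
  shows "((\<lambda>s. \<integral>x. g x * \<psi> (x + s *\<^sub>R h) \<partial>lebesgue) has_real_derivative
           (\<integral>x. g x * (G (x + s *\<^sub>R h) \<bullet> h) \<partial>lebesgue)) (at s)"
  unfolding DERIV_def tendsto_at_iff_sequentially
proof (intro allI impI)
  fix X :: "nat \<Rightarrow> real" assume X: "\<forall>i. X i \<in> UNIV - {0}" "X \<longlonglongrightarrow> 0"
  have Gc: "continuous_on UNIV G" using \<psi>(1) by (simp add: C1grad_def)
  have G0: "x \<notin> cball 0 R \<Longrightarrow> G x = 0" for x by (rule C1grad_zero_outside[OF \<psi>(1) closed_cball \<psi>(2)])
  obtain B where B: "B > 0" "\<And>x. norm (G x) \<le> B" using bounded_if_compact_support[OF Gc G0] by blast
  obtain M where M: "\<And>i. \<bar>X i\<bar> \<le> M" using X(2) convergent_imp_Bseq convergentI Bseq_def real_norm_def by metis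
  \<comment> \<open>Every shift in play moves a point by at most
    \<open>(\<bar>s\<bar> + M) * norm h\<close>, so both translates of \<psi> vanish beyond radius
    \<open>T\<close>.\<close>
  define T where "T = R + (\<bar>s\<bar> + M) * norm h"
  have M0: "M \<ge> 0" using M[of 0] by linarith
  have zero: "\<psi> (x + (s + X i) *\<^sub>R h) = 0 \<and> \<psi> (x + s *\<^sub>R h) = 0" if "x \<notin> cball 0 T" for x i
  proof -
    have *: "x + r *\<^sub>R h \<notin> cball 0 R" if "\<bar>r\<bar> \<le> \<bar>s\<bar> + M" for r
    proof -
      have "norm (r *\<^sub>R h) \<le> (\<bar>s\<bar> + M) * norm h" using that by (simp add: mult_right_mono)
      moreover have "norm x \<le> norm (x + r *\<^sub>R h) + norm (r *\<^sub>R h)"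
        using norm_triangle_ineq4[of "x + r *\<^sub>R h" "r *\<^sub>R h"] by simp
      moreover have "norm x > T" using \<open>x \<notin> cball 0 T\<close> by simp
      ultimately have "norm (x + r *\<^sub>R h) > R" by (simp add: T_def)
      thus ?thesis by simp
    qed
    have "\<bar>s + X i\<bar> \<le> \<bar>s\<bar> + M" using M[of i] abs_triangle_ineq[of s "X i"] by linarith
    thus ?thesis using \<psi>(2) * M0 by simp
  qed
  define q where "q i x = (\<psi> (x + (s + X i) *\<^sub>R h) - \<psi> (x + s *\<^sub>R h)) / X i" for i x
  have \<psi>c: "continuous_on UNIV (\<lambda>x. \<psi> (x + r *\<^sub>R h))" for r
    by (rule continuous_on_compose2[OF C1grad_continuous[OF \<psi>(1)]]) (auto intro!: continuous_intros)
  have \<psi>m: "(\<lambda>x. \<psi> (x + r *\<^sub>R h)) \<in> borel_measurable lebesgue" for r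
    by (rule continuous_measurable_lebesgue[OF \<psi>c])
  have qb: "\<bar>q i x\<bar> \<le> B * norm h" for i x
  proof -
    have "\<bar>\<psi> (x + (s + X i) *\<^sub>R h) - \<psi> (x + s *\<^sub>R h)\<bar> \<le> B * norm ((x + (s + X i) *\<^sub>R h) - (x + s *\<^sub>R h))"
      by (rule C1grad_lipschitz[OF \<psi>(1) B(2)])
    also have "\<dots> = B * norm h * \<bar>X i\<bar>" by (simp add: algebra_simps)
    finally show ?thesis using X(1) by (simp add: q_def divide_le_eq)
  qed
  have int: "integrable lebesgue (\<lambda>x. g x * \<psi> (x + r *\<^sub>R h))" for r
  proof (rule loc_int_mult_cont[OF g \<psi>c, of "-(r *\<^sub>R h)" R])
    fix x assume "x \<notin> cball (- (r *\<^sub>R h)) R"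
    hence "x + r *\<^sub>R h \<notin> cball 0 R"
      by (metis mem_cball dist_norm dist_commute diff_minus_eq_add diff_zero)
    thus "\<psi> (x + r *\<^sub>R h) = 0" by (rule \<psi>(2))
  qed
  have e: "((\<integral>x. g x * \<psi> (x + (s + X i) *\<^sub>R h) \<partial>lebesgue) - (\<integral>x. g x * \<psi> (x + s *\<^sub>R h) \<partial>lebesgue)) / X i
      = (\<integral>x. g x * q i x \<partial>lebesgue)" for i
  proof -
    have "(\<integral>x. g x * q i x \<partial>lebesgue) = (\<integral>x. (g x * \<psi> (x + (s + X i) *\<^sub>R h) - g x * \<psi> (x + s *\<^sub>R h)) / X i \<partial>lebesgue)"
      by (simp add: q_def right_diff_distrib)
    also have "\<dots> = ((\<integral>x. g x * \<psi> (x + (s + X i) *\<^sub>R h) \<partial>lebesgue) - (\<integral>x. g x * \<psi> (x + s *\<^sub>R h) \<partial>lebesgue)) / X i"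
      using int by simp
    finally show ?thesis by simp
  qed
  have "(\<lambda>i. \<integral>x. g x * q i x \<partial>lebesgue) \<longlonglongrightarrow> (\<integral>x. g x * (G (x + s *\<^sub>R h) \<bullet> h) \<partial>lebesgue)"
  proof (rule integral_dominated_convergence[where w = "\<lambda>x. (B * norm h) * \<bar>indicator (cball 0 T) x * g x\<bar>"])
    have gm: "g \<in> borel_measurable lebesgue" using g by (simp add: loc_int_def)
    have "continuous_on UNIV (\<lambda>x. G (x + s *\<^sub>R h) \<bullet> h)"
      by (intro continuous_intros continuous_on_compose2[OF Gc]) auto
    thus "(\<lambda>x. g x * (G (x + s *\<^sub>R h) \<bullet> h)) \<in> borel_measurable lebesgue"
      by (intro borel_measurable_times gm) (rule continuous_measurable_lebesgue)
    show "(\<lambda>x. g x * q i x) \<in> borel_measurable lebesgue" for i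
      unfolding q_def using gm \<psi>m by (intro borel_measurable_times borel_measurable_divide borel_measurable_diff borel_measurable_const)
    show "integrable lebesgue (\<lambda>x. (B * norm h) * \<bar>indicator (cball 0 T) x * g x\<bar>)"
      using g by (intro integrable_mult_right integrable_abs) (simp add: loc_int_def)
    show "AE x in lebesgue. (\<lambda>i. g x * q i x) \<longlonglongrightarrow> g x * (G (x + s *\<^sub>R h) \<bullet> h)"
    proof (intro AE_I2 tendsto_intros)
      fix x
      have "((\<lambda>r. x + r *\<^sub>R h) has_derivative (\<lambda>r. r *\<^sub>R h)) (at s)" by (auto intro!: derivative_eq_intros)
      from has_derivative_compose[OF this, of \<psi> "\<lambda>v. G (x + s *\<^sub>R h) \<bullet> v"] \<psi>(1)
      have "((\<lambda>r. \<psi> (x + r *\<^sub>R h)) has_real_derivative (G (x + s *\<^sub>R h) \<bullet> h)) (at s)"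
        by (simp add: C1grad_def has_field_derivative_def mult.commute[of _ "G (x + s *\<^sub>R h) \<bullet> h"])
      hence "((\<lambda>r. (\<psi> (x + (s + r) *\<^sub>R h) - \<psi> (x + s *\<^sub>R h)) / r) \<longlongrightarrow> G (x + s *\<^sub>R h) \<bullet> h) (at 0)"
        unfolding DERIV_def .
      thus "(\<lambda>i. q i x) \<longlonglongrightarrow> G (x + s *\<^sub>R h) \<bullet> h"
        using X unfolding q_def tendsto_at_iff_sequentially by (auto simp: o_def)
    qed
    show "AE x in lebesgue. norm (g x * q i x) \<le> (B * norm h) * \<bar>indicator (cball 0 T) x * g x\<bar>" for i
    proof (rule AE_I2)
      fix x
      show "norm (g x * q i x) \<le> (B * norm h) * \<bar>indicator (cball 0 T) x * g x\<bar>"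
      proof (cases "x \<in> cball 0 T")
        case True
        thus ?thesis using mult_right_mono[OF qb[of i x], of "\<bar>g x\<bar>"] by (simp add: abs_mult mult.commute)
      next
        case False
        hence "q i x = 0" using zero by (simp add: q_def)
        thus ?thesis using False by simp
      qed
    qed
  qed
  thus "((\<lambda>r. ((\<integral>x. g x * \<psi> (x + (s + r) *\<^sub>R h) \<partial>lebesgue) - (\<integral>x. g x * \<psi> (x + s *\<^sub>R h) \<partial>lebesgue)) / r) \<circ> X)
     \<longlonglongrightarrow> (\<integral>x. g x * (G (x + s *\<^sub>R h) \<bullet> h) \<partial>lebesgue)"
    by (simp only: o_def e)
qed

section \<open>Cutoff functions and density of continuous functions\<close>

text \<open>The derivative of the squared positive part is 2-Lipschitz, hence a quadratic remainder
  with constant 1, uniform in \<open>s\<close>. The uniformity is used again for the smoothing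
  kernel, where it makes convolutions differentiable.\<close>

lemma pospart_square_remainder:
  fixes s d :: real
  shows "\<bar>(max (s + d) 0)\<^sup>2 - (max s 0)\<^sup>2 - 2 * max s 0 * d\<bar> \<le> d\<^sup>2"
proof (cases "s \<ge> 0")
  case s: True
  show ?thesis
  proof (cases "s + d \<ge> 0")
    case True thus ?thesis using s by (simp add: power2_sum)
  next
    case False
    have "0 \<le> s * (- s - 2 * d)" using s False by (intro mult_nonneg_nonneg) auto
    moreover have "s * (- s - 2 * d) \<le> d\<^sup>2" using zero_le_power2[of "s + d"] by (simp add: power2_eq_square algebra_simps)
    ultimately show ?thesis using s False by (simp add: max_def power2_eq_square algebra_simps)
  qed
next
  case s: False
  show ?thesis
  proof (cases "s + d \<ge> 0")
    case True
    have "(s + d)\<^sup>2 \<le> d\<^sup>2" using s True by (intro power_mono) auto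
    thus ?thesis using s True by (simp add: max_def)
  next
    case False thus ?thesis using s by (simp add: max_def)
  qed
qed

lemma DERIV_pospart_square:
  "((\<lambda>s. (max s 0)\<^sup>2) has_real_derivative 2 * max s 0) (at s)"
  unfolding DERIV_def
proof (rule Lim_null_comparison[THEN LIM_zero_cancel])
  show "\<forall>\<^sub>F h in at 0. norm (((max (s + h) 0)\<^sup>2 - (max s 0)\<^sup>2) / h - 2 * max s 0) \<le> \<bar>h\<bar>"
    unfolding eventually_at
  proof (intro exI[of _ 1] conjI ballI impI)
    fix h :: real assume h: "h \<noteq> 0 \<and> dist h 0 < 1"
    have "((max (s + h) 0)\<^sup>2 - (max s 0)\<^sup>2) / h - 2 * max s 0 = ((max (s + h) 0)\<^sup>2 - (max s 0)\<^sup>2 - 2 * max s 0 * h) / h"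
      using h by (simp add: diff_divide_distrib)
    moreover have "\<bar>((max (s + h) 0)\<^sup>2 - (max s 0)\<^sup>2 - 2 * max s 0 * h)\<bar> \<le> \<bar>h\<bar> * \<bar>h\<bar>"
      using pospart_square_remainder[of s h] by (simp add: power2_eq_square)
    ultimately show "norm (((max (s + h) 0)\<^sup>2 - (max s 0)\<^sup>2) / h - 2 * max s 0) \<le> \<bar>h\<bar>"
      using h by (simp add: abs_divide divide_le_eq)
  qed simp
  show "((\<lambda>h::real. \<bar>h\<bar>) \<longlongrightarrow> 0) (at 0)" by (auto intro!: tendsto_eq_intros)
qed

text \<open>The primitive of the tent that rises to 2 at s = 1/2 and returns to 0 at s = 1: a C^1
  passage from 0 to 1. The height 2 of the tent enters the gradient constant of the cutoffs.\<close>

definition smoothstep :: "real \<Rightarrow> real" where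
  "smoothstep s = 2 * (max s 0)\<^sup>2 - 4 * (max (s - 1/2) 0)\<^sup>2 + 2 * (max (s - 1) 0)\<^sup>2"

definition smoothstep' :: "real \<Rightarrow> real" where
  "smoothstep' s = 4 * max s 0 - 8 * max (s - 1/2) 0 + 4 * max (s - 1) 0"

lemma DERIV_smoothstep: "(smoothstep has_real_derivative smoothstep' s) (at s)"
proof -
  have sh: "((\<lambda>s. (max (s - c) 0)\<^sup>2) has_real_derivative 2 * max (s - c) 0) (at s)" for c
  proof -
    have "((\<lambda>s. s - c) has_real_derivative 1) (at s)" by (auto intro!: derivative_eq_intros)
    from DERIV_chain2[OF DERIV_pospart_square this] show ?thesis by simp
  qed
  have "((\<lambda>s. 2 * (max s 0)\<^sup>2 - 4 * (max (s - 1/2) 0)\<^sup>2 + 2 * (max (s - 1) 0)\<^sup>2) has_real_derivative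
    2 * (2 * max s 0) - 4 * (2 * max (s - 1/2) 0) + 2 * (2 * max (s - 1) 0)) (at s)"
    by (intro DERIV_add DERIV_diff DERIV_cmult sh DERIV_pospart_square)
  thus ?thesis by (simp add: smoothstep_def[abs_def] smoothstep'_def)
qed

lemma continuous_smoothstep': "continuous_on UNIV smoothstep'"
  unfolding smoothstep'_def[abs_def] by (intro continuous_intros)

lemma smoothstep'_bounds: "0 \<le> smoothstep' s" "smoothstep' s \<le> 2"
  unfolding smoothstep'_def by (auto simp: max_def)

lemma smoothstep'_zero: "s \<le> 0 \<or> s \<ge> 1 \<Longrightarrow> smoothstep' s = 0"
  unfolding smoothstep'_def by (auto simp: max_def)

lemma smoothstep_zero: "s \<le> 0 \<Longrightarrow> smoothstep s = 0"
  unfolding smoothstep_def by (auto simp: max_def)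

lemma smoothstep_one: "s \<ge> 1 \<Longrightarrow> smoothstep s = 1"
  unfolding smoothstep_def by (auto simp: max_def power2_eq_square field_simps)

lemma smoothstep_mono: "s \<le> t \<Longrightarrow> smoothstep s \<le> smoothstep t"
  by (rule DERIV_nonneg_imp_nondecreasing) (use DERIV_smoothstep smoothstep'_bounds in blast)+

lemma smoothstep_range: "0 \<le> smoothstep s" "smoothstep s \<le> 1"
  using smoothstep_mono[of "min s 0" s] smoothstep_zero[of "min s 0"]
    smoothstep_mono[of s "max s 1"] smoothstep_one[of "max s 1"] by auto

lemma C1grad_dist_square: "C1grad (\<lambda>x. c - (norm (x - y))\<^sup>2) (\<lambda>x. - 2 *\<^sub>R (x - y))"
  unfolding C1grad_def
proof (intro conjI allI)
  fix x
  have "((\<lambda>x. c - (x - y) \<bullet> (x - y)) has_derivative (\<lambda>v. - 2 * ((x - y) \<bullet> v))) (at x)"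
    by (auto intro!: derivative_eq_intros simp: inner_commute)
  thus "((\<lambda>x. c - (norm (x - y))\<^sup>2) has_derivative (\<lambda>v. (- 2 *\<^sub>R (x - y)) \<bullet> v)) (at x)"
    by (simp add: power2_norm_eq_inner)
qed (intro continuous_intros)

text \<open>The step is applied to the squared distance, which is smooth at the centre. Its slope is
  at most 2 and the gradient of (b^2 - |x - y|^2) / (b^2 - a^2) is at most 2b / ((b - a)(b + a))
  there, whence 4 / (b - a). The gradient lives on the ring only, so a cut costs the area of the
  ring.\<close>

lemma cutoff_exists:
  fixes y :: R2
  assumes ab: "0 < a" "a < b"
  obtains \<eta> G where "C1grad \<eta> G" "\<And>x. 0 \<le> \<eta> x" "\<And>x. \<eta> x \<le> 1"
    "\<And>x. x \<in> cball y a \<Longrightarrow> \<eta> x = 1" "\<And>x. x \<notin> ball y b \<Longrightarrow> \<eta> x = 0"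
    "\<And>x. norm (G x) \<le> 4 / (b - a) * indicator (ball y b - ball y a) x"
proof -
  define D where "D = b\<^sup>2 - a\<^sup>2"
  have D: "D = (b - a) * (b + a)" by (simp add: D_def power2_eq_square algebra_simps)
  have D0: "D > 0" using ab by (simp add: D)
  define A where "A x = (b\<^sup>2 - (norm (x - y))\<^sup>2) / D" for x
  have cA: "C1grad A (\<lambda>x. (- 2 / D) *\<^sub>R (x - y))"
    using C1grad_mult[OF C1grad_const[of "1/D"] C1grad_dist_square[of "b\<^sup>2" y]] by (simp add: A_def[abs_def])
  define \<eta> where "\<eta> x = smoothstep (A x)" for x
  define G where "G x = smoothstep' (A x) *\<^sub>R ((- 2 / D) *\<^sub>R (x - y))" for x
  have "C1grad \<eta> G" unfolding \<eta>_def G_def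
    by (rule C1grad_compose[OF DERIV_smoothstep continuous_smoothstep' cA])
  moreover have "0 \<le> \<eta> x" "\<eta> x \<le> 1" for x by (auto simp: \<eta>_def smoothstep_range)
  moreover have A1: "A x \<ge> 1" if "norm (x - y) \<le> a" for x
    using power_mono[OF that, of 2] D0 by (simp add: A_def D_def)
  hence "\<eta> x = 1" if "x \<in> cball y a" for x
    using that by (simp add: \<eta>_def smoothstep_one dist_norm norm_minus_commute)
  moreover have A0: "A x \<le> 0" if "norm (x - y) \<ge> b" for x
    using power_mono[OF that, of 2] D0 ab by (simp add: A_def divide_le_0_iff)
  hence "\<eta> x = 0" if "x \<notin> ball y b" for x
    using that by (simp add: \<eta>_def smoothstep_zero dist_norm norm_minus_commute)
  moreover have "norm (G x) \<le> 4 / (b - a) * indicator (ball y b - ball y a) x" for x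
  proof (cases "x \<in> ball y b - ball y a")
    case True
    hence n: "norm (x - y) \<le> b" by (simp add: dist_norm norm_minus_commute)
    have "norm (G x) = smoothstep' (A x) * (2 / D * norm (x - y))"
      using smoothstep'_bounds D0 by (simp add: G_def abs_mult)
    also have "\<dots> \<le> 2 * (2 / D * b)"
      using n smoothstep'_bounds D0 ab by (intro mult_mono) auto
    also have "\<dots> \<le> 4 / (b - a)" unfolding D using ab by (simp add: divide_simps)
    finally show ?thesis using True by simp
  next
    case False
    hence "norm (x - y) \<ge> b \<or> norm (x - y) \<le> a" by (auto simp: dist_norm norm_minus_commute)
    hence "smoothstep' (A x) = 0" using A0 A1 smoothstep'_zero by blast
    thus ?thesis using False by (simp add: G_def)
  qed
  ultimately show ?thesis using that by blast
qed

text \<open>Truncation in height and in space comes first: it supplies a dominating function, so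
  that an almost everywhere approximation by continuous functions, truncated in the same way,
  becomes an approximation in L1.\<close>

lemma L1_dense_continuous:
  fixes g :: "R2 \<Rightarrow> real"
  assumes g: "integrable lebesgue g" and e: "e > 0"
  obtains c R where "continuous_on UNIV c" "R > 0" "\<And>x. x \<notin> cball 0 R \<Longrightarrow> c x = 0" "integrable lebesgue c"
    "(\<integral>x. \<bar>g x - c x\<bar> \<partial>lebesgue) < e"
proof -
  have gm: "g \<in> borel_measurable lebesgue" using g by simp
  define T where "T n x = indicator (cball 0 (real n)) x * max (- real n) (min (real n) (g x))" for n :: nat and x :: R2
  have Tm: "T n \<in> borel_measurable lebesgue" for n
    unfolding T_def by (intro borel_measurable_times borel_measurable_indicator borel_measurable_max borel_measurable_min gm) auto
  have "(\<lambda>n. \<integral>x. \<bar>g x - T n x\<bar> \<partial>lebesgue) \<longlonglongrightarrow> (\<integral>x. 0 \<partial>(lebesgue :: R2 measure))"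
  proof (rule integral_dominated_convergence[where w = "\<lambda>x. 2 * \<bar>g x\<bar>"])
    show "integrable lebesgue (\<lambda>x. 2 * \<bar>g x\<bar>)" using g by simp
    show "AE x in lebesgue. (\<lambda>n. \<bar>g x - T n x\<bar>) \<longlonglongrightarrow> 0"
    proof (rule AE_I2, rule tendsto_eventually)
      fix x
      obtain N :: nat where N: "real N \<ge> max (norm x) \<bar>g x\<bar>" using real_arch_simple by blast
      show "\<forall>\<^sub>F n in sequentially. \<bar>g x - T n x\<bar> = 0"
      proof (rule eventually_sequentiallyI[of N])
        fix n assume "N \<le> n"
        hence "real n \<ge> max (norm x) \<bar>g x\<bar>" using N by (meson of_nat_le_iff order_trans)
        hence "norm x \<le> real n" "\<bar>g x\<bar> \<le> real n" by auto
        thus "\<bar>g x - T n x\<bar> = 0" by (auto simp: T_def abs_le_iff)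
      qed
    qed
    show "AE x in lebesgue. norm \<bar>g x - T n x\<bar> \<le> 2 * \<bar>g x\<bar>" for n
      by (rule AE_I2) (auto simp: T_def indicator_def max_def min_def)
  qed (use gm Tm in \<open>auto intro: borel_measurable_diff borel_measurable_abs\<close>)
  hence "\<forall>\<^sub>F n in sequentially. (\<integral>x. \<bar>g x - T n x\<bar> \<partial>lebesgue) < e / 2"
    using order_tendstoD(2)[of _ "0::real" sequentially "e/2"] e by simp
  then obtain n where n: "(\<integral>x. \<bar>g x - T n x\<bar> \<partial>lebesgue) < e / 2" by (meson eventually_happens sequentially_bot)
  have "T n measurable_on UNIV"
    using lebesgue_measurable_imp_measurable_on[of "T n" UNIV] Tm by simp
  then obtain N c where c: "negligible N" "\<And>j. continuous_on UNIV (c j)"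
    "\<And>x. x \<notin> N \<Longrightarrow> (\<lambda>j::nat. c j x) \<longlonglongrightarrow> T n x" unfolding measurable_on_def by auto
  \<comment> \<open>A continuous ramp equal to 1 on the ball of radius \<open>n\<close>, where
    \<open>T n\<close> lives: multiplying by it preserves the limit and gives the approximants
    compact support.\<close>
  define k :: "R2 \<Rightarrow> real" where "k x = max 0 (min 1 (real n + 1 - norm x))" for x
  define d where "d j x = k x * max (- real n) (min (real n) (c j x))" for j x
  have dc: "continuous_on UNIV (d j)" for j
    unfolding d_def k_def by (intro continuous_intros c)
  have d0: "d j x = 0" if "x \<notin> cball 0 (real n + 1)" for j x
    using that by (simp add: d_def k_def)
  have dm: "d j \<in> borel_measurable lebesgue" for j by (rule continuous_measurable_lebesgue[OF dc])
  have db: "\<bar>d j x\<bar> \<le> real n * indicator (cball 0 (real n + 1)) x" for j x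
  proof (cases "x \<in> cball 0 (real n + 1)")
    case True
    have "\<bar>k x\<bar> * \<bar>max (- real n) (min (real n) (c j x))\<bar> \<le> 1 * real n"
      by (rule mult_mono) (auto simp: k_def)
    thus ?thesis using True by (simp add: d_def abs_mult)
  qed (use d0 in auto)
  have Tb: "\<bar>T n x\<bar> \<le> real n * indicator (cball 0 (real n + 1)) x" for x
    by (auto simp: T_def indicator_def)
  have ib: "integrable lebesgue (\<lambda>x. real n * indicator (cball (0::R2) (real n + 1)) x)"
    by (intro integrable_mult_right integrable_real_indicator) (use emeasure_lborel_cball_finite in auto)
  have Ti: "integrable lebesgue (T n)"
    by (rule Bochner_Integration.integrable_bound[OF ib Tm]) (rule AE_I2, use Tb in auto)
  have di: "integrable lebesgue (d j)" for j
    by (rule Bochner_Integration.integrable_bound[OF ib dm]) (rule AE_I2, use db in auto)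
  have "(\<lambda>j. \<integral>x. \<bar>T n x - d j x\<bar> \<partial>lebesgue) \<longlonglongrightarrow> (\<integral>x. 0 \<partial>(lebesgue :: R2 measure))"
  proof (rule integral_dominated_convergence[where w = "\<lambda>x. 2 * (real n * indicator (cball 0 (real n + 1)) x)"])
    show "integrable lebesgue (\<lambda>x. 2 * (real n * indicator (cball (0::R2) (real n + 1)) x))" by (rule integrable_mult_right) (rule ib)
    have "AE x in lebesgue. x \<notin> N" using c(1) by (simp add: AE_not_in negligible_iff_null_sets)
    thus "AE x in lebesgue. (\<lambda>j. \<bar>T n x - d j x\<bar>) \<longlonglongrightarrow> 0"
    proof eventually_elim
      fix x assume "x \<notin> N"
      hence "(\<lambda>j. \<bar>T n x - d j x\<bar>) \<longlonglongrightarrow> \<bar>T n x - k x * max (- real n) (min (real n) (T n x))\<bar>"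
        unfolding d_def by (intro tendsto_intros c)
      moreover have "k x * max (- real n) (min (real n) (T n x)) = T n x"
        by (cases "x \<in> cball 0 (real n)") (auto simp: k_def T_def)
      ultimately show "(\<lambda>j. \<bar>T n x - d j x\<bar>) \<longlonglongrightarrow> 0" by simp
    qed
    show "AE x in lebesgue. norm \<bar>T n x - d j x\<bar> \<le> 2 * (real n * indicator (cball 0 (real n + 1)) x)" for j
    proof (rule AE_I2)
      fix x
      show "norm \<bar>T n x - d j x\<bar> \<le> 2 * (real n * indicator (cball 0 (real n + 1)) x)"
        using order_trans[OF abs_triangle_ineq4 add_mono[OF Tb[of x] db[of j x]]]
        by (simp only: mult_2 real_norm_def abs_abs)
    qed
  qed (use dm Tm in \<open>auto intro: borel_measurable_diff borel_measurable_abs\<close>)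
  hence "\<forall>\<^sub>F j in sequentially. (\<integral>x. \<bar>T n x - d j x\<bar> \<partial>lebesgue) < e / 2"
    using order_tendstoD(2)[of _ "0::real" sequentially "e/2"] e by simp
  then obtain j where j: "(\<integral>x. \<bar>T n x - d j x\<bar> \<partial>lebesgue) < e / 2" by (meson eventually_happens sequentially_bot)
  have "(\<integral>x. \<bar>g x - d j x\<bar> \<partial>lebesgue) \<le> (\<integral>x. \<bar>g x - T n x\<bar> + \<bar>T n x - d j x\<bar> \<partial>lebesgue)"
    by (rule integral_mono) (use g Ti di in auto)
  also have "\<dots> < e" using n j g Ti di by simp
  finally show ?thesis using that[of "d j" "real n + 1"] dc d0 di by auto
qed

section \<open>Mollification\<close>

lemma integrable_scaleR_bounded:
  fixes g :: "'a \<Rightarrow> real" and h :: "'a \<Rightarrow> 'b::{banach,second_countable_topology}"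
  assumes "integrable M g" "h \<in> borel_measurable M" "\<And>x. norm (h x) \<le> B"
  shows "integrable M (\<lambda>x. g x *\<^sub>R h x)"
proof (rule Bochner_Integration.integrable_bound)
  show "integrable M (\<lambda>x. B * \<bar>g x\<bar>)" using assms(1) by simp
  show "(\<lambda>x. g x *\<^sub>R h x) \<in> borel_measurable M" using assms by (intro borel_measurable_scaleR) auto
  have "0 \<le> B" using assms(3) norm_ge_zero order_trans by blast
  thus "AE x in M. norm (g x *\<^sub>R h x) \<le> norm (B * \<bar>g x\<bar>)"
    using mult_left_mono[OF assms(3) abs_ge_zero] by (intro AE_I2) (simp add: abs_mult mult.commute[of B])
qed

lemma lebesgue_integral_eq_lborel:
  fixes k :: "R2 \<Rightarrow> real"
  assumes "k \<in> borel_measurable borel"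
  shows "(\<integral>x. k x \<partial>lebesgue) = (\<integral>x. k x \<partial>lborel)" "integrable lebesgue k \<longleftrightarrow> integrable lborel k"
  using assms integral_completion[of k lborel] integrable_completion[of k lborel] by auto

lemma integrable_shift:
  fixes k :: "R2 \<Rightarrow> real"
  assumes "integrable lborel k"
  shows "integrable lborel (\<lambda>x. k (x + h))"
proof -
  have "integrable (distr lborel borel ((+) h)) k" using assms by (simp only: lborel_distr_plus)
  hence "integrable lborel (\<lambda>x. k (h + x))" by (subst (asm) integrable_distr_eq) (use assms in auto)
  thus ?thesis by (simp add: add.commute)
qed

text \<open>Uniform continuity settles the case of a compactly supported continuous function; three
  errors of size e/3 transfer it to \<open>g\<close>, translations being isometries of L1.\<close>

lemma L1_translation_continuous:
  fixes g :: "R2 \<Rightarrow> real"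
  assumes g: "integrable lborel g" and e: "e > 0"
  obtains d where "d > 0" "\<And>h. norm h < d \<Longrightarrow> (\<integral>x. \<bar>g (x + h) - g x\<bar> \<partial>lborel) < e"
proof -
  have gm[measurable]: "g \<in> borel_measurable borel" using g by simp
  have "integrable lebesgue g" using g by (simp add: integrable_completion)
  then obtain c R where c: "continuous_on UNIV c" "R > 0" "\<And>x. x \<notin> cball 0 R \<Longrightarrow> c x = 0" "integrable lebesgue c"
    "(\<integral>x. \<bar>g x - c x\<bar> \<partial>lebesgue) < e / 3" using L1_dense_continuous[of g "e/3"] e by auto
  have cm[measurable]: "c \<in> borel_measurable borel" by (rule borel_measurable_continuous_onI[OF c(1)])
  have ci: "integrable lborel c" using c(4) by (simp add: integrable_completion)
  have gc: "(\<integral>x. \<bar>g x - c x\<bar> \<partial>lborel) < e / 3"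
    using c(5) by (subst (asm) lebesgue_integral_eq_lborel) auto
  define m where "m = measure lborel (cball (0::R2) (R+1))"
  have m0: "m \<ge> 0" by (simp add: m_def)
  define \<eta> where "\<eta> = e / 3 / (m + 1)"
  have \<eta>0: "\<eta> > 0" using e m0 by (simp add: \<eta>_def)
  have "uniformly_continuous_on (cball 0 (R+2)) c"
    by (rule compact_uniformly_continuous) (use c(1) continuous_on_subset in auto)
  then obtain d where d: "d > 0" "\<And>x y. x \<in> cball 0 (R+2) \<Longrightarrow> y \<in> cball 0 (R+2) \<Longrightarrow> dist y x < d \<Longrightarrow> dist (c y) (c x) < \<eta>"
    unfolding uniformly_continuous_on_def using \<eta>0 by metis
  have "(\<integral>x. \<bar>g (x + h) - g x\<bar> \<partial>lborel) < e" if h: "norm h < min d 1" for h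
  proof -
    have cb: "\<bar>c (x + h) - c x\<bar> \<le> \<eta> * indicator (cball 0 (R+1)) x" for x
    proof (cases "x \<in> cball 0 (R+1)")
      case True
      have "norm (x + h) \<le> R + 2" using True h norm_triangle_ineq[of x h] by simp
      hence "dist (c (x + h)) (c x) < \<eta>" using True h by (intro d(2)) (auto simp: dist_norm[of "x + h"] simp del: mem_cball)
      thus ?thesis using True by (simp add: dist_real_def)
    next
      case False
      have "norm x \<le> norm (x + h) + norm h" using norm_triangle_ineq4[of "x + h" h] by simp
      hence "norm (x + h) > R" using False h by simp
      thus ?thesis using False c(3) by simp
    qed
    have ii: "integrable lborel (\<lambda>x. \<eta> * indicator (cball (0::R2) (R+1)) x)"
      by (intro integrable_mult_right integrable_real_indicator) (use emeasure_lborel_cball_finite in auto)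
    have "(\<integral>x. \<bar>c (x + h) - c x\<bar> \<partial>lborel) \<le> (\<integral>x. \<eta> * indicator (cball (0::R2) (R+1)) x \<partial>lborel)"
      by (rule integral_mono) (use cb ii ci integrable_shift[OF ci] in auto)
    also have "\<dots> = \<eta> * m" using emeasure_lborel_cball_finite by (simp add: m_def)
    also have "\<dots> < e / 3" using e m0 by (simp add: \<eta>_def field_simps)
    finally have A: "(\<integral>x. \<bar>c (x + h) - c x\<bar> \<partial>lborel) < e / 3" .
    have B: "(\<integral>x. \<bar>g (x + h) - c (x + h)\<bar> \<partial>lborel) < e / 3"
      using gc integral_shift[of "\<lambda>x. \<bar>g x - c x\<bar>" h] by simp
    have "(\<integral>x. \<bar>g (x + h) - g x\<bar> \<partial>lborel) \<le>
       (\<integral>x. (\<bar>g (x + h) - c (x + h)\<bar> + \<bar>c (x + h) - c x\<bar>) + \<bar>g x - c x\<bar> \<partial>lborel)"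
      by (rule integral_mono) (use g ci integrable_shift[OF ci] integrable_shift[OF g] in auto)
    also have "\<dots> = (\<integral>x. \<bar>g (x + h) - c (x + h)\<bar> \<partial>lborel) + (\<integral>x. \<bar>c (x + h) - c x\<bar> \<partial>lborel) + (\<integral>x. \<bar>g x - c x\<bar> \<partial>lborel)"
      using g ci integrable_shift[OF ci] integrable_shift[OF g] by simp
    finally show ?thesis using A B gc by linarith
  qed
  thus ?thesis using that[of "min d 1"] d(1) by auto
qed

section \<open>The smoothing kernel and convolutions with it\<close>

text \<open>Not normalised: \<open>mollification\<close> divides by the integral. The function is
  even, C^1, and supported in the ball of radius \<open>e\<close>.\<close>

definition mker :: "real \<Rightarrow> R2 \<Rightarrow> real" where
  "mker e z = (max (e\<^sup>2 - (norm z)\<^sup>2) 0)\<^sup>2"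

definition mkgrad :: "real \<Rightarrow> R2 \<Rightarrow> R2" where
  "mkgrad e z = (2 * max (e\<^sup>2 - (norm z)\<^sup>2) 0) *\<^sub>R (- 2 *\<^sub>R z)"

lemma C1grad_mker: "C1grad (mker e) (mkgrad e)"
  using C1grad_compose[OF DERIV_pospart_square _ C1grad_dist_square[of "e\<^sup>2" 0]]
  unfolding mker_def[abs_def] mkgrad_def[abs_def] by (simp add: continuous_intros)

lemma mker_zero: "e > 0 \<Longrightarrow> norm z \<ge> e \<Longrightarrow> mker e z = 0" "e > 0 \<Longrightarrow> norm z \<ge> e \<Longrightarrow> mkgrad e z = 0"
  using power_mono[of e "norm z" 2] by (auto simp: mker_def mkgrad_def)

lemma mker_nonneg: "mker e z \<ge> 0"
  by (simp add: mker_def)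

lemma mker_measurable[measurable]: "mker e \<in> borel_measurable borel"
  by (rule borel_measurable_continuous_onI[OF C1grad_continuous[OF C1grad_mker]])

lemma mkgrad_measurable[measurable]: "mkgrad e \<in> borel_measurable borel"
  by (rule borel_measurable_continuous_onI) (use C1grad_mker in \<open>auto simp: C1grad_def\<close>)

lemma mker_le: "mker e z \<le> (e\<^sup>2)\<^sup>2"
  unfolding mker_def by (intro power_mono) auto

lemma mkgrad_bounded:
  assumes "e > 0"
  obtains B where "\<And>z. norm (mkgrad e z) \<le> B"
proof -
  have c: "continuous_on UNIV (mkgrad e)" using C1grad_mker by (auto simp: C1grad_def)
  have z: "mkgrad e z = 0" if "z \<notin> cball 0 e" for z
    by (rule mker_zero(2)[OF assms]) (use that in auto)
  from bounded_if_compact_support[OF c z] that show ?thesis by metis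
qed

text \<open>For |z| > e + 1 everything vanishes. Otherwise the increment of e^2 - |z|^2 is d = -2
  z.v - |v|^2, with |d| <= (2e + 3)|v|. The remainder of the squared positive part contributes d^2,
  and the quadratic part of \<open>d\<close>, absent from the linear term, contributes at most 2 e^2
  |v|^2.\<close>

lemma mker_remainder:
  assumes e: "e > 0" and v: "norm v \<le> 1"
  shows "\<bar>mker e (z + v) - mker e z - mkgrad e z \<bullet> v\<bar> \<le> ((2 * e + 3)\<^sup>2 + 2 * e\<^sup>2) * (norm v)\<^sup>2"
proof (cases "norm z \<le> e + 1")
  case True
  define s where "s = e\<^sup>2 - (norm z)\<^sup>2"
  define d where "d = - 2 * (z \<bullet> v) - (norm v)\<^sup>2"
  have sd: "e\<^sup>2 - (norm (z + v))\<^sup>2 = s + d"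
    by (simp add: s_def d_def power2_norm_eq_inner algebra_simps inner_commute)
  have "mker e (z + v) - mker e z - mkgrad e z \<bullet> v = ((max (s + d) 0)\<^sup>2 - (max s 0)\<^sup>2 - 2 * max s 0 * d) - 2 * max s 0 * (norm v)\<^sup>2"
    unfolding mker_def mkgrad_def sd s_def[symmetric] by (simp add: d_def algebra_simps)
  moreover have "\<bar>(max (s + d) 0)\<^sup>2 - (max s 0)\<^sup>2 - 2 * max s 0 * d\<bar> \<le> d\<^sup>2" by (rule pospart_square_remainder)
  moreover have "d\<^sup>2 \<le> (2 * e + 3)\<^sup>2 * (norm v)\<^sup>2"
  proof -
    have "\<bar>d\<bar> \<le> 2 * \<bar>z \<bullet> v\<bar> + (norm v)\<^sup>2" unfolding d_def using zero_le_power2[of "norm v"] by linarith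
    also have "\<dots> \<le> 2 * ((e + 1) * norm v) + 1 * norm v"
      unfolding power2_eq_square using order_trans[OF Cauchy_Schwarz_ineq2 mult_right_mono[OF True norm_ge_zero]] v
      by (intro add_mono mult_left_mono mult_right_mono) auto
    also have "\<dots> = (2 * e + 3) * norm v" by (simp add: algebra_simps)
    finally have "\<bar>d\<bar>\<^sup>2 \<le> ((2 * e + 3) * norm v)\<^sup>2" by (intro power_mono) auto
    thus ?thesis by (simp add: power_mult_distrib)
  qed
  moreover have "0 \<le> 2 * max s 0 * (norm v)\<^sup>2" by simp
  moreover have "2 * max s 0 * (norm v)\<^sup>2 \<le> 2 * e\<^sup>2 * (norm v)\<^sup>2"
    by (intro mult_right_mono) (auto simp: s_def)
  moreover have "\<bar>p - q\<bar> \<le> r + t" if "\<bar>p\<bar> \<le> c" "c \<le> r" "0 \<le> q" "q \<le> t" for p q r t c :: real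
    using that by linarith
  ultimately show ?thesis by (simp only: distrib_right)
next
  case False
  have "norm z \<le> norm (z + v) + norm v" using norm_triangle_ineq4[of "z + v" v] by simp
  hence "norm (z + v) \<ge> e" "norm z \<ge> e" using False v by auto
  thus ?thesis using mker_zero[OF e] by simp
qed

text \<open>Integrated against |g|, the uniform remainder of the kernel is again quadratic in the
  increment, which is differentiability; continuity of the gradient follows by dominated
  convergence.\<close>

lemma C1grad_convolution:
  assumes e: "e > 0" and g: "integrable lborel g"
  shows "C1grad (\<lambda>x. \<integral>y. g y * mker e (x - y) \<partial>lborel) (\<lambda>x. \<integral>y. g y *\<^sub>R mkgrad e (x - y) \<partial>lborel)"
  unfolding C1grad_def
proof (intro conjI allI)
  have gm[measurable]: "g \<in> borel_measurable borel" using g by simp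
  obtain B where B: "\<And>z. norm (mkgrad e z) \<le> B" using mkgrad_bounded e by metis
  have i1: "integrable lborel (\<lambda>y. g y * mker e (x - y))" for x
    using integrable_scaleR_bounded[OF g, of "\<lambda>y. mker e (x - y)" "(e\<^sup>2)\<^sup>2"] mker_le mker_nonneg by simp
  have i2: "integrable lborel (\<lambda>y. g y *\<^sub>R mkgrad e (x - y))" for x
    by (rule integrable_scaleR_bounded[OF g _ B]) simp
  define F where "F x = (\<integral>y. g y * mker e (x - y) \<partial>lborel)" for x
  define F' where "F' x = (\<integral>y. g y *\<^sub>R mkgrad e (x - y) \<partial>lborel)" for x
  define C where "C = (2 * e + 3)\<^sup>2 + 2 * e\<^sup>2"
  have C0: "C > 0" using e by (simp add: C_def add_pos_nonneg)
  define n1 where "n1 = (\<integral>y. \<bar>g y\<bar> \<partial>lborel)"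
  have n0: "n1 \<ge> 0" by (simp add: n1_def)
  have rem: "\<bar>F (x + v) - F x - F' x \<bullet> v\<bar> \<le> C * (norm v)\<^sup>2 * n1" if v: "norm v \<le> 1" for x v
  proof -
    have "F' x \<bullet> v = (\<integral>y. (g y *\<^sub>R mkgrad e (x - y)) \<bullet> v \<partial>lborel)"
      unfolding F'_def by (rule integral_inner_left[symmetric]) (rule i2)
    hence "F (x + v) - F x - F' x \<bullet> v = (\<integral>y. g y * mker e (x + v - y) - g y * mker e (x - y) - (g y *\<^sub>R mkgrad e (x - y)) \<bullet> v \<partial>lborel)"
      unfolding F_def using i1 integrable_inner_left[OF i2[of x], of v] by simp
    also have "\<bar>\<dots>\<bar> \<le> (\<integral>y. (C * (norm v)\<^sup>2) * \<bar>g y\<bar> \<partial>lborel)"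
    proof (rule integral_abs_bound[THEN order_trans], rule integral_mono)
      fix y
      have "g y * mker e (x + v - y) - g y * mker e (x - y) - (g y *\<^sub>R mkgrad e (x - y)) \<bullet> v
        = g y * (mker e ((x - y) + v) - mker e (x - y) - mkgrad e (x - y) \<bullet> v)"
        by (simp add: algebra_simps)
      thus "\<bar>g y * mker e (x + v - y) - g y * mker e (x - y) - (g y *\<^sub>R mkgrad e (x - y)) \<bullet> v\<bar> \<le> (C * (norm v)\<^sup>2) * \<bar>g y\<bar>"
        using mult_left_mono[OF mker_remainder[OF e v, of "x - y"], of "\<bar>g y\<bar>"]
        by (simp add: abs_mult C_def mult.commute)
    qed (use i1 integrable_inner_left[OF i2[of x], of v] g in auto)
    also have "\<dots> = C * (norm v)\<^sup>2 * n1" by (simp add: n1_def)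
    finally show ?thesis .
  qed
  show "((\<lambda>x. \<integral>y. g y * mker e (x - y) \<partial>lborel) has_derivative (\<lambda>v. (\<integral>y. g y *\<^sub>R mkgrad e (x - y) \<partial>lborel) \<bullet> v)) (at x)" for x
    unfolding F_def[symmetric] F'_def[symmetric] has_derivative_at_alt
  proof (intro conjI allI impI)
    show "bounded_linear ((\<bullet>) (F' x))" by (rule bounded_linear_inner_right)
    fix r :: real assume r: "0 < r"
    define d where "d = min 1 (r / (C * n1 + 1))"
    have d0: "d > 0" using r C0 n0 by (simp add: d_def add_nonneg_pos)
    show "\<exists>d>0. \<forall>y. norm (y - x) < d \<longrightarrow> norm (F y - F x - F' x \<bullet> (y - x)) \<le> r * norm (y - x)"
    proof (intro exI[of _ d] conjI allI impI d0)
      fix y assume y: "norm (y - x) < d"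
      have "\<bar>F (x + (y - x)) - F x - F' x \<bullet> (y - x)\<bar> \<le> C * (norm (y - x))\<^sup>2 * n1"
        by (rule rem) (use y in \<open>auto simp: d_def\<close>)
      also have "\<dots> = (C * n1 * norm (y - x)) * norm (y - x)" by (simp add: power2_eq_square algebra_simps)
      also have "\<dots> \<le> r * norm (y - x)"
      proof (rule mult_right_mono)
        have "C * n1 * norm (y - x) \<le> (C * n1 + 1) * (r / (C * n1 + 1))"
          using y C0 n0 by (intro mult_mono) (auto simp: d_def)
        also have "\<dots> = r" using C0 n0 by (simp add: add_nonneg_pos less_imp_neq[symmetric])
        finally show "C * n1 * norm (y - x) \<le> r" .
      qed simp
      finally show "norm (F y - F x - F' x \<bullet> (y - x)) \<le> r * norm (y - x)" by simp
    qed
  qed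
  show "continuous_on UNIV (\<lambda>x. \<integral>y. g y *\<^sub>R mkgrad e (x - y) \<partial>lborel)"
  proof (rule continuous_on_sequentiallyI)
    fix u :: "nat \<Rightarrow> R2" and a assume u: "u \<longlonglongrightarrow> a"
    have Gc: "continuous_on UNIV (mkgrad e)" using C1grad_mker by (simp add: C1grad_def)
    show "(\<lambda>n. \<integral>y. g y *\<^sub>R mkgrad e (u n - y) \<partial>lborel) \<longlonglongrightarrow> (\<integral>y. g y *\<^sub>R mkgrad e (a - y) \<partial>lborel)"
    proof (rule integral_dominated_convergence[where w = "\<lambda>y. B * \<bar>g y\<bar>"])
      show "AE y in lborel. (\<lambda>n. g y *\<^sub>R mkgrad e (u n - y)) \<longlonglongrightarrow> g y *\<^sub>R mkgrad e (a - y)"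
        by (intro AE_I2 tendsto_intros continuous_on_tendsto_compose[OF Gc] u) auto
      show "AE y in lborel. norm (g y *\<^sub>R mkgrad e (u n - y)) \<le> B * \<bar>g y\<bar>" for n
        using mult_left_mono[OF B abs_ge_zero] by (intro AE_I2) (simp add: mult.commute[of B])
    qed (use g in auto)
  qed
qed

lemma mker_integral:
  assumes "e > 0"
  shows "integrable lborel (mker e)" "(\<integral>z. mker e z \<partial>lborel) > 0"
proof -
  have "loc_int (\<lambda>x. 1)" by (rule loc_int_bounded[of _ 1]) auto
  hence "integrable lebesgue (\<lambda>x. 1 * mker e x)"
    by (rule loc_int_mult_cont[OF _ C1grad_continuous[OF C1grad_mker], where y = 0 and R = e]) (rule mker_zero(1)[OF assms], auto)
  thus i: "integrable lborel (mker e)" by (simp add: integrable_completion)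
  have "0 < measure lborel (ball (0::R2) (e/2)) * (e\<^sup>2 / 2)\<^sup>2"
    using assms content_ball_pos[of "e/2" "0::R2"] by simp
  also have "\<dots> = (\<integral>z. (e\<^sup>2 / 2)\<^sup>2 * indicator (ball (0::R2) (e/2)) z \<partial>lborel)"
    using emeasure_lborel_ball_finite by simp
  also have "\<dots> \<le> (\<integral>z. mker e z \<partial>lborel)"
  proof (rule integral_mono[OF _ i])
    show "integrable lborel (\<lambda>z. (e\<^sup>2 / 2)\<^sup>2 * indicator (ball (0::R2) (e/2)) z)"
      by (intro integrable_mult_right integrable_real_indicator) (use emeasure_lborel_ball_finite in auto)
    show "(e\<^sup>2 / 2)\<^sup>2 * indicator (ball 0 (e/2)) z \<le> mker e z" for z :: R2
    proof (cases "z \<in> ball 0 (e/2)")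
      case True
      hence "(norm z)\<^sup>2 \<le> (e/2)\<^sup>2" by (intro power_mono) auto
      hence "4 * (norm z)\<^sup>2 \<le> e\<^sup>2" by (simp add: power_divide)
      moreover have "0 \<le> (norm z)\<^sup>2" by simp
      ultimately have "e\<^sup>2 / 2 \<le> max (e\<^sup>2 - (norm z)\<^sup>2) 0" by linarith
      thus ?thesis using True unfolding mker_def by (simp add: power_mono)
    qed (simp add: mker_nonneg)
  qed
  finally show "(\<integral>z. mker e z \<partial>lborel) > 0" .
qed

text \<open>A pairing of \<open>F\<close> with \<open>k\<close> is an average of pairings of
  \<open>g\<close> with translates of \<open>k\<close>, so every upper bound shared by the small
  translates survives. Translates of unit fields are unit fields; this is how smoothing keeps the
  variation from growing. The other conclusions record the sup bound, the support and the L1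
  distance.\<close>

lemma mollification:
  fixes g :: "R2 \<Rightarrow> real"
  assumes g: "integrable lborel g" and e: "e > 0"
  obtains F G where "C1grad F G" "integrable lborel F"
    "\<And>k c B. continuous_on UNIV k \<Longrightarrow> (\<And>x. \<bar>k x\<bar> \<le> B) \<Longrightarrow>
        (\<And>z. norm z < e \<Longrightarrow> (\<integral>x. g x * k (x + z) \<partial>lborel) \<le> c) \<Longrightarrow> (\<integral>x. F x * k x \<partial>lborel) \<le> c"
    "\<And>b. (\<And>x. \<bar>g x\<bar> \<le> b) \<Longrightarrow> (\<And>x. \<bar>F x\<bar> \<le> b)"
    "\<And>y R. (\<And>x. x \<notin> cball y R \<Longrightarrow> g x = 0) \<Longrightarrow> (\<And>x. x \<notin> cball y (R + e) \<Longrightarrow> F x = 0)"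
    "\<And>t. (\<And>h. norm h < e \<Longrightarrow> (\<integral>x. \<bar>g (x + h) - g x\<bar> \<partial>lborel) \<le> t) \<Longrightarrow> (\<integral>x. \<bar>F x - g x\<bar> \<partial>lborel) \<le> t"
proof -
  have gm[measurable]: "g \<in> borel_measurable borel" using g by simp
  define I where "I = (\<integral>z. mker e z \<partial>lborel)"
  have I0: "I > 0" and ki: "integrable lborel (mker e)" using mker_integral[OF e] by (auto simp: I_def)
  define F where "F x = (1 / I) * (\<integral>y. g y * mker e (x - y) \<partial>lborel)" for x
  define G where "G x = (1 / I) *\<^sub>R (\<integral>y. g y *\<^sub>R mkgrad e (x - y) \<partial>lborel)" for x
  have cG: "C1grad F G"
    using C1grad_mult[OF C1grad_const[of "1/I"] C1grad_convolution[OF e g]]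
    by (simp add: F_def[abs_def] G_def[abs_def])
  have Fm[measurable]: "F \<in> borel_measurable borel" by (rule borel_measurable_continuous_onI[OF C1grad_continuous[OF cG]])
  have F: "F x = (1 / I) * (\<integral>z. g (x + z) * mker e z \<partial>lborel)" for x
  proof -
    have "(\<integral>y. g y * mker e (x - y) \<partial>lborel) = (\<integral>z. g (z + x) * mker e (x - (z + x)) \<partial>lborel)"
      by (rule integral_shift[symmetric]) simp
    thus ?thesis by (simp add: F_def add.commute mker_def)
  qed
  have sh: "integrable lborel (\<lambda>x. g (x + z))" for z by (rule integrable_shift[OF g])
  have n1: "(\<integral>x. \<bar>g (x + z)\<bar> \<partial>lborel) = (\<integral>x. \<bar>g x\<bar> \<partial>lborel)" for z
    using integral_shift[of "\<lambda>x. \<bar>g x\<bar>" z] by simp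
  have big: "integrable (lborel \<Otimes>\<^sub>M lborel) (\<lambda>(z, x). mker e z * (g (x + z) * k x))"
    if km[measurable]: "k \<in> borel_measurable borel" and kb: "\<And>x. \<bar>k x\<bar> \<le> B'" for k B'
  proof (rule lborel_pair.Fubini_integrable)
    have i: "integrable lborel (\<lambda>x. g (x + z) * k x)" for z
      using integrable_scaleR_bounded[OF sh, of k B'] kb by simp
    show "AE z in lborel. integrable lborel (\<lambda>x. case (z, x) of (z, x) \<Rightarrow> mker e z * (g (x + z) * k x))"
      using i by (intro AE_I2) simp
    have B0: "B' \<ge> 0" using kb[of 0] by linarith
    have le: "(\<integral>x. \<bar>g (x + z) * k x\<bar> \<partial>lborel) \<le> B' * (\<integral>x. \<bar>g x\<bar> \<partial>lborel)" for z
    proof -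
      have "(\<integral>x. \<bar>g (x + z) * k x\<bar> \<partial>lborel) \<le> (\<integral>x. B' * \<bar>g (x + z)\<bar> \<partial>lborel)"
      proof (rule integral_mono)
        show "integrable lborel (\<lambda>x. \<bar>g (x + z) * k x\<bar>)" using i by (rule integrable_abs)
        show "\<bar>g (x + z) * k x\<bar> \<le> B' * \<bar>g (x + z)\<bar>" for x
          using mult_left_mono[OF kb abs_ge_zero] by (simp add: abs_mult mult.commute[of B'])
      qed (use sh in simp)
      thus ?thesis using n1 by simp
    qed
    show "integrable lborel (\<lambda>z. \<integral>x. norm (case (z, x) of (z, x) \<Rightarrow> mker e z * (g (x + z) * k x)) \<partial>lborel)"
    proof (rule Bochner_Integration.integrable_bound)
      show "integrable lborel (\<lambda>z. mker e z * (B' * (\<integral>x. \<bar>g x\<bar> \<partial>lborel)))" using ki by simp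
      show "AE z in lborel. norm (\<integral>x. norm (case (z, x) of (z, x) \<Rightarrow> mker e z * (g (x + z) * k x)) \<partial>lborel)
         \<le> norm (mker e z * (B' * (\<integral>x. \<bar>g x\<bar> \<partial>lborel)))"
        using le mult_left_mono[OF le mker_nonneg] B0 mker_nonneg[of e]
        by (intro AE_I2) (auto simp: abs_mult)
    qed simp
  qed simp
  have Fint: "integrable lborel F"
  proof -
    have "integrable (lborel \<Otimes>\<^sub>M lborel) (\<lambda>(z, x). mker e z * (g (x + z) * 1))" by (rule big[of _ 1]) auto
    from lborel_pair.integrable_snd[OF this] have "integrable lborel (\<lambda>x. \<integral>z. mker e z * (g (x + z) * 1) \<partial>lborel)" by simp
    hence "integrable lborel (\<lambda>x. (1 / I) * (\<integral>z. mker e z * (g (x + z) * 1) \<partial>lborel))" by (rule integrable_mult_right)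
    moreover have "F = (\<lambda>x. (1 / I) * (\<integral>z. mker e z * (g (x + z) * 1) \<partial>lborel))"
      by (rule ext) (simp add: F mult.commute)
    ultimately show ?thesis by (simp only:)
  qed
  have pair: "(\<integral>x. F x * k x \<partial>lborel) \<le> c"
    if k: "continuous_on UNIV k" and kb: "\<And>x. \<bar>k x\<bar> \<le> B" and le: "\<And>z. norm z < e \<Longrightarrow> (\<integral>x. g x * k (x + z) \<partial>lborel) \<le> c" for k c B
  proof -
    have km[measurable]: "k \<in> borel_measurable borel" by (rule borel_measurable_continuous_onI[OF k])
    have le': "(\<integral>x. g (x + z) * k x \<partial>lborel) \<le> c" if "norm z < e" for z
    proof -
      have "(\<integral>x. g (x + z) * k x \<partial>lborel) = (\<integral>x. g (x + - z + z) * k (x + - z) \<partial>lborel)"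
        by (rule integral_shift[symmetric]) simp
      thus ?thesis using le[of "- z"] that by simp
    qed
    have fi: "integrable (lborel \<Otimes>\<^sub>M lborel) (\<lambda>(z, x). mker e z * (g (x + z) * k x))" by (rule big[OF km kb])
    have pt: "I * (F x * k x) = (\<integral>z. mker e z * (g (x + z) * k x) \<partial>lborel)" for x
    proof -
      have "I * (F x * k x) = (\<integral>z. g (x + z) * mker e z \<partial>lborel) * k x" using I0 by (simp add: F)
      also have "\<dots> = (\<integral>z. (g (x + z) * mker e z) * k x \<partial>lborel)" by (rule integral_mult_left_zero[symmetric])
      also have "(\<lambda>z. (g (x + z) * mker e z) * k x) = (\<lambda>z. mker e z * (g (x + z) * k x))" by (simp add: mult_ac)
      finally show ?thesis .
    qed
    have "I * (\<integral>x. F x * k x \<partial>lborel) = (\<integral>x. (\<integral>z. mker e z * (g (x + z) * k x) \<partial>lborel) \<partial>lborel)"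
      by (simp only: pt[symmetric] integral_mult_right_zero)
    also have "\<dots> = (\<integral>z. (\<integral>x. mker e z * (g (x + z) * k x) \<partial>lborel) \<partial>lborel)"
      using lborel_pair.Fubini_integral[OF fi] by simp
    also have "\<dots> \<le> (\<integral>z. mker e z * c \<partial>lborel)"
    proof (rule integral_mono)
      show "integrable lborel (\<lambda>z. \<integral>x. mker e z * (g (x + z) * k x) \<partial>lborel)"
        using lborel_pair.integrable_fst[OF fi] by simp
      show "(\<integral>x. mker e z * (g (x + z) * k x) \<partial>lborel) \<le> mker e z * c" for z
        using le'[of z] mker_nonneg[of e z] mker_zero(1)[OF e, of z]
        by (cases "norm z < e") (auto intro: mult_left_mono)
    qed (use ki in simp)
    also have "\<dots> = I * c" by (simp add: I_def)
    finally show ?thesis using I0 by simp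
  qed
  have bnd: "\<bar>F x\<bar> \<le> b" if "\<And>x. \<bar>g x\<bar> \<le> b" for b x
  proof -
    have "I * \<bar>F x\<bar> = \<bar>\<integral>z. g (x + z) * mker e z \<partial>lborel\<bar>" using I0 by (simp add: F abs_mult)
    also have "\<dots> \<le> (\<integral>z. b * mker e z \<partial>lborel)"
    proof (rule integral_abs_bound[THEN order_trans], rule integral_mono)
      show "integrable lborel (\<lambda>z. \<bar>g (x + z) * mker e z\<bar>)"
        using integrable_scaleR_bounded[OF ki, of "\<lambda>z. g (x + z)" b] that by (simp add: mult.commute)
      show "\<bar>g (x + z) * mker e z\<bar> \<le> b * mker e z" for z
        using mult_right_mono[OF that mker_nonneg] mker_nonneg[of e z] by (simp add: abs_mult)
    qed (use ki in simp)
    also have "\<dots> = I * b" by (simp add: I_def)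
    finally show ?thesis using I0 by simp
  qed
  have supp: "F x = 0" if "\<And>x. x \<notin> cball y R \<Longrightarrow> g x = 0" "x \<notin> cball y (R + e)" for y R x
  proof -
    have "g (x + z) * mker e z = 0" for z
    proof (cases "norm z < e")
      case True
      have "dist y x \<le> dist y (x + z) + norm z"
        using dist_triangle[of y x "x + z"] by (simp add: dist_norm)
      hence "x + z \<notin> cball y R" using that(2) True by auto
      thus ?thesis using that(1) by simp
    qed (use mker_zero(1)[OF e, of z] in simp)
    hence "(\<lambda>z. g (x + z) * mker e z) = (\<lambda>z. 0)" by blast
    thus ?thesis unfolding F by simp
  qed
  have L1: "(\<integral>x. \<bar>F x - g x\<bar> \<partial>lborel) \<le> t"
    if t: "\<And>h. norm h < e \<Longrightarrow> (\<integral>x. \<bar>g (x + h) - g x\<bar> \<partial>lborel) \<le> t" for t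
  proof -
    define D where "D z x = mker e z * (g (x + z) - g x)" for z x
    have i1: "integrable (lborel \<Otimes>\<^sub>M lborel) (\<lambda>(z, x). mker e z * (g (x + z) * 1))" by (rule big[of _ 1]) auto
    have i2: "integrable (lborel \<Otimes>\<^sub>M lborel) (\<lambda>(z, x). mker e z * g x)"
      by (rule lborel_pair.Fubini_integrable) (use ki g in \<open>auto simp: abs_mult mker_nonneg\<close>)
    have Di: "integrable (lborel \<Otimes>\<^sub>M lborel) (\<lambda>(z, x). D z x)"
      using Bochner_Integration.integrable_diff[OF i1 i2] by (simp add: D_def case_prod_unfold right_diff_distrib)
    hence Da: "integrable (lborel \<Otimes>\<^sub>M lborel) (\<lambda>(z, x). \<bar>D z x\<bar>)"
      using integrable_abs[OF Di] by (simp add: case_prod_unfold)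
    have pw: "I * \<bar>F x - g x\<bar> \<le> (\<integral>z. \<bar>D z x\<bar> \<partial>lborel)" if "integrable lborel (\<lambda>z. D z x)" for x
    proof -
      have gk: "integrable lborel (\<lambda>z. mker e z * g x)" using ki by simp
      have "integrable lborel (\<lambda>z. D z x + mker e z * g x)" using that gk by (rule Bochner_Integration.integrable_add)
      hence gz: "integrable lborel (\<lambda>z. g (x + z) * mker e z)" by (simp add: D_def algebra_simps)
      have "I * (F x - g x) = (\<integral>z. g (x + z) * mker e z \<partial>lborel) - (\<integral>z. mker e z * g x \<partial>lborel)"
        using I0 by (simp add: F I_def right_diff_distrib)
      also have "\<dots> = (\<integral>z. g (x + z) * mker e z - mker e z * g x \<partial>lborel)"
        using gk gz by (rule Bochner_Integration.integral_diff[symmetric, rotated])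
      also have "\<dots> = (\<integral>z. D z x \<partial>lborel)" by (simp add: D_def algebra_simps)
      finally have "\<bar>I * (F x - g x)\<bar> \<le> (\<integral>z. \<bar>D z x\<bar> \<partial>lborel)" using integral_abs_bound[of lborel "\<lambda>z. D z x"] by simp
      thus ?thesis using I0 by (simp add: abs_mult)
    qed
    have ae: "AE x in lborel. integrable lborel (\<lambda>z. D z x)"
      using lborel_pair.AE_integrable_snd[OF Di] by simp
    have "I * (\<integral>x. \<bar>F x - g x\<bar> \<partial>lborel) = (\<integral>x. I * \<bar>F x - g x\<bar> \<partial>lborel)" by simp
    also have "\<dots> \<le> (\<integral>x. (\<integral>z. \<bar>D z x\<bar> \<partial>lborel) \<partial>lborel)"
    proof (rule integral_mono_AE)
      show "integrable lborel (\<lambda>x. I * \<bar>F x - g x\<bar>)" using Fint g by simp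
      show "integrable lborel (\<lambda>x. \<integral>z. \<bar>D z x\<bar> \<partial>lborel)" using lborel_pair.integrable_snd[OF Da] by simp
      show "AE x in lborel. I * \<bar>F x - g x\<bar> \<le> (\<integral>z. \<bar>D z x\<bar> \<partial>lborel)"
        using ae by eventually_elim (rule pw)
    qed
    also have "\<dots> = (\<integral>z. (\<integral>x. \<bar>D z x\<bar> \<partial>lborel) \<partial>lborel)" using lborel_pair.Fubini_integral[OF Da] by simp
    also have "\<dots> \<le> (\<integral>z. mker e z * t \<partial>lborel)"
    proof (rule integral_mono)
      show "integrable lborel (\<lambda>z. \<integral>x. \<bar>D z x\<bar> \<partial>lborel)" using lborel_pair.integrable_fst[OF Da] by simp
      show "(\<integral>x. \<bar>D z x\<bar> \<partial>lborel) \<le> mker e z * t" for z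
        using t[of z] mker_nonneg[of e z] mker_zero(1)[OF e, of z]
        by (cases "norm z < e") (auto simp: D_def abs_mult intro: mult_left_mono)
    qed (use ki in simp)
    also have "\<dots> = I * t" by (simp add: I_def)
    finally show ?thesis using I0 by simp
  qed
  show ?thesis by (rule that[OF cG Fint pair bnd supp L1])
qed

section \<open>Splitting the total variation and level sets\<close>

text \<open>By translation invariance the integral of \<psi>(x + s h) does not depend on
  \<open>s\<close>, and its derivative in \<open>s\<close> is the integral in question.\<close>

lemma integral_C1grad_zero:
  assumes \<psi>: "C1grad \<psi> G" "\<And>x. x \<notin> cball 0 R \<Longrightarrow> \<psi> x = 0"
  shows "(\<integral>x. G x \<bullet> h \<partial>lebesgue) = 0"
proof -
  have l: "loc_int (\<lambda>x. 1)" by (rule loc_int_bounded[of _ 1]) auto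
  have m: "\<psi> \<in> borel_measurable borel" by (rule borel_measurable_continuous_onI[OF C1grad_continuous[OF \<psi>(1)]])
  have "(\<integral>x. 1 * \<psi> (x + s *\<^sub>R h) \<partial>lebesgue) = (\<integral>x. \<psi> x \<partial>lborel)" for s
    using integral_shift[OF m, of "s *\<^sub>R h"] m by (subst lebesgue_integral_eq_lborel) auto
  hence "((\<lambda>s::real. \<integral>x. \<psi> x \<partial>lborel) has_real_derivative (\<integral>x. 1 * (G (x + 0 *\<^sub>R h) \<bullet> h) \<partial>lebesgue)) (at 0)"
    using conv_has_derivative[OF l \<psi>, where h = h and s = 0] by simp
  from DERIV_unique[OF this DERIV_const] show ?thesis by simp
qed

text \<open>The rows of the Jacobian are the gradients of the components, so the divergence is a sum
  of directional derivatives, each of integral zero.\<close>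

lemma integral_divg_zero:
  assumes t: "testfield \<phi>"
  shows "(\<integral>x. divg \<phi> x \<partial>lebesgue) = 0"
proof -
  obtain R where R: "R > 0" "\<And>x. x \<notin> cball 0 R \<Longrightarrow> \<phi> x = 0" using testfield_zero_outside[OF t] by blast
  define D where "D x = frechet_derivative \<phi> (at x)" for x
  define G where "G i x = (\<chi> j. D x (axis j 1) $ i)" for i x
  have lin: "linear (D x)" for x
    unfolding D_def using testfieldD(1)[OF t] has_derivative_linear by blast
  have G: "C1grad (\<lambda>x. \<phi> x $ i) (G i)" for i
    unfolding C1grad_def
  proof (intro conjI allI)
    fix x
    have "D x v $ i = G i x \<bullet> v" for v
    proof -
      have "D x v = D x (\<Sum>j\<in>UNIV. (v $ j) *\<^sub>R axis j 1)"
        using basis_expansion[of v] by (simp add: scalar_mult_eq_scaleR)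
      also have "\<dots> = (\<Sum>j\<in>UNIV. (v $ j) *\<^sub>R D x (axis j 1))"
        by (simp add: linear_sum[OF lin] linear_scale[OF lin])
      finally show ?thesis by (simp add: G_def inner_vec_def mult.commute)
    qed
    moreover have "((\<lambda>x. \<phi> x $ i) has_derivative (\<lambda>v. D x v $ i)) (at x)"
      unfolding D_def by (rule bounded_linear.has_derivative[OF bounded_linear_vec_nth testfieldD(1)[OF t]])
    ultimately show "((\<lambda>x. \<phi> x $ i) has_derivative (\<lambda>v. G i x \<bullet> v)) (at x)" by simp
    have "continuous_on UNIV (\<lambda>x. D x (axis j 1) $ i)" for j
      unfolding D_def by (intro continuous_intros testfieldD(2)[OF t])
    thus "continuous_on UNIV (G i)" unfolding G_def by (intro continuous_on_vec_lambda)
  qed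
  have z: "\<phi> x $ i = 0" if "x \<notin> cball 0 R" for x i using R(2)[OF that] by simp
  have i0: "(\<integral>x. G i x \<bullet> axis i 1 \<partial>lebesgue) = 0" for i by (rule integral_C1grad_zero[OF G z])
  have l: "loc_int (\<lambda>x. 1)" by (rule loc_int_bounded[of _ 1]) auto
  have ii: "integrable lebesgue (\<lambda>x. G i x \<bullet> axis i 1)" for i
  proof -
    have "continuous_on UNIV (\<lambda>x. G i x \<bullet> axis i 1)"
      using G[of i] by (intro continuous_intros) (simp add: C1grad_def)
    hence "integrable lebesgue (\<lambda>x. 1 * (G i x \<bullet> axis i 1))"
    proof (rule loc_int_mult_cont[OF l, where y = 0 and R = R])
      fix x :: R2 assume "x \<notin> cball 0 R"
      hence "G i x = 0" using C1grad_zero_outside[OF G closed_cball z] by blast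
      thus "G i x \<bullet> axis i 1 = 0" by simp
    qed
    thus ?thesis by simp
  qed
  have "divg \<phi> x = (\<Sum>i\<in>UNIV. G i x \<bullet> axis i 1)" for x
    by (simp add: divg_def G_def D_def inner_axis)
  hence "(\<integral>x. divg \<phi> x \<partial>lebesgue) = (\<Sum>i\<in>UNIV. (\<integral>x. G i x \<bullet> axis i 1 \<partial>lebesgue))"
    by (simp add: Bochner_Integration.integral_sum ii)
  thus ?thesis using i0 by simp
qed

section \<open>Chain rule and splitting of the variation\<close>

text \<open>Equivalent to \<open>TV g \<le> ereal c\<close>, but stated over the reals: extended
  arithmetic is avoided and a bound can be proved against one test field at a time.\<close>

definition TVle :: "(R2 \<Rightarrow> real) \<Rightarrow> real \<Rightarrow> bool" where
  "TVle g c \<longleftrightarrow> (\<forall>\<phi>. testfield \<phi> \<longrightarrow> (\<forall>x. norm (\<phi> x) \<le> 1) \<longrightarrow> (\<integral>x. g x * divg \<phi> x \<partial>lebesgue) \<le> c)"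

lemma TVleD: "TVle g c \<Longrightarrow> testfield \<phi> \<Longrightarrow> (\<And>x. norm (\<phi> x) \<le> 1) \<Longrightarrow> (\<integral>x. g x * divg \<phi> x \<partial>lebesgue) \<le> c"
  by (auto simp: TVle_def)

lemma TVle_scaled:
  assumes "TVle g c" "testfield \<phi>" "\<And>x. norm (\<phi> x) \<le> M" "M > 0"
  shows "(\<integral>x. g x * divg \<phi> x \<partial>lebesgue) \<le> M * c"
proof -
  have "(\<integral>x. g x * divg (\<lambda>x. (1 / M) *\<^sub>R \<phi> x) x \<partial>lebesgue) \<le> c"
    by (rule TVleD[OF assms(1) testfield_cmult(1)[OF assms(2)]]) (use assms(3,4) in \<open>simp add: divide_le_eq\<close>)
  moreover have "(\<lambda>x. g x * divg (\<lambda>x. (1 / M) *\<^sub>R \<phi> x) x) = (\<lambda>x. (1 / M) * (g x * divg \<phi> x))"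
    by (simp only: testfield_cmult(2)[OF assms(2)]) (simp add: mult_ac)
  ultimately show ?thesis using assms(4) by (simp add: divide_le_eq mult.commute)
qed

text \<open>With K(s) = s H'(s) - H(s), so that K' = s H'', the difference of the two integrands is
  the divergence of K(u) \<phi>, whose integral is zero. The gradient of \<open>u\<close> has
  disappeared from the identity, which is why it can pass to limits of smooth functions.\<close>

lemma smooth_chain_rule:
  assumes u: "C1grad u G" and H: "\<And>s. (H has_real_derivative H' s) (at s)" "\<And>s. (H' has_real_derivative H'' s) (at s)" "continuous_on UNIV H''"
    and t: "testfield \<phi>"
  shows "(\<integral>x. H (u x) * divg \<phi> x \<partial>lebesgue) = (\<integral>x. u x * divg (\<lambda>x. H' (u x) *\<^sub>R \<phi> x) x \<partial>lebesgue)"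
proof -
  have Hc: "continuous_on UNIV H" "continuous_on UNIV H'"
    using H(1,2) DERIV_continuous_on by blast+
  define K where "K s = s * H' s - H s" for s
  have K: "(K has_real_derivative s * H'' s) (at s)" for s
    unfolding K_def by (rule derivative_eq_intros H refl | simp)+
  have cK: "C1grad (\<lambda>x. K (u x)) (\<lambda>x. (u x * H'' (u x)) *\<^sub>R G x)"
    by (rule C1grad_compose[OF K _ u]) (intro continuous_intros H(3))
  have cH': "C1grad (\<lambda>x. H' (u x)) (\<lambda>x. H'' (u x) *\<^sub>R G x)"
    by (rule C1grad_compose[OF H(2,3) u])
  have uc: "continuous_on UNIV u" by (rule C1grad_continuous[OF u])
  have lu: "integrable lebesgue (\<lambda>x. k x * divg \<psi> x)" if k: "continuous_on UNIV k" and \<psi>: "testfield \<psi>" for k \<psi>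
  proof -
    obtain R where R: "R > 0" "\<And>x. x \<notin> cball 0 R \<Longrightarrow> \<psi> x = 0" using testfield_zero_outside[OF \<psi>] by blast
    have "loc_int (\<lambda>x. 1)" by (rule loc_int_bounded[of _ 1]) auto
    hence "integrable lebesgue (\<lambda>x. 1 * (k x * divg \<psi> x))"
    proof (rule loc_int_mult_cont[where y = 0 and R = R])
      fix x :: R2 assume "x \<notin> cball 0 R"
      hence "divg \<psi> x = 0" using divg_zero_outside[OF \<psi> closed_cball R(2)] by blast
      thus "k x * divg \<psi> x = 0" by simp
    qed (intro continuous_intros k continuous_divg[OF \<psi>])
    thus ?thesis by simp
  qed
  have i1: "integrable lebesgue (\<lambda>x. H (u x) * divg \<phi> x)"
    by (intro lu t continuous_on_compose2[OF Hc(1) uc]) simp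
  have i2: "integrable lebesgue (\<lambda>x. u x * divg (\<lambda>x. H' (u x) *\<^sub>R \<phi> x) x)"
    by (intro lu uc testfield_scale(1)[OF t cH'])
  have "(\<integral>x. u x * divg (\<lambda>x. H' (u x) *\<^sub>R \<phi> x) x \<partial>lebesgue) - (\<integral>x. H (u x) * divg \<phi> x \<partial>lebesgue)
     = (\<integral>x. u x * divg (\<lambda>x. H' (u x) *\<^sub>R \<phi> x) x - H (u x) * divg \<phi> x \<partial>lebesgue)" using i1 i2 by simp
  also have "\<dots> = (\<integral>x. divg (\<lambda>x. K (u x) *\<^sub>R \<phi> x) x \<partial>lebesgue)"
    unfolding testfield_scale(2)[OF t cH'] testfield_scale(2)[OF t cK] by (simp add: K_def algebra_simps)
  also have "\<dots> = 0" by (rule integral_divg_zero[OF testfield_scale(1)[OF t cK]])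
  finally show ?thesis by simp
qed

lemma lipschitz_compose_loc_int:
  assumes H: "\<And>a b. \<bar>H a - H b\<bar> \<le> M * \<bar>a - b\<bar>" "continuous_on UNIV H" and w: "loc_int w"
  shows "loc_int (\<lambda>x. H (w x))"
  unfolding loc_int_def
proof (intro conjI allI)
  have wm: "w \<in> borel_measurable lebesgue" using w by (simp add: loc_int_def)
  have Hm: "H \<in> borel_measurable borel" by (rule borel_measurable_continuous_onI[OF H(2)])
  show m: "(\<lambda>x. H (w x)) \<in> borel_measurable lebesgue" by (rule measurable_compose[OF wm Hm])
  fix R
  have c: "loc_int (\<lambda>x. \<bar>H 0\<bar>)" by (rule loc_int_bounded[of _ "\<bar>H 0\<bar>"]) auto
  have M0: "0 \<le> M" using order_trans[OF abs_ge_zero H(1)[of 1 0]] by simp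
  show "integrable lebesgue (\<lambda>x. indicator (cball 0 R) x * H (w x))"
  proof (rule Bochner_Integration.integrable_bound)
    show "integrable lebesgue (\<lambda>x. indicator (cball 0 R) x * \<bar>H 0\<bar> + M * \<bar>indicator (cball 0 R) x * w x\<bar>)"
      using c w unfolding loc_int_def by (intro Bochner_Integration.integrable_add integrable_mult_right integrable_abs) auto
    show "AE x in lebesgue. norm (indicator (cball 0 R) x * H (w x)) \<le> norm (indicator (cball 0 R) x * \<bar>H 0\<bar> + M * \<bar>indicator (cball 0 R) x * w x\<bar>)"
    proof (rule AE_I2)
      fix x
      have "\<bar>H (w x)\<bar> \<le> \<bar>H 0\<bar> + M * \<bar>w x\<bar>" using H(1)[of "w x" 0] by simp
      thus "norm (indicator (cball 0 R) x * H (w x)) \<le> norm (indicator (cball 0 R) x * \<bar>H 0\<bar> + M * \<bar>indicator (cball 0 R) x * w x\<bar>)"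
        using M0 by (auto simp: indicator_def)
    qed
    show "(\<lambda>x. indicator (cball 0 R) x * H (w x)) \<in> borel_measurable lebesgue"
      by (intro borel_measurable_times borel_measurable_indicator m) auto
  qed
qed

text \<open>Composition with a Lipschitz function turns L1-closeness into closeness of pairings;
  this is the estimate that removes the mollification at the end of the splitting.\<close>

lemma lipschitz_pairing:
  assumes H: "\<And>a b. \<bar>H a - H b\<bar> \<le> M * \<bar>a - b\<bar>" "continuous_on UNIV H"
    and w: "loc_int w1" "loc_int w2" "integrable lebesgue (\<lambda>x. w1 x - w2 x)"
    and t: "testfield \<phi>" and B: "\<And>x. \<bar>divg \<phi> x\<bar> \<le> B"
  shows "(\<integral>x. H (w1 x) * divg \<phi> x \<partial>lebesgue) \<le> (\<integral>x. H (w2 x) * divg \<phi> x \<partial>lebesgue) + M * B * (\<integral>x. \<bar>w1 x - w2 x\<bar> \<partial>lebesgue)"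
proof -
  have i: "integrable lebesgue (\<lambda>x. H (w1 x) * divg \<phi> x)" "integrable lebesgue (\<lambda>x. H (w2 x) * divg \<phi> x)"
    using loc_int_divg[OF lipschitz_compose_loc_int[OF H] t] w by auto
  have "(\<integral>x. H (w1 x) * divg \<phi> x \<partial>lebesgue) \<le> (\<integral>x. H (w2 x) * divg \<phi> x + M * B * \<bar>w1 x - w2 x\<bar> \<partial>lebesgue)"
  proof (rule integral_mono)
    fix x
    have "(H (w1 x) - H (w2 x)) * divg \<phi> x \<le> \<bar>H (w1 x) - H (w2 x)\<bar> * \<bar>divg \<phi> x\<bar>" by (simp add: abs_mult[symmetric])
    also have "\<dots> \<le> (M * \<bar>w1 x - w2 x\<bar>) * B"
      using H(1)[of "w1 x" "w2 x"] B[of x] by (intro mult_mono) (auto intro: order_trans[OF abs_ge_zero])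
    finally show "H (w1 x) * divg \<phi> x \<le> H (w2 x) * divg \<phi> x + M * B * \<bar>w1 x - w2 x\<bar>" by (simp add: algebra_simps)
  qed (use i w in auto)
  also have "\<dots> = (\<integral>x. H (w2 x) * divg \<phi> x \<partial>lebesgue) + M * B * (\<integral>x. \<bar>w1 x - w2 x\<bar> \<partial>lebesgue)"
    using i w by simp
  finally show ?thesis .
qed

lemma divg_bounded:
  assumes "testfield \<phi>"
  obtains B where "B > 0" "\<And>x. \<bar>divg \<phi> x\<bar> \<le> B"
proof -
  obtain R where R: "R > 0" "\<And>x. x \<notin> cball 0 R \<Longrightarrow> \<phi> x = 0" using testfield_zero_outside[OF assms] by blast
  have "divg \<phi> x = 0" if "x \<notin> cball 0 R" for x
    using divg_zero_outside[OF assms closed_cball R(2)] that by blast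
  from bounded_if_compact_support[OF continuous_divg[OF assms] this] obtain B where "B > 0" "\<And>x. norm (divg \<phi> x) \<le> B"
    by blast
  thus ?thesis using that by simp
qed

text \<open>For smooth \<open>u\<close> the two integrals add up to the pairing of \<open>u\<close> with the divergence of the single field
  \<open>H'(u) \<phi> + (M - H'(u)) \<psi>\<close>, whose length is at most \<open>M\<close>; the general case follows by mollification,
  which does not increase the variation.\<close>

lemma TV_splitting:
  assumes u: "loc_int u" "TVle u c"
    and H: "\<And>s. (H has_real_derivative H' s) (at s)" "\<And>s. (H' has_real_derivative H'' s) (at s)" "continuous_on UNIV H''"
    and M: "M > 0" "\<And>s. 0 \<le> H' s" "\<And>s. H' s \<le> M"
    and t: "testfield \<phi>" "\<And>x. norm (\<phi> x) \<le> 1" "testfield \<psi>" "\<And>x. norm (\<psi> x) \<le> 1"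
  shows "(\<integral>x. H (u x) * divg \<phi> x \<partial>lebesgue) + (\<integral>x. (M * u x - H (u x)) * divg \<psi> x \<partial>lebesgue) \<le> M * c"
proof -
  have um: "u \<in> borel_measurable lebesgue" using u by (simp add: loc_int_def)
  obtain u' where u': "u' \<in> borel_measurable lborel" "AE x in lborel. u x = u' x"
    using completion_ex_borel_measurable_real[OF um] by blast
  obtain R1 where R1: "R1 > 0" "\<And>x. x \<notin> cball 0 R1 \<Longrightarrow> \<phi> x = 0" using testfield_zero_outside[OF t(1)] by blast
  obtain R2 where R2: "R2 > 0" "\<And>x. x \<notin> cball 0 R2 \<Longrightarrow> \<psi> x = 0" using testfield_zero_outside[OF t(3)] by blast
  define R where "R = max R1 R2"
  have R: "R > 0" "\<And>x. x \<notin> cball 0 R \<Longrightarrow> \<phi> x = 0" "\<And>x. x \<notin> cball 0 R \<Longrightarrow> \<psi> x = 0"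
    using R1 R2 by (auto simp: R_def)
  \<comment> \<open>A Borel, integrable substitute for \<open>u\<close>. The mollification radius is
    at most 1, so fields supported in radius \<open>R\<close> and shifted by less than that stay
    inside the margin of 2, where \<open>g\<close> agrees with \<open>u\<close> almost
    everywhere.\<close>
  define g where "g x = indicator (cball 0 (R + 2)) x * u' x" for x
  have um': "u' \<in> borel_measurable borel" using u'(1) by simp
  have gm[measurable]: "g \<in> borel_measurable borel"
    unfolding g_def by (intro borel_measurable_times borel_measurable_indicator um') auto
  have aeu: "AE x in lebesgue. u x = u' x" using u'(2) by (rule AE_completion)
  have gl: "integrable lebesgue g"
  proof (rule integrable_cong_AE_imp)
    show "integrable lebesgue (\<lambda>x. indicator (cball 0 (R + 2)) x * u x)" using u by (simp add: loc_int_def)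
    show "g \<in> borel_measurable lebesgue" using gm by (intro measurable_completion) simp
    show "AE x in lebesgue. indicator (cball 0 (R + 2)) x * u x = g x" using aeu by eventually_elim (simp add: g_def)
  qed
  hence gi: "integrable lborel g" by (simp add: lebesgue_integral_eq_lborel)
  have gu: "AE x in lebesgue. x \<in> cball 0 (R + 2) \<longrightarrow> g x = u x" using aeu by eventually_elim (simp add: g_def)
  have lig: "loc_int w" if "integrable lebesgue w" for w
    using integrable_mult_indicator[OF _ that] that by (auto simp: loc_int_def)
  obtain B1 where B1: "B1 > 0" "\<And>x. \<bar>divg \<phi> x\<bar> \<le> B1" using divg_bounded[OF t(1)] by blast
  obtain B2 where B2: "B2 > 0" "\<And>x. \<bar>divg \<psi> x\<bar> \<le> B2" using divg_bounded[OF t(3)] by blast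
  have Hc: "continuous_on UNIV H" "continuous_on UNIV H'" using H(1,2) DERIV_continuous_on by blast+
  define L where "L s = M * s - H s" for s
  have Lf: "L = (\<lambda>s. M * s - H s)" by (rule ext) (rule L_def)
  have L: "(L has_real_derivative M - H' s) (at s)" "((\<lambda>s. M - H' s) has_real_derivative - H'' s) (at s)" for s
    using DERIV_diff[OF DERIV_cmult_Id[of M] H(1)[of s]] DERIV_diff[OF DERIV_const[of M] H(2)[of s]]
    by (simp_all add: Lf)
  have Lc: "continuous_on UNIV L" unfolding Lf by (intro continuous_intros Hc(1))
  have lip: "\<bar>P a - P b\<bar> \<le> M * \<bar>a - b\<bar>" if "\<And>s. (P has_real_derivative P' s) (at s)" "\<And>s. \<bar>P' s\<bar> \<le> M" for P P' a b
  proof -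
    have "norm (P a - P b) \<le> M * norm (a - b)"
      by (rule field_differentiable_bound[of UNIV P P']) (use that in auto)
    thus ?thesis by simp
  qed
  have Hl: "\<bar>H a - H b\<bar> \<le> M * \<bar>a - b\<bar>" for a b by (rule lip[OF H(1)]) (use M in auto)
  have Ll: "\<bar>L a - L b\<bar> \<le> M * \<bar>a - b\<bar>" for a b by (rule lip[OF L(1)]) (use M in \<open>auto simp: abs_le_iff\<close>)
  have sw: "(\<integral>x. P (u x) * divg \<zeta> x \<partial>lebesgue) = (\<integral>x. P (g x) * divg \<zeta> x \<partial>lebesgue)"
    if P: "continuous_on UNIV P" and \<zeta>: "testfield \<zeta>" "\<And>x. x \<notin> cball 0 (R+2) \<Longrightarrow> \<zeta> x = 0" for P \<zeta>
  proof (rule integral_cong_AE)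
    have Pm: "P \<in> borel_measurable borel" by (rule borel_measurable_continuous_onI[OF P])
    have dm: "divg \<zeta> \<in> borel_measurable lebesgue" by (rule continuous_measurable_lebesgue[OF continuous_divg[OF \<zeta>(1)]])
    show "(\<lambda>x. P (u x) * divg \<zeta> x) \<in> borel_measurable lebesgue" "(\<lambda>x. P (g x) * divg \<zeta> x) \<in> borel_measurable lebesgue"
      using measurable_compose[OF um Pm] measurable_compose[OF borel_measurable_integrable[OF gl] Pm] dm
      by (auto intro: borel_measurable_times)
    show "AE x in lebesgue. P (u x) * divg \<zeta> x = P (g x) * divg \<zeta> x"
      using gu
    proof eventually_elim
      fix x assume gx: "x \<in> cball 0 (R + 2) \<longrightarrow> g x = u x"
      show "P (u x) * divg \<zeta> x = P (g x) * divg \<zeta> x"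
      proof (cases "x \<in> cball 0 (R + 2)")
        case False
        hence "divg \<zeta> x = 0" using divg_zero_outside[OF \<zeta>(1) closed_cball \<zeta>(2)] by blast
        thus ?thesis by simp
      qed (use gx in simp)
    qed
  qed
  show ?thesis
  proof (rule field_le_epsilon)
    fix \<epsilon> :: real assume \<epsilon>: "\<epsilon> > 0"
    define \<delta> where "\<delta> = \<epsilon> / (M * B1 + M * B2)"
    have \<delta>: "\<delta> > 0" using \<epsilon> M B1 B2 by (simp add: \<delta>_def add_pos_pos)
    obtain d where d: "d > 0" "\<And>h. norm h < d \<Longrightarrow> (\<integral>x. \<bar>g (x + h) - g x\<bar> \<partial>lborel) < \<delta>"
      using L1_translation_continuous[OF gi \<delta>] by blast
    have d1: "min d 1 > 0" using d by simp
    obtain F G where F: "C1grad F G" "integrable lborel F"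
      "\<And>k c B. continuous_on UNIV k \<Longrightarrow> (\<And>x. \<bar>k x\<bar> \<le> B) \<Longrightarrow>
        (\<And>z. norm z < min d 1 \<Longrightarrow> (\<integral>x. g x * k (x + z) \<partial>lborel) \<le> c) \<Longrightarrow> (\<integral>x. F x * k x \<partial>lborel) \<le> c"
      "\<And>t. (\<And>h. norm h < min d 1 \<Longrightarrow> (\<integral>x. \<bar>g (x + h) - g x\<bar> \<partial>lborel) \<le> t) \<Longrightarrow> (\<integral>x. \<bar>F x - g x\<bar> \<partial>lborel) \<le> t"
      by (rule mollification[OF gi d1]) blast
    have Fl: "integrable lebesgue F" using F(2) by (simp add: integrable_completion)
    have Fm[measurable]: "F \<in> borel_measurable borel" using F(2) by simp
    have FL1: "(\<integral>x. \<bar>g x - F x\<bar> \<partial>lebesgue) \<le> \<delta>"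
      using F(4)[of \<delta>] d(2) by (subst lebesgue_integral_eq_lborel) (auto simp: abs_minus_commute less_imp_le)
    have cH: "C1grad (\<lambda>x. H' (F x)) (\<lambda>x. H'' (F x) *\<^sub>R G x)" by (rule C1grad_compose[OF H(2,3) F(1)])
    have cL: "C1grad (\<lambda>x. M - H' (F x)) (\<lambda>x. - H'' (F x) *\<^sub>R G x)"
      by (rule C1grad_compose[OF L(2) _ F(1)]) (intro continuous_intros H(3))
    define \<Xi> where "\<Xi> x = H' (F x) *\<^sub>R \<phi> x + (M - H' (F x)) *\<^sub>R \<psi> x" for x
    have t1: "testfield (\<lambda>x. H' (F x) *\<^sub>R \<phi> x)" by (rule testfield_scale(1)[OF t(1) cH])
    have t2: "testfield (\<lambda>x. (M - H' (F x)) *\<^sub>R \<psi> x)" by (rule testfield_scale(1)[OF t(3) cL])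
    have t\<Xi>: "testfield \<Xi>" unfolding \<Xi>_def by (rule testfield_add(1)[OF t1 t2])
    have n\<Xi>: "norm (\<Xi> x) \<le> M" for x
    proof -
      have "norm (\<Xi> x) \<le> H' (F x) * norm (\<phi> x) + (M - H' (F x)) * norm (\<psi> x)"
        unfolding \<Xi>_def using M by (intro norm_triangle_le) simp
      also have "\<dots> \<le> H' (F x) * 1 + (M - H' (F x)) * 1"
        using M t by (intro add_mono mult_left_mono) auto
      finally show ?thesis by simp
    qed
    have z\<Xi>: "x \<notin> cball 0 R \<Longrightarrow> \<Xi> x = 0" for x using R by (simp add: \<Xi>_def)
    obtain B where B: "\<And>x. \<bar>divg \<Xi> x\<bar> \<le> B" using divg_bounded[OF t\<Xi>] by blast
    have "(\<integral>x. F x * divg \<Xi> x \<partial>lborel) \<le> M * c"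
    proof (rule F(3)[OF continuous_divg[OF t\<Xi>] B])
      fix z :: R2 assume z: "norm z < min d 1"
      have tz: "testfield (\<lambda>x. \<Xi> (x + z))" by (rule testfield_shift(1)[OF t\<Xi>])
      have zz: "\<Xi> (x + z) = 0" if "x \<notin> cball 0 (R + 2)" for x
      proof (rule z\<Xi>)
        have "norm x \<le> norm (x + z) + norm z" using norm_triangle_ineq4[of "x + z" z] by simp
        thus "x + z \<notin> cball 0 R" using that z by simp
      qed
      have [measurable]: "divg \<Xi> \<in> borel_measurable borel" by (rule borel_measurable_continuous_onI[OF continuous_divg[OF t\<Xi>]])
      have "(\<integral>x. g x * divg \<Xi> (x + z) \<partial>lborel) = (\<integral>x. g x * divg \<Xi> (x + z) \<partial>lebesgue)"
        by (subst lebesgue_integral_eq_lborel) auto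
      also have "\<dots> = (\<integral>x. u x * divg (\<lambda>x. \<Xi> (x + z)) x \<partial>lebesgue)"
        using sw[of "\<lambda>s. s", OF _ tz zz] by (simp add: testfield_shift(2)[OF t\<Xi>])
      also have "\<dots> \<le> M * c" by (rule TVle_scaled[OF u(2) tz n\<Xi> M(1)])
      finally show "(\<integral>x. g x * divg \<Xi> (x + z) \<partial>lborel) \<le> M * c" .
    qed
    moreover have "divg \<Xi> \<in> borel_measurable borel" by (rule borel_measurable_continuous_onI[OF continuous_divg[OF t\<Xi>]])
    hence "(\<integral>x. F x * divg \<Xi> x \<partial>lebesgue) = (\<integral>x. F x * divg \<Xi> x \<partial>lborel)"
      by (intro lebesgue_integral_eq_lborel borel_measurable_times Fm)
    ultimately have A: "(\<integral>x. F x * divg \<Xi> x \<partial>lebesgue) \<le> M * c" by simp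
    have "(\<integral>x. H (F x) * divg \<phi> x \<partial>lebesgue) + (\<integral>x. L (F x) * divg \<psi> x \<partial>lebesgue)
       = (\<integral>x. F x * divg (\<lambda>x. H' (F x) *\<^sub>R \<phi> x) x \<partial>lebesgue) + (\<integral>x. F x * divg (\<lambda>x. (M - H' (F x)) *\<^sub>R \<psi> x) x \<partial>lebesgue)"
      using smooth_chain_rule[OF F(1) H t(1)] smooth_chain_rule[OF F(1) L _ t(3)] H(3)
      by (simp add: continuous_intros)
    also have "\<dots> = (\<integral>x. F x * divg (\<lambda>x. H' (F x) *\<^sub>R \<phi> x) x + F x * divg (\<lambda>x. (M - H' (F x)) *\<^sub>R \<psi> x) x \<partial>lebesgue)"
      using loc_int_divg[OF lig[OF Fl] t1] loc_int_divg[OF lig[OF Fl] t2] by simp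
    also have "\<dots> = (\<integral>x. F x * divg \<Xi> x \<partial>lebesgue)"
      unfolding \<Xi>_def testfield_add(2)[OF t1 t2] by (simp add: distrib_left)
    finally have Bd: "(\<integral>x. H (F x) * divg \<phi> x \<partial>lebesgue) + (\<integral>x. L (F x) * divg \<psi> x \<partial>lebesgue) \<le> M * c" using A by simp
    have gF: "integrable lebesgue (\<lambda>x. g x - F x)" using gl Fl by simp
    have z2: "\<phi> x = 0" "\<psi> x = 0" if "x \<notin> cball 0 (R + 2)" for x
    proof -
      have "x \<notin> cball 0 R" using that by simp
      thus "\<phi> x = 0" "\<psi> x = 0" using R by auto
    qed
    have s1: "(\<integral>x. H (u x) * divg \<phi> x \<partial>lebesgue) \<le> (\<integral>x. H (F x) * divg \<phi> x \<partial>lebesgue) + M * B1 * (\<integral>x. \<bar>g x - F x\<bar> \<partial>lebesgue)"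
      by (subst sw[OF Hc(1) t(1)], erule z2(1), rule lipschitz_pairing[OF Hl Hc(1) lig[OF gl] lig[OF Fl] gF t(1) B1(2)])
    have s2: "(\<integral>x. L (u x) * divg \<psi> x \<partial>lebesgue) \<le> (\<integral>x. L (F x) * divg \<psi> x \<partial>lebesgue) + M * B2 * (\<integral>x. \<bar>g x - F x\<bar> \<partial>lebesgue)"
      by (subst sw[OF Lc t(3)], erule z2(2), rule lipschitz_pairing[OF Ll Lc lig[OF gl] lig[OF Fl] gF t(3) B2(2)])
    have "(M * B1 + M * B2) * (\<integral>x. \<bar>g x - F x\<bar> \<partial>lebesgue) \<le> (M * B1 + M * B2) * \<delta>"
      using FL1 M B1 B2 by (intro mult_left_mono) auto
    also have "\<dots> = \<epsilon>" using M B1 B2 by (simp add: \<delta>_def add_pos_pos less_imp_neq[symmetric])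
    finally have s3: "M * B1 * (\<integral>x. \<bar>g x - F x\<bar> \<partial>lebesgue) + M * B2 * (\<integral>x. \<bar>g x - F x\<bar> \<partial>lebesgue) \<le> \<epsilon>"
      by (simp only: distrib_right)
    show "(\<integral>x. H (u x) * divg \<phi> x \<partial>lebesgue) + (\<integral>x. (M * u x - H (u x)) * divg \<psi> x \<partial>lebesgue) \<le> M * c + \<epsilon>"
      using s1 s2 s3 Bd unfolding L_def by linarith
  qed
qed

section \<open>A step function of class C^2\<close>

lemma DERIV_pospart_cube:
  "((\<lambda>s. (max s 0)^3) has_real_derivative 3 * (max s 0)\<^sup>2) (at s)"
proof -
  have e: "(max s 0)^3 = s * (max s 0)\<^sup>2" for s :: real by (auto simp: max_def power3_eq_cube power2_eq_square)
  have "((\<lambda>s. s * (max s 0)\<^sup>2) has_real_derivative 1 * (max s 0)\<^sup>2 + (2 * max s 0) * s) (at s)"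
    by (rule DERIV_mult[OF DERIV_ident DERIV_pospart_square])
  moreover have "1 * (max s 0)\<^sup>2 + (2 * max s 0) * s = 3 * (max s 0)\<^sup>2"
    by (auto simp: max_def power2_eq_square)
  ultimately show ?thesis unfolding e by (simp only:)
qed

text \<open>The primitive of the quadratic B-spline with knots 0, 1/3, 2/3, 1; the factor 9/2 makes
  the total rise equal to 1. The splitting asks for a continuous second derivative, which
  \<open>smoothstep\<close> does not have.\<close>

definition step2 :: "real \<Rightarrow> real" where
  "step2 s = 9/2 * ((max s 0)^3 - 3 * (max (s - 1/3) 0)^3 + 3 * (max (s - 2/3) 0)^3 - (max (s - 1) 0)^3)"

definition step2' :: "real \<Rightarrow> real" where
  "step2' s = 27/2 * ((max s 0)\<^sup>2 - 3 * (max (s - 1/3) 0)\<^sup>2 + 3 * (max (s - 2/3) 0)\<^sup>2 - (max (s - 1) 0)\<^sup>2)"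

definition step2'' :: "real \<Rightarrow> real" where
  "step2'' s = 27 * (max s 0 - 3 * max (s - 1/3) 0 + 3 * max (s - 2/3) 0 - max (s - 1) 0)"

lemma DERIV_step2: "(step2 has_real_derivative step2' s) (at s)" "(step2' has_real_derivative step2'' s) (at s)"
proof -
  have c: "((\<lambda>s. s - c) has_real_derivative 1) (at s)" for c by (auto intro!: derivative_eq_intros)
  have sh3: "((\<lambda>s. (max (s - c) 0)^3) has_real_derivative 3 * (max (s - c) 0)\<^sup>2) (at s)" for c
    using DERIV_chain2[OF DERIV_pospart_cube c] by simp
  have sh2: "((\<lambda>s. (max (s - c) 0)\<^sup>2) has_real_derivative 2 * max (s - c) 0) (at s)" for c
    using DERIV_chain2[OF DERIV_pospart_square c] by simp
  have "((\<lambda>s. 9/2 * ((max s 0)^3 - 3 * (max (s - 1/3) 0)^3 + 3 * (max (s - 2/3) 0)^3 - (max (s - 1) 0)^3)) has_real_derivative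
     9/2 * (3 * (max s 0)\<^sup>2 - 3 * (3 * (max (s - 1/3) 0)\<^sup>2) + 3 * (3 * (max (s - 2/3) 0)\<^sup>2) - 3 * (max (s - 1) 0)\<^sup>2)) (at s)"
    by (intro DERIV_add DERIV_diff DERIV_cmult sh3 DERIV_pospart_cube)
  thus "(step2 has_real_derivative step2' s) (at s)"
    by (simp add: step2_def[abs_def] step2'_def algebra_simps)
  have "((\<lambda>s. 27/2 * ((max s 0)\<^sup>2 - 3 * (max (s - 1/3) 0)\<^sup>2 + 3 * (max (s - 2/3) 0)\<^sup>2 - (max (s - 1) 0)\<^sup>2)) has_real_derivative
     27/2 * (2 * max s 0 - 3 * (2 * max (s - 1/3) 0) + 3 * (2 * max (s - 2/3) 0) - 2 * max (s - 1) 0)) (at s)"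
    by (intro DERIV_add DERIV_diff DERIV_cmult sh2 DERIV_pospart_square)
  thus "(step2' has_real_derivative step2'' s) (at s)"
    by (simp add: step2'_def[abs_def] step2''_def algebra_simps)
qed

lemma continuous_step2'': "continuous_on UNIV step2''"
  unfolding step2''_def[abs_def] by (intro continuous_intros)

text \<open>Any finite upper bound would serve: 14 is 27/2 rounded up, from the crude estimate that
  the bracket \<open>r\<close> is at most 1.\<close>

lemma step2'_bounds: "0 \<le> step2' s" "step2' s \<le> 14"
proof -
  define r where "r = (max s 0)\<^sup>2 - 3 * (max (s - 1/3) 0)\<^sup>2 + 3 * (max (s - 2/3) 0)\<^sup>2 - (max (s - 1) 0)\<^sup>2"
  consider "s \<le> 0" | "0 \<le> s" "s \<le> 1/3" | "1/3 \<le> s" "s \<le> 2/3" | "2/3 \<le> s" "s \<le> 1" | "1 \<le> s" by linarith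
  hence "0 \<le> r \<and> r \<le> 1"
  proof cases
    case 1 thus ?thesis by (simp add: r_def)
  next
    case 2 hence "r = s\<^sup>2" by (simp add: r_def)
    moreover have "s\<^sup>2 \<le> 1\<^sup>2" using 2 by (intro power_mono) auto
    ultimately show ?thesis by simp
  next
    case 3 hence r: "r = s\<^sup>2 - 3 * (s - 1/3)\<^sup>2" by (simp add: r_def)
    have "r = 2 * ((s - 1/3) * (2/3 - s)) + 1/9" unfolding r by (simp add: power2_eq_square field_simps)
    moreover have "0 \<le> (s - 1/3) * (2/3 - s)" using 3 by simp
    moreover have "(s - 1/3) * (2/3 - s) \<le> (1/3) * (1/3)" using 3 by (intro mult_mono) auto
    ultimately show ?thesis by simp
  next
    case 4 hence r: "r = s\<^sup>2 - 3 * (s - 1/3)\<^sup>2 + 3 * (s - 2/3)\<^sup>2" by (simp add: r_def)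
    have "r = (1 - s)\<^sup>2" unfolding r by (simp add: power2_eq_square field_simps)
    moreover have "(1 - s)\<^sup>2 \<le> 1\<^sup>2" using 4 by (intro power_mono) auto
    ultimately show ?thesis by simp
  next
    case 5 hence r: "r = s\<^sup>2 - 3 * (s - 1/3)\<^sup>2 + 3 * (s - 2/3)\<^sup>2 - (s - 1)\<^sup>2" by (simp add: r_def)
    have "r = 0" unfolding r by (simp add: power2_eq_square field_simps)
    thus ?thesis by simp
  qed
  thus "0 \<le> step2' s" "step2' s \<le> 14" unfolding step2'_def r_def[symmetric] by auto
qed

lemma step2_zero: "s \<le> 0 \<Longrightarrow> step2 s = 0"
  by (simp add: step2_def)

lemma step2_one: "s \<ge> 1 \<Longrightarrow> step2 s = 1"
proof -
  assume "s \<ge> 1"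
  hence "step2 s = 9/2 * (s^3 - 3 * (s - 1/3)^3 + 3 * (s - 2/3)^3 - (s - 1)^3)" by (simp add: step2_def)
  also have "\<dots> = 1" by (simp add: power3_eq_cube field_simps)
  finally show ?thesis .
qed

lemma step2_mono: "s \<le> t \<Longrightarrow> step2 s \<le> step2 t"
  by (rule DERIV_nonneg_imp_nondecreasing) (use DERIV_step2(1) step2'_bounds in blast)+

lemma step2_range: "0 \<le> step2 s" "step2 s \<le> 1"
  using step2_mono[of "min s 0" s] step2_zero[of "min s 0"]
    step2_mono[of s "max s 1"] step2_one[of "max s 1"] by auto

section \<open>Calibrations and their passage to level sets\<close>

text \<open>Membership of \<open>v\<close> in the subdifferential at \<open>u\<close>, unfolded by
  one-homogeneity: \<open>v\<close> pairs with each \<open>g\<close> to at most its variation, with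
  equality at \<open>u\<close>. The last clause is one half of the equality, the other half is the
  case g = u.\<close>

definition calib :: "(R2 \<Rightarrow> real) \<Rightarrow> (R2 \<Rightarrow> real) \<Rightarrow> bool" where
  "calib v u \<longleftrightarrow> L2 v \<and> L2 u \<and> (\<forall>g c. L2 g \<longrightarrow> TVle g c \<longrightarrow> (\<integral>x. v x * g x \<partial>lebesgue) \<le> c)
     \<and> TVle u (\<integral>x. v x * u x \<partial>lebesgue)"

lemma calibD: "calib v u \<Longrightarrow> L2 g \<Longrightarrow> TVle g c \<Longrightarrow> (\<integral>x. v x * g x \<partial>lebesgue) \<le> c"
  by (auto simp: calib_def)

lemma TVle_uminus: assumes "TVle g c" shows "TVle (\<lambda>x. - g x) c"
  unfolding TVle_def
proof (intro allI impI)
  fix \<phi> assume t: "testfield \<phi>" "\<forall>x. norm (\<phi> x) \<le> 1"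
  have "(\<integral>x. g x * divg (\<lambda>x. - \<phi> x) x \<partial>lebesgue) \<le> c"
    by (rule TVleD[OF assms testfield_uminus(1)[OF t(1)]]) (use t in auto)
  thus "(\<integral>x. - g x * divg \<phi> x \<partial>lebesgue) \<le> c" by (simp add: testfield_uminus(2)[OF t(1)])
qed

lemma calib_uminus: assumes "calib v u" shows "calib (\<lambda>x. - v x) (\<lambda>x. - u x)"
  unfolding calib_def
proof (intro conjI allI impI)
  show "L2 (\<lambda>x. - v x)" "L2 (\<lambda>x. - u x)" using assms by (auto simp: calib_def L2_uminus)
  show "TVle (\<lambda>x. - u x) (\<integral>x. - v x * - u x \<partial>lebesgue)" using assms TVle_uminus[of u] by (simp add: calib_def)
  fix g c assume g: "L2 g" "TVle g c"
  from calibD[OF assms L2_uminus[OF g(1)] TVle_uminus[OF g(2)]]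
  show "(\<integral>x. - v x * g x \<partial>lebesgue) \<le> c" by simp
qed

text \<open>Let H be a smooth step of slope at most M. Splitting gives J(H(u)) + J(M u - H(u)) <= M
  J(u), where the right side is M <v, u>, and \<open>v\<close> pairs with M u - H(u) to at most its
  variation. Subtraction leaves J(H(u)) <= <v, H(u)>. As the step steepens to a jump at
  \<open>t\<close>, the inequality passes to the indicator.\<close>

lemma calib_superlevel:
  assumes c: "calib v u" and t: "t > 0"
  defines "E \<equiv> {x. u x \<ge> t}"
  shows "E \<in> sets lebesgue" "emeasure lebesgue E < \<infinity>" "calib v (indicator E)"
proof -
  have vL: "L2 v" and uL: "L2 u" and uT: "TVle u (\<integral>x. v x * u x \<partial>lebesgue)" using c by (auto simp: calib_def)
  have um: "u \<in> borel_measurable lebesgue" by (rule L2_measurable[OF uL])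
  have lv: "{x. u x \<ge> s} \<in> sets lebesgue \<and> emeasure lebesgue {x. u x \<ge> s} < \<infinity>" if s: "s > 0" for s
  proof
    have "{x \<in> space lebesgue. u x \<ge> s} \<in> sets lebesgue" using um by measurable
    thus m: "{x. u x \<ge> s} \<in> sets lebesgue" by simp
    have "integrable lebesgue (\<lambda>x. indicator {x. u x \<ge> s} x :: real)"
    proof (rule Bochner_Integration.integrable_bound[of _ "\<lambda>x. (1 / s\<^sup>2) * (u x)\<^sup>2"])
      show "integrable lebesgue (\<lambda>x. (1 / s\<^sup>2) * (u x)\<^sup>2)" using L2_integrable_sq[OF uL] by simp
      have "1 \<le> (1 / s\<^sup>2) * (u x)\<^sup>2" if "u x \<ge> s" for x
        using power_mono[OF that, of 2] s by simp
      thus "AE x in lebesgue. norm (indicator {x. u x \<ge> s} x :: real) \<le> norm ((1 / s\<^sup>2) * (u x)\<^sup>2)"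
        by (intro AE_I2) (auto simp: indicator_def)
    qed (use m in simp)
    thus "emeasure lebesgue {x. u x \<ge> s} < \<infinity>" using m by (simp add: integrable_indicator_iff)
  qed
  show E: "E \<in> sets lebesgue" "emeasure lebesgue E < \<infinity>" using lv[OF t] by (auto simp: E_def)
  define D where "D = {x. u x \<ge> t / 2}"
  have D: "D \<in> sets lebesgue" "emeasure lebesgue D < \<infinity>" using lv[of "t/2"] t by (auto simp: D_def)
  have DL: "L2 (indicator D)" by (rule L2_indicator[OF D])
  \<comment> \<open>With this slope \<open>H n\<close> rises between t - t/(2(n+1)) and t. All these
    intervals lie above t/2, so \<open>indicator D\<close> dominates, and since each step has
    reached 1 at \<open>t\<close>, the limit is the closed superlevel set.\<close>
  define a where "a n = 2 * real (Suc n) / t" for n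
  have a0: "a n > 0" for n using t by (simp add: a_def)
  define H where "H n s = step2 (a n * (s - t) + 1)" for n s
  have lin: "((\<lambda>s. a n * (s - t) + 1) has_real_derivative a n) (at s)" for n s
    by (auto intro!: derivative_eq_intros)
  have H1: "(H n has_real_derivative step2' (a n * (s - t) + 1) * a n) (at s)" for n s
    using DERIV_chain2[OF DERIV_step2(1) lin] by (simp add: H_def[abs_def])
  have H2: "((\<lambda>s. step2' (a n * (s - t) + 1) * a n) has_real_derivative step2'' (a n * (s - t) + 1) * a n * a n) (at s)" for n s
    using DERIV_cmult_right[OF DERIV_chain2[OF DERIV_step2(2) lin], where c = "a n"] by simp
  have H3: "continuous_on UNIV (\<lambda>s. step2'' (a n * (s - t) + 1) * a n * a n)" for n
    by (intro continuous_intros continuous_on_compose2[OF continuous_step2'']) auto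
  have Hc: "continuous_on UNIV (H n)" for n
    by (rule DERIV_continuous_on) (use H1 in \<open>auto intro: has_field_derivative_at_within\<close>)
  have Hm: "(\<lambda>x. H n (u x)) \<in> borel_measurable lebesgue" for n
    by (rule measurable_compose[OF um borel_measurable_continuous_onI[OF Hc]])
  have Hb: "\<bar>H n (u x)\<bar> \<le> indicator D x" for n x
  proof (cases "x \<in> D")
    case True thus ?thesis using step2_range by (simp add: H_def)
  next
    case False
    hence "u x - t \<le> - (t / 2)" by (simp add: D_def)
    hence "a n * (u x - t) \<le> a n * (- (t / 2))" using a0[of n] by (intro mult_left_mono) auto
    also have "\<dots> = - real (Suc n)" using t by (simp add: a_def field_simps)
    finally have "a n * (u x - t) + 1 \<le> 0" by simp
    thus ?thesis by (simp add: H_def step2_zero)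
  qed
  have HL: "L2 (\<lambda>x. H n (u x))" for n
    by (rule L2_bound[OF DL Hm, of _ 1]) (use Hb in auto)
  have lim: "(\<lambda>n. H n (u x)) \<longlonglongrightarrow> indicator E x" for x
  proof (cases "u x \<ge> t")
    case True
    hence "H n (u x) = 1" for n using a0[of n] by (simp add: H_def step2_one)
    thus ?thesis using True by (simp add: E_def)
  next
    case False
    define p where "p = 2 * (t - u x) / t"
    have p0: "0 < p" using False t by (simp add: p_def)
    then obtain N :: nat where N: "1 < real N * p" using reals_Archimedean3 by blast
    have "H n (u x) = 0" if "n \<ge> N" for n
    proof -
      have "real N * p \<le> real (Suc n) * p" using that p0 by (intro mult_right_mono) auto
      moreover have "a n * (u x - t) = - (real (Suc n) * p)" using t by (simp add: a_def p_def field_simps)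
      ultimately have "a n * (u x - t) + 1 \<le> 0" using N by linarith
      thus ?thesis by (simp add: H_def step2_zero)
    qed
    hence "(\<lambda>n. H n (u x)) \<longlonglongrightarrow> 0" by (intro tendsto_eventually eventually_sequentiallyI)
    thus ?thesis using False by (simp add: E_def)
  qed
  have conv: "(\<lambda>n. \<integral>x. k x * H n (u x) \<partial>lebesgue) \<longlonglongrightarrow> (\<integral>x. k x * indicator E x \<partial>lebesgue)" if k: "L2 k" for k
  proof (rule integral_dominated_convergence[where w = "\<lambda>x. \<bar>k x * indicator D x\<bar>"])
    have km: "k \<in> borel_measurable lebesgue" by (rule L2_measurable[OF k])
    show "(\<lambda>x. k x * indicator E x) \<in> borel_measurable lebesgue"
      using km E(1) by (auto intro: borel_measurable_times borel_measurable_indicator)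
    show "(\<lambda>x. k x * H n (u x)) \<in> borel_measurable lebesgue" for n
      using km Hm by (rule borel_measurable_times)
    show "integrable lebesgue (\<lambda>x. \<bar>k x * indicator D x\<bar>)" using L2_integrable_mult[OF k DL] by (rule integrable_abs)
    show "AE x in lebesgue. (\<lambda>n. k x * H n (u x)) \<longlonglongrightarrow> k x * indicator E x"
      by (intro AE_I2 tendsto_intros lim)
    show "AE x in lebesgue. norm (k x * H n (u x)) \<le> \<bar>k x * indicator D x\<bar>" for n
    proof (rule AE_I2)
      fix x show "norm (k x * H n (u x)) \<le> \<bar>k x * indicator D x\<bar>"
        using mult_left_mono[OF Hb[of n x] abs_ge_zero[of "k x"]] by (simp add: abs_mult)
    qed
  qed
  show "calib v (indicator E)"
    unfolding calib_def
  proof (intro conjI allI impI vL L2_indicator E)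
    fix g c' assume "L2 g" "TVle g c'"
    thus "(\<integral>x. v x * g x \<partial>lebesgue) \<le> c'" by (rule calibD[OF c])
  next
    show "TVle (indicator E) (\<integral>x. v x * indicator E x \<partial>lebesgue)"
      unfolding TVle_def
    proof (intro allI impI)
      fix \<phi> assume \<phi>: "testfield \<phi>" "\<forall>x. norm (\<phi> x) \<le> 1"
      have dL: "L2 (divg \<phi>)" by (rule L2_divg[OF \<phi>(1)])
      have le: "(\<integral>x. divg \<phi> x * H n (u x) \<partial>lebesgue) \<le> (\<integral>x. v x * H n (u x) \<partial>lebesgue)" for n
      proof -
        define M where "M = 14 * a n"
        have M: "M > 0" using a0[of n] by (simp add: M_def)
        have wL: "L2 (\<lambda>x. M * u x - H n (u x))" by (intro L2_diff L2_cmult uL HL)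
        \<comment> \<open>With \<phi> fixed, the splitting bounds the pairing with every \<psi>;
          read as a bound on the variation of M u - H(u), it can be fed to
          \<open>calibD\<close>.\<close>
        have "TVle (\<lambda>x. M * u x - H n (u x)) (M * (\<integral>x. v x * u x \<partial>lebesgue) - (\<integral>x. H n (u x) * divg \<phi> x \<partial>lebesgue))"
          unfolding TVle_def
        proof (intro allI impI)
          fix \<psi> assume \<psi>: "testfield \<psi>" "\<forall>x. norm (\<psi> x) \<le> 1"
          have "(\<integral>x. H n (u x) * divg \<phi> x \<partial>lebesgue) + (\<integral>x. (M * u x - H n (u x)) * divg \<psi> x \<partial>lebesgue) \<le> M * (\<integral>x. v x * u x \<partial>lebesgue)"
          proof (rule TV_splitting[OF L2_loc_int[OF uL] uT H1 H2 H3 M])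
            show "0 \<le> step2' (a n * (s - t) + 1) * a n" "step2' (a n * (s - t) + 1) * a n \<le> M" for s
              using step2'_bounds a0[of n] by (auto simp: M_def intro!: mult_right_mono)
          qed (use \<phi> \<psi> in auto)
          thus "(\<integral>x. (M * u x - H n (u x)) * divg \<psi> x \<partial>lebesgue) \<le> M * (\<integral>x. v x * u x \<partial>lebesgue) - (\<integral>x. H n (u x) * divg \<phi> x \<partial>lebesgue)"
            by simp
        qed
        from calibD[OF c wL this]
        have "(\<integral>x. v x * (M * u x - H n (u x)) \<partial>lebesgue) \<le> M * (\<integral>x. v x * u x \<partial>lebesgue) - (\<integral>x. H n (u x) * divg \<phi> x \<partial>lebesgue)" .
        moreover have "(\<integral>x. v x * (M * u x - H n (u x)) \<partial>lebesgue) = M * (\<integral>x. v x * u x \<partial>lebesgue) - (\<integral>x. v x * H n (u x) \<partial>lebesgue)"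
          using L2_integrable_mult[OF vL uL] L2_integrable_mult[OF vL HL[of n]]
          by (simp add: right_diff_distrib mult.left_commute[of _ M])
        ultimately show ?thesis by (simp add: mult.commute)
      qed
      have "(\<integral>x. divg \<phi> x * indicator E x \<partial>lebesgue) \<le> (\<integral>x. v x * indicator E x \<partial>lebesgue)"
        by (rule LIMSEQ_le[OF conv[OF dL] conv[OF vL]]) (use le in auto)
      thus "(\<integral>x. indicator E x * divg \<phi> x \<partial>lebesgue) \<le> (\<integral>x. v x * indicator E x \<partial>lebesgue)"
        by (simp add: mult.commute)
    qed
  qed
qed

text \<open>For t < 0 the set {u <= t} is the superlevel set {-u >= -t}, and -v calibrates -u; the
  sign \<sigma> keeps both cases in one statement.\<close>

lemma calib_lev:
  assumes c: "calib v u" and t: "t \<noteq> 0"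
  obtains \<sigma> :: real where "\<sigma> = 1 \<or> \<sigma> = -1" "lev u t \<in> sets lebesgue" "emeasure lebesgue (lev u t) < \<infinity>"
    "calib (\<lambda>x. \<sigma> * v x) (indicator (lev u t))"
proof (cases "t > 0")
  case True
  hence e: "lev u t = {x. u x \<ge> t}" by (simp add: lev_def)
  show ?thesis by (rule that[of 1]) (use calib_superlevel[OF c True] in \<open>auto simp: e\<close>)
next
  case False
  hence e: "lev u t = {x. - u x \<ge> - t}" by (auto simp: lev_def)
  have "- t > 0" using False t by simp
  show ?thesis by (rule that[of "-1"]) (use calib_superlevel[OF calib_uminus[OF c] \<open>- t > 0\<close>] in \<open>auto simp: e\<close>)
qed

section \<open>Cutting a level set\<close>

text \<open>An upper bound for the variation of the cut set: its pairing with \<open>v\<close> plus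
  the price of the cut, twice the gradient bound times the area of the part of \<open>A\<close>
  where the gradient lives. A set calibrated by \<open>v\<close> satisfies it with \<open>v\<close>
  and its complement with -v, so one density estimate covers both sides.\<close>

definition quasi_minimal :: "R2 set \<Rightarrow> (R2 \<Rightarrow> real) \<Rightarrow> bool" where
  "quasi_minimal A v \<longleftrightarrow> A \<in> sets lebesgue \<and> L2 v \<and>
     (\<forall>\<eta> G y b S L. C1grad \<eta> G \<longrightarrow> (\<forall>x. 0 \<le> \<eta> x \<and> \<eta> x \<le> 1) \<longrightarrow> (\<forall>x. x \<notin> cball y b \<longrightarrow> \<eta> x = 0) \<longrightarrow>
        S \<in> lmeasurable \<longrightarrow> (\<forall>x. norm (G x) \<le> L * indicator S x) \<longrightarrow>
        TVle (\<lambda>x. \<eta> x * indicator A x)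
          ((\<integral>x. v x * (\<eta> x * indicator A x) \<partial>lebesgue) + 2 * L * measure lebesgue (A \<inter> S)))"

text \<open>\<open>p\<close> stands for a sum or difference of two unit fields, hence the bound 2
  and the factor 2 in the price of a cut.\<close>

lemma flux_bound:
  fixes A S :: "R2 set" and G p :: "R2 \<Rightarrow> R2"
  assumes A: "A \<in> sets lebesgue" and S: "S \<in> lmeasurable"
    and G: "continuous_on UNIV G" "\<And>x. norm (G x) \<le> L * indicator S x"
    and p: "continuous_on UNIV p" "\<And>x. norm (p x) \<le> 2"
  shows "integrable lebesgue (\<lambda>x. indicator A x * (G x \<bullet> p x))"
    "\<bar>\<integral>x. indicator A x * (G x \<bullet> p x) \<partial>lebesgue\<bar> \<le> 2 * L * measure lebesgue (A \<inter> S)"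
proof -
  have b: "\<bar>indicator A x * (G x \<bullet> p x)\<bar> \<le> (2 * L) * indicator (A \<inter> S) x" for x
  proof -
    have "\<bar>G x \<bullet> p x\<bar> \<le> norm (G x) * norm (p x)" by (rule Cauchy_Schwarz_ineq2)
    also have "\<dots> \<le> (L * indicator S x) * 2" using G(2)[of x] p(2)[of x]
      by (intro mult_mono) (auto intro: order_trans[OF norm_ge_zero])
    finally show ?thesis by (auto simp: indicator_def)
  qed
  have AS: "A \<inter> S \<in> lmeasurable" using A S by (rule fmeasurable_Int_fmeasurable[of S lebesgue A, simplified Int_commute, rotated])
  have i: "integrable lebesgue (\<lambda>x. (2 * L) * indicator (A \<inter> S) x :: real)"
    by (rule integrable_mult_right) (rule integrable_real_indicator, use AS in \<open>auto simp: fmeasurable_def\<close>)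
  have m: "(\<lambda>x. indicator A x * (G x \<bullet> p x)) \<in> borel_measurable lebesgue"
  proof (rule borel_measurable_times)
    show "(\<lambda>x. G x \<bullet> p x) \<in> borel_measurable lebesgue"
      by (rule continuous_measurable_lebesgue) (intro continuous_intros G p)
  qed (rule borel_measurable_indicator[OF A])
  show "integrable lebesgue (\<lambda>x. indicator A x * (G x \<bullet> p x))"
    by (rule Bochner_Integration.integrable_bound[OF i m]) (rule AE_I2, unfold real_norm_def, rule order_trans[OF b abs_ge_self])
  hence "\<bar>\<integral>x. indicator A x * (G x \<bullet> p x) \<partial>lebesgue\<bar> \<le> (\<integral>x. (2 * L) * indicator (A \<inter> S) x \<partial>lebesgue)"
    by (intro integral_abs_bound[THEN order_trans] integral_mono integrable_abs i b)
  also have "\<dots> = 2 * L * measure lebesgue (A \<inter> S)" by simp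
  finally show "\<bar>\<integral>x. indicator A x * (G x \<bullet> p x) \<partial>lebesgue\<bar> \<le> 2 * L * measure lebesgue (A \<inter> S)" .
qed

text \<open>The competitor is the outer piece (1 - \<eta>) 1_E. Since \<eta> \<phi> + (1 - \<eta>)
  \<psi> is a unit field, the variations of the inner and outer pieces add up to at most that of
  \<open>E\<close> plus the flux through the ring. The calibration bounds the outer piece from below
  by its pairing with \<open>v\<close>; the difference is the bound for the inner piece.\<close>

lemma calib_quasi_minimal_inside:
  assumes E: "E \<in> sets lebesgue" and c: "calib v (indicator E)"
  shows "quasi_minimal E v"
proof -
  have vL: "L2 v" and EL: "L2 (indicator E :: R2 \<Rightarrow> real)" and ET: "TVle (indicator E) (\<integral>x. v x * indicator E x \<partial>lebesgue)"
    using c by (auto simp: calib_def)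
  show ?thesis unfolding quasi_minimal_def
  proof (intro conjI allI impI E vL)
    fix \<eta> G y b S L
    assume \<eta>: "C1grad \<eta> G" and r: "\<forall>x. 0 \<le> \<eta> x \<and> \<eta> x \<le> 1" and s: "\<forall>x. x \<notin> cball y b \<longrightarrow> \<eta> x = 0"
      and S: "S \<in> lmeasurable" and L: "\<forall>x. norm (G x) \<le> L * indicator S x"
    let ?\<mu> = "2 * L * measure lebesgue (E \<inter> S)"
    have \<eta>m: "\<eta> \<in> borel_measurable lebesgue" by (rule continuous_measurable_lebesgue[OF C1grad_continuous[OF \<eta>]])
    have Im: "(indicator E :: R2 \<Rightarrow> real) \<in> borel_measurable lebesgue" by (rule borel_measurable_indicator[OF E])
    have m1: "(\<lambda>x. \<eta> x * indicator E x) \<in> borel_measurable lebesgue" "(\<lambda>x. (1 - \<eta> x) * indicator E x) \<in> borel_measurable lebesgue"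
      by (intro borel_measurable_times borel_measurable_diff borel_measurable_const \<eta>m Im)+
    have L1: "L2 (\<lambda>x. \<eta> x * indicator E x)" "L2 (\<lambda>x. (1 - \<eta> x) * indicator E x)"
    proof -
      show "L2 (\<lambda>x. \<eta> x * indicator E x)" by (rule L2_bound[OF EL m1(1), of 1]) (use r in \<open>auto simp: indicator_def\<close>)
      show "L2 (\<lambda>x. (1 - \<eta> x) * indicator E x)" by (rule L2_bound[OF EL m1(2), of 1]) (use r in \<open>auto simp: indicator_def\<close>)
    qed
    have Gc: "continuous_on UNIV G" using \<eta> by (simp add: C1grad_def)
    show "TVle (\<lambda>x. \<eta> x * indicator E x) ((\<integral>x. v x * (\<eta> x * indicator E x) \<partial>lebesgue) + ?\<mu>)"
      unfolding TVle_def
    proof (intro allI impI)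
      fix \<phi> assume \<phi>: "testfield \<phi>" "\<forall>x. norm (\<phi> x) \<le> 1"
      have "TVle (\<lambda>x. (1 - \<eta> x) * indicator E x) ((\<integral>x. v x * indicator E x \<partial>lebesgue) + ?\<mu> - (\<integral>x. \<eta> x * indicator E x * divg \<phi> x \<partial>lebesgue))"
        unfolding TVle_def
      proof (intro allI impI)
        fix \<psi> assume \<psi>: "testfield \<psi>" "\<forall>x. norm (\<psi> x) \<le> 1"
        define \<Xi> where "\<Xi> x = \<eta> x *\<^sub>R \<phi> x + (1 - \<eta> x) *\<^sub>R \<psi> x" for x
        note t1 = testfield_scale[OF \<phi>(1) \<eta>] and t2 = testfield_scale[OF \<psi>(1) C1grad_one_minus[OF \<eta>]]
        have t: "testfield \<Xi>" unfolding \<Xi>_def by (rule testfield_add(1)[OF t1(1) t2(1)])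
        have n: "norm (\<Xi> x) \<le> 1" for x
        proof -
          have "norm (\<Xi> x) \<le> \<eta> x * norm (\<phi> x) + (1 - \<eta> x) * norm (\<psi> x)"
            unfolding \<Xi>_def using r by (intro norm_triangle_le) simp
          also have "\<dots> \<le> \<eta> x * 1 + (1 - \<eta> x) * 1"
            using r \<phi> \<psi> by (intro add_mono mult_left_mono) auto
          finally show ?thesis by simp
        qed
        have p: "continuous_on UNIV (\<lambda>x. \<psi> x - \<phi> x)" "norm (\<psi> x - \<phi> x) \<le> 2" for x
        proof -
          show "continuous_on UNIV (\<lambda>x. \<psi> x - \<phi> x)" by (intro continuous_intros testfield_continuous \<phi> \<psi>)
          show "norm (\<psi> x - \<phi> x) \<le> 2"
            using norm_triangle_ineq4[of "\<psi> x" "\<phi> x"] \<phi>(2)[rule_format, of x] \<psi>(2)[rule_format, of x] by linarith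
        qed
        note fb = flux_bound[OF E S Gc L[rule_format] p]
        have iX: "integrable lebesgue (\<lambda>x. indicator E x * divg \<Xi> x)" by (rule L2_integrable_mult[OF EL L2_divg[OF t]])
        have i1: "integrable lebesgue (\<lambda>x. \<eta> x * indicator E x * divg \<phi> x)" by (rule L2_integrable_mult[OF L1(1) L2_divg[OF \<phi>(1)]])
        have i2: "integrable lebesgue (\<lambda>x. (1 - \<eta> x) * indicator E x * divg \<psi> x)" by (rule L2_integrable_mult[OF L1(2) L2_divg[OF \<psi>(1)]])
        have "(\<integral>x. \<eta> x * indicator E x * divg \<phi> x \<partial>lebesgue) + (\<integral>x. (1 - \<eta> x) * indicator E x * divg \<psi> x \<partial>lebesgue)
          = (\<integral>x. \<eta> x * indicator E x * divg \<phi> x + (1 - \<eta> x) * indicator E x * divg \<psi> x \<partial>lebesgue)" using i1 i2 by simp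
        also have "\<dots> = (\<integral>x. indicator E x * divg \<Xi> x + indicator E x * (G x \<bullet> (\<psi> x - \<phi> x)) \<partial>lebesgue)"
          unfolding \<Xi>_def testfield_add(2)[OF t1(1) t2(1)] t1(2) t2(2) by (simp add: algebra_simps inner_diff_right)
        also have "\<dots> = (\<integral>x. indicator E x * divg \<Xi> x \<partial>lebesgue) + (\<integral>x. indicator E x * (G x \<bullet> (\<psi> x - \<phi> x)) \<partial>lebesgue)"
          using iX fb(1) by (rule Bochner_Integration.integral_add)
        also have "\<dots> \<le> (\<integral>x. v x * indicator E x \<partial>lebesgue) + ?\<mu>"
          using TVleD[OF ET t n] fb(2) by (intro add_mono) auto
        finally show "(\<integral>x. (1 - \<eta> x) * indicator E x * divg \<psi> x \<partial>lebesgue) \<le>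
           (\<integral>x. v x * indicator E x \<partial>lebesgue) + ?\<mu> - (\<integral>x. \<eta> x * indicator E x * divg \<phi> x \<partial>lebesgue)" by simp
      qed
      from calibD[OF c L1(2) this]
      have 1: "(\<integral>x. v x * ((1 - \<eta> x) * indicator E x) \<partial>lebesgue) \<le> (\<integral>x. v x * indicator E x \<partial>lebesgue) + ?\<mu> - (\<integral>x. \<eta> x * indicator E x * divg \<phi> x \<partial>lebesgue)" .
      have "(\<lambda>x. v x * ((1 - \<eta> x) * indicator E x)) = (\<lambda>x. v x * indicator E x - v x * (\<eta> x * indicator E x))" by (auto simp: algebra_simps)
      hence "(\<integral>x. v x * ((1 - \<eta> x) * indicator E x) \<partial>lebesgue) = (\<integral>x. v x * indicator E x \<partial>lebesgue) - (\<integral>x. v x * (\<eta> x * indicator E x) \<partial>lebesgue)"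
        using L2_integrable_mult[OF vL L1(1)] L2_integrable_mult[OF vL EL] by simp
      thus "(\<integral>x. \<eta> x * indicator E x * divg \<phi> x \<partial>lebesgue) \<le> (\<integral>x. v x * (\<eta> x * indicator E x) \<partial>lebesgue) + ?\<mu>"
        using 1 by linarith
    qed
  qed
qed

text \<open>The competitor fills instead of cutting: 1_E + \<eta> 1_(-E). Because div(\<eta>(\<psi>
  + \<phi>)) has integral zero, integrals over the complement can be traded for integrals over
  \<open>E\<close>, where the unit field (1 - \<eta>) \<psi> - \<eta> \<phi> tests the calibrated
  set.\<close>

lemma calib_quasi_minimal_outside:
  assumes E: "E \<in> sets lebesgue" and c: "calib v (indicator E)"
  shows "quasi_minimal (- E) (\<lambda>x. - v x)"
proof -
  have vL: "L2 v" and EL: "L2 (indicator E :: R2 \<Rightarrow> real)" and ET: "TVle (indicator E) (\<integral>x. v x * indicator E x \<partial>lebesgue)"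
    using c by (auto simp: calib_def)
  have E': "- E \<in> sets lebesgue" using E sets.compl_sets[OF E] by (simp add: Compl_eq_Diff_UNIV)
  show ?thesis unfolding quasi_minimal_def
  proof (intro conjI allI impI E' L2_uminus vL)
    fix \<eta> G y b S L
    assume \<eta>: "C1grad \<eta> G" and r: "\<forall>x. 0 \<le> \<eta> x \<and> \<eta> x \<le> 1" and s: "\<forall>x. x \<notin> cball y b \<longrightarrow> \<eta> x = 0"
      and S: "S \<in> lmeasurable" and L: "\<forall>x. norm (G x) \<le> L * indicator S x"
    let ?\<mu> = "2 * L * measure lebesgue (- E \<inter> S)"
    have \<eta>m: "\<eta> \<in> borel_measurable lebesgue" by (rule continuous_measurable_lebesgue[OF C1grad_continuous[OF \<eta>]])
    have Im: "(indicator (-E) :: R2 \<Rightarrow> real) \<in> borel_measurable lebesgue" by (rule borel_measurable_indicator[OF E'])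
    have BL: "L2 (indicator (cball y b) :: R2 \<Rightarrow> real)"
      by (rule L2_indicator) (use emeasure_lborel_cball_finite in auto)
    have m1: "(\<lambda>x. \<eta> x * indicator (-E) x) \<in> borel_measurable lebesgue" by (intro borel_measurable_times \<eta>m Im)
    have L1: "L2 (\<lambda>x. \<eta> x * indicator (-E) x)"
      by (rule L2_bound[OF BL m1, of 1]) (use r s in \<open>auto simp: indicator_def\<close>)
    have L3: "L2 (\<lambda>x. indicator E x + \<eta> x * indicator (-E) x)" by (rule L2_add[OF EL L1])
    have Gc: "continuous_on UNIV G" using \<eta> by (simp add: C1grad_def)
    show "TVle (\<lambda>x. \<eta> x * indicator (-E) x) ((\<integral>x. - v x * (\<eta> x * indicator (-E) x) \<partial>lebesgue) + ?\<mu>)"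
      unfolding TVle_def
    proof (intro allI impI)
      fix \<phi> assume \<phi>: "testfield \<phi>" "\<forall>x. norm (\<phi> x) \<le> 1"
      have "TVle (\<lambda>x. indicator E x + \<eta> x * indicator (-E) x)
         ((\<integral>x. v x * indicator E x \<partial>lebesgue) + ?\<mu> - (\<integral>x. \<eta> x * indicator (-E) x * divg \<phi> x \<partial>lebesgue))"
        unfolding TVle_def
      proof (intro allI impI)
        fix \<psi> assume \<psi>: "testfield \<psi>" "\<forall>x. norm (\<psi> x) \<le> 1"
        define \<Xi> where "\<Xi> x = (1 - \<eta> x) *\<^sub>R \<psi> x - \<eta> x *\<^sub>R \<phi> x" for x
        note t1 = testfield_scale[OF \<phi>(1) \<eta>] and t2 = testfield_scale[OF \<psi>(1) C1grad_one_minus[OF \<eta>]]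
        have t: "testfield \<Xi>" unfolding \<Xi>_def by (rule testfield_diff(1)[OF t2(1) t1(1)])
        have n: "norm (\<Xi> x) \<le> 1" for x
        proof -
          have "norm (\<Xi> x) \<le> norm ((1 - \<eta> x) *\<^sub>R \<psi> x) + norm (\<eta> x *\<^sub>R \<phi> x)"
            unfolding \<Xi>_def by (rule norm_triangle_ineq4)
          also have "\<dots> = (1 - \<eta> x) * norm (\<psi> x) + \<eta> x * norm (\<phi> x)" using r by simp
          also have "\<dots> \<le> (1 - \<eta> x) * 1 + \<eta> x * 1"
            using r \<phi> \<psi> by (intro add_mono mult_left_mono) auto
          finally show ?thesis by simp
        qed
        note ts = testfield_add[OF \<psi>(1) \<phi>(1)]
        note t3 = testfield_scale[OF ts(1) \<eta>]
        have p: "continuous_on UNIV (\<lambda>x. - (\<psi> x + \<phi> x))" "norm (- (\<psi> x + \<phi> x)) \<le> 2" for x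
        proof -
          show "continuous_on UNIV (\<lambda>x. - (\<psi> x + \<phi> x))"
            by (intro continuous_intros testfield_continuous \<phi> \<psi>)
          show "norm (- (\<psi> x + \<phi> x)) \<le> 2"
            using norm_triangle_ineq[of "\<psi> x" "\<phi> x"] \<phi>(2)[rule_format, of x] \<psi>(2)[rule_format, of x]
            unfolding norm_minus_cancel by linarith
        qed
        note fb = flux_bound[OF E' S Gc L[rule_format] p]
        have iX: "integrable lebesgue (\<lambda>x. indicator E x * divg \<Xi> x)" by (rule L2_integrable_mult[OF EL L2_divg[OF t]])
        have i1: "integrable lebesgue (\<lambda>x. \<eta> x * indicator (-E) x * divg \<phi> x)" by (rule L2_integrable_mult[OF L1(1) L2_divg[OF \<phi>(1)]])
        have i2: "integrable lebesgue (\<lambda>x. (indicator E x + \<eta> x * indicator (-E) x) * divg \<psi> x)" by (rule L2_integrable_mult[OF L3 L2_divg[OF \<psi>(1)]])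
        have one: "loc_int (\<lambda>x. 1)" by (rule loc_int_bounded[of _ 1]) auto
        have i3: "integrable lebesgue (divg (\<lambda>x. \<eta> x *\<^sub>R (\<psi> x + \<phi> x)))" using loc_int_divg[OF one t3(1)] by simp
        have "(\<integral>x. \<eta> x * indicator (-E) x * divg \<phi> x \<partial>lebesgue) + (\<integral>x. (indicator E x + \<eta> x * indicator (-E) x) * divg \<psi> x \<partial>lebesgue)
          = (\<integral>x. \<eta> x * indicator (-E) x * divg \<phi> x + (indicator E x + \<eta> x * indicator (-E) x) * divg \<psi> x \<partial>lebesgue)" using i1 i2 by simp
        \<comment> \<open>On \<open>E\<close> the integrand is div \<psi> = div \<Xi> +
          div(\<eta>(\<psi> + \<phi>)). Off \<open>E\<close> it is \<eta> (div \<phi> + div \<psi>),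
          which differs from div(\<eta>(\<psi> + \<phi>)) by the gradient term.\<close>
        also have "\<dots> = (\<integral>x. (indicator E x * divg \<Xi> x + indicator (-E) x * (G x \<bullet> (- (\<psi> x + \<phi> x)))) + divg (\<lambda>x. \<eta> x *\<^sub>R (\<psi> x + \<phi> x)) x \<partial>lebesgue)"
          unfolding \<Xi>_def testfield_diff(2)[OF t2(1) t1(1)] t1(2) t2(2) t3(2) ts(2)
          by (rule Bochner_Integration.integral_cong) (auto simp: indicator_def algebra_simps inner_add_right)
        also have "\<dots> = (\<integral>x. indicator E x * divg \<Xi> x \<partial>lebesgue) + (\<integral>x. indicator (-E) x * (G x \<bullet> (- (\<psi> x + \<phi> x))) \<partial>lebesgue)"
          using iX fb(1) i3 integral_divg_zero[OF t3(1)] by simp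
        also have "\<dots> \<le> (\<integral>x. v x * indicator E x \<partial>lebesgue) + ?\<mu>"
          using TVleD[OF ET t n] fb(2) by (intro add_mono) auto
        finally show "(\<integral>x. (indicator E x + \<eta> x * indicator (-E) x) * divg \<psi> x \<partial>lebesgue) \<le>
           (\<integral>x. v x * indicator E x \<partial>lebesgue) + ?\<mu> - (\<integral>x. \<eta> x * indicator (-E) x * divg \<phi> x \<partial>lebesgue)" by simp
      qed
      from calibD[OF c L3 this]
      have 1: "(\<integral>x. v x * (indicator E x + \<eta> x * indicator (-E) x) \<partial>lebesgue) \<le> (\<integral>x. v x * indicator E x \<partial>lebesgue) + ?\<mu> - (\<integral>x. \<eta> x * indicator (-E) x * divg \<phi> x \<partial>lebesgue)" .
      have "(\<integral>x. v x * (indicator E x + \<eta> x * indicator (-E) x) \<partial>lebesgue) = (\<integral>x. v x * indicator E x \<partial>lebesgue) + (\<integral>x. v x * (\<eta> x * indicator (-E) x) \<partial>lebesgue)"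
        using L2_integrable_mult[OF vL L1(1)] L2_integrable_mult[OF vL EL] by (simp add: distrib_left)
      thus "(\<integral>x. \<eta> x * indicator (-E) x * divg \<phi> x \<partial>lebesgue) \<le> (\<integral>x. - v x * (\<eta> x * indicator (-E) x) \<partial>lebesgue) + ?\<mu>"
        using 1 by simp
    qed
  qed
qed

section \<open>Translations and isoperimetric inequalities\<close>

text \<open>Up to sign, the derivative of the pairing along the segment is |h| times the pairing of
  \<open>G\<close> with the divergence of the translated \<psi> times the unit vector
  \<open>k\<close>; the mean value theorem concludes. Only fields supported near \<open>y\<close>
  are tested, so a local bound on the variation of \<open>G\<close> is enough.\<close>

lemma translation_bound_smooth:
  assumes G: "loc_int G" and \<psi>: "C1grad \<psi> P" "\<And>x. x \<notin> cball y a \<Longrightarrow> \<psi> x = 0" "\<And>x. \<bar>\<psi> x\<bar> \<le> 1"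
    and c: "\<And>\<zeta>. testfield \<zeta> \<Longrightarrow> (\<And>x. norm (\<zeta> x) \<le> 1) \<Longrightarrow> (\<And>x. x \<notin> cball y (a + norm h) \<Longrightarrow> \<zeta> x = 0) \<Longrightarrow>
       (\<integral>x. G x * divg \<zeta> x \<partial>lebesgue) \<le> c"
  shows "(\<integral>x. G x * \<psi> x \<partial>lebesgue) - (\<integral>x. G x * \<psi> (x - h) \<partial>lebesgue) \<le> norm h * c"
proof (cases "h = 0")
  case False
  define k where "k = (1 / norm h) *\<^sub>R h"
  have nk: "norm k = 1" and hk: "h = norm h *\<^sub>R k" using False by (auto simp: k_def)
  define \<Phi> where "\<Phi> s = (\<integral>x. G x * \<psi> (x + s *\<^sub>R (- h)) \<partial>lebesgue)" for s :: real
  define D where "D s = (\<integral>x. G x * (P (x + s *\<^sub>R (- h)) \<bullet> (- h)) \<partial>lebesgue)" for s :: real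
  have z0: "\<psi> x = 0" if "x \<notin> cball 0 (a + norm y)" for x
  proof (rule \<psi>(2))
    have "norm x \<le> norm (x - y) + norm y" using norm_triangle_ineq[of "x - y" y] by simp
    thus "x \<notin> cball y a" using that by (simp add: dist_norm norm_minus_commute)
  qed
  have der: "(\<Phi> has_real_derivative D s) (at s)" for s
    unfolding \<Phi>_def[abs_def] D_def by (rule conv_has_derivative[OF G \<psi>(1) z0])
  obtain s where s: "0 < s" "s < 1" "\<Phi> 1 - \<Phi> 0 = D s"
    using MVT2[of 0 1 \<Phi> D] der by auto
  have sh: "C1grad (\<lambda>x. \<psi> (x + s *\<^sub>R (- h))) (\<lambda>x. P (x + s *\<^sub>R (- h)))" by (rule C1grad_shift[OF \<psi>(1)])
  have z: "\<psi> (x + s *\<^sub>R (- h)) = 0" if "x \<notin> cball y (a + norm h)" for x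
  proof (rule \<psi>(2))
    have "dist y x \<le> dist y (x + s *\<^sub>R (- h)) + norm (s *\<^sub>R (- h))"
      using dist_triangle[of y x "x + s *\<^sub>R (- h)"] by (simp add: dist_norm)
    moreover have "norm (s *\<^sub>R (- h)) \<le> norm h" using s mult_right_mono[of s 1 "norm h"] by simp
    ultimately show "x + s *\<^sub>R (- h) \<notin> cball y a" using that by auto
  qed
  note t = testfield_scalar[OF sh z]
  have "(\<integral>x. G x * divg (\<lambda>x. \<psi> (x + s *\<^sub>R (- h)) *\<^sub>R k) x \<partial>lebesgue) \<le> c"
  proof (rule c)
    show "testfield (\<lambda>x. \<psi> (x + s *\<^sub>R (- h)) *\<^sub>R k)" by (rule t(1))
    show "norm (\<psi> (x + s *\<^sub>R (- h)) *\<^sub>R k) \<le> 1" for x using \<psi>(3) nk by simp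
    show "\<psi> (x + s *\<^sub>R (- h)) *\<^sub>R k = 0" if "x \<notin> cball y (a + norm h)" for x using z[OF that] by simp
  qed
  hence "(\<integral>x. G x * (P (x + s *\<^sub>R (- h)) \<bullet> k) \<partial>lebesgue) \<le> c" using t(2) by simp
  hence le: "norm h * (\<integral>x. G x * (P (x + s *\<^sub>R (- h)) \<bullet> k) \<partial>lebesgue) \<le> norm h * c" by (rule mult_left_mono) simp
  have "- D s = norm h * (\<integral>x. G x * (P (x + s *\<^sub>R (- h)) \<bullet> k) \<partial>lebesgue)"
  proof -
    have "G x * (P (x + s *\<^sub>R (- h)) \<bullet> (- h)) = (- norm h) * (G x * (P (x + s *\<^sub>R (- h)) \<bullet> k))" for x
      by (subst (2) hk) (simp del: scaleR_minus_right)
    hence "D s = (\<integral>x. (- norm h) * (G x * (P (x + s *\<^sub>R (- h)) \<bullet> k)) \<partial>lebesgue)" unfolding D_def by (simp only:)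
    thus ?thesis by (simp only: integral_mult_right_zero)
  qed
  with le s(3) have "\<Phi> 0 - \<Phi> 1 \<le> norm h * c" by linarith
  thus ?thesis by (simp add: \<Phi>_def)
qed simp

lemma integrable_bounded_support:
  fixes w :: "R2 \<Rightarrow> real"
  assumes "w \<in> borel_measurable borel" "\<And>x. \<bar>w x\<bar> \<le> B" "\<And>x. x \<notin> cball y a \<Longrightarrow> w x = 0"
  shows "integrable lborel w"
proof (rule Bochner_Integration.integrable_bound[of _ "\<lambda>x. B * indicator (cball y a) x"])
  show "integrable lborel (\<lambda>x. B * indicator (cball y a) x)"
    by (rule integrable_mult_right) (rule integrable_real_indicator, use emeasure_lborel_cball_finite in auto)
  have "\<bar>w x\<bar> \<le> B * indicator (cball y a) x" for x using assms(2)[of x] assms(3)[of x] by (cases "x \<in> cball y a") auto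
  thus "AE x in lborel. norm (w x) \<le> norm (B * indicator (cball y a) x)"
    by (intro AE_I2) (metis abs_ge_self order_trans real_norm_def)
qed (use assms in simp)

text \<open>Mollifying \<open>w\<close> reduces the claim to the smooth case; the slack in a + |h| <
  b makes room for the enlarged support.\<close>

lemma translation_bound:
  assumes G: "G \<in> borel_measurable lebesgue" "\<And>x. \<bar>G x\<bar> \<le> 1"
    and w: "w \<in> borel_measurable borel" "\<And>x. \<bar>w x\<bar> \<le> 1" "\<And>x. x \<notin> cball y a \<Longrightarrow> w x = 0"
    and b: "a + norm h < b"
    and c: "\<And>\<zeta>. testfield \<zeta> \<Longrightarrow> (\<And>x. norm (\<zeta> x) \<le> 1) \<Longrightarrow> (\<And>x. x \<notin> cball y b \<Longrightarrow> \<zeta> x = 0) \<Longrightarrow>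
       (\<integral>x. G x * divg \<zeta> x \<partial>lebesgue) \<le> c"
  shows "(\<integral>x. G x * w x \<partial>lebesgue) - (\<integral>x. G x * w (x - h) \<partial>lebesgue) \<le> norm h * c"
proof (rule field_le_epsilon)
  fix \<epsilon> :: real assume \<epsilon>: "\<epsilon> > 0"
  have wi: "integrable lborel w" by (rule integrable_bounded_support[OF w])
  obtain d where d: "d > 0" "\<And>h. norm h < d \<Longrightarrow> (\<integral>x. \<bar>w (x + h) - w x\<bar> \<partial>lborel) < \<epsilon> / 2"
    using L1_translation_continuous[OF wi, of "\<epsilon>/2"] \<epsilon> by auto
  define e where "e = min d (b - a - norm h)"
  have e: "e > 0" using d b by (simp add: e_def)
  obtain F P where F: "C1grad F P" "integrable lborel F"
      "\<And>b x. (\<And>x. \<bar>w x\<bar> \<le> b) \<Longrightarrow> \<bar>F x\<bar> \<le> b"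
      "\<And>y R x. (\<And>x. x \<notin> cball y R \<Longrightarrow> w x = 0) \<Longrightarrow> x \<notin> cball y (R + e) \<Longrightarrow> F x = 0"
      "\<And>t. (\<And>h. norm h < e \<Longrightarrow> (\<integral>x. \<bar>w (x + h) - w x\<bar> \<partial>lborel) \<le> t) \<Longrightarrow> (\<integral>x. \<bar>F x - w x\<bar> \<partial>lborel) \<le> t"
    by (rule mollification[OF wi e]) blast
  have Fm[measurable]: "F \<in> borel_measurable borel" "w \<in> borel_measurable borel" using F(2) w by auto
  have L1: "(\<integral>x. \<bar>F x - w x\<bar> \<partial>lborel) \<le> \<epsilon> / 2" using F(5)[of "\<epsilon>/2"] d(2) by (auto simp: e_def less_imp_le)
  have FG: "(\<integral>x. G x * F x \<partial>lebesgue) - (\<integral>x. G x * F (x - h) \<partial>lebesgue) \<le> norm h * c"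
  proof (rule translation_bound_smooth[OF loc_int_bounded[OF G] F(1)])
    show "F x = 0" if "x \<notin> cball y (a + e)" for x using F(4)[OF w(3)] that by blast
    show "\<bar>F x\<bar> \<le> 1" for x using F(3)[OF w(2)] by blast
    fix \<zeta> assume z: "testfield \<zeta>" "\<And>x. norm (\<zeta> x) \<le> 1" "\<And>x. x \<notin> cball y (a + e + norm h) \<Longrightarrow> \<zeta> x = 0"
    show "(\<integral>x. G x * divg \<zeta> x \<partial>lebesgue) \<le> c"
    proof (rule c[OF z(1,2)])
      fix x assume "x \<notin> cball y b" thus "\<zeta> x = 0" by (intro z(3)) (auto simp: e_def)
    qed
  qed
  have mult: "integrable lebesgue (\<lambda>x. G x * k x)" if "integrable lebesgue k" for k
    using integrable_scaleR_bounded[OF that G(1), of 1] G(2) by (simp add: mult.commute)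
  have le: "(\<integral>x. G x * k1 x \<partial>lebesgue) \<le> (\<integral>x. G x * k2 x \<partial>lebesgue) + (\<integral>x. \<bar>k1 x - k2 x\<bar> \<partial>lebesgue)"
    if k: "integrable lebesgue k1" "integrable lebesgue k2" for k1 k2
  proof -
    have "(\<integral>x. G x * k1 x \<partial>lebesgue) \<le> (\<integral>x. G x * k2 x + \<bar>k1 x - k2 x\<bar> \<partial>lebesgue)"
    proof (rule integral_mono)
      fix x
      have "G x * (k1 x - k2 x) \<le> \<bar>G x\<bar> * \<bar>k1 x - k2 x\<bar>" by (simp add: abs_mult[symmetric])
      also have "\<dots> \<le> 1 * \<bar>k1 x - k2 x\<bar>" by (rule mult_right_mono[OF G(2)]) simp
      finally show "G x * k1 x \<le> G x * k2 x + \<bar>k1 x - k2 x\<bar>" by (simp add: right_diff_distrib)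
    qed (use mult k in auto)
    thus ?thesis using mult k by simp
  qed
  have il: "integrable lebesgue w" "integrable lebesgue F" using wi F(2) by (auto simp: integrable_completion)
  have wish: "integrable lborel (\<lambda>x. w (x - h))" "integrable lborel (\<lambda>x. F (x - h))"
    using integrable_shift[OF wi, of "- h"] integrable_shift[OF F(2), of "- h"] by auto
  hence ish: "integrable lebesgue (\<lambda>x. w (x - h))" "integrable lebesgue (\<lambda>x. F (x - h))"
    by (simp_all add: integrable_completion)
  have 1: "(\<integral>x. \<bar>w x - F x\<bar> \<partial>lebesgue) \<le> \<epsilon> / 2"
    using L1 by (subst lebesgue_integral_eq_lborel) (auto simp: abs_minus_commute)
  have 2: "(\<integral>x. \<bar>F (x - h) - w (x - h)\<bar> \<partial>lebesgue) \<le> \<epsilon> / 2"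
    using L1 integral_shift[of "\<lambda>x. \<bar>F x - w x\<bar>" "- h"] by (subst lebesgue_integral_eq_lborel) auto
  show "(\<integral>x. G x * w x \<partial>lebesgue) - (\<integral>x. G x * w (x - h) \<partial>lebesgue) \<le> norm h * c + \<epsilon>"
    using le[OF il] le[OF ish(2,1)] 1 2 FG by linarith
qed

section \<open>Isoperimetric inequalities by averaging correlations\<close>

lemma correlation_integral:
  fixes a b :: "R2 \<Rightarrow> real"
  assumes a: "integrable lborel a" and b: "integrable lborel b"
  shows "integrable lborel (\<lambda>h. \<integral>x. a x * b (x + h) \<partial>lborel)"
    "(\<integral>h. (\<integral>x. a x * b (x + h) \<partial>lborel) \<partial>lborel) = (\<integral>x. a x \<partial>lborel) * (\<integral>x. b x \<partial>lborel)"
proof -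
  have [measurable]: "a \<in> borel_measurable borel" "b \<in> borel_measurable borel" using a b by auto
  have bi: "integrable lborel (\<lambda>h. b (x + h))" for x using integrable_shift[OF b, of x] by (simp add: add.commute)
  have be: "(\<integral>h. b (x + h) \<partial>lborel) = (\<integral>x. b x \<partial>lborel)" "(\<integral>h. \<bar>b (x + h)\<bar> \<partial>lborel) = (\<integral>x. \<bar>b x\<bar> \<partial>lborel)" for x
    using integral_shift[of b x] integral_shift[of "\<lambda>x. \<bar>b x\<bar>" x] by (auto simp: add.commute)
  have i: "integrable (lborel \<Otimes>\<^sub>M lborel) (\<lambda>(x, h). a x * b (x + h))"
  proof (rule lborel_pair.Fubini_integrable)
    show "AE x in lborel. integrable lborel (\<lambda>h. case (x, h) of (x, h) \<Rightarrow> a x * b (x + h))"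
      using bi by (intro AE_I2) simp
    show "integrable lborel (\<lambda>x. \<integral>h. norm (case (x, h) of (x, h) \<Rightarrow> a x * b (x + h)) \<partial>lborel)"
      using a by (simp add: abs_mult be)
  qed simp
  show "integrable lborel (\<lambda>h. \<integral>x. a x * b (x + h) \<partial>lborel)" using lborel_pair.integrable_snd[OF i] by simp
  show "(\<integral>h. (\<integral>x. a x * b (x + h) \<partial>lborel) \<partial>lborel) = (\<integral>x. a x \<partial>lborel) * (\<integral>x. b x \<partial>lborel)"
    using lborel_pair.Fubini_integral[OF i] by (simp add: be)
qed

lemma measure_cball_R2: "R \<ge> 0 \<Longrightarrow> measure lborel (cball (y::R2) R) = pi * R\<^sup>2"
  using content_cball[of R y] by (simp add: unit_ball_vol_2)

lemma TVle_nonneg: "TVle g c \<Longrightarrow> 0 \<le> c"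
proof -
  assume a: "TVle g c"
  have t: "testfield (\<lambda>x. 0)" and d: "divg (\<lambda>x. 0) x = 0" for x
    using testfieldI[of "\<lambda>x. 0" "\<lambda>x v. 0"] compact_tsupp[of 0 0 "\<lambda>x. 0"] by (auto simp: zero_vec_def[symmetric])
  from TVleD[OF a t] show "0 \<le> c" by (simp add: d)
qed

lemma measure_integral_le:
  assumes i: "integrable lborel K" and b: "\<And>h. h \<in> cball (0::R2) R \<Longrightarrow> m \<le> K h" and nn: "\<And>h. 0 \<le> K h" and R: "R \<ge> 0"
  shows "m * (pi * R\<^sup>2) \<le> (\<integral>h. K h \<partial>lborel)"
proof -
  have "m * (pi * R\<^sup>2) = (\<integral>h. m * indicator (cball (0::R2) R) h \<partial>lborel)"
    using measure_cball_R2[OF R, of 0] emeasure_lborel_cball_finite by simp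
  also have "\<dots> \<le> (\<integral>h. K h \<partial>lborel)"
  proof (rule integral_mono[OF _ i])
    show "integrable lborel (\<lambda>h. m * indicator (cball (0::R2) R) h)"
      by (rule integrable_mult_right) (rule integrable_real_indicator, use emeasure_lborel_cball_finite in auto)
    show "m * indicator (cball 0 R) h \<le> K h" for h using b[of h] nn[of h] by (cases "h \<in> cball 0 R") auto
  qed
  finally show ?thesis .
qed

text \<open>Averaging \<open>\<integral> (G(x + h) - G x)\<^sup>2 \<le> |h| c\<close> over the disc of radius \<open>R\<close>, on which the correlation
  \<open>\<integral> G x G(x + h) dx\<close> has integral at most \<open>(\<integral> G)\<^sup>2\<close>.\<close>

lemma isoperimetric:
  assumes G: "G \<in> borel_measurable borel" "\<And>x. 0 \<le> G x" "\<And>x. G x \<le> 1" "\<And>x. x \<notin> cball y a \<Longrightarrow> G x = 0"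
    and c: "TVle G c" and R: "R > 0"
  shows "(2 * (\<integral>x. (G x)\<^sup>2 \<partial>lborel) - R * c) * (pi * R\<^sup>2) \<le> 2 * (\<integral>x. G x \<partial>lborel)\<^sup>2"
proof -
  note [measurable] = G(1)
  have ab: "\<bar>G x\<bar> \<le> 1" for x using G(2,3)[of x] by simp
  have Gi: "integrable lborel G" by (rule integrable_bounded_support[OF G(1) ab G(4)])
  have mult: "integrable lborel (\<lambda>x. G x * k x)" if "integrable lborel k" for k
    using integrable_scaleR_bounded[OF that, of G 1] ab by (simp add: mult.commute)
  have Gl: "G \<in> borel_measurable lebesgue" by (intro measurable_completion) simp
  define K where "K h = (\<integral>x. G x * G (x + h) \<partial>lborel)" for h
  have K0: "0 \<le> K h" for h unfolding K_def by (rule Bochner_Integration.integral_nonneg) (use G in auto)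
  have sq: "2 * (\<integral>x. (G x)\<^sup>2 \<partial>lborel) - R * c \<le> 2 * K h" if h: "h \<in> cball 0 R" for h
  proof -
    \<comment> \<open>With this test function the left side of the translation bound is 2
      \<integral> G^2 - 2 K(h), which is the integral of (G(x + h) - G x)^2.\<close>
    define w where "w x = G x - G (x + h)" for x
    have wm[measurable]: "w \<in> borel_measurable borel" unfolding w_def by measurable
    have wb: "\<bar>w x\<bar> \<le> 1" for x using G(2,3)[of x] G(2,3)[of "x + h"] by (simp add: w_def abs_le_iff)
    have w0: "w x = 0" if "x \<notin> cball y (a + norm h)" for x
    proof -
      have "dist y x \<le> dist y (x + h) + norm h" using dist_triangle[of y x "x + h"] by (simp add: dist_norm)
      hence "x + h \<notin> cball y a" "x \<notin> cball y a" using that norm_ge_zero[of h] by (auto simp del: norm_ge_zero)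
      thus ?thesis using G(4) by (simp add: w_def)
    qed
    have "(\<integral>x. G x * w x \<partial>lebesgue) - (\<integral>x. G x * w (x - h) \<partial>lebesgue) \<le> norm h * c"
      by (rule translation_bound[OF Gl ab wm wb w0, where b = "a + norm h + norm h + 1"]) (use TVleD[OF c] in auto)
    also have "\<dots> \<le> R * c" using h TVle_nonneg[OF c] by (intro mult_right_mono) auto
    finally have A: "(\<integral>x. G x * w x \<partial>lborel) - (\<integral>x. G x * w (x - h) \<partial>lborel) \<le> R * c"
      by (subst (asm) (1 2) lebesgue_integral_eq_lborel) auto
    have i: "integrable lborel (\<lambda>x. G x * G x)" "integrable lborel (\<lambda>x. G x * G (x + h))" "integrable lborel (\<lambda>x. G x * G (x - h))"
      using mult Gi integrable_shift[OF Gi, of h] integrable_shift[OF Gi, of "- h"] by auto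
    have "(\<integral>x. G x * w x \<partial>lborel) = (\<integral>x. (G x)\<^sup>2 \<partial>lborel) - K h"
      unfolding w_def K_def using i by (simp add: right_diff_distrib power2_eq_square)
    moreover have "(\<integral>x. G x * w (x - h) \<partial>lborel) = (\<integral>x. G x * G (x - h) \<partial>lborel) - (\<integral>x. (G x)\<^sup>2 \<partial>lborel)"
      unfolding w_def using i by (simp add: right_diff_distrib power2_eq_square)
    moreover have "(\<integral>x. G x * G (x - h) \<partial>lborel) = K h"
      unfolding K_def using integral_shift[of "\<lambda>x. G x * G (x - h)" h] by (simp add: mult.commute)
    ultimately show ?thesis using A by linarith
  qed
  have "(2 * (\<integral>x. (G x)\<^sup>2 \<partial>lborel) - R * c) * (pi * R\<^sup>2) \<le> (\<integral>h. 2 * K h \<partial>lborel)"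
    by (rule measure_integral_le) (use correlation_integral(1)[OF Gi Gi] sq K0 R in \<open>auto simp: K_def\<close>)
  also have "\<dots> = 2 * (\<integral>x. G x \<partial>lborel)\<^sup>2"
    using correlation_integral(2)[OF Gi Gi] by (simp add: K_def power2_eq_square)
  finally show ?thesis .
qed

text \<open>The product of the two areas is the integral over \<open>h\<close> of the measure of
  those points of the disc outside \<open>U\<close> that \<open>h\<close> carries into its part
  inside \<open>U\<close>. Each such measure is at most |h| c <= 2 \<rho> c, and it vanishes for |h|
  > 2 \<rho>. Fields supported in radius 4 \<rho> suffice because \<rho> + |h| <= 3 \<rho>. Small
  variation thus forces one of the two parts to be small.\<close>

lemma relative_isoperimetric:
  assumes U: "U \<in> sets borel" and \<rho>: "\<rho> > 0"
    and c: "\<And>\<zeta>. testfield \<zeta> \<Longrightarrow> (\<And>x. norm (\<zeta> x) \<le> 1) \<Longrightarrow> (\<And>x. x \<notin> cball y (4 * \<rho>) \<Longrightarrow> \<zeta> x = 0) \<Longrightarrow>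
       (\<integral>x. indicator U x * divg \<zeta> x \<partial>lebesgue) \<le> c"
  shows "measure lborel (cball y \<rho> - U) * measure lborel (cball y \<rho> \<inter> U) \<le> 2 * \<rho> * c * (pi * (2 * \<rho>)\<^sup>2)"
proof -
  note [measurable] = U
  define w :: "R2 \<Rightarrow> real" where "w = indicator (cball y \<rho> \<inter> U)"
  define a :: "R2 \<Rightarrow> real" where "a = indicator (cball y \<rho> - U)"
  have [measurable]: "cball y \<rho> \<in> sets borel" by simp
  have wm[measurable]: "w \<in> borel_measurable borel" and am[measurable]: "a \<in> borel_measurable borel" unfolding w_def a_def by measurable
  have wi: "integrable lborel w" by (rule integrable_bounded_support[of w 1 y \<rho>]) (auto simp: w_def indicator_def)
  have ai: "integrable lborel a" by (rule integrable_bounded_support[of a 1 y \<rho>]) (auto simp: a_def indicator_def)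
  have Um: "(indicator U :: R2 \<Rightarrow> real) \<in> borel_measurable lebesgue" by (intro measurable_completion) simp
  define K where "K h = (\<integral>x. a x * w (x + h) \<partial>lborel)" for h
  have c0: "0 \<le> c"
  proof -
    have t: "testfield (\<lambda>x. 0)" and d: "divg (\<lambda>x. 0) x = 0" for x
      using testfieldI[of "\<lambda>x. 0" "\<lambda>x v. 0"] compact_tsupp[of 0 0 "\<lambda>x. 0"] by (auto simp: zero_vec_def[symmetric])
    from c[OF t] show ?thesis by (simp add: d)
  qed
  have le: "K h \<le> 2 * \<rho> * c" if h: "norm h \<le> 2 * \<rho>" for h
  proof -
    have i1: "integrable lborel (\<lambda>x. w (x + h))" by (rule integrable_shift[OF wi])
    have i2: "integrable lborel (\<lambda>x. indicator U x * w (x + h))"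
    proof -
      have "norm (indicator U x :: real) \<le> 1" for x by (simp add: indicator_def)
      from integrable_scaleR_bounded[OF i1 _ this] show ?thesis by (simp add: mult.commute)
    qed
    have i3: "integrable lborel (\<lambda>x. a x * w (x + h))"
    proof -
      have "norm (a x) \<le> 1" for x by (simp add: a_def indicator_def)
      from integrable_scaleR_bounded[OF i1 _ this] show ?thesis by (simp add: mult.commute)
    qed
    have "(\<integral>x. indicator U x * w x \<partial>lebesgue) - (\<integral>x. indicator U x * w (x - (- h)) \<partial>lebesgue) \<le> norm (- h) * c"
    proof (rule translation_bound[OF Um _ wm, where y = y and a = \<rho> and b = "4 * \<rho>"])
      show "\<rho> + norm (- h) < 4 * \<rho>" using h \<rho> by simp
    qed (use c in \<open>auto simp: w_def indicator_def\<close>)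
    also have "\<dots> \<le> 2 * \<rho> * c" using h c0 by (intro mult_right_mono) auto
    finally have A: "(\<integral>x. indicator U x * w x \<partial>lborel) - (\<integral>x. indicator U x * w (x + h) \<partial>lborel) \<le> 2 * \<rho> * c"
      by (subst (asm) (1 2) lebesgue_integral_eq_lborel) auto
    have "(\<integral>x. indicator U x * w x \<partial>lborel) = (\<integral>x. w x \<partial>lborel)"
      by (rule Bochner_Integration.integral_cong) (auto simp: w_def indicator_def)
    also have "\<dots> = (\<integral>x. w (x + h) \<partial>lborel)" by (rule integral_shift[symmetric]) simp
    finally have "(\<integral>x. w (x + h) - indicator U x * w (x + h) \<partial>lborel) \<le> 2 * \<rho> * c" using A i1 i2 by simp
    moreover have "K h \<le> (\<integral>x. w (x + h) - indicator U x * w (x + h) \<partial>lborel)"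
      unfolding K_def by (rule integral_mono) (use i1 i2 i3 in \<open>auto simp: a_def w_def indicator_def\<close>)
    ultimately show ?thesis by simp
  qed
  have z: "K h = 0" if "norm h > 2 * \<rho>" for h
  proof -
    have "a x * w (x + h) = 0" for x
    proof (rule ccontr)
      assume "a x * w (x + h) \<noteq> 0"
      hence "x \<in> cball y \<rho>" "x + h \<in> cball y \<rho>" by (auto simp: a_def w_def indicator_def split: if_splits)
      hence "dist (x + h) x \<le> \<rho> + \<rho>" by (intro dist_triangle_le[of _ y]) (auto simp: dist_commute)
      thus False using that by (simp add: dist_norm)
    qed
    thus ?thesis unfolding K_def by (simp only: Bochner_Integration.integral_zero)
  qed
  have "measure lborel (cball y \<rho> - U) * measure lborel (cball y \<rho> \<inter> U) = (\<integral>h. K h \<partial>lborel)"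
    unfolding K_def correlation_integral(2)[OF ai wi] by (simp add: a_def w_def)
  also have "\<dots> \<le> (\<integral>h. (2 * \<rho> * c) * indicator (cball (0::R2) (2 * \<rho>)) h \<partial>lborel)"
  proof (rule integral_mono)
    show "integrable lborel K" unfolding K_def by (rule correlation_integral(1)[OF ai wi])
    show "integrable lborel (\<lambda>h. (2 * \<rho> * c) * indicator (cball (0::R2) (2 * \<rho>)) h)"
      by (rule integrable_mult_right) (rule integrable_real_indicator, use emeasure_lborel_cball_finite in auto)
    show "K h \<le> (2 * \<rho> * c) * indicator (cball 0 (2 * \<rho>)) h" for h
      using le[of h] z[of h] by (cases "norm h \<le> 2 * \<rho>") (auto simp: indicator_def)
  qed
  also have "\<dots> = 2 * \<rho> * c * (pi * (2 * \<rho>)\<^sup>2)"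
    using measure_cball_R2[of "2 * \<rho>" 0] \<rho> emeasure_lborel_cball_finite by simp
  finally show ?thesis .
qed

section \<open>Density estimates\<close>

lemma TVle_cong_AE:
  assumes "TVle g c" "AE x in lebesgue. g x = g' x" "g \<in> borel_measurable lebesgue" "g' \<in> borel_measurable lebesgue"
  shows "TVle g' c"
  unfolding TVle_def
proof (intro allI impI)
  fix \<phi> assume t: "testfield \<phi>" "\<forall>x. norm (\<phi> x) \<le> 1"
  have d: "divg \<phi> \<in> borel_measurable lebesgue" by (rule continuous_measurable_lebesgue[OF continuous_divg[OF t(1)]])
  have "(\<integral>x. g' x * divg \<phi> x \<partial>lebesgue) = (\<integral>x. g x * divg \<phi> x \<partial>lebesgue)"
    by (rule integral_cong_AE) (use assms d in \<open>auto intro: borel_measurable_times\<close>)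
  thus "(\<integral>x. g' x * divg \<phi> x \<partial>lebesgue) \<le> c" using TVleD[OF assms(1) t(1)] t(2) by simp
qed

text \<open>Level sets of L2 functions are only Lebesgue measurable, whereas the translation and
  Fubini arguments run on Borel functions and \<open>lborel\<close>.\<close>

lemma borel_representative:
  assumes "A \<in> sets lebesgue"
  obtains B :: "R2 set" where "B \<in> sets borel" "AE x in lebesgue. x \<in> A \<longleftrightarrow> x \<in> B"
proof -
  have "(indicator A :: R2 \<Rightarrow> real) \<in> borel_measurable lebesgue" using assms by (rule borel_measurable_indicator)
  then obtain g where g: "g \<in> borel_measurable lborel" "AE x in lborel. indicator A x = (g x :: real)"
    using completion_ex_borel_measurable_real by blast
  have [measurable]: "g \<in> borel_measurable borel" using g(1) by simp
  have "{x \<in> space borel. g x = 1} \<in> sets borel" by measurable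
  moreover have "AE x in lebesgue. x \<in> A \<longleftrightarrow> x \<in> {x \<in> space borel. g x = 1}"
    using AE_completion[OF g(2)] by eventually_elim (auto simp: indicator_def split: if_splits)
  ultimately show ?thesis using that by blast
qed

lemma measure_cong_AE:
  assumes "AE x in M. x \<in> A \<longleftrightarrow> x \<in> B" "A \<in> sets M" "B \<in> sets M"
  shows "measure M A = measure M B"
  using emeasure_eq_AE[OF assms] by (simp add: measure_def)

section \<open>From the cut inequality to linear growth\<close>

text \<open>In the application \<alpha> and \<beta> are the square roots of the areas in two discs
  whose radii differ by \<open>d\<close>, \<open>s\<close> is sqrt pi, and \<open>i\<close> is the
  isoperimetric inequality. If \<beta> - \<alpha> were below d/200, then \<alpha>^2 >= 0.99
  \<beta>^2, the cut would cost at most 0.16 \<beta>^2 and the pairing with the dual variable at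
  most 1.2 \<beta>^2, leaving at least 1.98 - 1.36 = 0.62 times \<beta>^2, more than half.\<close>

lemma density_step_arith:
  fixes \<alpha> \<beta> s d \<kappa> :: real
  assumes ab: "0 \<le> \<alpha>" "\<alpha> \<le> \<beta>" "0 < \<beta>" and s: "1 \<le> s" and d: "0 < d" "d \<le> \<beta>" and k: "\<kappa> \<le> 3/5 * s"
    and i: "2 * \<alpha>\<^sup>2 - (2 * \<beta> / s) * (\<kappa> * \<beta> + 8 / d * (\<beta>\<^sup>2 - \<alpha>\<^sup>2)) \<le> \<beta>\<^sup>2 / 2"
  shows "\<alpha> \<le> \<beta> - d / 200"
proof (rule ccontr)
  assume "\<not> ?thesis"
  hence \<Delta>: "\<beta> - \<alpha> < d / 200" by simp
  have 1: "(2 * \<beta> / s) * (\<kappa> * \<beta>) \<le> 6/5 * \<beta>\<^sup>2"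
  proof -
    have "(2 * \<beta> / s) * (\<kappa> * \<beta>) = (2 * \<beta>\<^sup>2) * (\<kappa> / s)" by (simp add: power2_eq_square)
    also have "\<dots> \<le> (2 * \<beta>\<^sup>2) * (3/5)" using k s by (intro mult_left_mono) (auto simp: divide_le_eq)
    finally show ?thesis by simp
  qed
  have 2: "8 / d * (\<beta>\<^sup>2 - \<alpha>\<^sup>2) \<le> 8 / 100 * \<beta>"
  proof -
    have "\<beta>\<^sup>2 - \<alpha>\<^sup>2 = (\<beta> - \<alpha>) * (\<beta> + \<alpha>)" by (simp add: power2_eq_square algebra_simps)
    also have "\<dots> \<le> (d / 200) * (2 * \<beta>)" using \<Delta> ab d by (intro mult_mono) auto
    finally have "8 / d * (\<beta>\<^sup>2 - \<alpha>\<^sup>2) \<le> 8 / d * ((d / 200) * (2 * \<beta>))" using d by (intro mult_left_mono) auto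
    also have "\<dots> = 8 / 100 * \<beta>" using d by (simp add: field_simps)
    finally show ?thesis .
  qed
  have 3: "(2 * \<beta> / s) * (8 / d * (\<beta>\<^sup>2 - \<alpha>\<^sup>2)) \<le> 16/100 * \<beta>\<^sup>2"
  proof -
    have z: "0 \<le> \<beta>\<^sup>2 - \<alpha>\<^sup>2" using ab by (simp add: power_mono)
    have "(2 * \<beta> / s) * (8 / d * (\<beta>\<^sup>2 - \<alpha>\<^sup>2)) \<le> (2 * \<beta>) * (8 / 100 * \<beta>)"
    proof (rule mult_mono[OF _ 2])
      show "2 * \<beta> / s \<le> 2 * \<beta>" using s ab by (simp add: divide_le_eq)
    qed (use ab d z in auto)
    thus ?thesis by (simp add: power2_eq_square)
  qed
  have 4: "\<alpha>\<^sup>2 \<ge> 99/100 * \<beta>\<^sup>2"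
  proof -
    have "\<alpha> \<ge> 199/200 * \<beta>" using \<Delta> d by simp
    hence "\<alpha>\<^sup>2 \<ge> (199/200 * \<beta>)\<^sup>2" using ab by (intro power_mono) auto
    moreover have "(199/200 * \<beta>)\<^sup>2 \<ge> 99/100 * \<beta>\<^sup>2" by (simp add: power_mult_distrib power2_eq_square)
    ultimately show ?thesis by linarith
  qed
  have "0 < \<beta>\<^sup>2" using ab by simp
  thus False using i 1 3 4 by (simp only: distrib_left)
qed

text \<open>A discrete form of \<beta>' >= \<theta> for a merely monotone \<beta>, available only
  for steps of length at most \<open>\<beta> b\<close>. If \<beta> r < \<theta> r, the radii
  \<open>b\<close> at which \<theta> b - \<beta> b is at least its value at \<open>r\<close> stay
  away from 0; a step down from close to their infimum would land below it.\<close>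

lemma linear_growth:
  fixes \<beta> :: "real \<Rightarrow> real"
  assumes pos: "\<And>r. 0 < r \<Longrightarrow> 0 < \<beta> r" and mono: "\<And>a b. 0 < a \<Longrightarrow> a \<le> b \<Longrightarrow> \<beta> a \<le> \<beta> b"
    and step: "\<And>a b. 0 < a \<Longrightarrow> a < b \<Longrightarrow> b \<le> r \<Longrightarrow> b - a \<le> \<beta> b \<Longrightarrow> \<beta> a \<le> \<beta> b - \<theta> * (b - a)"
    and \<theta>: "0 < \<theta>" and r: "0 < r"
  shows "\<theta> * r \<le> \<beta> r"
proof (rule ccontr)
  assume n: "\<not> ?thesis"
  define S where "S = {b. 0 < b \<and> b \<le> r \<and> \<theta> * r - \<beta> r \<le> \<theta> * b - \<beta> b}"
  have rS: "r \<in> S" using r by (simp add: S_def)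
  have bb: "bdd_below S" by (rule bdd_belowI[of _ 0]) (auto simp: S_def)
  define q where "q = (\<theta> * r - \<beta> r) / \<theta>"
  have q: "q > 0" using n \<theta> by (simp add: q_def)
  have qS: "q \<le> b" if "b \<in> S" for b
  proof -
    have "\<theta> * r - \<beta> r \<le> \<theta> * b" using that pos[of b] by (simp add: S_def)
    thus ?thesis using \<theta> by (simp add: q_def divide_le_eq mult.commute)
  qed
  define B where "B = Inf S"
  have B: "q \<le> B" unfolding B_def by (rule cInf_greatest) (use rS qS in auto)
  have m: "\<beta> B > 0" using B q by (intro pos) simp
  have "Inf S < B + \<beta> B" using m by (simp add: B_def)
  then obtain b where b: "b \<in> S" "b < B + \<beta> B" using cInf_lessD rS by (metis empty_iff)
  have bB: "B \<le> b" unfolding B_def by (rule cInf_lower[OF b(1) bb])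
  \<comment> \<open>The step from \<open>b\<close> to \<open>a\<close> is allowed since \<beta> B <=
    \<beta> b; b < B + \<beta> B puts \<open>a\<close> below the infimum, and the maximum with B/2
    keeps it positive.\<close>
  define a where "a = max (b - \<beta> B) (B / 2)"
  have a: "0 < a" "a < B" using B q b by (auto simp: a_def)
  have "\<beta> B \<le> \<beta> b" using mono[OF _ bB] B q by simp
  moreover have "b - a \<le> \<beta> B" by (simp add: a_def)
  ultimately have "\<beta> a \<le> \<beta> b - \<theta> * (b - a)" using a bB b by (intro step) (auto simp: S_def)
  hence "\<theta> * b - \<beta> b \<le> \<theta> * a - \<beta> a" by (simp add: algebra_simps)
  hence "a \<in> S" using b a bB by (simp add: S_def)
  hence "B \<le> a" unfolding B_def by (rule cInf_lower[OF _ bb])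
  thus False using a by simp
qed

lemma fmeasurable_Int_ball: "A \<in> sets lebesgue \<Longrightarrow> A \<inter> ball y r \<in> lmeasurable"
  using fmeasurable_Int_fmeasurable[of "ball y r" lebesgue A] by (simp add: Int_commute)

text \<open>Averaging over radius R = 2 sqrt(M / pi) makes pi R^2 = 4 M, so the correlation term 2
  M^2 becomes M/2 after division. The cutoff only blurs the set between the two discs: its square
  dominates the inner indicator, its integral is at most the outer area.\<close>

lemma cutoff_isoperimetric:
  assumes A: "A \<in> sets lebesgue" and \<eta>: "C1grad \<eta> P" "\<And>x. 0 \<le> \<eta> x" "\<And>x. \<eta> x \<le> 1"
      "\<And>x. x \<in> cball y a \<Longrightarrow> \<eta> x = 1" "\<And>x. x \<notin> ball y b \<Longrightarrow> \<eta> x = 0"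
    and T: "TVle (\<lambda>x. \<eta> x * indicator A x) c" and M: "M = measure lebesgue (A \<inter> ball y b)" "0 < M"
  shows "2 * measure lebesgue (A \<inter> ball y a) - (2 * sqrt M / sqrt pi) * c \<le> M / 2"
    "L2 (\<lambda>x. \<eta> x * indicator A x)" "L2norm (\<lambda>x. \<eta> x * indicator A x) \<le> sqrt M"
proof -
  obtain A' where A': "A' \<in> sets borel" "AE x in lebesgue. x \<in> A \<longleftrightarrow> x \<in> A'" using borel_representative[OF A] by blast
  note [measurable] = A'(1)
  have \<eta>m[measurable]: "\<eta> \<in> borel_measurable borel" by (rule borel_measurable_continuous_onI[OF C1grad_continuous[OF \<eta>(1)]])
  have \<eta>l: "\<eta> \<in> borel_measurable lebesgue" by (rule continuous_measurable_lebesgue[OF C1grad_continuous[OF \<eta>(1)]])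
  define G where "G x = \<eta> x * indicator A' x" for x
  have Gm[measurable]: "G \<in> borel_measurable borel" unfolding G_def by measurable
  have Gl: "G \<in> borel_measurable lebesgue" by (intro measurable_completion) simp
  have Al: "(\<lambda>x. \<eta> x * indicator A x) \<in> borel_measurable lebesgue"
    by (intro borel_measurable_times \<eta>l borel_measurable_indicator A)
  have ae: "AE x in lebesgue. \<eta> x * indicator A x = G x"
    using A'(2) by eventually_elim (simp add: G_def indicator_def)
  have TG: "TVle G c" by (rule TVle_cong_AE[OF T ae Al Gl])
  have A'b: "measure lebesgue (A' \<inter> ball y t) = measure lebesgue (A \<inter> ball y t)" for t
    by (rule measure_cong_AE) (use A'(1) A A'(2) in auto)
  have mb: "measure lborel (A' \<inter> ball y t) = measure lebesgue (A \<inter> ball y t)" for t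
    using A'b[of t] A'(1) by (simp add: measure_completion)
  have em: "emeasure lborel (A' \<inter> ball y t) < \<infinity>" for t
    using emeasure_mono[of "A' \<inter> ball y t" "ball y t" lborel] emeasure_lborel_ball_finite[of y t]
    by (auto intro: le_less_trans)
  have ii: "integrable lborel (\<lambda>x. indicator (A' \<inter> ball y t) x :: real)" for t
    by (rule integrable_real_indicator) (use em A'(1) in auto)
  have ab: "x \<in> ball y b" if "x \<in> ball y a" for x using \<eta>(4)[of x] \<eta>(5)[of x] that by auto
  have G1: "G x \<le> indicator (A' \<inter> ball y b) x" "indicator (A' \<inter> ball y a) x \<le> (G x)\<^sup>2" "0 \<le> G x" "G x \<le> 1" for x
    using \<eta>(2-5)[of x] by (auto simp: G_def indicator_def)
  have Gi: "integrable lborel G"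
    by (rule Bochner_Integration.integrable_bound[OF ii[of b]]) (use G1 in auto)
  have G2i: "integrable lborel (\<lambda>x. (G x)\<^sup>2)"
  proof (rule Bochner_Integration.integrable_bound[OF Gi])
    show "AE x in lborel. norm ((G x)\<^sup>2) \<le> norm (G x)"
      using G1(3,4) by (intro AE_I2) (auto simp: power2_eq_square mult_left_le)
  qed simp
  have I1: "(\<integral>x. G x \<partial>lborel) \<le> M"
    using integral_mono[OF Gi ii[of b] G1(1)] mb[of b] M by simp
  have I1': "0 \<le> (\<integral>x. G x \<partial>lborel)" using G1(3) by (intro Bochner_Integration.integral_nonneg)
  have I2: "measure lebesgue (A \<inter> ball y a) \<le> (\<integral>x. (G x)\<^sup>2 \<partial>lborel)"
    using integral_mono[OF ii[of a] G2i G1(2)] mb[of a] by simp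
  have I3: "(\<integral>x. (G x)\<^sup>2 \<partial>lborel) \<le> M"
  proof -
    have "(\<integral>x. (G x)\<^sup>2 \<partial>lborel) \<le> (\<integral>x. G x \<partial>lborel)"
      by (rule integral_mono[OF G2i Gi]) (use G1(3,4) in \<open>auto simp: power2_eq_square mult_left_le\<close>)
    thus ?thesis using I1 by simp
  qed
  have eq2: "(\<integral>x. (\<eta> x * indicator A x)\<^sup>2 \<partial>lebesgue) = (\<integral>x. (G x)\<^sup>2 \<partial>lborel)"
  proof -
    have "(\<integral>x. (\<eta> x * indicator A x)\<^sup>2 \<partial>lebesgue) = (\<integral>x. (G x)\<^sup>2 \<partial>lebesgue)"
      by (rule integral_cong_AE) (use ae Al Gl in auto)
    thus ?thesis by (simp add: lebesgue_integral_eq_lborel)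
  qed
  show "L2 (\<lambda>x. \<eta> x * indicator A x)"
  proof (rule L2_AE_cong)
    show "L2 G" using G2i Gl by (simp add: L2_def lebesgue_integral_eq_lborel)
    show "AE x in lebesgue. G x = \<eta> x * indicator A x" using ae by eventually_elim simp
  qed (rule Al)
  show "L2norm (\<lambda>x. \<eta> x * indicator A x) \<le> sqrt M"
    unfolding L2norm_def eq2 using I3 by simp
  define R where "R = 2 * sqrt M / sqrt pi"
  have R0: "R > 0" using M by (simp add: R_def)
  have piR: "pi * R\<^sup>2 = 4 * M"
    using M by (simp add: R_def power_divide power_mult_distrib)
  have "(2 * (\<integral>x. (G x)\<^sup>2 \<partial>lborel) - R * c) * (pi * R\<^sup>2) \<le> 2 * (\<integral>x. G x \<partial>lborel)\<^sup>2"
  proof (rule isoperimetric[OF Gm G1(3,4) _ TG R0])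
    show "G x = 0" if "x \<notin> cball y b" for x
    proof -
      have "x \<notin> ball y b" using that by simp
      thus ?thesis using \<eta>(5) by (simp add: G_def)
    qed
  qed
  also have "\<dots> \<le> 2 * M\<^sup>2" using I1 I1' by (simp add: power_mono)
  finally have "(2 * (\<integral>x. (G x)\<^sup>2 \<partial>lborel) - R * c) * (4 * M) \<le> (M / 2) * (4 * M)"
    unfolding piR by (simp add: power2_eq_square)
  hence "2 * (\<integral>x. (G x)\<^sup>2 \<partial>lborel) - R * c \<le> M / 2" using M(2) by (simp only: mult_le_cancel_right)
  thus "2 * measure lebesgue (A \<inter> ball y a) - (2 * sqrt M / sqrt pi) * c \<le> M / 2"
    using I2 unfolding R_def by linarith
qed

text \<open>Cutting between radii a < b bounds the variation by \<kappa> \<beta>(b), through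
  Cauchy-Schwarz on the disc where \<open>v\<close> is small, plus 8/(b - a) times the area of the
  ring. The isoperimetric inequality bounds it from below with factor 3/4 sqrt pi, which exceeds
  \<kappa>; so \<beta>, the root of the area, grows at rate at least 1/200. Positivity of the areas
  at all radii starts the growth.\<close>

lemma density_estimate:
  assumes q: "quasi_minimal A v" and \<kappa>: "0 \<le> \<kappa>" "\<kappa> \<le> 3/5 * sqrt pi"
    and v: "(\<integral>x. indicator (ball y r0) x * (v x)\<^sup>2 \<partial>lebesgue) \<le> \<kappa>\<^sup>2"
    and pos: "\<And>r. r > 0 \<Longrightarrow> measure lebesgue (A \<inter> ball y r) > 0"
    and r: "0 < r" "r \<le> r0"
  shows "(r / 200)\<^sup>2 \<le> measure lebesgue (A \<inter> ball y r)"
proof -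
  have A: "A \<in> sets lebesgue" and vL: "L2 v" using q by (auto simp: quasi_minimal_def)
  define m where "m r = measure lebesgue (A \<inter> ball y r)" for r
  define \<beta> where "\<beta> r = sqrt (m r)" for r
  have m0: "0 \<le> m r" for r by (simp add: m_def)
  have \<beta>2: "(\<beta> r)\<^sup>2 = m r" for r using m0 by (simp add: \<beta>_def)
  have mpos: "0 < m r" if "0 < r" for r using pos[OF that] by (simp add: m_def)
  have \<beta>pos: "0 < \<beta> r" if "0 < r" for r using mpos[OF that] by (simp add: \<beta>_def)
  have mmono: "m a \<le> m b" if "a \<le> b" for a b
    unfolding m_def
  proof (rule measure_mono_fmeasurable)
    show "A \<inter> ball y a \<subseteq> A \<inter> ball y b" using that by auto
    show "A \<inter> ball y a \<in> sets lebesgue" using A by auto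
  qed (rule fmeasurable_Int_ball[OF A])
  have s1: "1 \<le> sqrt pi" using pi_ge_two by simp
  have step: "\<beta> a \<le> \<beta> b - 1/200 * (b - a)" if ab: "0 < a" "a < b" "b \<le> r" "b - a \<le> \<beta> b" for a b
  proof -
    obtain \<eta> P where \<eta>: "C1grad \<eta> P" "\<And>x. 0 \<le> \<eta> x" "\<And>x. \<eta> x \<le> 1"
      "\<And>x. x \<in> cball y a \<Longrightarrow> \<eta> x = 1" "\<And>x. x \<notin> ball y b \<Longrightarrow> \<eta> x = 0"
      "\<And>x. norm (P x) \<le> 4 / (b - a) * indicator (ball y b - ball y a) x"
      by (rule cutoff_exists[OF ab(1,2), of y]) blast
    define c where "c = (\<integral>x. v x * (\<eta> x * indicator A x) \<partial>lebesgue) + 2 * (4 / (b - a)) * measure lebesgue (A \<inter> (ball y b - ball y a))"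
    have T: "TVle (\<lambda>x. \<eta> x * indicator A x) c"
      unfolding c_def
    proof -
      have "C1grad \<eta> P \<longrightarrow> (\<forall>x. 0 \<le> \<eta> x \<and> \<eta> x \<le> 1) \<longrightarrow> (\<forall>x. x \<notin> cball y b \<longrightarrow> \<eta> x = 0) \<longrightarrow>
        ball y b - ball y a \<in> lmeasurable \<longrightarrow> (\<forall>x. norm (P x) \<le> 4 / (b - a) * indicator (ball y b - ball y a) x) \<longrightarrow>
        TVle (\<lambda>x. \<eta> x * indicator A x)
          ((\<integral>x. v x * (\<eta> x * indicator A x) \<partial>lebesgue) + 2 * (4 / (b - a)) * measure lebesgue (A \<inter> (ball y b - ball y a)))"
        using q unfolding quasi_minimal_def by blast
      moreover have "\<forall>x. x \<notin> cball y b \<longrightarrow> \<eta> x = 0"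
      proof (intro allI impI)
        fix x assume "x \<notin> cball y b"
        hence "x \<notin> ball y b" by simp
        thus "\<eta> x = 0" by (rule \<eta>(5))
      qed
      moreover have "ball y b - ball y a \<in> lmeasurable" by (intro fmeasurable_Diff) auto
      ultimately show "TVle (\<lambda>x. \<eta> x * indicator A x)
          ((\<integral>x. v x * (\<eta> x * indicator A x) \<partial>lebesgue) + 2 * (4 / (b - a)) * measure lebesgue (A \<inter> (ball y b - ball y a)))"
        using \<eta> by blast
    qed
    have b0: "0 < b" using ab by simp
    note ci = cutoff_isoperimetric[of A \<eta> P y a b c "m b", OF A \<eta>(1-3) _ _ T m_def mpos[OF b0]]
    have iso: "2 * measure lebesgue (A \<inter> ball y a) - (2 * sqrt (m b) / sqrt pi) * c \<le> m b / 2"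
      "L2 (\<lambda>x. \<eta> x * indicator A x)" "L2norm (\<lambda>x. \<eta> x * indicator A x) \<le> sqrt (m b)"
    proof -
      show "2 * measure lebesgue (A \<inter> ball y a) - (2 * sqrt (m b) / sqrt pi) * c \<le> m b / 2" by (rule ci(1)[OF \<eta>(4,5)])
      show "L2 (\<lambda>x. \<eta> x * indicator A x)" by (rule ci(2)[OF \<eta>(4,5)])
      show "L2norm (\<lambda>x. \<eta> x * indicator A x) \<le> sqrt (m b)" by (rule ci(3)[OF \<eta>(4,5)])
    qed
    have vc: "(\<integral>x. v x * (\<eta> x * indicator A x) \<partial>lebesgue) \<le> \<kappa> * \<beta> b"
    proof -
      have bl: "ball y r0 \<in> sets lebesgue" by simp
      have v1: "L2 (\<lambda>x. indicator (ball y r0) x * v x)" by (rule L2_indicator_mult[OF vL bl])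
      have "(\<integral>x. v x * (\<eta> x * indicator A x) \<partial>lebesgue) = (\<integral>x. (indicator (ball y r0) x * v x) * (\<eta> x * indicator A x) \<partial>lebesgue)"
      proof (rule Bochner_Integration.integral_cong)
        fix x show "v x * (\<eta> x * indicator A x) = indicator (ball y r0) x * v x * (\<eta> x * indicator A x)"
          using \<eta>(5)[of x] ab r by (auto simp: indicator_def)
      qed simp
      also have "\<dots> \<le> L2norm (\<lambda>x. indicator (ball y r0) x * v x) * L2norm (\<lambda>x. \<eta> x * indicator A x)"
        by (rule L2_Cauchy_Schwarz[OF v1 iso(2)])
      also have "\<dots> \<le> \<kappa> * \<beta> b"
      proof (rule mult_mono)
        have "(\<lambda>x. (indicator (ball y r0) x * v x)\<^sup>2) = (\<lambda>x. indicator (ball y r0) x * (v x)\<^sup>2)"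
          by (auto simp: indicator_def)
        thus "L2norm (\<lambda>x. indicator (ball y r0) x * v x) \<le> \<kappa>"
          unfolding L2norm_def using v \<kappa>(1) by (simp add: real_le_lsqrt)
        show "L2norm (\<lambda>x. \<eta> x * indicator A x) \<le> \<beta> b" using iso(3) by (simp add: \<beta>_def)
      qed (use \<kappa> in \<open>auto simp: L2norm_def intro!: Bochner_Integration.integral_nonneg\<close>)
      finally show ?thesis .
    qed
    have ring: "measure lebesgue (A \<inter> (ball y b - ball y a)) = m b - m a"
    proof -
      have "A \<inter> (ball y b - ball y a) = (A \<inter> ball y b) - (A \<inter> ball y a)" by auto
      moreover have "A \<inter> ball y a \<subseteq> A \<inter> ball y b" using ab by auto
      moreover have "A \<inter> ball y b \<in> lmeasurable" "A \<inter> ball y a \<in> lmeasurable" by (auto intro: fmeasurable_Int_ball[OF A])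
      ultimately show ?thesis unfolding m_def by (simp add: measurable_measure_Diff fmeasurableD)
    qed
    define R where "R = 2 * \<beta> b / sqrt pi"
    have R0: "R > 0" using \<beta>pos[OF b0] by (simp add: R_def)
    have "2 * m a - R * c \<le> m b / 2" using iso(1) by (simp only: m_def R_def \<beta>_def)
    moreover have "R * c \<le> R * (\<kappa> * \<beta> b + 8 / (b - a) * (m b - m a))"
      using vc R0 unfolding c_def ring by (intro mult_left_mono) auto
    ultimately have "2 * (\<beta> a)\<^sup>2 - (2 * \<beta> b / sqrt pi) * (\<kappa> * \<beta> b + 8 / (b - a) * ((\<beta> b)\<^sup>2 - (\<beta> a)\<^sup>2)) \<le> (\<beta> b)\<^sup>2 / 2"
      unfolding \<beta>2 R_def by linarith
    hence "\<beta> a \<le> \<beta> b - (b - a) / 200"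
      by (rule density_step_arith[rotated -1])
         (use \<beta>pos[OF ab(1)] \<beta>pos[OF b0] mmono[of a b] ab s1 \<kappa> in \<open>auto simp: \<beta>_def\<close>)
    thus ?thesis by simp
  qed
  have "1/200 * r \<le> \<beta> r"
    by (rule linear_growth[OF \<beta>pos _ step _ r(1)]) (auto simp: \<beta>_def intro!: mmono)
  hence "(1/200 * r)\<^sup>2 \<le> (\<beta> r)\<^sup>2" using r by (intro power_mono) auto
  thus ?thesis unfolding \<beta>2 m_def by simp
qed

section \<open>Dual variables\<close>

lemma TV_le_iff: "TV g \<le> ereal c \<longleftrightarrow> TVle g c"
  unfolding TV_def TVle_def by (auto simp: SUP_le_iff)

lemma TVle_zero: "TVle (\<lambda>x. 0) 0"
  by (simp add: TVle_def)

lemma TV_nonneg: "0 \<le> TV g"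
proof (cases "TV g")
  case (real c)
  hence "TVle g c" by (simp add: TV_le_iff[symmetric])
  thus ?thesis using TVle_nonneg real by simp
next
  case MInf
  hence "TVle g (-1)" by (simp add: TV_le_iff[symmetric])
  thus ?thesis using TVle_nonneg[of g "-1"] by simp
qed simp

lemma TV_finite_obtain:
  assumes "TV g < \<infinity>" obtains c where "TV g = ereal c" "TVle g c" "c \<ge> 0"
proof (cases "TV g")
  case (real c)
  hence "TVle g c" by (simp add: TV_le_iff[symmetric])
  thus ?thesis using that real TVle_nonneg by blast
qed (use assms TV_nonneg[of g] in auto)

lemma TVle_add:
  assumes "L2 f" "L2 g" "TVle f a" "TVle g b" shows "TVle (\<lambda>x. f x + g x) (a + b)"
  unfolding TVle_def
proof (intro allI impI)
  fix \<phi> assume t: "testfield \<phi>" "\<forall>x. norm (\<phi> x) \<le> 1"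
  have "(\<integral>x. (f x + g x) * divg \<phi> x \<partial>lebesgue) = (\<integral>x. f x * divg \<phi> x \<partial>lebesgue) + (\<integral>x. g x * divg \<phi> x \<partial>lebesgue)"
    using L2_integrable_mult[OF assms(1) L2_divg[OF t(1)]] L2_integrable_mult[OF assms(2) L2_divg[OF t(1)]]
    by (simp add: distrib_right)
  thus "(\<integral>x. (f x + g x) * divg \<phi> x \<partial>lebesgue) \<le> a + b"
    using TVleD[OF assms(3) t(1)] TVleD[OF assms(4) t(1)] t(2) by (simp add: add_mono)
qed

lemma TVle_cmult:
  assumes "TVle g c" "s \<ge> 0" shows "TVle (\<lambda>x. s * g x) (s * c)"
  unfolding TVle_def
proof (intro allI impI)
  fix \<phi> assume t: "testfield \<phi>" "\<forall>x. norm (\<phi> x) \<le> 1"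
  have "(\<integral>x. g x * divg \<phi> x \<partial>lebesgue) \<le> c" by (rule TVleD[OF assms(1) t(1)]) (use t in auto)
  hence "s * (\<integral>x. g x * divg \<phi> x \<partial>lebesgue) \<le> s * c" using assms(2) by (rule mult_left_mono)
  thus "(\<integral>x. s * g x * divg \<phi> x \<partial>lebesgue) \<le> s * c" by (simp add: mult.assoc)
qed

text \<open>Testing the subgradient inequality with 0 gives the equality clause, testing it with u +
  g and using subadditivity gives the dual bound; conversely the two clauses add up to the
  inequality.\<close>

lemma subdiffJ_iff_calib:
  assumes u: "L2 u" shows "v \<in> subdiffJ u \<longleftrightarrow> calib v u"
proof
  assume v: "v \<in> subdiffJ u"
  hence vL: "L2 v" and fin: "TV u < \<infinity>"
    and sub: "\<And>g. L2 g \<Longrightarrow> TV u + ereal (\<integral>x. v x * (g x - u x) \<partial>lebesgue) \<le> TV g"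
    by (auto simp: subdiffJ_def)
  obtain a where a: "TV u = ereal a" "TVle u a" using TV_finite_obtain[OF fin] by blast
  show "calib v u" unfolding calib_def
  proof (intro conjI allI impI vL u)
    have "TV (\<lambda>x. 0) \<le> ereal 0" using TVle_zero by (simp only: TV_le_iff)
    from order_trans[OF sub[OF L2_zero] this]
    have "ereal a + ereal (\<integral>x. v x * (0 - u x) \<partial>lebesgue) \<le> ereal 0" by (simp only: a(1))
    hence "a \<le> (\<integral>x. v x * u x \<partial>lebesgue)" by simp
    thus "TVle u (\<integral>x. v x * u x \<partial>lebesgue)" using a(1) by (simp add: TV_le_iff[symmetric])
  next
    fix g c assume g: "L2 g" "TVle g c"
    have "TV (\<lambda>x. u x + g x) \<le> ereal (a + c)" using TVle_add[OF u g(1) a(2) g(2)] by (simp add: TV_le_iff)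
    from order_trans[OF sub[OF L2_add[OF u g(1)]] this]
    have "ereal a + ereal (\<integral>x. v x * (u x + g x - u x) \<partial>lebesgue) \<le> ereal (a + c)" by (simp only: a(1))
    thus "(\<integral>x. v x * g x \<partial>lebesgue) \<le> c" by simp
  qed
next
  assume c: "calib v u"
  hence vL: "L2 v" and uT: "TV u \<le> ereal (\<integral>x. v x * u x \<partial>lebesgue)" by (auto simp: calib_def TV_le_iff)
  have fin: "TV u < \<infinity>" using uT by (rule le_less_trans) simp
  obtain a where a: "TV u = ereal a" using TV_finite_obtain[OF fin] by blast
  show "v \<in> subdiffJ u" unfolding subdiffJ_def
  proof (intro CollectI conjI allI impI vL fin)
    fix g assume g: "L2 g"
    show "TV u + ereal (\<integral>x. v x * (g x - u x) \<partial>lebesgue) \<le> TV g"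
    proof (cases "TV g < \<infinity>")
      case True
      then obtain b where b: "TV g = ereal b" "TVle g b" using TV_finite_obtain by blast
      have "(\<integral>x. v x * (g x - u x) \<partial>lebesgue) = (\<integral>x. v x * g x \<partial>lebesgue) - (\<integral>x. v x * u x \<partial>lebesgue)"
        using L2_integrable_mult[OF vL g] L2_integrable_mult[OF vL u] by (simp add: right_diff_distrib)
      thus ?thesis using calibD[OF c g b(2)] uT a b(1) by simp
    qed simp
  qed
qed

text \<open>First-order optimality: after division by \<open>s\<close> the quadratic term is a
  multiple of \<open>s\<close>, and \<open>s\<close> is chosen to make it at most
  \<open>e\<close>.\<close>

lemma quadratic_perturbation:
  fixes u h g :: "'a::real_inner"
  assumes "\<And>s. 0 < s \<Longrightarrow> s \<le> 1 \<Longrightarrow> (norm (u - h))\<^sup>2 / 2 \<le> s * c + (norm (u + s *\<^sub>R g - h))\<^sup>2 / 2"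
  shows "inner (h - u) g \<le> c"
proof (rule field_le_epsilon)
  fix e :: real assume e: "e > 0"
  define s where "s = min 1 (2 * e / ((norm g)\<^sup>2 + 1))"
  have n: "(norm g)\<^sup>2 + 1 > 0" by (simp add: add_nonneg_pos)
  have s: "0 < s" "s \<le> 1" using e n by (auto simp: s_def)
  have "u + s *\<^sub>R g - h = (u - h) + s *\<^sub>R g" by simp
  hence "(norm (u + s *\<^sub>R g - h))\<^sup>2 = (norm (u - h))\<^sup>2 - 2 * s * inner (h - u) g + s\<^sup>2 * (norm g)\<^sup>2"
    unfolding power2_norm_eq_inner
    by (simp add: inner_add_left inner_add_right inner_diff_left inner_diff_right inner_commute power2_eq_square algebra_simps)
  hence "s * inner (h - u) g \<le> s * (c + s * (norm g)\<^sup>2 / 2)"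
    using assms[OF s] by (simp add: power2_eq_square algebra_simps)
  hence "inner (h - u) g \<le> c + s * (norm g)\<^sup>2 / 2" using s by simp
  also have "s * (norm g)\<^sup>2 / 2 \<le> e"
  proof -
    have "s * (norm g)\<^sup>2 \<le> (2 * e / ((norm g)\<^sup>2 + 1)) * ((norm g)\<^sup>2 + 1)"
      by (intro mult_mono) (use e n in \<open>auto simp: s_def\<close>)
    thus ?thesis using n by simp
  qed
  finally show "inner (h - u) g \<le> c + e" by simp
qed

text \<open>The optimality condition, with (h - u) / lam as subgradient. Comparison with 0 makes the
  variation of \<open>u\<close> finite. Perturbing by s g and subadditivity give the dual bound;
  shrinking \<open>u\<close> to (1 - s) u, which reduces the variation in proportion, gives equality
  at \<open>u\<close>.\<close>

lemma minimizer_calib: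
  assumes lam: "lam > 0" and h: "L2 h" and m: "is_minimizer lam h u"
  shows "calib (\<lambda>x. (h x - u x) / lam) u"
proof -
  have u: "L2 u" and min: "\<And>g. L2 g \<Longrightarrow> ereal lam * TV u + ereal ((L2norm (\<lambda>x. u x - h x))^2 / 2)
       \<le> ereal lam * TV g + ereal ((L2norm (\<lambda>x. g x - h x))^2 / 2)"
    using m by (auto simp: is_minimizer_def)
  have T0: "TV (\<lambda>x. 0) \<le> 0" using TVle_zero by (simp add: TV_le_iff[symmetric] zero_ereal_def)
  hence "TV (\<lambda>x. 0) = 0" using TV_nonneg[of "\<lambda>x. 0"] by simp
  hence "ereal lam * TV u + ereal ((L2norm (\<lambda>x. u x - h x))^2 / 2) < \<infinity>"
    using min[OF L2_zero] by (auto intro: le_less_trans)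
  hence fin: "TV u < \<infinity>" using lam by (cases "TV u") auto
  obtain a where a: "TV u = ereal a" "TVle u a" using TV_finite_obtain[OF fin] by blast
  have minr: "lam * a + (norm (to_l2 u - to_l2 h))\<^sup>2 / 2 \<le> lam * b + (norm (to_l2 g - to_l2 h))\<^sup>2 / 2"
    if g: "L2 g" and b: "TVle g b" for g b
  proof -
    have "ereal lam * TV g \<le> ereal lam * ereal b" using b lam by (intro ereal_mult_left_mono) (auto simp: TV_le_iff)
    from order_trans[OF min[OF g] add_right_mono[OF this]]
    have "ereal lam * ereal a + ereal ((L2norm (\<lambda>x. u x - h x))^2 / 2) \<le> ereal lam * ereal b + ereal ((L2norm (\<lambda>x. g x - h x))^2 / 2)"
      by (simp only: a(1))
    hence "lam * a + (L2norm (\<lambda>x. u x - h x))^2 / 2 \<le> lam * b + (L2norm (\<lambda>x. g x - h x))^2 / 2" by simp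
    thus ?thesis by (simp add: norm_to_l2[symmetric] L2_diff u g h to_l2_diff)
  qed
  have key: "inner (to_l2 h - to_l2 u) (to_l2 g) \<le> lam * c" if g: "L2 g"
    and T: "\<And>s. 0 < s \<Longrightarrow> s \<le> 1 \<Longrightarrow> TVle (\<lambda>x. u x + s * g x) (a + s * c)" for g c
  proof (rule quadratic_perturbation)
    fix s :: real assume s: "0 < s" "s \<le> 1"
    have "lam * a + (norm (to_l2 u - to_l2 h))\<^sup>2 / 2 \<le> lam * (a + s * c) + (norm (to_l2 (\<lambda>x. u x + s * g x) - to_l2 h))\<^sup>2 / 2"
      by (rule minr[OF L2_add[OF u L2_cmult[OF g]] T[OF s]])
    thus "(norm (to_l2 u - to_l2 h))\<^sup>2 / 2 \<le> s * (lam * c) + (norm (to_l2 u + s *\<^sub>R to_l2 g - to_l2 h))\<^sup>2 / 2"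
      by (simp add: to_l2_add to_l2_cmult u g L2_cmult algebra_simps)
  qed
  have pair: "(\<integral>x. (h x - u x) / lam * g x \<partial>lebesgue) = inner (to_l2 h - to_l2 u) (to_l2 g) / lam" if "L2 g" for g
    using inner_to_l2[OF L2_diff[OF h u] that] by (simp add: to_l2_diff h u)
  show ?thesis unfolding calib_def
  proof (intro conjI allI impI u)
    show "L2 (\<lambda>x. (h x - u x) / lam)" using L2_cmult[OF L2_diff[OF h u], of "1 / lam"] by simp
    fix g c assume g: "L2 g" "TVle g c"
    have "inner (to_l2 h - to_l2 u) (to_l2 g) \<le> lam * c"
      by (rule key[OF g(1)]) (use TVle_add[OF u L2_cmult[OF g(1)] a(2) TVle_cmult[OF g(2)]] in simp)
    thus "(\<integral>x. (h x - u x) / lam * g x \<partial>lebesgue) \<le> c" unfolding pair[OF g(1)] using lam by (simp add: divide_le_eq mult.commute)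
  next
    have T: "TVle (\<lambda>x. u x + s * - u x) (a + s * - a)" if "0 < s" "s \<le> 1" for s
      using TVle_cmult[OF a(2), of "1 - s"] that by (simp add: algebra_simps)
    have "inner (to_l2 h - to_l2 u) (to_l2 (\<lambda>x. - u x)) \<le> lam * (- a)" by (rule key[OF L2_uminus[OF u] T])
    hence "lam * a \<le> inner (to_l2 h - to_l2 u) (to_l2 u)" by (simp add: to_l2_uminus u)
    hence "a \<le> (\<integral>x. (h x - u x) / lam * u x \<partial>lebesgue)" unfolding pair[OF u] using lam by (simp add: le_divide_eq mult.commute)
    thus "TVle u (\<integral>x. (h x - u x) / lam * u x \<partial>lebesgue)" using a(1) by (simp add: TV_le_iff[symmetric])
  qed
qed

section \<open>The dual unit ball and projections onto it\<close>

text \<open>Its polar hull is the dual unit ball of the variation in L2; the subdifferential at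
  \<open>u\<close> is the face of that ball on which the pairing with \<open>u\<close> is
  largest.\<close>

definition unit_divergences :: "l2 set" where
  "unit_divergences = (\<lambda>\<phi>. to_l2 (divg \<phi>)) ` {\<phi>. testfield \<phi> \<and> (\<forall>x. norm (\<phi> x) \<le> 1)}"

lemma TVle_iff_inner:
  assumes "L2 g" shows "TVle g c \<longleftrightarrow> (\<forall>d\<in>unit_divergences. inner (to_l2 g) d \<le> c)"
  unfolding TVle_def unit_divergences_def using assms by (auto simp: inner_to_l2 L2_divg)

text \<open>The variation bound \<open>c\<close> of \<open>g\<close> is exactly the constant of a
  half-space containing the unit divergences. The second condition puts \<open>u\<close> into the
  normal cone of the hull at \<open>v\<close>; for the dual variables this says that
  \<open>V n\<close> is the projection of (f + w n) / lam n, the difference being u n / lam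
  n.\<close>

lemma calib_iff_polar_hull:
  assumes v: "L2 v" and u: "L2 u"
  shows "calib v u \<longleftrightarrow> to_l2 v \<in> polar_hull unit_divergences \<and>
     (\<forall>d\<in>polar_hull unit_divergences. inner (to_l2 u) d \<le> inner (to_l2 u) (to_l2 v))"
proof
  assume c: "calib v u"
  have "to_l2 v \<in> polar_hull unit_divergences"
    unfolding polar_hull_def
  proof (intro CollectI allI impI)
    fix g c' assume "\<forall>d\<in>unit_divergences. inner g d \<le> c'"
    hence "TVle (of_l2 g) c'" by (simp add: TVle_iff_inner L2_of_l2 to_l2_of_l2)
    from calibD[OF c L2_of_l2 this] have "inner (to_l2 v) (to_l2 (of_l2 g)) \<le> c'" by (simp add: inner_to_l2 v L2_of_l2)
    thus "inner g (to_l2 v) \<le> c'" by (simp add: to_l2_of_l2 inner_commute)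
  qed
  moreover have "inner (to_l2 u) d \<le> inner (to_l2 u) (to_l2 v)" if d: "d \<in> polar_hull unit_divergences" for d
  proof (rule polar_hullD[OF d])
    have "TVle u (\<integral>x. v x * u x \<partial>lebesgue)" using c by (simp add: calib_def)
    thus "e \<in> unit_divergences \<Longrightarrow> inner (to_l2 u) e \<le> inner (to_l2 u) (to_l2 v)" for e
      by (simp add: TVle_iff_inner u inner_to_l2 v mult.commute)
  qed
  ultimately show "to_l2 v \<in> polar_hull unit_divergences \<and>
     (\<forall>d\<in>polar_hull unit_divergences. inner (to_l2 u) d \<le> inner (to_l2 u) (to_l2 v))" by blast
next
  assume a: "to_l2 v \<in> polar_hull unit_divergences \<and>
     (\<forall>d\<in>polar_hull unit_divergences. inner (to_l2 u) d \<le> inner (to_l2 u) (to_l2 v))"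
  show "calib v u" unfolding calib_def
  proof (intro conjI allI impI u v)
    fix g c assume g: "L2 g" "TVle g c"
    have "inner (to_l2 g) (to_l2 v) \<le> c"
      using polar_hullD[of "to_l2 v" unit_divergences "to_l2 g" c] a g by (simp add: TVle_iff_inner)
    thus "(\<integral>x. v x * g x \<partial>lebesgue) \<le> c" by (simp add: inner_to_l2 g v mult.commute)
  next
    have "\<forall>d\<in>unit_divergences. inner (to_l2 u) d \<le> inner (to_l2 u) (to_l2 v)" using a polar_hull_superset by blast
    thus "TVle u (\<integral>x. v x * u x \<partial>lebesgue)" by (simp add: TVle_iff_inner u inner_to_l2 v mult.commute)
  qed
qed

text \<open>\<open>z n\<close> is the projection of f / lam n, taken directly in the hull, and its
  limit is the subgradient of least norm at \<open>f\<close>. Nonexpansiveness bounds V n - z n by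
  the norm of w n / lam n. The \<open>V n\<close> are therefore bounded, and u n - f = w n - lam n V
  n tends to 0.\<close>

lemma dual_convergence:
  assumes f: "L2 f" and vf: "calib v f" and lam: "\<And>n. lam n > 0" "lam \<longlonglongrightarrow> 0"
    and w: "\<And>n. L2 (w n)" and e: "\<And>n. L2norm (w n) / lam n \<le> C" and u: "\<And>n. is_minimizer (lam n) (\<lambda>x. f x + w n x) (u n)"
  defines "V \<equiv> \<lambda>n x. (f x + w n x - u n x) / lam n"
  obtains v0 z where "calib v0 f" "\<And>v'. calib v' f \<Longrightarrow> L2norm v0 \<le> L2norm v'"
    "\<And>n. L2 (z n)" "(\<lambda>n. L2norm (\<lambda>x. z n x - v0 x)) \<longlonglongrightarrow> 0" "\<And>n. calib (V n) (u n)"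
    "\<And>n. L2norm (\<lambda>x. V n x - z n x) \<le> L2norm (w n) / lam n"
    "(\<lambda>n. L2norm (\<lambda>x. u n x - f x)) \<longlonglongrightarrow> 0"
proof -
  let ?K = "polar_hull unit_divergences"
  have vL: "L2 v" using vf by (simp add: calib_def)
  have uL: "L2 (u n)" for n using u by (simp add: is_minimizer_def)
  have cal: "calib (V n) (u n)" for n
    unfolding V_def by (rule minimizer_calib[OF lam(1) L2_add[OF f w] u])
  have VL: "L2 (V n)" for n using cal by (simp add: calib_def)
  define F where "F = to_l2 f"
  note vK = vf[unfolded calib_iff_polar_hull[OF vL f]]
  have ne: "?K \<noteq> {}" using vK by blast
  have "\<exists>p\<in>?K. \<forall>d\<in>?K. inner ((1 / lam n) *\<^sub>R F - p) (d - p) \<le> 0" for n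
    using closed_convex_projection[OF convex_polar_hull closed_polar_hull ne] by metis
  then obtain Z where Z: "\<And>n. Z n \<in> ?K" "\<And>n d. d \<in> ?K \<Longrightarrow> inner ((1 / lam n) *\<^sub>R F - Z n) (d - Z n) \<le> 0" by metis
  have Z': "inner (F - lam n *\<^sub>R Z n) (d - Z n) \<le> 0" if "d \<in> ?K" for n d
  proof -
    have "F - lam n *\<^sub>R Z n = lam n *\<^sub>R ((1 / lam n) *\<^sub>R F - Z n)"
      using lam(1)[of n] by (simp add: scaleR_diff_right)
    hence "inner (F - lam n *\<^sub>R Z n) (d - Z n) = lam n * inner ((1 / lam n) *\<^sub>R F - Z n) (d - Z n)"
      by (simp only: inner_scaleR_left)
    thus ?thesis using Z(2)[OF that, of n] lam(1)[of n] by (simp add: mult_le_0_iff)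
  qed
  have vmax: "\<And>d. d \<in> ?K \<Longrightarrow> inner F d \<le> inner F (to_l2 v)" using vK by (simp add: F_def)
  obtain v0 where v0: "v0 \<in> ?K" "Z \<longlonglongrightarrow> v0" "\<And>d. d \<in> ?K \<Longrightarrow> inner F d \<le> inner F v0"
    "\<And>v'. v' \<in> ?K \<Longrightarrow> (\<And>d. d \<in> ?K \<Longrightarrow> inner F d \<le> inner F v') \<Longrightarrow> norm v0 \<le> norm v'"
    using scaled_projection_limit[OF closed_polar_hull _ vmax lam Z(1) Z'] vK by blast
  have c0: "calib (of_l2 v0) f"
    using v0(1,3) by (simp add: calib_iff_polar_hull L2_of_l2 f to_l2_of_l2 F_def)
  have min0: "L2norm (of_l2 v0) \<le> L2norm v'" if c: "calib v' f" for v'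
  proof -
    have L: "L2 v'" using c by (simp add: calib_def)
    have "norm v0 \<le> norm (to_l2 v')"
      by (rule v0(4)) (use c calib_iff_polar_hull[OF L f] in \<open>auto simp: F_def\<close>)
    thus ?thesis by (simp add: norm_to_l2[symmetric] L L2_of_l2 to_l2_of_l2)
  qed
  have VZ: "norm (to_l2 (V n) - Z n) \<le> L2norm (w n) / lam n" for n
  proof -
    have Vk: "to_l2 (V n) \<in> ?K" "\<And>d. d \<in> ?K \<Longrightarrow> inner (to_l2 (u n)) d \<le> inner (to_l2 (u n)) (to_l2 (V n))"
      using cal[of n] by (auto simp: calib_iff_polar_hull VL uL)
    define y where "y = (1 / lam n) *\<^sub>R (F + to_l2 (w n))"
    have "to_l2 (V n) = y - (1 / lam n) *\<^sub>R to_l2 (u n)"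
    proof -
      have "V n = (\<lambda>x. (1 / lam n) * ((f x + w n x) - u n x))" by (simp add: V_def)
      hence "to_l2 (V n) = (1 / lam n) *\<^sub>R to_l2 (\<lambda>x. (f x + w n x) - u n x)"
        by (simp only: to_l2_cmult[OF L2_diff[OF L2_add[OF f w] uL]])
      thus ?thesis
        by (simp only: to_l2_diff[OF L2_add[OF f w] uL] to_l2_add[OF f w] y_def F_def scaleR_diff_right)
    qed
    hence yu: "y - to_l2 (V n) = (1 / lam n) *\<^sub>R to_l2 (u n)" by simp
    have "inner (y - to_l2 (V n)) (Z n - to_l2 (V n)) \<le> 0"
      unfolding yu using Vk(2)[OF Z(1)[of n]] lam(1)[of n] by (simp add: inner_diff_right divide_right_mono)
    from projection_nonexpansive[OF this Z(2)[OF Vk(1)]]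
    have "norm (to_l2 (V n) - Z n) \<le> norm (y - (1 / lam n) *\<^sub>R F)" .
    also have "y - (1 / lam n) *\<^sub>R F = (1 / lam n) *\<^sub>R to_l2 (w n)" by (simp add: y_def scaleR_add_right)
    finally show ?thesis using lam(1)[of n] by (simp add: norm_to_l2 w)
  qed
  have e1: "L2norm (\<lambda>x. of_l2 (Z n) x - of_l2 v0 x) = norm (Z n - v0)" for n
    by (simp add: norm_to_l2[symmetric] L2_diff L2_of_l2 to_l2_diff to_l2_of_l2)
  have e2: "L2norm (\<lambda>x. V n x - of_l2 (Z n) x) = norm (to_l2 (V n) - Z n)" for n
    by (simp add: norm_to_l2[symmetric] L2_diff L2_of_l2 VL to_l2_diff to_l2_of_l2)
  have zl: "(\<lambda>n. L2norm (\<lambda>x. of_l2 (Z n) x - of_l2 v0 x)) \<longlonglongrightarrow> 0"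
    unfolding e1 using v0(2) by (intro tendsto_norm_zero LIM_zero)
  have "Bseq Z" using v0(2) by (intro convergent_imp_Bseq convergentI)
  then obtain B where B: "\<And>n. norm (Z n) \<le> B" by (auto simp: Bseq_def)
  have ul: "(\<lambda>n. L2norm (\<lambda>x. u n x - f x)) \<longlonglongrightarrow> 0"
  proof (rule Lim_null_comparison)
    show "(\<lambda>n. lam n * (C + (B + C))) \<longlonglongrightarrow> 0" using tendsto_mult_left_zero[OF lam(2)] by simp
    show "\<forall>\<^sub>F n in sequentially. norm (L2norm (\<lambda>x. u n x - f x)) \<le> lam n * (C + (B + C))"
    proof (rule always_eventually, rule allI)
      fix n
      have "(\<lambda>x. u n x - f x) = (\<lambda>x. w n x - lam n * V n x)" using lam(1)[of n] by (auto simp: V_def)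
      hence "L2norm (\<lambda>x. u n x - f x) = norm (to_l2 (w n) - lam n *\<^sub>R to_l2 (V n))"
        by (simp add: norm_to_l2[symmetric] L2_diff L2_cmult w VL to_l2_diff to_l2_cmult)
      also have "\<dots> \<le> norm (to_l2 (w n)) + lam n * norm (to_l2 (V n))"
        using norm_triangle_ineq4[of "to_l2 (w n)" "lam n *\<^sub>R to_l2 (V n)"] lam(1)[of n] by simp
      also have "\<dots> \<le> lam n * C + lam n * (B + C)"
      proof (rule add_mono)
        show "norm (to_l2 (w n)) \<le> lam n * C" using e[of n] lam(1)[of n] by (simp add: norm_to_l2 w divide_le_eq mult.commute)
        have "norm (to_l2 (V n)) \<le> norm (Z n) + norm (to_l2 (V n) - Z n)" using norm_triangle_ineq[of "Z n" "to_l2 (V n) - Z n"] by simp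
        hence "norm (to_l2 (V n)) \<le> B + C" using B[of n] VZ[of n] e[of n] by linarith
        thus "lam n * norm (to_l2 (V n)) \<le> lam n * (B + C)" using lam(1)[of n] by simp
      qed
      finally have "L2norm (\<lambda>x. u n x - f x) \<le> lam n * (C + (B + C))" by (simp only: distrib_left)
      moreover have "0 \<le> L2norm (\<lambda>x. u n x - f x)" by (simp add: L2norm_def)
      ultimately show "norm (L2norm (\<lambda>x. u n x - f x)) \<le> lam n * (C + (B + C))"
        by (simp only: real_norm_def abs_of_nonneg)
    qed
  qed
  show ?thesis by (rule that[OF c0 min0 L2_of_l2 zl cal _ ul]) (use VZ in \<open>auto simp: e2\<close>)
qed

text \<open>Split v^2 at a height \<open>n\<close>: where it exceeds \<open>n\<close> its total mass
  is small, elsewhere it contributes at most n pi r^2 to a disc. Neither bound depends on the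
  centre.\<close>

lemma uniform_local_smallness:
  assumes v: "L2 v" and e: "e > 0"
  obtains r where "r > 0" "\<And>y. (\<integral>x. indicator (ball y r) x * (v x)\<^sup>2 \<partial>lebesgue) \<le> e"
proof -
  define g where "g x = (v x)\<^sup>2" for x
  have gi: "integrable lebesgue g" unfolding g_def by (rule L2_integrable_sq[OF v])
  have gm: "g \<in> borel_measurable lebesgue" using gi by simp
  define T where "T n x = (if g x > real n then g x else 0)" for n x
  have "{x \<in> space lebesgue. g x > real n} \<in> sets lebesgue" for n using gm by measurable
  hence sm: "{x. g x > real n} \<in> sets lebesgue" for n by simp
  have T: "T n = (\<lambda>x. indicator {x. g x > real n} x * g x)" for n by (auto simp: T_def)
  have Tm: "T n \<in> borel_measurable lebesgue" for n
    unfolding T by (intro borel_measurable_times borel_measurable_indicator sm gm)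
  have "(\<lambda>n. \<integral>x. T n x \<partial>lebesgue) \<longlonglongrightarrow> (\<integral>x. 0 \<partial>(lebesgue :: R2 measure))"
  proof (rule integral_dominated_convergence[where w = g])
    show "AE x in lebesgue. (\<lambda>n. T n x) \<longlonglongrightarrow> 0"
    proof (rule AE_I2, rule tendsto_eventually)
      fix x
      obtain N :: nat where N: "g x \<le> real N" using real_arch_simple by blast
      show "\<forall>\<^sub>F n in sequentially. T n x = 0"
      proof (rule eventually_sequentiallyI[of N])
        fix n assume "N \<le> n"
        hence "real N \<le> real n" by simp
        thus "T n x = 0" using N by (simp add: T_def)
      qed
    qed
    show "AE x in lebesgue. norm (T n x) \<le> g x" for n by (rule AE_I2) (simp add: T_def g_def)
  qed (use gi Tm in auto)
  hence "\<forall>\<^sub>F n in sequentially. (\<integral>x. T n x \<partial>lebesgue) < e / 2"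
    using order_tendstoD(2)[of _ "0::real" sequentially "e/2"] e by simp
  then obtain n where n: "(\<integral>x. T n x \<partial>lebesgue) < e / 2" by (meson eventually_happens sequentially_bot)
  define r where "r = min 1 (e / (2 * (real n * pi + 1)))"
  have p1: "real n * pi + 1 > 0" by (simp add: add_nonneg_pos)
  have r: "r > 0" "r \<le> 1" using e p1 by (auto simp: r_def)
  have Ti: "integrable lebesgue (T n)"
    by (rule Bochner_Integration.integrable_bound[OF gi Tm]) (auto simp: T_def g_def)
  have "(\<integral>x. indicator (ball y r) x * (v x)\<^sup>2 \<partial>lebesgue) \<le> e" for y
  proof -
    have bi: "integrable lebesgue (\<lambda>x. real n * indicator (ball y r) x)"
      by (rule integrable_mult_right) (rule integrable_real_indicator, use emeasure_lborel_ball_finite in auto)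
    have "integrable lebesgue (\<lambda>x. indicator (ball y r) x * g x)"
      using integrable_mult_indicator[OF _ gi, of "ball y r"] by simp
    hence "(\<integral>x. indicator (ball y r) x * g x \<partial>lebesgue) \<le> (\<integral>x. T n x + real n * indicator (ball y r) x \<partial>lebesgue)"
    proof (rule integral_mono)
      show "indicator (ball y r) x * g x \<le> T n x + real n * indicator (ball y r) x" for x
        by (auto simp: T_def g_def indicator_def)
    qed (use Ti bi in simp)
    also have "\<dots> = (\<integral>x. T n x \<partial>lebesgue) + real n * measure lebesgue (ball y r)"
      using Ti bi by simp
    also have "measure lebesgue (ball y r) = pi * r\<^sup>2"
      using content_ball[of r y] r by (simp add: unit_ball_vol_2)
    also have "real n * (pi * r\<^sup>2) \<le> e / 2"
    proof -
      have "real n * (pi * r\<^sup>2) \<le> (real n * pi + 1) * r"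
      proof -
        have "r\<^sup>2 \<le> r" using r by (simp add: power2_eq_square mult_left_le)
        hence "(real n * pi) * r\<^sup>2 \<le> (real n * pi) * r" by (intro mult_left_mono) auto
        thus ?thesis using r by (simp only: distrib_right mult.assoc)
      qed
      also have "\<dots> \<le> (real n * pi + 1) * (e / (2 * (real n * pi + 1)))"
        using p1 by (intro mult_left_mono) (auto simp: r_def)
      also have "\<dots> = e / 2"
      proof -
        have "P * (e / (2 * P)) = e / 2" if "P > 0" for P :: real using that by simp
        from this[OF p1] show ?thesis .
      qed
      finally show ?thesis .
    qed
    finally show ?thesis using n by (simp add: g_def)
  qed
  thus ?thesis using that r by blast
qed

section \<open>Convergence of the level sets\<close>

text \<open>\<sigma> v and -\<sigma> v have the same square as \<open>v\<close>, so a single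
  smallness hypothesis serves both \<open>E\<close> and its complement.\<close>

lemma calib_density:
  assumes E: "E \<in> sets lebesgue" and s: "\<sigma> = 1 \<or> \<sigma> = -1" and c: "calib (\<lambda>x. \<sigma> * v x) (indicator E)"
    and \<kappa>: "0 \<le> \<kappa>" "\<kappa> \<le> 3/5 * sqrt pi" and v: "(\<integral>x. indicator (ball y r0) x * (v x)\<^sup>2 \<partial>lebesgue) \<le> \<kappa>\<^sup>2"
    and pos: "\<And>r. r > 0 \<Longrightarrow> 0 < measure lebesgue (E \<inter> ball y r)" "\<And>r. r > 0 \<Longrightarrow> 0 < measure lebesgue (ball y r - E)"
    and r: "0 < r" "r \<le> r0"
  shows "(r / 200)\<^sup>2 \<le> measure lebesgue (E \<inter> ball y r)" "(r / 200)\<^sup>2 \<le> measure lebesgue (ball y r - E)"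
proof -
  have s2: "(\<sigma> * a)\<^sup>2 = a\<^sup>2" "(- (\<sigma> * a))\<^sup>2 = a\<^sup>2" for a using s by auto
  show "(r / 200)\<^sup>2 \<le> measure lebesgue (E \<inter> ball y r)"
    by (rule density_estimate[OF calib_quasi_minimal_inside[OF E c] \<kappa> _ pos(1) r]) (use v s2 in auto)
  have eq: "- E \<inter> ball y t = ball y t - E" for t by auto
  have "(r / 200)\<^sup>2 \<le> measure lebesgue (- E \<inter> ball y r)"
    by (rule density_estimate[OF calib_quasi_minimal_outside[OF E c] \<kappa> _ _ r]) (use v s2 pos(2) eq in auto)
  thus "(r / 200)\<^sup>2 \<le> measure lebesgue (ball y r - E)" unfolding eq .
qed

lemma L2norm_indicator_le:
  assumes "L2 g" "S \<in> sets lebesgue" shows "L2norm (\<lambda>x. indicator S x * g x) \<le> L2norm g"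
  unfolding L2norm_def
proof (rule real_sqrt_le_mono, rule integral_mono)
  show "integrable lebesgue (\<lambda>x. (indicator S x * g x)\<^sup>2)" using L2_indicator_mult[OF assms] by (rule L2_integrable_sq)
  show "integrable lebesgue (\<lambda>x. (g x)\<^sup>2)" using assms(1) by (rule L2_integrable_sq)
qed (auto simp: indicator_def)

text \<open>3/5 = 1/2 + 1/20 + 1/20: the noise accounts for sqrt(4 pi)/4 = sqrt pi / 2, the late
  \<open>z n\<close> are within sqrt pi / 20 of \<open>v0\<close>, and \<open>v0\<close> has norm at
  most sqrt pi / 20 on every disc of radius \<open>r0\<close>.\<close>

lemma dual_uniform_smallness:
  assumes v0: "L2 v0" and z: "\<And>n. L2 (z n)" "(\<lambda>n. L2norm (\<lambda>x. z n x - v0 x)) \<longlonglongrightarrow> 0"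
    and V: "\<And>n. L2 (V n)" "\<And>n. L2norm (\<lambda>x. V n x - z n x) \<le> sqrt (4 * pi) / 4"
  obtains r0 N where "r0 > 0" "\<And>n y. n \<ge> N \<Longrightarrow> (\<integral>x. indicator (ball y r0) x * (V n x)\<^sup>2 \<partial>lebesgue) \<le> (3/5 * sqrt pi)\<^sup>2"
proof -
  have p: "sqrt pi / 20 > 0" by simp
  obtain r0 where r0: "r0 > 0" "\<And>y. (\<integral>x. indicator (ball y r0) x * (v0 x)\<^sup>2 \<partial>lebesgue) \<le> (sqrt pi / 20)\<^sup>2"
    using uniform_local_smallness[OF v0, of "(sqrt pi / 20)\<^sup>2"] by auto
  from order_tendstoD(2)[OF z(2) p] obtain N where N: "\<And>n. n \<ge> N \<Longrightarrow> L2norm (\<lambda>x. z n x - v0 x) < sqrt pi / 20"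
    by (auto simp: eventually_sequentially)
  have "(\<integral>x. indicator (ball y r0) x * (V n x)\<^sup>2 \<partial>lebesgue) \<le> (3/5 * sqrt pi)\<^sup>2" if n: "n \<ge> N" for n y
  proof -
    let ?B = "ball y r0"
    have B: "?B \<in> sets lebesgue" by simp
    have sq: "(\<lambda>x. indicator ?B x * (g x)\<^sup>2) = (\<lambda>x. (indicator ?B x * g x)\<^sup>2)" for g :: "R2 \<Rightarrow> real" by (auto simp: indicator_def)
    define a where "a = to_l2 (\<lambda>x. indicator ?B x * (V n x - z n x))"
    define b where "b = to_l2 (\<lambda>x. indicator ?B x * (z n x - v0 x))"
    define c where "c = to_l2 (\<lambda>x. indicator ?B x * v0 x)"
    have L: "L2 (\<lambda>x. indicator ?B x * (V n x - z n x))" "L2 (\<lambda>x. indicator ?B x * (z n x - v0 x))"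
      "L2 (\<lambda>x. indicator ?B x * v0 x)" "L2 (\<lambda>x. indicator ?B x * V n x)"
      by (intro L2_indicator_mult L2_diff V z v0 B)+
    have "(\<lambda>x. indicator ?B x * V n x) = (\<lambda>x. (indicator ?B x * (V n x - z n x) + indicator ?B x * (z n x - v0 x)) + indicator ?B x * v0 x)"
      by (auto simp: indicator_def)
    hence e: "to_l2 (\<lambda>x. indicator ?B x * V n x) = a + b + c"
      by (simp only: to_l2_add[OF L2_add[OF L(1,2)] L(3)] to_l2_add[OF L(1,2)] a_def b_def c_def)
    have "norm a \<le> sqrt pi / 2"
    proof -
      have "norm a \<le> L2norm (\<lambda>x. V n x - z n x)"
        unfolding a_def norm_to_l2[OF L(1)] by (rule L2norm_indicator_le[OF L2_diff[OF V(1) z(1)] B])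
      also have "\<dots> \<le> sqrt (4 * pi) / 4" by (rule V(2))
      also have "\<dots> = sqrt pi / 2" by (simp add: real_sqrt_mult)
      finally show ?thesis .
    qed
    moreover have "norm b \<le> sqrt pi / 20"
      unfolding b_def norm_to_l2[OF L(2)] using L2norm_indicator_le[OF L2_diff[OF z(1) v0] B, of n] N[OF n] by linarith
    moreover have "norm c \<le> sqrt pi / 20"
      unfolding c_def norm_to_l2[OF L(3)] L2norm_def by (rule real_le_lsqrt) (simp, rule r0(2)[of y, unfolded sq])
    ultimately have "norm (a + b + c) \<le> 3/5 * sqrt pi"
      using norm_triangle_ineq[of "a + b" c] norm_triangle_ineq[of a b] by simp
    hence "(norm (a + b + c))\<^sup>2 \<le> (3/5 * sqrt pi)\<^sup>2" by (intro power_mono) auto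
    thus ?thesis unfolding sq norm_sq_to_l2[OF L(4), unfolded e] .
  qed
  thus ?thesis using that r0(1) by blast
qed

section \<open>Painleve-Kuratowski limits of boundaries\<close>

lemma sdist_nonneg: "0 \<le> sdist x S"
  by (simp add: sdist_def infdist_nonneg)

lemma pk_liminf_subset_limsup: "pk_liminf S \<subseteq> pk_limsup S"
proof
  fix x assume "x \<in> pk_liminf S"
  hence "limsup (\<lambda>n. sdist x (S n)) = 0" by (simp add: pk_liminf_def)
  moreover have "liminf (\<lambda>n. sdist x (S n)) \<le> limsup (\<lambda>n. sdist x (S n))" by (rule Liminf_le_Limsup) simp
  moreover have "0 \<le> liminf (\<lambda>n. sdist x (S n))" by (rule Liminf_bounded) (simp add: sdist_nonneg)
  ultimately show "x \<in> pk_limsup S" by (simp add: pk_limsup_def)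
qed

lemma pk_liminfI:
  assumes "\<And>e. e > 0 \<Longrightarrow> \<forall>\<^sub>F n in sequentially. \<exists>y\<in>S n. dist x y < e"
  shows "x \<in> pk_liminf S"
proof -
  have "limsup (\<lambda>n. sdist x (S n)) \<le> ereal e" if e: "e > 0" for e
  proof (rule Limsup_bounded)
    show "\<forall>\<^sub>F n in sequentially. sdist x (S n) \<le> ereal e"
      using assms[OF e]
    proof eventually_elim
      fix n assume "\<exists>y\<in>S n. dist x y < e"
      then obtain y where y: "y \<in> S n" "dist x y < e" by blast
      hence "infdist x (S n) \<le> e" using infdist_le[OF y(1), of x] by simp
      thus "sdist x (S n) \<le> ereal e" using y by (auto simp: sdist_def)
    qed
  qed
  hence "limsup (\<lambda>n. sdist x (S n)) \<le> 0" by (intro ereal_le_epsilon2[rule_format, of _ 0]) auto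
  moreover have "0 \<le> limsup (\<lambda>n. sdist x (S n))"
    by (rule order_trans[OF Liminf_bounded Liminf_le_Limsup]) (auto simp: sdist_nonneg)
  ultimately show ?thesis by (simp add: pk_liminf_def)
qed

lemma pk_limsupD:
  assumes "x \<in> pk_limsup S" "e > 0"
  shows "\<exists>\<^sub>F n in sequentially. \<exists>y\<in>S n. dist x y < e"
proof (rule ccontr)
  assume "\<not> ?thesis"
  hence "\<forall>\<^sub>F n in sequentially. \<forall>y\<in>S n. e \<le> dist x y" by (simp add: frequently_def not_less)
  hence "\<forall>\<^sub>F n in sequentially. ereal e \<le> sdist x (S n)"
  proof eventually_elim
    fix n assume a: "\<forall>y\<in>S n. e \<le> dist x y"
    \<comment> \<open>For an empty \<open>S n\<close> the distance is infinite, not the default 0 of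
      \<open>infdist\<close>, so the bound holds there too.\<close>
    show "ereal e \<le> sdist x (S n)"
      using a by (auto simp: sdist_def infdist_def intro!: cINF_greatest)
  qed
  hence "ereal e \<le> liminf (\<lambda>n. sdist x (S n))" by (rule Liminf_bounded)
  thus False using assms by (simp add: pk_limsup_def)
qed

text \<open>A point off the boundary of \<open>F\<close> has a disc inside \<open>F\<close> or
  inside its complement; a nearby boundary point of \<open>E n\<close> would, by density, put area
  (r/200)^2 into the symmetric difference. Conversely \<open>F\<close> and its complement have
  positive area near a boundary point of \<open>F\<close>, so every late \<open>E n\<close> meets
  the disc without containing it, and the disc, being connected, meets its boundary.\<close>

lemma pk_lim_frontier:
  assumes E: "\<And>n. E n \<in> sets lebesgue" and F: "F \<in> sets lebesgue"
    and D: "\<And>n. (E n - F) \<union> (F - E n) \<in> lmeasurable" "(\<lambda>n. measure lebesgue ((E n - F) \<union> (F - E n))) \<longlonglongrightarrow> 0"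
    and r0: "r0 > 0" and dens: "\<And>n y r. n \<ge> N \<Longrightarrow> y \<in> frontier (E n) \<Longrightarrow> 0 < r \<Longrightarrow> r \<le> r0 \<Longrightarrow>
      (r / 200)\<^sup>2 \<le> measure lebesgue (E n \<inter> ball y r) \<and> (r / 200)\<^sup>2 \<le> measure lebesgue (ball y r - E n)"
    and Fr: "\<And>x r. x \<in> frontier F \<Longrightarrow> 0 < r \<Longrightarrow> 0 < measure lebesgue (F \<inter> ball x r) \<and> 0 < measure lebesgue (ball x r - F)"
  shows "pk_lim (\<lambda>n. frontier (E n)) (frontier F)"
proof -
  have small: "\<forall>\<^sub>F n in sequentially. measure lebesgue ((E n - F) \<union> (F - E n)) < e" if "e > 0" for e
    using order_tendstoD(2)[OF D(2) that] .
  have sub: "measure lebesgue A \<le> measure lebesgue ((E n - F) \<union> (F - E n))" if "A \<subseteq> (E n - F) \<union> (F - E n)" "A \<in> sets lebesgue" for A n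
    by (rule measure_mono_fmeasurable[OF that D(1)])
  have sets: "E n \<inter> ball y r \<in> sets lebesgue" "ball y r - E n \<in> sets lebesgue" "F \<inter> ball y r \<in> sets lebesgue" "ball y r - F \<in> sets lebesgue" for n y r
    using E F by auto
  have 1: "pk_limsup (\<lambda>n. frontier (E n)) \<subseteq> frontier F"
  proof
    fix x assume x: "x \<in> pk_limsup (\<lambda>n. frontier (E n))"
    show "x \<in> frontier F"
    proof (rule ccontr)
      assume "x \<notin> frontier F"
      hence "x \<in> interior F \<or> x \<in> interior (- F)" by (auto simp: frontier_def interior_closure)
      then obtain \<rho> where \<rho>: "\<rho> > 0" "ball x \<rho> \<subseteq> F \<or> ball x \<rho> \<subseteq> - F" by (meson mem_interior)
      define r where "r = min r0 (\<rho> / 2)"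
      have r: "0 < r" "r \<le> r0" "r \<le> \<rho> / 2" using r0 \<rho> by (auto simp: r_def)
      have "\<forall>\<^sub>F n in sequentially. n \<ge> N \<and> measure lebesgue ((E n - F) \<union> (F - E n)) < (r / 200)\<^sup>2"
        using small[of "(r/200)\<^sup>2"] r eventually_ge_at_top[of N] by (simp add: eventually_conj)
      from frequently_eventually_frequently[OF pk_limsupD[OF x] this, of "\<rho> / 2"] \<rho>(1)
      have "\<exists>\<^sub>F n in sequentially. (\<exists>y\<in>frontier (E n). dist x y < \<rho> / 2) \<and> n \<ge> N \<and> measure lebesgue ((E n - F) \<union> (F - E n)) < (r / 200)\<^sup>2"
        by (simp only: half_gt_zero_iff)
      then obtain n y where n: "n \<ge> N" "measure lebesgue ((E n - F) \<union> (F - E n)) < (r / 200)\<^sup>2"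
        and y: "y \<in> frontier (E n)" "dist x y < \<rho> / 2" by (auto dest: frequently_ex)
      have b: "ball y r \<subseteq> ball x \<rho>"
      proof
        fix p assume "p \<in> ball y r"
        thus "p \<in> ball x \<rho>" using dist_triangle[of x p y] y(2) r(3) by simp
      qed
      from \<rho>(2) show False
      proof
        assume "ball x \<rho> \<subseteq> F"
        hence "ball y r - E n \<subseteq> (E n - F) \<union> (F - E n)" using b by blast
        from sub[OF this sets(2)] dens[OF n(1) y(1) r(1,2)] n(2) show False by linarith
      next
        assume "ball x \<rho> \<subseteq> - F"
        hence "E n \<inter> ball y r \<subseteq> (E n - F) \<union> (F - E n)" using b by blast
        from sub[OF this sets(1)] dens[OF n(1) y(1) r(1,2)] n(2) show False by linarith
      qed
    qed
  qed
  have 2: "frontier F \<subseteq> pk_liminf (\<lambda>n. frontier (E n))"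
  proof
    fix x assume x: "x \<in> frontier F"
    show "x \<in> pk_liminf (\<lambda>n. frontier (E n))"
    proof (rule pk_liminfI)
      fix e :: real assume e: "e > 0"
      note Fx = Fr[OF x e]
      have "\<forall>\<^sub>F n in sequentially. measure lebesgue ((E n - F) \<union> (F - E n)) < measure lebesgue (F \<inter> ball x e)
          \<and> measure lebesgue ((E n - F) \<union> (F - E n)) < measure lebesgue (ball x e - F)"
        using small Fx by (intro eventually_conj) auto
      thus "\<forall>\<^sub>F n in sequentially. \<exists>y\<in>frontier (E n). dist x y < e"
      proof eventually_elim
        fix n assume n: "measure lebesgue ((E n - F) \<union> (F - E n)) < measure lebesgue (F \<inter> ball x e)
          \<and> measure lebesgue ((E n - F) \<union> (F - E n)) < measure lebesgue (ball x e - F)"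
        have "\<not> F \<inter> ball x e \<subseteq> (E n - F) \<union> (F - E n)" using sub[OF _ sets(3)] n by force
        hence a: "ball x e \<inter> E n \<noteq> {}" by blast
        have "\<not> ball x e - F \<subseteq> (E n - F) \<union> (F - E n)" using sub[OF _ sets(4)] n by force
        hence b: "ball x e - E n \<noteq> {}" by blast
        from connected_Int_frontier[OF connected_ball a b] show "\<exists>y\<in>frontier (E n). dist x y < e" by auto
      qed
    qed
  qed
  show ?thesis unfolding pk_lim_def using 1 2 pk_liminf_subset_limsup[of "\<lambda>n. frontier (E n)"] by blast
qed

section \<open>Convergence of level sets in measure\<close>

text \<open>Fubini on the graph of a Borel version \<open>g\<close> of \<open>f\<close>: for fixed
  \<open>x\<close> the section in \<open>t\<close> is a single point, hence null.\<close>

lemma AE_level_null: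
  fixes f :: "R2 \<Rightarrow> real"
  assumes "f \<in> borel_measurable lebesgue"
  shows "AE t in lborel. emeasure lebesgue {x. f x = t} = 0"
proof -
  obtain g where g: "g \<in> borel_measurable lborel" "AE x in lborel. f x = g x"
    using completion_ex_borel_measurable_real[OF assms] by blast
  have gm[measurable]: "g \<in> borel_measurable borel" using g(1) by simp
  have "(\<integral>\<^sup>+t. (\<integral>\<^sup>+x. indicator {x. g x = t} x \<partial>lborel) \<partial>lborel) = (\<integral>\<^sup>+x. (\<integral>\<^sup>+t. indicator {x. g x = t} x \<partial>lborel) \<partial>lborel)"
    using lborel_pair.Fubini[of "\<lambda>(x, t). indicator {x. g x = t} x"] by (simp add: indicator_def)
  also have "(\<lambda>x. \<integral>\<^sup>+t. indicator {x. g x = t} x \<partial>(lborel :: real measure)) = (\<lambda>x. 0)"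
  proof
    fix x
    have "(\<integral>\<^sup>+t. indicator {x. g x = t} x \<partial>(lborel :: real measure)) = (\<integral>\<^sup>+t. indicator {g x} t \<partial>lborel)"
      by (intro nn_integral_cong) (auto simp: indicator_def)
    thus "(\<integral>\<^sup>+t. indicator {x. g x = t} x \<partial>(lborel :: real measure)) = 0" by simp
  qed
  finally have "(\<integral>\<^sup>+t. (\<integral>\<^sup>+x. indicator {x. g x = t} x \<partial>lborel) \<partial>(lborel :: real measure)) = 0" by simp
  moreover have "(\<lambda>t. \<integral>\<^sup>+x. indicator {x. g x = t} x \<partial>lborel) \<in> borel_measurable (lborel :: real measure)"
    unfolding indicator_def by measurable
  ultimately have "AE t in lborel. (\<integral>\<^sup>+x. indicator {x. g x = t} x \<partial>lborel) = 0"
    using nn_integral_0_iff_AE by blast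
  thus ?thesis
  proof eventually_elim
    fix t assume "(\<integral>\<^sup>+x. indicator {x. g x = t} x \<partial>lborel) = 0"
    hence "emeasure lborel {x. g x = t} = 0" by (subst (asm) nn_integral_indicator) auto
    hence "AE x in lborel. x \<notin> {x. g x = t}" by (intro AE_not_in) (auto intro!: null_setsI)
    hence "AE x in lborel. x \<notin> {x. f x = t}" using g(2) by eventually_elim simp
    hence "AE x in lebesgue. x \<notin> {x. f x = t}" by (rule AE_completion)
    moreover have "{x. f x = t} \<in> sets lebesgue"
    proof -
      have "{x \<in> space lebesgue. f x = t} \<in> sets lebesgue" using assms by measurable
      thus ?thesis by simp
    qed
    ultimately show "emeasure lebesgue {x. f x = t} = 0" using AE_iff_measurable[of "{x. f x = t}" lebesgue "\<lambda>x. x \<notin> {x. f x = t}"] by simp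
  qed
qed

lemma lev_lmeasurable:
  assumes "L2 g" "t \<noteq> 0" shows "lev g t \<in> lmeasurable"
proof -
  have m: "g \<in> borel_measurable lebesgue" by (rule L2_measurable[OF assms(1)])
  have "{x \<in> space lebesgue. g x \<ge> t} \<in> sets lebesgue" "{x \<in> space lebesgue. g x \<le> t} \<in> sets lebesgue" using m by measurable
  hence s: "lev g t \<in> sets lebesgue" by (simp add: lev_def)
  have "integrable lebesgue (\<lambda>x. indicator (lev g t) x :: real)"
  proof (rule Bochner_Integration.integrable_bound[of _ "\<lambda>x. (1 / t\<^sup>2) * (g x)\<^sup>2"])
    show "integrable lebesgue (\<lambda>x. (1 / t\<^sup>2) * (g x)\<^sup>2)" using L2_integrable_sq[OF assms(1)] by simp
    have "t\<^sup>2 \<le> (g x)\<^sup>2" if "x \<in> lev g t" for x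
      using that assms(2) by (intro abs_le_square_iff[THEN iffD1]) (auto simp: lev_def split: if_splits)
    thus "AE x in lebesgue. norm (indicator (lev g t) x :: real) \<le> norm ((1 / t\<^sup>2) * (g x)\<^sup>2)"
      using assms(2) by (intro AE_I2) (auto simp: indicator_def)
  qed (use s in simp)
  thus ?thesis using s by (simp add: integrable_indicator_iff fmeasurable_def)
qed

text \<open>The two level sets agree where |f - t| > \<epsilon> and |u n - f| < \<epsilon>. The
  strip |f - t| <= \<epsilon> shrinks to the null set {f = t}; for fixed \<epsilon> the set |u n -
  f| >= \<epsilon> is small by Chebyshev.\<close>

lemma level_convergence:
  assumes f: "L2 f" and u: "\<And>n. L2 (u n)" and conv: "(\<lambda>n. L2norm (\<lambda>x. u n x - f x)) \<longlonglongrightarrow> 0"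
    and t: "t \<noteq> 0" and null: "emeasure lebesgue {x. f x = t} = 0"
  shows "(\<lambda>n. measure lebesgue ((lev (u n) t - lev f t) \<union> (lev f t - lev (u n) t))) \<longlonglongrightarrow> 0"
proof (rule LIMSEQ_I)
  fix e :: real assume e: "e > 0"
  have fm: "f \<in> borel_measurable lebesgue" by (rule L2_measurable[OF f])
  \<comment> \<open>The width is at most |t|/2, so every strip lies in the level set of
    \<open>f\<close> at t/2, which has finite measure, as continuity of the measure from above
    requires.\<close>
  define B where "B k = {x. \<bar>f x - t\<bar> \<le> \<bar>t\<bar> / (2 * real (Suc k))}" for k :: nat
  have Bs: "B k \<in> sets lebesgue" for k
  proof -
    have "{x \<in> space lebesgue. \<bar>f x - t\<bar> \<le> \<bar>t\<bar> / (2 * real (Suc k))} \<in> sets lebesgue" using fm by measurable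
    thus ?thesis by (simp add: B_def)
  qed
  have anti: "decseq B"
  proof (rule decseq_SucI)
    fix k
    have "\<bar>t\<bar> / (2 * real (Suc (Suc k))) \<le> \<bar>t\<bar> / (2 * real (Suc k))" by (intro divide_left_mono) auto
    thus "B (Suc k) \<subseteq> B k" unfolding B_def by (auto intro: order_trans)
  qed
  have Bsub: "B k \<subseteq> lev f (t / 2)" for k
  proof
    fix x assume "x \<in> B k"
    hence "\<bar>f x - t\<bar> \<le> \<bar>t\<bar> / (2 * real (Suc k))" by (simp only: B_def mem_Collect_eq)
    also have "\<dots> \<le> \<bar>t\<bar> / 2" by (intro divide_left_mono) auto
    finally have "\<bar>f x - t\<bar> \<le> \<bar>t\<bar> / 2" .
    thus "x \<in> lev f (t / 2)" using t by (auto simp: lev_def abs_if split: if_splits)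
  qed
  have Bm: "B k \<in> lmeasurable" for k
    by (rule fmeasurableI2[OF lev_lmeasurable[OF f, of "t/2"] Bsub Bs]) (use t in simp)
  have inter: "(\<Inter>k. B k) = {x. f x = t}"
  proof
    show "(\<Inter>k. B k) \<subseteq> {x. f x = t}"
    proof
      fix x assume x: "x \<in> (\<Inter>k. B k)"
      have "\<bar>f x - t\<bar> \<le> 0"
      proof (rule LIMSEQ_le_const)
        have "(\<lambda>k. (\<bar>t\<bar> / 2) * inverse (real (Suc k))) \<longlonglongrightarrow> (\<bar>t\<bar> / 2) * 0"
          by (intro tendsto_intros LIMSEQ_inverse_real_of_nat)
        thus "(\<lambda>k. (\<bar>t\<bar> / 2) * inverse (real (Suc k))) \<longlonglongrightarrow> 0" by simp
        show "\<exists>N. \<forall>k\<ge>N. \<bar>f x - t\<bar> \<le> (\<bar>t\<bar> / 2) * inverse (real (Suc k))"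
        proof (intro exI[of _ 0] allI impI)
          fix k :: nat
          have "x \<in> B k" using x by blast
          hence "\<bar>f x - t\<bar> \<le> \<bar>t\<bar> / (2 * real (Suc k))" by (simp only: B_def mem_Collect_eq)
          also have "\<dots> = (\<bar>t\<bar> / 2) * inverse (real (Suc k))" by (simp only: divide_inverse inverse_mult_distrib mult.assoc)
          finally show "\<bar>f x - t\<bar> \<le> (\<bar>t\<bar> / 2) * inverse (real (Suc k))" .
        qed
      qed
      thus "x \<in> {x. f x = t}" by simp
    qed
  qed (auto simp: B_def)
  have "(\<lambda>k. measure lebesgue (B k)) \<longlonglongrightarrow> measure lebesgue (\<Inter>k. B k)"
  proof (rule Lim_measure_decseq[OF _ anti])
    show "range B \<subseteq> sets lebesgue" using Bs by blast
    show "emeasure lebesgue (B i) \<noteq> \<infinity>" for i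
      unfolding infinity_ennreal_def by (rule fmeasurableD2[OF Bm])
  qed
  hence "(\<lambda>k. measure lebesgue (B k)) \<longlonglongrightarrow> 0" unfolding inter using null by (simp add: measure_def)
  from order_tendstoD(2)[OF this, of "e/2"] e
  obtain k where k: "measure lebesgue (B k) < e / 2" by (auto simp: eventually_sequentially)
  define \<epsilon> where "\<epsilon> = \<bar>t\<bar> / (2 * real (Suc k))"
  have \<epsilon>: "\<epsilon> > 0" using t by (simp add: \<epsilon>_def)
  have "(\<lambda>n. (L2norm (\<lambda>x. u n x - f x))\<^sup>2 / \<epsilon>\<^sup>2) \<longlonglongrightarrow> 0\<^sup>2 / \<epsilon>\<^sup>2" by (intro tendsto_intros conv) (use \<epsilon> in simp)
  from order_tendstoD(2)[OF this, of "e/2"] e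
  obtain N where N: "\<And>n. n \<ge> N \<Longrightarrow> (L2norm (\<lambda>x. u n x - f x))\<^sup>2 / \<epsilon>\<^sup>2 < e / 2" by (auto simp: eventually_sequentially)
  have "norm (measure lebesgue ((lev (u n) t - lev f t) \<union> (lev f t - lev (u n) t)) - 0) < e" if n: "n \<ge> N" for n
  proof -
    let ?D = "(lev (u n) t - lev f t) \<union> (lev f t - lev (u n) t)"
    define A where "A = {x. \<bar>u n x - f x\<bar> \<ge> \<epsilon>}"
    have dL: "L2 (\<lambda>x. u n x - f x)" by (rule L2_diff[OF u f])
    have "{x \<in> space lebesgue. \<bar>u n x - f x\<bar> \<ge> \<epsilon>} \<in> sets lebesgue" using L2_measurable[OF dL] by measurable
    hence As: "A \<in> sets lebesgue" by (simp add: A_def)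
    have pw: "indicator A x \<le> (1 / \<epsilon>\<^sup>2) * (u n x - f x)\<^sup>2" for x
    proof (cases "x \<in> A")
      case True
      hence "\<epsilon>\<^sup>2 \<le> \<bar>u n x - f x\<bar>\<^sup>2" using \<epsilon> by (intro power_mono) (auto simp: A_def)
      thus ?thesis using True \<epsilon> by simp
    qed simp
    have ri: "integrable lebesgue (\<lambda>x. (1 / \<epsilon>\<^sup>2) * (u n x - f x)\<^sup>2)" using L2_integrable_sq[OF dL] by simp
    have ia: "integrable lebesgue (\<lambda>x. indicator A x :: real)"
      by (rule Bochner_Integration.integrable_bound[OF ri]) (use As pw in \<open>auto simp: abs_le_iff intro!: AE_I2\<close>)
    have Am: "A \<in> lmeasurable" using ia As by (simp add: integrable_indicator_iff fmeasurable_def)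
    have "measure lebesgue A = (\<integral>x. indicator A x \<partial>lebesgue)" by simp
    also have "\<dots> \<le> (\<integral>x. (1 / \<epsilon>\<^sup>2) * (u n x - f x)\<^sup>2 \<partial>lebesgue)" by (rule integral_mono[OF ia ri pw])
    also have "\<dots> = (L2norm (\<lambda>x. u n x - f x))\<^sup>2 / \<epsilon>\<^sup>2" by (simp add: L2norm_def)
    finally have "measure lebesgue A \<le> (L2norm (\<lambda>x. u n x - f x))\<^sup>2 / \<epsilon>\<^sup>2" .
    from order_le_less_trans[OF this N[OF n]] have mA: "measure lebesgue A < e / 2" .
    have "?D \<subseteq> A \<union> B k"
    proof
      fix x assume x: "x \<in> ?D"
      show "x \<in> A \<union> B k"
      proof (rule ccontr)
        assume "x \<notin> A \<union> B k"
        hence "\<bar>u n x - f x\<bar> < \<epsilon>" "\<bar>f x - t\<bar> > \<epsilon>" by (auto simp: A_def B_def \<epsilon>_def not_le)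
        thus False using x by (auto simp: lev_def split: if_splits)
      qed
    qed
    moreover have "?D \<in> sets lebesgue"
      using lev_lmeasurable[OF u t, of n] lev_lmeasurable[OF f t] by (auto dest: fmeasurableD)
    ultimately have "measure lebesgue ?D \<le> measure lebesgue (A \<union> B k)"
      by (intro measure_mono_fmeasurable fmeasurable.Un Am Bm)
    also have "\<dots> \<le> measure lebesgue A + measure lebesgue (B k)" by (rule measure_Un_le[OF As Bs])
    finally show ?thesis using mA k by simp
  qed
  thus "\<exists>no. \<forall>n\<ge>no. norm (measure lebesgue ((lev (u n) t - lev f t) \<union> (lev f t - lev (u n) t)) - 0) < e" by blast
qed

section \<open>Supports of derivatives\<close>

text \<open>\<open>suppD\<close> speaks of single small discs. A finite subcover is peeled off one
  disc at a time: \<theta> \<psi> is supported in a disc where pairings vanish, while (1 - \<theta>)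
  \<psi> is supported off the quarter disc and hence covered by the remaining ones.\<close>

lemma pairing_zero_off_suppD:
  assumes g: "loc_int g" and t: "testfield \<phi>" and d: "tsupp \<phi> \<inter> suppD g = {}"
  shows "(\<integral>x. g x * divg \<phi> x \<partial>lebesgue) = 0"
proof -
  define good where "good p \<longleftrightarrow> snd p > 0 \<and> (\<forall>\<psi>. testfield \<psi> \<longrightarrow> tsupp \<psi> \<subseteq> ball (fst p) (snd p) \<longrightarrow> (\<integral>x. g x * divg \<psi> x \<partial>lebesgue) = 0)"
    for p :: "R2 \<times> real"
  have main: "(\<integral>x. g x * divg \<psi> x \<partial>lebesgue) = 0"
    if "finite L" "\<forall>p\<in>L. good p" "testfield \<psi>" "tsupp \<psi> \<subseteq> (\<Union>p\<in>L. ball (fst p) (snd p / 4))" for L \<psi>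
    using that
  proof (induction L arbitrary: \<psi> rule: finite_induct)
    case empty
    have "tsupp \<psi> = {}" using empty.prems(3) by simp
    hence "\<psi> x = 0" for x using zero_off_tsupp[of x \<psi>] by simp
    hence "divg \<psi> x = 0" for x by (intro divg_zero_outside[OF empty.prems(2) closed_empty]) auto
    thus ?case by simp
  next
    case (insert p L)
    obtain y r where p: "p = (y, r)" by (cases p)
    have r: "r > 0" and gd: "\<And>\<psi>. testfield \<psi> \<Longrightarrow> tsupp \<psi> \<subseteq> ball y r \<Longrightarrow> (\<integral>x. g x * divg \<psi> x \<partial>lebesgue) = 0"
      using insert.prems(1) by (auto simp: good_def p)
    have ab: "0 < r / 4" "r / 4 < r / 2" using r by auto
    obtain \<theta> G where \<theta>: "C1grad \<theta> G" "\<And>x. x \<in> cball y (r/4) \<Longrightarrow> \<theta> x = 1" "\<And>x. x \<notin> ball y (r/2) \<Longrightarrow> \<theta> x = 0"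
      by (rule cutoff_exists[OF ab, of y]) blast
    note t1 = testfield_scale[OF insert.prems(2) \<theta>(1)] and t2 = testfield_scale[OF insert.prems(2) C1grad_one_minus[OF \<theta>(1)]]
    have "tsupp (\<lambda>x. \<theta> x *\<^sub>R \<psi> x) \<subseteq> cball y (r/2)"
    proof (rule tsupp_subset)
      fix x assume "x \<notin> cball y (r/2)"
      hence "x \<notin> ball y (r/2)" by simp
      thus "\<theta> x *\<^sub>R \<psi> x = 0" using \<theta>(3) by simp
    qed simp
    also have "\<dots> \<subseteq> ball y r" using r by auto
    finally have z1: "(\<integral>x. g x * divg (\<lambda>x. \<theta> x *\<^sub>R \<psi> x) x \<partial>lebesgue) = 0" by (rule gd[OF t1(1)])
    have "tsupp (\<lambda>x. (1 - \<theta> x) *\<^sub>R \<psi> x) \<subseteq> tsupp \<psi> - ball y (r/4)"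
    proof (rule tsupp_subset)
      show "closed (tsupp \<psi> - ball y (r/4))" by (auto simp: tsupp_def intro: closed_Diff)
      fix x assume "x \<notin> tsupp \<psi> - ball y (r/4)"
      hence "x \<notin> tsupp \<psi> \<or> x \<in> cball y (r/4)" by auto
      thus "(1 - \<theta> x) *\<^sub>R \<psi> x = 0" using \<theta>(2) zero_off_tsupp[of x \<psi>] by auto
    qed
    also have "\<dots> \<subseteq> (\<Union>p\<in>L. ball (fst p) (snd p / 4))" using insert.prems(3) by (auto simp: p)
    finally have z2: "(\<integral>x. g x * divg (\<lambda>x. (1 - \<theta> x) *\<^sub>R \<psi> x) x \<partial>lebesgue) = 0"
      using insert.prems(1) by (intro insert.IH t2(1)) auto
    have "divg \<psi> x = divg (\<lambda>x. \<theta> x *\<^sub>R \<psi> x) x + divg (\<lambda>x. (1 - \<theta> x) *\<^sub>R \<psi> x) x" for x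
      unfolding t1(2) t2(2) by (simp add: algebra_simps)
    thus ?case
      using z1 z2 loc_int_divg[OF g t1(1)] loc_int_divg[OF g t2(1)] by (simp add: distrib_left)
  qed
  have "\<exists>r. good (y, r)" if "y \<in> tsupp \<phi>" for y
  proof -
    have "y \<notin> suppD g" using that d by blast
    thus ?thesis unfolding suppD_def good_def by auto
  qed
  then obtain r where r: "\<And>y. y \<in> tsupp \<phi> \<Longrightarrow> good (y, r y)" by metis
  have cov: "tsupp \<phi> \<subseteq> (\<Union>y\<in>tsupp \<phi>. ball y (r y / 4))"
  proof
    fix y assume y: "y \<in> tsupp \<phi>"
    hence "r y > 0" using r[OF y] by (simp add: good_def)
    thus "y \<in> (\<Union>y\<in>tsupp \<phi>. ball y (r y / 4))" using y by (intro UN_I[of y]) auto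
  qed
  obtain C where C: "C \<subseteq> tsupp \<phi>" "finite C" "tsupp \<phi> \<subseteq> (\<Union>y\<in>C. ball y (r y / 4))"
    by (rule compactE_image[OF testfieldD(3)[OF t] open_ball cov]) blast
  show ?thesis
    by (rule main[of "(\<lambda>y. (y, r y)) ` C", OF _ _ t]) (use C r in auto)
qed

lemma measure_pos_iff_not_negligible:
  assumes "S \<in> lmeasurable" shows "0 < measure lebesgue S \<longleftrightarrow> \<not> negligible S"
  using assms negligible_iff_measure[of S] measure_nonneg[of lebesgue S] by (auto simp: less_le)

lemma not_negligible_open: "open S \<Longrightarrow> S \<noteq> {} \<Longrightarrow> \<not> negligible (S :: R2 set)"
  using open_not_negligible by blast

section \<open>Points with positive area on both sides\<close>

text \<open>The points near which \<open>U\<close> is null and those near which its complement is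
  null form disjoint open sets. Neither contains the disc, and the disc is connected, so some point
  of it lies in neither.\<close>

lemma mixed_point_exists:
  fixes U :: "R2 set"
  assumes U: "U \<in> sets lebesgue" and 1: "\<not> negligible (ball y \<rho> \<inter> U)" and 2: "\<not> negligible (ball y \<rho> - U)"
  obtains z where "z \<in> ball y \<rho>" "\<And>r. r > 0 \<Longrightarrow> 0 < measure lebesgue (U \<inter> ball z r)" "\<And>r. r > 0 \<Longrightarrow> 0 < measure lebesgue (ball z r - U)"
proof -
  have m: "U \<inter> ball z r \<in> lmeasurable" "ball z r - U \<in> lmeasurable" for z r
  proof -
    show "U \<inter> ball z r \<in> lmeasurable" by (rule fmeasurable_Int_ball[OF U])
    have "- U \<in> sets lebesgue" using sets.compl_sets[OF U] by (simp add: Compl_eq_Diff_UNIV)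
    from fmeasurable_Int_ball[OF this, of z r] show "ball z r - U \<in> lmeasurable" by (simp add: Diff_eq Int_commute)
  qed
  define O1 where "O1 = {z. \<exists>r>0. negligible (U \<inter> ball z r)}"
  define O2 where "O2 = {z. \<exists>r>0. negligible (ball z r - U)}"
  have sub: "ball w (r - dist z w) \<subseteq> ball z r" for w z :: R2 and r
  proof
    fix p assume "p \<in> ball w (r - dist z w)" thus "p \<in> ball z r" using dist_triangle[of z p w] by simp
  qed
  have op1: "open O1"
    unfolding open_contains_ball
  proof
    fix z assume "z \<in> O1"
    then obtain r where r: "r > 0" "negligible (U \<inter> ball z r)" by (auto simp: O1_def)
    have "w \<in> O1" if "w \<in> ball z r" for w
      using that sub[of w r z] negligible_subset[OF r(2), of "U \<inter> ball w (r - dist z w)"] unfolding O1_def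
      by (intro CollectI exI[of _ "r - dist z w"]) auto
    thus "\<exists>e>0. ball z e \<subseteq> O1" using r(1) by blast
  qed
  have op2: "open O2"
    unfolding open_contains_ball
  proof
    fix z assume "z \<in> O2"
    then obtain r where r: "r > 0" "negligible (ball z r - U)" by (auto simp: O2_def)
    have "w \<in> O2" if "w \<in> ball z r" for w
      using that sub[of w r z] negligible_subset[OF r(2), of "ball w (r - dist z w) - U"] unfolding O2_def
      by (intro CollectI exI[of _ "r - dist z w"]) auto
    thus "\<exists>e>0. ball z e \<subseteq> O2" using r(1) by blast
  qed
  have disj: "O1 \<inter> O2 = {}"
  proof (rule ccontr)
    assume "O1 \<inter> O2 \<noteq> {}"
    then obtain z r s where z: "r > 0" "negligible (U \<inter> ball z r)" "s > 0" "negligible (ball z s - U)" by (auto simp: O1_def O2_def)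
    have "ball z (min r s) \<subseteq> (U \<inter> ball z r) \<union> (ball z s - U)" by auto
    hence "negligible (ball z (min r s))" using negligible_subset negligible_Un z by blast
    thus False using not_negligible_open[of "ball z (min r s)"] z by auto
  qed
  have n1: "\<not> ball y \<rho> \<subseteq> O1"
  proof
    assume s: "ball y \<rho> \<subseteq> O1"
    have "negligible (ball y \<rho> \<inter> U)"
    proof (rule locally_negligible_alt[THEN iffD2], rule ballI)
      fix z assume z: "z \<in> ball y \<rho> \<inter> U"
      then obtain r where r: "r > 0" "negligible (U \<inter> ball z r)" using s by (auto simp: O1_def)
      show "\<exists>V. openin (top_of_set (ball y \<rho> \<inter> U)) V \<and> z \<in> V \<and> negligible V"
        using z r negligible_subset[OF r(2), of "ball y \<rho> \<inter> U \<inter> ball z r"]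
        by (intro exI[of _ "ball y \<rho> \<inter> U \<inter> ball z r"]) auto
    qed
    thus False using 1 by simp
  qed
  have n2: "\<not> ball y \<rho> \<subseteq> O2"
  proof
    assume s: "ball y \<rho> \<subseteq> O2"
    have "negligible (ball y \<rho> - U)"
    proof (rule locally_negligible_alt[THEN iffD2], rule ballI)
      fix z assume z: "z \<in> ball y \<rho> - U"
      then obtain r where r: "r > 0" "negligible (ball z r - U)" using s by (auto simp: O2_def)
      show "\<exists>V. openin (top_of_set (ball y \<rho> - U)) V \<and> z \<in> V \<and> negligible V"
        using z r negligible_subset[OF r(2), of "(ball y \<rho> - U) \<inter> ball z r"]
        by (intro exI[of _ "(ball y \<rho> - U) \<inter> ball z r"]) auto
    qed
    thus False using 2 by simp
  qed
  have "\<not> ball y \<rho> \<subseteq> O1 \<union> O2"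
  proof
    assume c: "ball y \<rho> \<subseteq> O1 \<union> O2"
    have "O1 \<inter> ball y \<rho> \<noteq> {}" "O2 \<inter> ball y \<rho> \<noteq> {}" using c n1 n2 by blast+
    thus False using connectedD[OF connected_ball[of y \<rho>] op1 op2 _ c] disj by blast
  qed
  then obtain z where z: "z \<in> ball y \<rho>" "z \<notin> O1" "z \<notin> O2" by blast
  show ?thesis
    by (rule that[OF z(1)]) (use z(2,3) m in \<open>auto simp: measure_pos_iff_not_negligible O1_def O2_def\<close>)
qed

text \<open>The constant is the supremum of the positive levels whose superlevel sets fill
  \<open>B\<close> up to a null set: positive levels below it are full, levels above it are null. If
  no level is full, u <= 0 almost everywhere, and positive levels say nothing more.\<close>

lemma constant_of_trivial_superlevels:
  fixes u :: "R2 \<Rightarrow> real"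
  assumes B: "\<not> negligible B" and dich: "\<And>t. t > 0 \<Longrightarrow> negligible (B \<inter> {x. u x \<ge> t}) \<or> negligible (B - {x. u x \<ge> t})"
  shows "(\<exists>s. negligible {x \<in> B. u x \<noteq> s}) \<or> negligible {x \<in> B. u x > 0}"
proof -
  define T where "T = {t. t > 0 \<and> negligible (B - {x. u x \<ge> t})}"
  have up: "negligible {x \<in> B. u x > s}" if s: "s \<ge> 0" and nT: "\<And>t. t > s \<Longrightarrow> t \<notin> T" for s
  proof -
    have "{x \<in> B. u x > s} \<subseteq> (\<Union>j. B \<inter> {x. u x \<ge> s + inverse (real (Suc j))})"
    proof
      fix x assume x: "x \<in> {x \<in> B. u x > s}"
      then obtain j where "inverse (real (Suc j)) < u x - s" using reals_Archimedean[of "u x - s"] by auto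
      thus "x \<in> (\<Union>j. B \<inter> {x. u x \<ge> s + inverse (real (Suc j))})" using x by (intro UN_I[of j]) auto
    qed
    moreover have "negligible (\<Union>j. B \<inter> {x. u x \<ge> s + inverse (real (Suc j))})"
    proof (rule negligible_countable_Union[OF countable_image[OF countableI_type]])
      fix S assume "S \<in> range (\<lambda>j. B \<inter> {x. u x \<ge> s + inverse (real (Suc j))})"
      then obtain j where S: "S = B \<inter> {x. u x \<ge> s + inverse (real (Suc j))}" by blast
      have p: "0 < inverse (real (Suc j))" by simp
      hence "s + inverse (real (Suc j)) \<notin> T" by (intro nT) simp
      moreover have pos: "s + inverse (real (Suc j)) > 0" using s p by (rule add_nonneg_pos)
      ultimately show "negligible S" using dich[OF pos] unfolding S T_def by blast
    qed
    ultimately show ?thesis by (rule negligible_subset[rotated])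
  qed
  show ?thesis
  proof (cases "T = {}")
    case True
    thus ?thesis using up[of 0] by auto
  next
    case False
    have down: "t' \<in> T" if "t \<in> T" "0 < t'" "t' \<le> t" for t t'
    proof -
      have "B - {x. u x \<ge> t'} \<subseteq> B - {x. u x \<ge> t}" using that(3) by auto
      thus ?thesis using that negligible_subset by (auto simp: T_def)
    qed
    have lower: "negligible {x \<in> B. u x < s}" if hT: "\<And>t. 0 < t \<Longrightarrow> t < s \<Longrightarrow> t \<in> T" and hs: "s > 0" for s
    proof -
      \<comment> \<open>Levels increasing to \<open>s\<close>; the double successor makes the first
        one s/2, whereas a single one would give the level 0.\<close>
      define a where "a j = s * (1 - inverse (real (Suc (Suc j))))" for j
      have i1: "inverse (real (Suc (Suc j))) < 1" for j by (simp add: inverse_less_1_iff)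
      have a: "0 < a j" "a j < s" for j using hs i1[of j] by (auto simp: a_def)
      have "{x \<in> B. u x < s} \<subseteq> (\<Union>j. B - {x. u x \<ge> a j})"
      proof
        fix x assume x: "x \<in> {x \<in> B. u x < s}"
        then obtain j where j: "inverse (real (Suc j)) < (s - u x) / s" using reals_Archimedean[of "(s - u x) / s"] hs by auto
        have "inverse (real (Suc (Suc j))) < inverse (real (Suc j))" by (simp add: less_imp_inverse_less)
        hence "inverse (real (Suc (Suc j))) < (s - u x) / s" using j by (rule less_trans)
        hence "s * inverse (real (Suc (Suc j))) < s * ((s - u x) / s)" using hs by (rule mult_strict_left_mono)
        moreover have "s * ((s - u x) / s) = s - u x" using hs by simp
        ultimately have "u x < a j" unfolding a_def right_diff_distrib by simp
        thus "x \<in> (\<Union>j. B - {x. u x \<ge> a j})" using x by (intro UN_I[of j]) auto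
      qed
      moreover have "negligible (\<Union>j. B - {x. u x \<ge> a j})"
        by (rule negligible_countable_Union[OF countable_image[OF countableI_type]]) (use hT a in \<open>auto simp: T_def\<close>)
      ultimately show ?thesis by (rule negligible_subset[rotated])
    qed
    \<comment> \<open>If the full levels were unbounded, \<open>u\<close> would exceed every number
      almost everywhere on \<open>B\<close>, and \<open>B\<close> would be null.\<close>
    have bdd: "bdd_above T"
    proof (rule ccontr)
      assume nb: "\<not> bdd_above T"
      have all: "t \<in> T" if "t > 0" for t
      proof -
        obtain t1 where "t1 \<in> T" "t1 > t" using nb by (meson bdd_aboveI not_le)
        thus ?thesis using down[of t1 t] that by simp
      qed
      have "B \<subseteq> (\<Union>j::nat. {x \<in> B. u x < real (Suc j)})"
      proof
        fix x assume x: "x \<in> B"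
        obtain j :: nat where "u x < real j" using reals_Archimedean2 by blast
        thus "x \<in> (\<Union>j::nat. {x \<in> B. u x < real (Suc j)})" using x by (intro UN_I[of j]) auto
      qed
      moreover have "negligible (\<Union>j::nat. {x \<in> B. u x < real (Suc j)})"
        by (rule negligible_countable_Union[OF countable_image[OF countableI_type]]) (use lower all in auto)
      ultimately show False using B negligible_subset by blast
    qed
    define s where "s = Sup T"
    have s: "s > 0" using False cSup_upper[OF _ bdd] unfolding s_def T_def by (metis (no_types, lifting) all_not_in_conv less_le_trans mem_Collect_eq)
    have "t \<in> T" if t: "0 < t" "t < s" for t
    proof -
      obtain t1 where "t1 \<in> T" "t < t1" using t(2) less_cSup_iff[OF False bdd] unfolding s_def by blast
      thus ?thesis using down[of t1 t] t by simp
    qed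
    hence "negligible {x \<in> B. u x < s}" using lower s by blast
    moreover have "negligible {x \<in> B. u x > s}"
    proof (rule up)
      fix t assume "t > s" thus "t \<notin> T" using cSup_upper[OF _ bdd, of t] unfolding s_def by auto
    qed (use s in simp)
    ultimately have "negligible ({x \<in> B. u x < s} \<union> {x \<in> B. u x > s})" by (rule negligible_Un)
    moreover have "{x \<in> B. u x \<noteq> s} = {x \<in> B. u x < s} \<union> {x \<in> B. u x > s}" by auto
    ultimately have "negligible {x \<in> B. u x \<noteq> s}" by (simp only:)
    thus ?thesis by blast
  qed
qed

text \<open>If no level t \<noteq> 0 divided the disc, the dichotomy for \<open>u\<close> and for -u
  would make \<open>u\<close> constant almost everywhere on it, and a constant pairs to 0 with every
  divergence supported there. A level that does divide the disc has a mixed point in it.\<close>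

lemma level_boundary_near_suppD:
  assumes u: "L2 u" and y: "y \<in> suppD u" and \<rho>: "\<rho> > 0"
  obtains t z where "t \<noteq> 0" "z \<in> ball y \<rho>" "\<And>r. r > 0 \<Longrightarrow> 0 < measure lebesgue (lev u t \<inter> ball z r)"
    "\<And>r. r > 0 \<Longrightarrow> 0 < measure lebesgue (ball z r - lev u t)"
proof -
  let ?B = "ball y \<rho>"
  have B: "\<not> negligible ?B" using not_negligible_open[of ?B] \<rho> by auto
  have "\<exists>t. t \<noteq> 0 \<and> \<not> negligible (?B \<inter> lev u t) \<and> \<not> negligible (?B - lev u t)"
  proof (rule ccontr)
    assume n: "\<not> ?thesis"
    have d1: "negligible (?B \<inter> {x. u x \<ge> t}) \<or> negligible (?B - {x. u x \<ge> t})" if "t > 0" for t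
    proof -
      have "{x. u x \<ge> t} = lev u t" using that by (auto simp: lev_def)
      thus ?thesis using n that by (metis less_irrefl)
    qed
    have d2: "negligible (?B \<inter> {x. - u x \<ge> t}) \<or> negligible (?B - {x. - u x \<ge> t})" if t: "t > 0" for t
    proof -
      have "{x. - u x \<ge> t} = lev u (- t)" using t by (auto simp: lev_def)
      thus ?thesis using n t by (metis neg_equal_0_iff_equal less_irrefl)
    qed
    have "\<exists>s. negligible {x \<in> ?B. u x \<noteq> s}"
    proof -
      consider s where "negligible {x \<in> ?B. u x \<noteq> s}" | s where "negligible {x \<in> ?B. - u x \<noteq> s}"
        | "negligible {x \<in> ?B. u x > 0}" "negligible {x \<in> ?B. - u x > 0}"
        using constant_of_trivial_superlevels[OF B d1] constant_of_trivial_superlevels[of ?B "\<lambda>x. - u x", OF B d2] by blast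
      thus ?thesis
      proof cases
        case 1 thus ?thesis by blast
      next
        case 2
        moreover have "{x \<in> ?B. - u x \<noteq> s} = {x \<in> ?B. u x \<noteq> - s}" by auto
        ultimately show ?thesis by metis
      next
        case 3
        have "{x \<in> ?B. u x \<noteq> 0} = {x \<in> ?B. u x > 0} \<union> {x \<in> ?B. - u x > 0}" by auto
        hence "negligible {x \<in> ?B. u x \<noteq> 0}" using negligible_Un[OF 3] by simp
        thus ?thesis by blast
      qed
    qed
    then obtain s where s: "negligible {x \<in> ?B. u x \<noteq> s}" by blast
    obtain \<phi> where \<phi>: "testfield \<phi>" "tsupp \<phi> \<subseteq> ?B" "(\<integral>x. u x * divg \<phi> x \<partial>lebesgue) \<noteq> 0"
      using y \<rho> by (auto simp: suppD_def)
    have dm: "divg \<phi> \<in> borel_measurable lebesgue" by (rule continuous_measurable_lebesgue[OF continuous_divg[OF \<phi>(1)]])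
    have cl: "closed (tsupp \<phi>)" by (simp add: tsupp_def)
    have z: "divg \<phi> x = 0" if "x \<notin> ?B" for x
      by (rule divg_zero_outside[OF \<phi>(1) cl]) (use zero_off_tsupp \<phi>(2) that in auto)
    have "AE x in lebesgue. x \<notin> {x \<in> ?B. u x \<noteq> s}" using s by (intro AE_not_in) (simp only: negligible_iff_null_sets)
    hence "AE x in lebesgue. u x * divg \<phi> x = s * divg \<phi> x"
    proof eventually_elim
      fix x assume "x \<notin> {x \<in> ?B. u x \<noteq> s}" thus "u x * divg \<phi> x = s * divg \<phi> x" using z[of x] by (cases "x \<in> ?B") auto
    qed
    hence "(\<integral>x. u x * divg \<phi> x \<partial>lebesgue) = (\<integral>x. s * divg \<phi> x \<partial>lebesgue)"
      by (intro integral_cong_AE) (use L2_measurable[OF u] dm in \<open>auto intro: borel_measurable_times\<close>)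
    thus False using \<phi>(3) integral_divg_zero[OF \<phi>(1)] by simp
  qed
  then obtain t where t: "t \<noteq> 0" "\<not> negligible (?B \<inter> lev u t)" "\<not> negligible (?B - lev u t)" by blast
  show ?thesis
    by (rule mixed_point_exists[OF fmeasurableD[OF lev_lmeasurable[OF u t(1)]] t(2,3)]) (rule that[OF t(1)], auto)
qed

section \<open>Proof of the theorem\<close>

text \<open>Up to an error of norm sqrt pi / 20, the dual variable lives in the ball of radius
  \<open>S\<close>. The error is too small to pay for the variation that the isoperimetric
  inequality demands, and the main part pays at most \<open>P * sqrt (pi * S\<^sup>2)\<close>
  whatever the set. So the area is at most a constant times its own square root.\<close>

lemma quasi_minimal_measure_bound:
  assumes U: "U \<in> lmeasurable" and q: "quasi_minimal U w" and p: "L2 p" "\<And>x. x \<notin> cball 0 S \<Longrightarrow> p x = 0"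
    and P: "L2norm p \<le> P" and S: "S \<ge> 0" and d: "L2norm (\<lambda>x. w x - p x) \<le> sqrt pi / 20"
  shows "measure lebesgue U \<le> (2 * (P * sqrt (pi * S\<^sup>2) + 1))\<^sup>2"
proof (cases "measure lebesgue U = 0")
  case False
  define m where "m = measure lebesgue U"
  have m: "m > 0" using False measure_nonneg[of lebesgue U] by (simp add: m_def less_le)
  have Us: "U \<in> sets lebesgue" by (rule fmeasurableD[OF U])
  have wL: "L2 w" using q by (simp add: quasi_minimal_def)
  have "(\<lambda>n. measure lebesgue (U \<inter> ball 0 (real n))) \<longlonglongrightarrow> measure lebesgue (\<Union>n. U \<inter> ball 0 (real n))"
  proof (rule Lim_measure_incseq)
    show "range (\<lambda>n. U \<inter> ball 0 (real n)) \<subseteq> sets lebesgue" using Us by auto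
    show "incseq (\<lambda>n. U \<inter> ball 0 (real n))" by (auto simp: incseq_def)
    have "(\<Union>n. U \<inter> ball 0 (real n)) \<subseteq> U" by auto
    moreover have "(\<Union>n. U \<inter> ball 0 (real n)) \<in> sets lebesgue" using Us by auto
    ultimately have "(\<Union>n. U \<inter> ball 0 (real n)) \<in> lmeasurable" by (rule fmeasurableI2[OF U])
    thus "emeasure lebesgue (\<Union>n. U \<inter> ball 0 (real n)) \<noteq> \<infinity>" unfolding infinity_ennreal_def by (rule fmeasurableD2)
  qed
  moreover have "(\<Union>n. U \<inter> ball 0 (real n)) = U"
    using reals_Archimedean2 by (auto simp: dist_norm)
  ultimately have "(\<lambda>n. measure lebesgue (U \<inter> ball 0 (real n))) \<longlonglongrightarrow> m" by (simp add: m_def)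
  moreover have "9/10 * m < m" using m by simp
  ultimately have "\<forall>\<^sub>F n in sequentially. 9/10 * m < measure lebesgue (U \<inter> ball 0 (real n))"
    by (rule order_tendstoD(1))
  then obtain N where N: "\<And>n. n \<ge> N \<Longrightarrow> 9/10 * m < measure lebesgue (U \<inter> ball 0 (real n))"
    by (auto simp: eventually_sequentially)
  obtain n1 :: nat where n1: "8 * m \<le> real n1" using real_arch_simple by blast
  \<comment> \<open>A radius at which the disc holds nine tenths of the area and the cut, whose
    price is at most 8 m / R, costs at most 1.\<close>
  define n where "n = Suc (max N n1)"
  define R where "R = real n"
  have R: "R > 0" "8 * m \<le> R" "9/10 * m < measure lebesgue (U \<inter> ball 0 R)"
    using n1 N[of n] by (auto simp: R_def n_def)
  have ab: "0 < R" "R < 2 * R" using R by auto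
  obtain \<eta> Q where \<eta>: "C1grad \<eta> Q" "\<And>x. 0 \<le> \<eta> x" "\<And>x. \<eta> x \<le> 1"
      "\<And>x. x \<in> cball 0 R \<Longrightarrow> \<eta> x = 1" "\<And>x. x \<notin> ball 0 (2 * R) \<Longrightarrow> \<eta> x = 0"
      "\<And>x. norm (Q x) \<le> 4 / (2 * R - R) * indicator (ball 0 (2 * R) - ball 0 R) x"
    by (rule cutoff_exists[OF ab, of 0]) blast
  define A where "A = ball (0::R2) (2 * R) - ball 0 R"
  have Am: "A \<in> lmeasurable" unfolding A_def by (intro fmeasurable_Diff) auto
  define c where "c = (\<integral>x. w x * (\<eta> x * indicator U x) \<partial>lebesgue) + 2 * (4 / R) * measure lebesgue (U \<inter> A)"
  have T: "TVle (\<lambda>x. \<eta> x * indicator U x) c"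
  proof -
    have "C1grad \<eta> Q \<longrightarrow> (\<forall>x. 0 \<le> \<eta> x \<and> \<eta> x \<le> 1) \<longrightarrow> (\<forall>x. x \<notin> cball 0 (2 * R) \<longrightarrow> \<eta> x = 0) \<longrightarrow>
        A \<in> lmeasurable \<longrightarrow> (\<forall>x. norm (Q x) \<le> 4 / R * indicator A x) \<longrightarrow> TVle (\<lambda>x. \<eta> x * indicator U x) c"
      using q unfolding quasi_minimal_def c_def by blast
    moreover have "\<forall>x. x \<notin> cball 0 (2 * R) \<longrightarrow> \<eta> x = 0"
    proof (intro allI impI)
      fix x :: R2 assume "x \<notin> cball 0 (2 * R)"
      hence "x \<notin> ball 0 (2 * R)" by simp
      thus "\<eta> x = 0" by (rule \<eta>(5))
    qed
    moreover have "\<forall>x. norm (Q x) \<le> 4 / R * indicator A x" using \<eta>(6) by (simp add: A_def)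
    ultimately show ?thesis using \<eta>(1-3) Am by blast
  qed
  define M where "M = measure lebesgue (U \<inter> ball 0 (2 * R))"
  have "U \<inter> ball 0 R \<subseteq> U \<inter> ball 0 (2 * R)" using R(1) by auto
  hence "measure lebesgue (U \<inter> ball 0 R) \<le> M" unfolding M_def
    using fmeasurable_Int_ball[OF Us] by (intro measure_mono_fmeasurable) (auto intro: fmeasurableD)
  hence M: "0 < M" using R(3) m by linarith
  have Mm: "M \<le> m" unfolding M_def m_def using U by (intro measure_mono_fmeasurable) (auto intro: fmeasurableD)
  note ci = cutoff_isoperimetric[of U \<eta> Q 0 R "2 * R" c M, OF Us \<eta>(1-3) _ _ T M_def M]
  have i1: "2 * measure lebesgue (U \<inter> ball 0 R) - (2 * sqrt M / sqrt pi) * c \<le> M / 2" by (rule ci(1)[OF \<eta>(4,5)])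
  have i2: "L2 (\<lambda>x. \<eta> x * indicator U x)" by (rule ci(2)[OF \<eta>(4,5)])
  have i3: "L2norm (\<lambda>x. \<eta> x * indicator U x) \<le> sqrt M" by (rule ci(3)[OF \<eta>(4,5)])
  have P0: "0 \<le> P" using P by (rule order_trans[rotated]) (simp add: L2norm_def)
  have c1: "(\<integral>x. w x * (\<eta> x * indicator U x) \<partial>lebesgue) \<le> sqrt pi / 20 * sqrt M + P * sqrt (pi * S\<^sup>2)"
  proof -
    have dL: "L2 (\<lambda>x. w x - p x)" by (rule L2_diff[OF wL p(1)])
    have bs: "cball (0::R2) S \<in> sets lebesgue" by simp
    have bL: "L2 (indicator (cball (0::R2) S) :: R2 \<Rightarrow> real)" by (rule L2_indicator[OF bs]) (use emeasure_lborel_cball_finite in simp)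
    have gL: "L2 (\<lambda>x. indicator (cball 0 S) x * (\<eta> x * indicator U x))" by (rule L2_indicator_mult[OF i2 bs])
    have "(\<integral>x. w x * (\<eta> x * indicator U x) \<partial>lebesgue) = (\<integral>x. (w x - p x) * (\<eta> x * indicator U x) + p x * (\<eta> x * indicator U x) \<partial>lebesgue)"
      by (simp add: algebra_simps)
    also have "\<dots> = (\<integral>x. (w x - p x) * (\<eta> x * indicator U x) \<partial>lebesgue) + (\<integral>x. p x * (\<eta> x * indicator U x) \<partial>lebesgue)"
      using L2_integrable_mult[OF dL i2] L2_integrable_mult[OF p(1) i2] by (rule Bochner_Integration.integral_add)
    also have "(\<integral>x. (w x - p x) * (\<eta> x * indicator U x) \<partial>lebesgue) \<le> L2norm (\<lambda>x. w x - p x) * L2norm (\<lambda>x. \<eta> x * indicator U x)"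
      by (rule L2_Cauchy_Schwarz[OF dL i2])
    also have "\<dots> \<le> sqrt pi / 20 * sqrt M" by (rule mult_mono[OF d i3]) (auto simp: L2norm_def)
    also have "(\<integral>x. p x * (\<eta> x * indicator U x) \<partial>lebesgue) = (\<integral>x. p x * (indicator (cball 0 S) x * (\<eta> x * indicator U x)) \<partial>lebesgue)"
      by (rule Bochner_Integration.integral_cong) (use p(2) in \<open>auto simp: indicator_def\<close>)
    also have "\<dots> \<le> L2norm p * L2norm (\<lambda>x. indicator (cball 0 S) x * (\<eta> x * indicator U x))"
      by (rule L2_Cauchy_Schwarz[OF p(1) gL])
    also have "\<dots> \<le> P * sqrt (pi * S\<^sup>2)"
    proof (rule mult_mono[OF P])
      have "(\<integral>x. (indicator (cball 0 S) x * (\<eta> x * indicator U x))\<^sup>2 \<partial>lebesgue) \<le> (\<integral>x. (indicator (cball (0::R2) S) x)\<^sup>2 \<partial>lebesgue)"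
        by (rule integral_mono[OF L2_integrable_sq[OF gL] L2_integrable_sq[OF bL]])
           (use \<eta>(2,3) in \<open>auto simp: indicator_def power2_eq_square intro!: mult_le_one\<close>)
      also have "\<dots> = (\<integral>x. indicator (cball (0::R2) S) x \<partial>lebesgue)"
        by (rule Bochner_Integration.integral_cong) (auto simp: indicator_def)
      also have "\<dots> = pi * S\<^sup>2" using measure_cball_R2[OF S, of 0] by simp
      finally show "L2norm (\<lambda>x. indicator (cball 0 S) x * (\<eta> x * indicator U x)) \<le> sqrt (pi * S\<^sup>2)"
        unfolding L2norm_def by (rule real_sqrt_le_mono)
    qed (use P0 in \<open>auto simp: L2norm_def\<close>)
    finally show ?thesis by simp
  qed
  have c2: "2 * (4 / R) * measure lebesgue (U \<inter> A) \<le> 1"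
  proof -
    have "measure lebesgue (U \<inter> A) \<le> m"
      unfolding m_def using U Us Am by (intro measure_mono_fmeasurable) (auto intro: fmeasurableD)
    hence "2 * (4 / R) * measure lebesgue (U \<inter> A) \<le> 2 * (4 / R) * m" using R by (intro mult_left_mono) auto
    also have "\<dots> \<le> 1" using R by simp
    finally show ?thesis .
  qed
  define a where "a = P * sqrt (pi * S\<^sup>2) + 1"
  have a0: "0 \<le> a" using P0 by (simp add: a_def)
  have "c \<le> sqrt pi / 20 * sqrt M + a" unfolding c_def a_def using c1 c2 by linarith
  hence "(2 * sqrt M / sqrt pi) * c \<le> (2 * sqrt M / sqrt pi) * (sqrt pi / 20 * sqrt M + a)"
    using M by (intro mult_left_mono) auto
  also have "\<dots> = M / 10 + (2 * sqrt M / sqrt pi) * a"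
    using M by (simp add: distrib_left power2_eq_square[symmetric])
  also have "(2 * sqrt M / sqrt pi) * a \<le> 2 * sqrt m * a"
  proof (rule mult_right_mono[OF _ a0])
    have s1: "1 \<le> sqrt pi" using pi_ge_two by simp
    have "2 * sqrt M / sqrt pi \<le> 2 * sqrt M / 1" using s1 M by (intro divide_left_mono) auto
    thus "2 * sqrt M / sqrt pi \<le> 2 * sqrt m" using Mm by (simp add: order_trans)
  qed
  \<comment> \<open>1.8 m on the left against 0.6 m on the right leaves 1.2 m <= 2 a sqrt m.\<close>
  finally have "2 * (9/10 * m) \<le> m / 2 + (m / 10 + 2 * sqrt m * a)" using i1 R(3) Mm by linarith
  moreover have "0 \<le> sqrt m * a" using m a0 by simp
  ultimately have "m \<le> sqrt m * (2 * a)" by (simp add: mult_ac)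
  hence "sqrt m * sqrt m \<le> sqrt m * (2 * a)" using m by simp
  moreover have "0 < sqrt m" using m by simp
  ultimately have "sqrt m \<le> 2 * a" by (rule mult_left_le_imp_le)
  hence "(sqrt m)\<^sup>2 \<le> (2 * a)\<^sup>2" using m by (intro power_mono) auto
  thus ?thesis using m by (simp add: m_def a_def)
qed simp

lemma calib_cong_AE:
  assumes c: "calib w (indicator A)" and ae: "AE x in lebesgue. x \<in> A \<longleftrightarrow> x \<in> B" and A: "A \<in> sets lebesgue" and B: "B \<in> sets lebesgue"
  shows "calib w (indicator B)"
proof -
  have m: "(indicator A :: R2 \<Rightarrow> real) \<in> borel_measurable lebesgue" "(indicator B :: R2 \<Rightarrow> real) \<in> borel_measurable lebesgue"
    using A B by (auto intro: borel_measurable_indicator)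
  have ae': "AE x in lebesgue. indicator A x = (indicator B x :: real)" using ae by eventually_elim (simp add: indicator_def)
  have wm: "w \<in> borel_measurable lebesgue" using c L2_measurable by (auto simp: calib_def)
  have e: "(\<integral>x. w x * indicator A x \<partial>lebesgue) = (\<integral>x. w x * indicator B x \<partial>lebesgue)"
    by (rule integral_cong_AE) (use m wm ae' in \<open>auto intro: borel_measurable_times\<close>)
  show ?thesis
    using c L2_AE_cong[OF _ ae' m(2)] TVle_cong_AE[OF _ ae' m] unfolding calib_def e by auto
qed

lemma lmeasurable_symdiff: "A \<in> lmeasurable \<Longrightarrow> B \<in> lmeasurable \<Longrightarrow> (A - B) \<union> (B - A) \<in> lmeasurable"
  by (intro fmeasurable.Un fmeasurable_Diff) (auto intro: fmeasurableD)

lemma good_rep_AE: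
  assumes g: "good_rep E' E" and E: "E \<in> lmeasurable"
  shows "AE x in lebesgue. x \<in> E' \<longleftrightarrow> x \<in> E" "E' \<in> lmeasurable"
    "\<And>x r. x \<in> frontier E' \<Longrightarrow> 0 < r \<Longrightarrow> 0 < measure lebesgue (E' \<inter> ball x r) \<and> 0 < measure lebesgue (ball x r - E')"
proof -
  have s: "E' \<in> sets lebesgue" "E \<in> sets lebesgue" using g E by (auto simp: good_rep_def intro: fmeasurableD)
  have "(E' - E) \<union> (E - E') \<in> null_sets lebesgue" using g s by (auto simp: good_rep_def null_sets_def)
  hence "AE x in lebesgue. x \<notin> (E' - E) \<union> (E - E')" by (rule AE_not_in)
  thus ae: "AE x in lebesgue. x \<in> E' \<longleftrightarrow> x \<in> E" by eventually_elim auto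
  have "emeasure lebesgue E' = emeasure lebesgue E" by (rule emeasure_eq_AE[OF ae s])
  thus "E' \<in> lmeasurable" using E s by (simp add: fmeasurable_def)
  fix x r assume x: "x \<in> frontier E'" "(0::real) < r"
  hence e: "0 < emeasure lebesgue (E' \<inter> ball x r)" "emeasure lebesgue (E' \<inter> ball x r) < emeasure lebesgue (ball x r)"
    using g by (auto simp: good_rep_def)
  have m: "E' \<inter> ball x r \<in> lmeasurable" "ball x r \<in> lmeasurable" using fmeasurable_Int_ball[OF s(1)] by auto
  have e': "0 < measure lebesgue (E' \<inter> ball x r)" "measure lebesgue (E' \<inter> ball x r) < measure lebesgue (ball x r)"
    using e unfolding emeasure_eq_measure2[OF m(1)] emeasure_eq_measure2[OF m(2)]
    by (auto simp: ennreal_less_iff)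
  have "ball x r - E' = ball x r - (E' \<inter> ball x r)" by auto
  hence "measure lebesgue (ball x r - E') = measure lebesgue (ball x r) - measure lebesgue (E' \<inter> ball x r)"
    using measurable_measure_Diff[OF m(2) fmeasurableD[OF m(1)]] by simp
  thus "0 < measure lebesgue (E' \<inter> ball x r) \<and> 0 < measure lebesgue (ball x r - E')" using e' by simp
qed

section \<open>Assembly: level sets and the inner bound for the supports\<close>

text \<open>The density estimate is applied to the representatives \<open>E n\<close>: differing
  from the level sets by null sets, they inherit the calibration, and it is at their boundary points
  that both sides are known to have positive area.\<close>

lemma level_sets_converge:
  assumes f: "L2 f" and cal: "\<And>n. calib (V n) (u n)" and conv: "(\<lambda>n. L2norm (\<lambda>x. u n x - f x)) \<longlonglongrightarrow> 0"
    and r0: "r0 > 0" and small: "\<And>n y. n \<ge> N \<Longrightarrow> (\<integral>x. indicator (ball y r0) x * (V n x)\<^sup>2 \<partial>lebesgue) \<le> (3/5 * sqrt pi)\<^sup>2"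
    and t: "t \<noteq> 0" and null: "emeasure lebesgue {x. f x = t} = 0"
  shows "(\<lambda>n. emeasure lebesgue ((lev (u n) t - lev f t) \<union> (lev f t - lev (u n) t))) \<longlonglongrightarrow> 0"
    "(\<forall>n. good_rep (E n) (lev (u n) t)) \<Longrightarrow> good_rep F (lev f t) \<Longrightarrow> pk_lim (\<lambda>n. frontier (E n)) (frontier F)"
proof -
  have u: "L2 (u n)" for n using cal by (simp add: calib_def)
  have lu: "lev (u n) t \<in> lmeasurable" for n by (rule lev_lmeasurable[OF u t])
  have lf: "lev f t \<in> lmeasurable" by (rule lev_lmeasurable[OF f t])
  have lim: "(\<lambda>n. measure lebesgue ((lev (u n) t - lev f t) \<union> (lev f t - lev (u n) t))) \<longlonglongrightarrow> 0"
    by (rule level_convergence[OF f u conv t null])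
  have "(\<lambda>n. ennreal (measure lebesgue ((lev (u n) t - lev f t) \<union> (lev f t - lev (u n) t)))) \<longlonglongrightarrow> ennreal 0"
    by (rule tendsto_ennrealI[OF lim])
  thus "(\<lambda>n. emeasure lebesgue ((lev (u n) t - lev f t) \<union> (lev f t - lev (u n) t))) \<longlonglongrightarrow> 0"
    by (simp only: emeasure_eq_measure2[OF lmeasurable_symdiff[OF lu lf]] ennreal_0)
  assume E: "\<forall>n. good_rep (E n) (lev (u n) t)" and F: "good_rep F (lev f t)"
  note gE = good_rep_AE[OF E[rule_format] lu] and gF = good_rep_AE[OF F lf]
  show "pk_lim (\<lambda>n. frontier (E n)) (frontier F)"
  proof (rule pk_lim_frontier[OF fmeasurableD[OF gE(2)] fmeasurableD[OF gF(2)] lmeasurable_symdiff[OF gE(2) gF(2)] _ r0])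
    have "measure lebesgue ((E n - F) \<union> (F - E n)) = measure lebesgue ((lev (u n) t - lev f t) \<union> (lev f t - lev (u n) t))" for n
    proof (rule measure_cong_AE)
      show "AE x in lebesgue. x \<in> (E n - F) \<union> (F - E n) \<longleftrightarrow> x \<in> (lev (u n) t - lev f t) \<union> (lev f t - lev (u n) t)"
        using gE(1)[of n] gF(1) by eventually_elim auto
    qed (intro fmeasurableD lmeasurable_symdiff gE(2) gF(2) lu lf)+
    thus "(\<lambda>n. measure lebesgue ((E n - F) \<union> (F - E n))) \<longlonglongrightarrow> 0" using lim by simp
    show "(r / 200)\<^sup>2 \<le> measure lebesgue (E n \<inter> ball y r) \<and> (r / 200)\<^sup>2 \<le> measure lebesgue (ball y r - E n)"
      if n: "N \<le> n" and y: "y \<in> frontier (E n)" and r: "0 < r" "r \<le> r0" for n y r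
    proof -
      obtain \<sigma> :: real where \<sigma>: "\<sigma> = 1 \<or> \<sigma> = -1" "calib (\<lambda>x. \<sigma> * V n x) (indicator (lev (u n) t))"
        using calib_lev[OF cal[of n] t] by blast
      have c: "calib (\<lambda>x. \<sigma> * V n x) (indicator (E n))"
      proof (rule calib_cong_AE[OF \<sigma>(2)])
        show "AE x in lebesgue. x \<in> lev (u n) t \<longleftrightarrow> x \<in> E n" using gE(1)[of n] by eventually_elim auto
      qed (intro fmeasurableD lu gE(2))+
      have k0: "0 \<le> 3/5 * sqrt pi" by simp
      show ?thesis
        using calib_density[OF fmeasurableD[OF gE(2)] \<sigma>(1) c k0 order_refl small[OF n] _ _ r] gE(3)[OF y] by blast
    qed
    show "0 < measure lebesgue (F \<inter> ball x r) \<and> 0 < measure lebesgue (ball x r - F)" if "x \<in> frontier F" "0 < r" for x r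
      by (rule gF(3)[OF that])
  qed
qed

text \<open>The pairing with a fixed field is continuous in L2: a field that detects
  \<open>f\<close> near \<open>x\<close> detects every late \<open>u n\<close>, which must then have
  a support point in the same disc.\<close>

lemma suppD_subset_pk_liminf:
  assumes f: "L2 f" and u: "\<And>n. L2 (u n)" and conv: "(\<lambda>n. L2norm (\<lambda>x. u n x - f x)) \<longlonglongrightarrow> 0"
  shows "suppD f \<subseteq> pk_liminf (\<lambda>n. suppD (u n))"
proof
  fix x assume x: "x \<in> suppD f"
  show "x \<in> pk_liminf (\<lambda>n. suppD (u n))"
  proof (rule pk_liminfI)
    fix e :: real assume e: "e > 0"
    obtain \<phi> where \<phi>: "testfield \<phi>" "tsupp \<phi> \<subseteq> ball x e" "(\<integral>x. f x * divg \<phi> x \<partial>lebesgue) \<noteq> 0"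
      using x e by (auto simp: suppD_def)
    note dL = L2_divg[OF \<phi>(1)]
    have "(\<lambda>n. inner (to_l2 (u n)) (to_l2 (divg \<phi>))) \<longlonglongrightarrow> inner (to_l2 f) (to_l2 (divg \<phi>))"
    proof (intro tendsto_intros)
      have "norm (to_l2 (u n) - to_l2 f) = L2norm (\<lambda>x. u n x - f x)" for n
        by (simp add: norm_to_l2[symmetric] L2_diff u f to_l2_diff)
      thus "(\<lambda>n. to_l2 (u n)) \<longlonglongrightarrow> to_l2 f"
        using conv by (subst tendsto_dist_iff) (simp add: dist_norm)
    qed
    hence "\<forall>\<^sub>F n in sequentially. inner (to_l2 (u n)) (to_l2 (divg \<phi>)) \<noteq> 0"
      by (rule tendsto_imp_eventually_ne) (use \<phi>(3) in \<open>simp add: inner_to_l2 f dL\<close>)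
    thus "\<forall>\<^sub>F n in sequentially. \<exists>y\<in>suppD (u n). dist x y < e"
    proof eventually_elim
      fix n assume "inner (to_l2 (u n)) (to_l2 (divg \<phi>)) \<noteq> 0"
      hence "(\<integral>x. u n x * divg \<phi> x \<partial>lebesgue) \<noteq> 0" by (simp add: inner_to_l2 u dL)
      hence "tsupp \<phi> \<inter> suppD (u n) \<noteq> {}" using pairing_zero_off_suppD[OF L2_loc_int[OF u] \<phi>(1)] by blast
      thus "\<exists>y\<in>suppD (u n). dist x y < e" using \<phi>(2) by auto
    qed
  qed
qed

section \<open>The outer bound for the supports\<close>

lemma L2_tail_small:
  assumes v: "L2 v" and e: "e > 0"
  obtains S where "S \<ge> 0" "L2norm (\<lambda>x. v x - indicator (cball 0 S) x * v x) \<le> e"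
proof -
  have vm: "v \<in> borel_measurable lebesgue" by (rule L2_measurable[OF v])
  have bs: "cball (0::R2) S \<in> sets lebesgue" for S by simp
  have tL: "L2 (\<lambda>x. v x - indicator (cball 0 S) x * v x)" for S by (intro L2_diff v L2_indicator_mult bs)
  have "(\<lambda>n. \<integral>x. (v x - indicator (cball 0 (real n)) x * v x)\<^sup>2 \<partial>lebesgue) \<longlonglongrightarrow> (\<integral>x. 0 \<partial>(lebesgue :: R2 measure))"
  proof (rule integral_dominated_convergence[where w = "\<lambda>x. (v x)\<^sup>2"])
    show "integrable lebesgue (\<lambda>x. (v x)\<^sup>2)" by (rule L2_integrable_sq[OF v])
    show "(\<lambda>x. (v x - indicator (cball 0 (real n)) x * v x)\<^sup>2) \<in> borel_measurable lebesgue" for n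
      using L2_integrable_sq[OF tL] by (rule borel_measurable_integrable)
    show "AE x in lebesgue. (\<lambda>n. (v x - indicator (cball 0 (real n)) x * v x)\<^sup>2) \<longlonglongrightarrow> 0"
    proof (rule AE_I2, rule tendsto_eventually)
      fix x :: R2
      obtain N :: nat where N: "norm x \<le> real N" using real_arch_simple by blast
      show "\<forall>\<^sub>F n in sequentially. (v x - indicator (cball 0 (real n)) x * v x)\<^sup>2 = 0"
      proof (rule eventually_sequentiallyI[of N])
        fix n assume "N \<le> n"
        hence "real N \<le> real n" by simp
        hence "x \<in> cball 0 (real n)" using N by simp
        thus "(v x - indicator (cball 0 (real n)) x * v x)\<^sup>2 = 0" by (simp only: indicator_simps) simp
      qed
    qed
    show "AE x in lebesgue. norm ((v x - indicator (cball 0 (real n)) x * v x)\<^sup>2) \<le> (v x)\<^sup>2" for n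
      by (rule AE_I2) (auto simp: indicator_def)
  qed simp
  hence "(\<lambda>n. \<integral>x. (v x - indicator (cball 0 (real n)) x * v x)\<^sup>2 \<partial>lebesgue) \<longlonglongrightarrow> 0" by simp
  moreover have "0 < e\<^sup>2" using e by simp
  ultimately have "\<forall>\<^sub>F n in sequentially. (\<integral>x. (v x - indicator (cball 0 (real n)) x * v x)\<^sup>2 \<partial>lebesgue) < e\<^sup>2"
    by (rule order_tendstoD(2))
  then obtain n where n: "(\<integral>x. (v x - indicator (cball 0 (real n)) x * v x)\<^sup>2 \<partial>lebesgue) < e\<^sup>2"
    by (meson eventually_happens sequentially_bot)
  have "L2norm (\<lambda>x. v x - indicator (cball 0 (real n)) x * v x) \<le> e"
    unfolding L2norm_def by (rule real_le_lsqrt) (use e n in auto)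
  thus ?thesis using that[of "real n"] by simp
qed

text \<open>Since W k tends to v0 and the g k are bounded, <g k, d - v0> is at most a small number,
  uniformly over unit divergences \<open>d\<close>. Such bounds survive convex combinations of tails
  and their limit \<open>h\<close>, which makes v0 calibrate \<open>h\<close>. The second conclusion
  is the same principle read backwards: a pairing that exceeds -e for \<open>h\<close> cannot stay
  at or below -e along a whole tail. It carries information back to the g k even when
  \<open>h\<close> is 0.\<close>

lemma calibrated_weak_limit:
  assumes v0: "L2 v0" "\<And>g c. L2 g \<Longrightarrow> TVle g c \<Longrightarrow> (\<integral>x. v0 x * g x \<partial>lebesgue) \<le> c"
    and g: "\<And>k. calib (W k) (g k)" "\<And>k. L2norm (g k) \<le> b" and W: "(\<lambda>k. L2norm (\<lambda>x. W k x - v0 x)) \<longlonglongrightarrow> 0"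
  obtains h where "calib v0 h"
    "\<And>\<psi> e N. testfield \<psi> \<Longrightarrow> (\<integral>x. h x * (divg \<psi> x - v0 x) \<partial>lebesgue) > - e \<Longrightarrow>
       \<exists>k\<ge>N. (\<integral>x. g k x * (divg \<psi> x - v0 x) \<partial>lebesgue) > - e"
proof -
  have gL: "L2 (g k)" and WL: "L2 (W k)" for k using g(1) by (auto simp: calib_def)
  have b0: "0 \<le> b" using g(2)[of 0] by (rule order_trans[rotated]) (simp add: L2norm_def)
  define H where "H k = to_l2 (g k)" for k
  define p0 where "p0 = to_l2 v0"
  have Hn: "norm (H k) \<le> b" for k using g(2)[of k] by (simp add: H_def norm_to_l2 gL)
  have est: "\<exists>K. \<forall>k\<ge>K. \<forall>d\<in>unit_divergences. inner (H k) (d - p0) \<le> e" if e: "e > 0" for e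
  proof -
    have "(\<lambda>k. b * L2norm (\<lambda>x. W k x - v0 x)) \<longlonglongrightarrow> b * 0" by (intro tendsto_intros W)
    hence "\<forall>\<^sub>F k in sequentially. b * L2norm (\<lambda>x. W k x - v0 x) < e" using order_tendstoD(2) e by simp
    then obtain K where K: "\<And>k. k \<ge> K \<Longrightarrow> b * L2norm (\<lambda>x. W k x - v0 x) < e" by (auto simp: eventually_sequentially)
    have "inner (H k) (d - p0) \<le> e" if k: "k \<ge> K" and d: "d \<in> unit_divergences" for k d
    proof -
      have "TVle (g k) (\<integral>x. W k x * g k x \<partial>lebesgue)" using g(1) by (simp add: calib_def)
      hence "inner (H k) d \<le> inner (H k) (to_l2 (W k))"
        using d by (simp add: TVle_iff_inner gL H_def inner_to_l2 WL mult.commute)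
      hence "inner (H k) (d - p0) \<le> inner (H k) (to_l2 (W k) - p0)" by (simp add: inner_diff_right)
      also have "\<dots> \<le> norm (H k) * norm (to_l2 (W k) - p0)" by (rule norm_cauchy_schwarz)
      also have "\<dots> \<le> b * norm (to_l2 (W k) - p0)" by (rule mult_right_mono[OF Hn]) simp
      also have "norm (to_l2 (W k) - p0) = L2norm (\<lambda>x. W k x - v0 x)"
        by (simp add: p0_def norm_to_l2[symmetric] L2_diff WL v0 to_l2_diff)
      finally show ?thesis using K[OF k] by simp
    qed
    thus ?thesis by blast
  qed
  define C where "C j = convex hull (H ` {j..})" for j
  have half: "C j \<subseteq> {z. inner a z \<le> c}" if "\<And>k. k \<ge> j \<Longrightarrow> inner (H k) a \<le> c" for j a c
    unfolding C_def
  proof (rule hull_minimal)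
    show "H ` {j..} \<subseteq> {z. inner a z \<le> c}" using that by (auto simp: inner_commute)
  qed (rule convex_halfspace_le)
  obtain q p where q: "\<And>j. q j \<in> C j" "q \<longlonglongrightarrow> p"
  proof (rule near_minimal_sequence[of C b])
    show "convex (C n)" for n by (simp add: C_def)
    show "C n \<subseteq> C m" if "m \<le> n" for m n unfolding C_def by (rule hull_mono) (use that in auto)
    show "\<exists>x\<in>C n. norm x \<le> b" for n
    proof (rule bexI[of _ "H n"])
      show "H n \<in> C n" unfolding C_def by (rule hull_inc) simp
    qed (rule Hn)
  qed (rule that)
  define h where "h = of_l2 p"
  have hL: "L2 h" and hp: "to_l2 h = p" by (auto simp: h_def L2_of_l2 to_l2_of_l2)
  have sub: "inner p d \<le> inner p p0" if d: "d \<in> unit_divergences" for d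
  proof (rule field_le_epsilon)
    fix e :: real assume "e > 0"
    then obtain K where K: "\<forall>k\<ge>K. \<forall>d\<in>unit_divergences. inner (H k) (d - p0) \<le> e" using est by blast
    have "inner (q j) (d - p0) \<le> e" if j: "j \<ge> K" for j
      using half[of j "d - p0" e] K d j q(1)[of j] by (auto simp: inner_commute)
    moreover have "(\<lambda>j. inner (q j) (d - p0)) \<longlonglongrightarrow> inner p (d - p0)" by (intro tendsto_intros q)
    ultimately have "inner p (d - p0) \<le> e" by (intro LIMSEQ_le_const2) auto
    thus "inner p d \<le> inner p p0 + e" by (simp add: inner_diff_right)
  qed
  have cal: "calib v0 h" unfolding calib_def
  proof (intro conjI allI impI v0(1) hL)
    show "TVle h (\<integral>x. v0 x * h x \<partial>lebesgue)"
      using sub by (simp add: TVle_iff_inner hL hp p0_def inner_to_l2[symmetric] v0 inner_commute)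
  qed (rule v0(2))
  have "\<exists>k\<ge>N. (\<integral>x. g k x * (divg \<psi> x - v0 x) \<partial>lebesgue) > - e"
    if \<psi>: "testfield \<psi>" and gt: "(\<integral>x. h x * (divg \<psi> x - v0 x) \<partial>lebesgue) > - e" for \<psi> e N
  proof (rule ccontr)
    assume n: "\<not> ?thesis"
    define d where "d = to_l2 (\<lambda>x. divg \<psi> x - v0 x)"
    have dL: "L2 (\<lambda>x. divg \<psi> x - v0 x)" by (rule L2_diff[OF L2_divg[OF \<psi>] v0(1)])
    have Hd: "inner (H k) d \<le> - e" if "k \<ge> N" for k using n that by (auto simp: H_def d_def inner_to_l2 gL dL not_less)
    have "inner (q j) d \<le> - e" if j: "j \<ge> N" for j
    proof -
      have "C j \<subseteq> {z. inner d z \<le> - e}" by (rule half) (use Hd j in simp)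
      thus ?thesis using q(1)[of j] by (auto simp: inner_commute)
    qed
    moreover have "(\<lambda>j. inner (q j) d) \<longlonglongrightarrow> inner p d" by (intro tendsto_intros q)
    ultimately have "inner p d \<le> - e" by (intro LIMSEQ_le_const2) auto
    moreover have "inner p d = (\<integral>x. h x * (divg \<psi> x - v0 x) \<partial>lebesgue)"
      using inner_to_l2[OF hL dL] by (simp add: hp d_def)
    ultimately show False using gt by simp
  qed
  thus ?thesis using that cal by blast
qed

text \<open>If \<open>x\<close> were outside, no \<open>h\<close> calibrated by \<open>v0\<close>
  would vary on a disc around it. A unit field nearly optimal for such an \<open>h\<close> can then
  be cut off near \<open>x\<close> without loss, and it is still nearly optimal for some late level
  set. Any unit field supported in the inner disc may be added to it, so the level set has variation
  at most 2 \<epsilon> there; the relative isoperimetric inequality then contradicts the density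
  estimate.\<close>

lemma pk_limsup_suppD_subset_Ext:
  assumes f: "L2 f" and cal: "\<And>n. calib (V n) (u n)"
    and v0: "calib v0 f" "\<And>v'. calib v' f \<Longrightarrow> L2norm v0 \<le> L2norm v'"
    and Vlim: "(\<lambda>n. L2norm (\<lambda>x. V n x - v0 x)) \<longlonglongrightarrow> 0"
    and r0: "r0 > 0" and small: "\<And>n y. n \<ge> N \<Longrightarrow> (\<integral>x. indicator (ball y r0) x * (V n x)\<^sup>2 \<partial>lebesgue) \<le> (3/5 * sqrt pi)\<^sup>2"
  shows "pk_limsup (\<lambda>n. suppD (u n)) \<subseteq> Ext f"
proof
  fix x assume x: "x \<in> pk_limsup (\<lambda>n. suppD (u n))"
  have uL: "L2 (u n)" and VL: "L2 (V n)" for n using cal by (auto simp: calib_def)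
  have v0L: "L2 v0" using v0(1) by (simp add: calib_def)
  have min: "v0 \<in> minsub f" unfolding minsub_def using v0 by (auto simp: subdiffJ_iff_calib f)
  show "x \<in> Ext f"
  proof (rule ccontr)
    assume nx: "x \<notin> Ext f"
    have "open (- Ext f)" by (simp add: Ext_def open_Compl)
    then obtain R where R: "R > 0" "ball x R \<subseteq> - Ext f" using nx by (meson ComplI open_contains_ball)
    have noD: "suppD h \<inter> ball x R = {}" if h: "calib v0 h" for h
    proof -
      have hL: "L2 h" using h by (simp add: calib_def)
      have "suppD h \<subseteq> \<Union> {suppD g | g. L2 g \<and> (\<exists>v\<in>minsub f. v \<in> subdiffJ g)}"
        using hL h min subdiffJ_iff_calib[OF hL, of v0] by blast
      also have "\<dots> \<subseteq> Ext f" unfolding Ext_def by (rule closure_subset)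
      finally show ?thesis using R(2) by blast
    qed
    have p40: "sqrt pi / 40 > 0" by simp
    obtain S where S: "S \<ge> 0" "L2norm (\<lambda>x. v0 x - indicator (cball 0 S) x * v0 x) \<le> sqrt pi / 40"
      by (rule L2_tail_small[OF v0L p40])
    from order_tendstoD(2)[OF Vlim p40] obtain N1 where N1: "\<And>n. n \<ge> N1 \<Longrightarrow> L2norm (\<lambda>x. V n x - v0 x) < sqrt pi / 40"
      by (auto simp: eventually_sequentially)
    \<comment> \<open>The levels themselves are uncontrolled; only the position is known, within R/8
      of \<open>x\<close>: R/16 to a support point and R/16 from there to a mixed point.\<close>
    have "\<exists>n t z. n \<ge> max k (max N N1) \<and> t \<noteq> 0 \<and> dist x z < R / 8 \<and>
        (\<forall>r>0. 0 < measure lebesgue (lev (u n) t \<inter> ball z r)) \<and> (\<forall>r>0. 0 < measure lebesgue (ball z r - lev (u n) t))" for k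
    proof -
      have R16: "R / 16 > 0" using R by simp
      from frequently_eventually_frequently[OF pk_limsupD[OF x R16] eventually_ge_at_top[of "max k (max N N1)"]]
      obtain n where n: "\<exists>y\<in>suppD (u n). dist x y < R / 16" "n \<ge> max k (max N N1)" by (auto dest!: frequently_ex)
      then obtain y where y: "y \<in> suppD (u n)" "dist x y < R / 16" by blast
      obtain t z where tz: "t \<noteq> 0" "z \<in> ball y (R / 16)" "\<And>r. r > 0 \<Longrightarrow> 0 < measure lebesgue (lev (u n) t \<inter> ball z r)"
         "\<And>r. r > 0 \<Longrightarrow> 0 < measure lebesgue (ball z r - lev (u n) t)"
        using level_boundary_near_suppD[OF uL y(1) R16] by metis
      have "dist x z < R / 8" using dist_triangle[of x z y] y(2) tz(2) by simp
      thus ?thesis using n(2) tz by blast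
    qed
    then obtain n t z where n: "\<And>k. n k \<ge> max k (max N N1)" and t: "\<And>k. t k \<noteq> 0" and z: "\<And>k. dist x (z k) < R / 8"
      and pos1: "\<And>k r. r > 0 \<Longrightarrow> 0 < measure lebesgue (lev (u (n k)) (t k) \<inter> ball (z k) r)"
      and pos2: "\<And>k r. r > 0 \<Longrightarrow> 0 < measure lebesgue (ball (z k) r - lev (u (n k)) (t k))" by metis
    define U where "U k = lev (u (n k)) (t k)" for k
    have Um: "U k \<in> lmeasurable" for k unfolding U_def by (rule lev_lmeasurable[OF uL t])
    have Us: "U k \<in> sets lebesgue" for k by (rule fmeasurableD[OF Um])
    have "\<exists>\<sigma>::real. (\<sigma> = 1 \<or> \<sigma> = -1) \<and> calib (\<lambda>x. \<sigma> * V (n k) x) (indicator (U k))" for k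
      unfolding U_def using calib_lev[OF cal[of "n k"] t[of k]] by metis
    then obtain \<sigma> :: "nat \<Rightarrow> real" where \<sigma>: "\<And>k. \<sigma> k = 1 \<or> \<sigma> k = -1"
      and cU: "\<And>k. calib (\<lambda>x. \<sigma> k * V (n k) x) (indicator (U k))" by metis
    define b where "b = 2 * (L2norm v0 * sqrt (pi * S\<^sup>2) + 1)"
    have b0: "0 \<le> b" by (simp add: b_def L2norm_def)
    have mU: "measure lebesgue (U k) \<le> b\<^sup>2" for k
      unfolding b_def
    proof (rule quasi_minimal_measure_bound[OF Um calib_quasi_minimal_inside[OF Us cU]])
      let ?p = "\<lambda>x. indicator (cball 0 S) x * v0 x"
      have bs: "cball (0::R2) S \<in> sets lebesgue" by simp
      have pL: "L2 ?p" by (rule L2_indicator_mult[OF v0L bs])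
      have sL: "L2norm (\<lambda>x. \<sigma> k * g x) = L2norm g" for g using \<sigma>[of k] by (auto simp: L2norm_def)
      show "L2 (\<lambda>x. \<sigma> k * ?p x)" by (rule L2_cmult[OF pL])
      show "\<sigma> k * ?p x = 0" if "x \<notin> cball 0 S" for x using that by simp
      show "L2norm (\<lambda>x. \<sigma> k * ?p x) \<le> L2norm v0" unfolding sL by (rule L2norm_indicator_le[OF v0L bs])
      have "L2norm (\<lambda>x. \<sigma> k * V (n k) x - \<sigma> k * ?p x) = L2norm (\<lambda>x. V (n k) x - ?p x)"
        using sL[of "\<lambda>x. V (n k) x - ?p x"] by (simp add: right_diff_distrib)
      also have "\<dots> = norm ((to_l2 (V (n k)) - to_l2 v0) + (to_l2 v0 - to_l2 ?p))"
        by (simp add: norm_to_l2[symmetric] L2_diff VL pL to_l2_diff)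
      also have "\<dots> \<le> norm (to_l2 (V (n k)) - to_l2 v0) + norm (to_l2 v0 - to_l2 ?p)" by (rule norm_triangle_ineq)
      also have "\<dots> = L2norm (\<lambda>x. V (n k) x - v0 x) + L2norm (\<lambda>x. v0 x - ?p x)"
        by (simp add: norm_to_l2[symmetric] L2_diff VL pL v0L to_l2_diff)
      also have "\<dots> \<le> sqrt pi / 20" using N1[of "n k"] n[of k] S(2) by simp
      finally show "L2norm (\<lambda>x. \<sigma> k * V (n k) x - \<sigma> k * ?p x) \<le> sqrt pi / 20" .
    qed (rule S(1))
    \<comment> \<open>The sign is moved from the dual variable to the set, so that each
      \<open>g k\<close> is calibrated by \<open>V (n k)\<close> itself and all of them share the
      limit \<open>v0\<close>.\<close>
    define g where "g k x = \<sigma> k * indicator (U k) x" for k x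
    have cg: "calib (V (n k)) (g k)" for k
      using \<sigma>[of k]
    proof
      assume "\<sigma> k = 1" thus ?thesis using cU[of k] by (simp add: g_def[abs_def])
    next
      assume s: "\<sigma> k = -1"
      from calib_uminus[OF cU[of k]] show ?thesis by (simp add: g_def[abs_def] s)
    qed
    have gn: "L2norm (g k) \<le> b" for k
    proof -
      have "(g k x)\<^sup>2 = indicator (U k) x" for x using \<sigma>[of k] by (auto simp: g_def indicator_def)
      hence "L2norm (g k) = sqrt (measure lebesgue (U k))" by (simp add: L2norm_def)
      thus ?thesis using mU[of k] b0 by (simp add: real_le_lsqrt)
    qed
    have nlim: "filterlim n at_top sequentially"
      by (rule filterlim_at_top_mono[OF filterlim_ident]) (use n in \<open>auto intro: always_eventually\<close>)
    have Wlim: "(\<lambda>k. L2norm (\<lambda>x. V (n k) x - v0 x)) \<longlonglongrightarrow> 0"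
      using filterlim_compose[OF Vlim nlim] by simp
    obtain h where h: "calib v0 h"
      "\<And>\<psi> e N. testfield \<psi> \<Longrightarrow> (\<integral>x. h x * (divg \<psi> x - v0 x) \<partial>lebesgue) > - e \<Longrightarrow>
         \<exists>k\<ge>N. (\<integral>x. g k x * (divg \<psi> x - v0 x) \<partial>lebesgue) > - e"
    proof (rule calibrated_weak_limit[OF v0L calibD[OF v0(1)] cg gn Wlim], goal_cases)
      case (3 h)
      show ?case by (rule 3(1)[OF 3(2,3)])
    qed
    have hL: "L2 h" using h(1) by (simp add: calib_def)
    \<comment> \<open>R/16 lets the discs of radius 4 \<rho> about \<open>z k\<close> fit into
      radius R/2 about \<open>x\<close>, as R/8 + R/4 < R/2; \<open>r0\<close> is the range of the
      density estimate.\<close>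
    define \<rho> where "\<rho> = min (R / 16) r0"
    have \<rho>: "\<rho> > 0" "\<rho> \<le> r0" "\<rho> \<le> R / 16" using R r0 by (auto simp: \<rho>_def)
    define q where "q = (\<rho> / 200)\<^sup>2"
    have q: "q > 0" using \<rho> by (simp add: q_def)
    \<comment> \<open>Makes the relative isoperimetric bound 2 \<rho> (2 \<epsilon>) pi (2 \<rho>)^2
      = 16 pi \<rho>^3 \<epsilon> equal to q^2 / 2, half of what density forces.\<close>
    define \<epsilon> where "\<epsilon> = q * q / (32 * pi * \<rho> ^ 3)"
    have \<epsilon>: "\<epsilon> > 0" using q \<rho> by (simp add: \<epsilon>_def)
    have "\<exists>\<phi>. testfield \<phi> \<and> (\<forall>x. norm (\<phi> x) \<le> 1) \<and> (\<integral>x. v0 x * h x \<partial>lebesgue) - \<epsilon> < (\<integral>x. h x * divg \<phi> x \<partial>lebesgue)"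
    proof (rule ccontr)
      assume "\<not> ?thesis"
      hence "TVle h ((\<integral>x. v0 x * h x \<partial>lebesgue) - \<epsilon>)" by (auto simp: TVle_def not_less)
      from calibD[OF v0(1) hL this] \<epsilon> show False by simp
    qed
    then obtain \<phi> where \<phi>: "testfield \<phi>" "\<And>x. norm (\<phi> x) \<le> 1" "(\<integral>x. v0 x * h x \<partial>lebesgue) - \<epsilon> < (\<integral>x. h x * divg \<phi> x \<partial>lebesgue)" by blast
    have ab: "0 < R / 2" "R / 2 < 3 * R / 4" using R by auto
    obtain \<eta> G where \<eta>: "C1grad \<eta> G" "\<And>y. 0 \<le> \<eta> y" "\<And>y. \<eta> y \<le> 1"
      "\<And>y. y \<in> cball x (R / 2) \<Longrightarrow> \<eta> y = 1" "\<And>y. y \<notin> ball x (3 * R / 4) \<Longrightarrow> \<eta> y = 0"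
      by (rule cutoff_exists[OF ab, of x]) blast
    note t1 = testfield_scale[OF \<phi>(1) \<eta>(1)] and t2 = testfield_scale[OF \<phi>(1) C1grad_one_minus[OF \<eta>(1)]]
    \<comment> \<open>Removing the part of \<phi> near \<open>x\<close> leaves the pairing with
      \<open>h\<close> unchanged, since \<open>h\<close> does not vary in the disc; on the freed
      inner disc another unit field can be placed.\<close>
    define \<psi> where "\<psi> y = (1 - \<eta> y) *\<^sub>R \<phi> y" for y
    have t\<psi>: "testfield \<psi>" unfolding \<psi>_def by (rule t2(1))
    have "tsupp (\<lambda>y. \<eta> y *\<^sub>R \<phi> y) \<subseteq> cball x (3 * R / 4)"
    proof (rule tsupp_subset)
      fix y assume "y \<notin> cball x (3 * R / 4)"
      hence "y \<notin> ball x (3 * R / 4)" by simp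
      thus "\<eta> y *\<^sub>R \<phi> y = 0" using \<eta>(5) by simp
    qed simp
    also have "\<dots> \<subseteq> ball x R" using R by auto
    finally have "(\<integral>y. h y * divg (\<lambda>y. \<eta> y *\<^sub>R \<phi> y) y \<partial>lebesgue) = 0"
      using noD[OF h(1)] by (intro pairing_zero_off_suppD[OF L2_loc_int[OF hL] t1(1)]) blast
    moreover have "(\<integral>y. h y * divg \<phi> y \<partial>lebesgue) = (\<integral>y. h y * divg (\<lambda>y. \<eta> y *\<^sub>R \<phi> y) y \<partial>lebesgue) + (\<integral>y. h y * divg \<psi> y \<partial>lebesgue)"
    proof -
      have e: "divg \<phi> y = divg (\<lambda>y. \<eta> y *\<^sub>R \<phi> y) y + divg \<psi> y" for y
        unfolding \<psi>_def t1(2) t2(2) by (simp add: algebra_simps)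
      show ?thesis unfolding e distrib_left
        by (rule Bochner_Integration.integral_add) (intro L2_integrable_mult hL L2_divg t1(1) t\<psi>)+
    qed
    moreover have "(\<integral>y. h y * (divg \<psi> y - v0 y) \<partial>lebesgue) = (\<integral>y. h y * divg \<psi> y \<partial>lebesgue) - (\<integral>y. v0 y * h y \<partial>lebesgue)"
      using L2_integrable_mult[OF hL L2_divg[OF t\<psi>]] L2_integrable_mult[OF v0L hL]
      by (simp add: right_diff_distrib mult.commute[of "h _" "v0 _"])
    ultimately have gt: "(\<integral>y. h y * (divg \<psi> y - v0 y) \<partial>lebesgue) > - \<epsilon>" using \<phi>(3) by linarith
    have "(\<lambda>k. b * L2norm (\<lambda>x. V (n k) x - v0 x)) \<longlonglongrightarrow> b * 0" by (intro tendsto_intros Wlim)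
    hence "\<forall>\<^sub>F k in sequentially. b * L2norm (\<lambda>x. V (n k) x - v0 x) < \<epsilon>" using order_tendstoD(2) \<epsilon> by simp
    then obtain K where K: "\<And>k. k \<ge> K \<Longrightarrow> b * L2norm (\<lambda>x. V (n k) x - v0 x) < \<epsilon>" by (auto simp: eventually_sequentially)
    obtain k where k: "k \<ge> K" "(\<integral>y. g k y * (divg \<psi> y - v0 y) \<partial>lebesgue) > - \<epsilon>" using h(2)[OF t\<psi> gt] by blast
    have gL: "L2 (g k)" using cg by (simp add: calib_def)
    \<comment> \<open>\<psi> vanishes where \<zeta> lives, so their sum is a unit field. One
      \<epsilon> is the deficit of \<psi>, the other pays for replacing \<open>V (n k)\<close> by
      \<open>v0\<close>.\<close>
    have loc: "(\<integral>y. g k y * divg \<zeta> y \<partial>lebesgue) \<le> 2 * \<epsilon>"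
      if \<zeta>: "testfield \<zeta>" "\<And>y. norm (\<zeta> y) \<le> 1" "\<And>y. y \<notin> cball x (R / 2) \<Longrightarrow> \<zeta> y = 0" for \<zeta>
    proof -
      note ts = testfield_add[OF t\<psi> \<zeta>(1)]
      have unit: "norm (\<psi> y + \<zeta> y) \<le> 1" for y
      proof (cases "y \<in> cball x (R / 2)")
        case True thus ?thesis using \<eta>(4) \<zeta>(2) by (simp add: \<psi>_def)
      next
        case False
        have "(1 - \<eta> y) * norm (\<phi> y) \<le> 1 * 1" using \<eta>(2,3) \<phi>(2) by (intro mult_mono) auto
        thus ?thesis using False \<zeta>(3) \<eta>(2,3) by (simp add: \<psi>_def)
      qed
      have "TVle (g k) (\<integral>y. V (n k) y * g k y \<partial>lebesgue)" using cg by (simp add: calib_def)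
      from TVleD[OF this ts(1) unit]
      have "(\<integral>y. g k y * divg (\<lambda>y. \<psi> y + \<zeta> y) y \<partial>lebesgue) \<le> (\<integral>y. V (n k) y * g k y \<partial>lebesgue)" .
      moreover have "(\<integral>y. g k y * divg (\<lambda>y. \<psi> y + \<zeta> y) y \<partial>lebesgue) = (\<integral>y. g k y * divg \<psi> y \<partial>lebesgue) + (\<integral>y. g k y * divg \<zeta> y \<partial>lebesgue)"
        unfolding ts(2) distrib_left by (rule Bochner_Integration.integral_add) (intro L2_integrable_mult gL L2_divg t\<psi> \<zeta>(1))+
      moreover have "(\<integral>y. g k y * (divg \<psi> y - v0 y) \<partial>lebesgue) = (\<integral>y. g k y * divg \<psi> y \<partial>lebesgue) - (\<integral>y. v0 y * g k y \<partial>lebesgue)"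
        using L2_integrable_mult[OF gL L2_divg[OF t\<psi>]] L2_integrable_mult[OF v0L gL]
        by (simp add: right_diff_distrib mult.commute[of "g k _" "v0 _"])
      moreover have "(\<integral>y. V (n k) y * g k y \<partial>lebesgue) - (\<integral>y. v0 y * g k y \<partial>lebesgue) < \<epsilon>"
      proof -
        have dL: "L2 (\<lambda>x. V (n k) x - v0 x)" by (rule L2_diff[OF VL v0L])
        have "(\<integral>y. V (n k) y * g k y \<partial>lebesgue) - (\<integral>y. v0 y * g k y \<partial>lebesgue) = (\<integral>y. (V (n k) y - v0 y) * g k y \<partial>lebesgue)"
          using L2_integrable_mult[OF VL gL] L2_integrable_mult[OF v0L gL] by (simp add: left_diff_distrib)
        also have "\<dots> \<le> L2norm (\<lambda>x. V (n k) x - v0 x) * L2norm (g k)" by (rule L2_Cauchy_Schwarz[OF dL gL])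
        also have "\<dots> \<le> L2norm (\<lambda>x. V (n k) x - v0 x) * b" by (rule mult_left_mono[OF gn]) (simp add: L2norm_def)
        also have "\<dots> < \<epsilon>" using K[OF k(1)] by (simp add: mult.commute)
        finally show ?thesis .
      qed
      ultimately show ?thesis using k(2) by linarith
    qed
    have locU: "(\<integral>y. indicator (U k) y * divg \<zeta> y \<partial>lebesgue) \<le> 2 * \<epsilon>"
      if \<zeta>: "testfield \<zeta>" "\<And>y. norm (\<zeta> y) \<le> 1" "\<And>y. y \<notin> cball x (R / 2) \<Longrightarrow> \<zeta> y = 0" for \<zeta>
      using \<sigma>[of k]
    proof
      assume "\<sigma> k = 1" thus ?thesis using loc[OF \<zeta>] by (simp add: g_def)
    next
      assume s: "\<sigma> k = -1"
      have "(\<integral>y. g k y * divg (\<lambda>y. - \<zeta> y) y \<partial>lebesgue) \<le> 2 * \<epsilon>"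
        by (rule loc[OF testfield_uminus(1)[OF \<zeta>(1)]]) (use \<zeta> in auto)
      thus ?thesis by (simp add: g_def s testfield_uminus(2)[OF \<zeta>(1)])
    qed
    obtain B where B: "B \<in> sets borel" "AE y in lebesgue. y \<in> U k \<longleftrightarrow> y \<in> B" using borel_representative[OF Us] by blast
    have Bl: "B \<in> sets lebesgue" using B(1) by simp
    let ?b = "cball (z k) \<rho>"
    have iso: "measure lborel (?b - B) * measure lborel (?b \<inter> B) \<le> 2 * \<rho> * (2 * \<epsilon>) * (pi * (2 * \<rho>)\<^sup>2)"
    proof (rule relative_isoperimetric[OF B(1) \<rho>(1)])
      fix \<zeta> assume \<zeta>: "testfield \<zeta>" "\<And>y. norm (\<zeta> y) \<le> 1" "\<And>y. y \<notin> cball (z k) (4 * \<rho>) \<Longrightarrow> \<zeta> y = 0"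
      have "\<zeta> y = 0" if y: "y \<notin> cball x (R / 2)" for y
      proof (rule \<zeta>(3))
        show "y \<notin> cball (z k) (4 * \<rho>)" using y z[of k] \<rho>(3) R(1) dist_triangle[of x y "z k"] by simp
      qed
      note le = locU[OF \<zeta>(1,2) this]
      have dm: "divg \<zeta> \<in> borel_measurable lebesgue" by (rule continuous_measurable_lebesgue[OF continuous_divg[OF \<zeta>(1)]])
      have "(\<integral>y. indicator B y * divg \<zeta> y \<partial>lebesgue) = (\<integral>y. indicator (U k) y * divg \<zeta> y \<partial>lebesgue)"
      proof (rule integral_cong_AE)
        show "AE y in lebesgue. indicator B y * divg \<zeta> y = indicator (U k) y * divg \<zeta> y"
          using B(2) by eventually_elim (simp add: indicator_def)
      qed (intro borel_measurable_times borel_measurable_indicator dm Bl Us)+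
      thus "(\<integral>y. indicator B y * divg \<zeta> y \<partial>lebesgue) \<le> 2 * \<epsilon>" using le by simp
    qed
    have k0: "0 \<le> 3/5 * sqrt pi" by simp
    have nk: "n k \<ge> N" using n[of k] by simp
    note dens = calib_density[OF Us \<sigma> cU k0 order_refl small[OF nk] pos1[of _ k, folded U_def] pos2[of _ k, folded U_def] \<rho>(1,2)]
    have m1: "q \<le> measure lborel (?b \<inter> B)"
    proof -
      have "q \<le> measure lebesgue (U k \<inter> ball (z k) \<rho>)" using dens(1) by (simp add: q_def)
      also have "\<dots> = measure lebesgue (B \<inter> ball (z k) \<rho>)"
        by (rule measure_cong_AE) (use B(2) Us Bl in auto)
      also have "\<dots> \<le> measure lebesgue (?b \<inter> B)"
        using Bl by (intro measure_mono_fmeasurable fmeasurable_Int_fmeasurable) auto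
      also have "\<dots> = measure lborel (?b \<inter> B)" using B(1) by (simp add: measure_completion)
      finally show ?thesis .
    qed
    have m2: "q \<le> measure lborel (?b - B)"
    proof -
      have "q \<le> measure lebesgue (ball (z k) \<rho> - U k)" using dens(2) by (simp add: q_def)
      also have "\<dots> = measure lebesgue (ball (z k) \<rho> - B)"
        by (rule measure_cong_AE) (use B(2) Us Bl in auto)
      also have "\<dots> \<le> measure lebesgue (?b - B)"
        using Bl by (intro measure_mono_fmeasurable fmeasurable_Diff) auto
      also have "\<dots> = measure lborel (?b - B)" using B(1) by (simp add: measure_completion)
      finally show ?thesis .
    qed
    have "q * q \<le> measure lborel (?b - B) * measure lborel (?b \<inter> B)" using m1 m2 q by (intro mult_mono) auto
    also note iso
    also have "2 * \<rho> * (2 * \<epsilon>) * (pi * (2 * \<rho>)\<^sup>2) = q * q / 2"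
      using \<rho>(1) by (simp add: \<epsilon>_def power2_eq_square power3_eq_cube)
    finally show False using q by simp
  qed
qed

theorem mainTheorem12:
  fixes f :: "R2 \<Rightarrow> real" and w u :: "nat \<Rightarrow> R2 \<Rightarrow> real" and lam :: "nat \<Rightarrow> real"
  assumes f_L2: "L2 f" and f_TV: "TV f < \<infinity>" and f_sub: "subdiffJ f \<noteq> {}"
    and w_L2: "\<forall>n. L2 (w n)"
    and lam_pos: "\<forall>n. lam n > 0" and lam_lim: "lam \<longlonglongrightarrow> 0"
    and w_small: "\<forall>n. L2norm (w n) / lam n \<le> sqrt (4 * pi) / 4"
    and u_min: "\<forall>n. is_minimizer (lam n) (\<lambda>x. f x + w n x) (u n)"
  shows "(\<exists>r::nat \<Rightarrow> nat. strict_mono r \<and>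
           (AE t in lborel.
              ((\<lambda>n. emeasure lebesgue ((lev (u (r n)) t - lev f t) \<union> (lev f t - lev (u (r n)) t)))
                 \<longlonglongrightarrow> 0)
            \<and> (\<forall>E F. (\<forall>n. good_rep (E n) (lev (u (r n)) t)) \<and> good_rep F (lev f t)
                 \<longrightarrow> pk_lim (\<lambda>n. frontier (E n)) (frontier F))))
       \<and> ((\<lambda>n. L2norm (w n) / lam n) \<longlonglongrightarrow> 0 \<longrightarrow>
            suppD f \<subseteq> pk_liminf (\<lambda>n. suppD (u n))
            \<and> pk_liminf (\<lambda>n. suppD (u n)) \<subseteq> pk_limsup (\<lambda>n. suppD (u n))
            \<and> pk_limsup (\<lambda>n. suppD (u n)) \<subseteq> Ext f)"
proof -
  obtain v where v: "calib v f" using f_sub subdiffJ_iff_calib[OF f_L2] by blast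
  define V where "V = (\<lambda>n x. (f x + w n x - u n x) / lam n)"
  obtain v0 z where v0: "calib v0 f" "\<And>v'. calib v' f \<Longrightarrow> L2norm v0 \<le> L2norm v'"
    and zL: "\<And>n. L2 (z n)" and zlim: "(\<lambda>n. L2norm (\<lambda>x. z n x - v0 x)) \<longlonglongrightarrow> 0"
    and cal: "\<And>n. calib (V n) (u n)" and Vz: "\<And>n. L2norm (\<lambda>x. V n x - z n x) \<le> L2norm (w n) / lam n"
    and ulim: "(\<lambda>n. L2norm (\<lambda>x. u n x - f x)) \<longlonglongrightarrow> 0"
    unfolding V_def
  proof (rule dual_convergence[OF f_L2 v lam_pos[rule_format] lam_lim w_L2[rule_format] w_small[rule_format] u_min[rule_format]], goal_cases)
    case (1 v0 z)
    show ?case by (rule 1(1)[OF 1(2-8)])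
  qed
  have VL: "L2 (V n)" and uL: "L2 (u n)" for n using cal by (auto simp: calib_def)
  have v0L: "L2 v0" using v0(1) by (simp add: calib_def)
  have Vz': "L2norm (\<lambda>x. V n x - z n x) \<le> sqrt (4 * pi) / 4" for n using order_trans[OF Vz w_small[rule_format]] .
  obtain r0 N where r0: "r0 > 0" and small: "\<And>n y. n \<ge> N \<Longrightarrow> (\<integral>x. indicator (ball y r0) x * (V n x)\<^sup>2 \<partial>lebesgue) \<le> (3/5 * sqrt pi)\<^sup>2"
    by (rule dual_uniform_smallness[OF v0L zL zlim VL Vz']) blast
  \<comment> \<open>At 0 the set \<open>lev\<close> may have infinite measure and is not reached by
    the calibration of level sets; a single value is a null exception.\<close>
  have "AE t in lborel. t \<noteq> (0::real)" by (rule AE_lborel_singleton)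
  with AE_level_null[OF L2_measurable[OF f_L2]]
  have first: "AE t in lborel.
      ((\<lambda>n. emeasure lebesgue ((lev (u (id n)) t - lev f t) \<union> (lev f t - lev (u (id n)) t))) \<longlonglongrightarrow> 0)
      \<and> (\<forall>E F. (\<forall>n. good_rep (E n) (lev (u (id n)) t)) \<and> good_rep F (lev f t) \<longrightarrow> pk_lim (\<lambda>n. frontier (E n)) (frontier F))"
  proof eventually_elim
    fix t assume t: "emeasure lebesgue {x. f x = t} = 0" "t \<noteq> 0"
    note c = level_sets_converge[OF f_L2 cal ulim r0 small t(2,1)]
    show "((\<lambda>n. emeasure lebesgue ((lev (u (id n)) t - lev f t) \<union> (lev f t - lev (u (id n)) t))) \<longlonglongrightarrow> 0)
      \<and> (\<forall>E F. (\<forall>n. good_rep (E n) (lev (u (id n)) t)) \<and> good_rep F (lev f t) \<longrightarrow> pk_lim (\<lambda>n. frontier (E n)) (frontier F))"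
      using c unfolding id_apply by blast
  qed
  \<comment> \<open>When the noise is negligible against \<open>lam\<close>, the dual variables
    themselves converge to \<open>v0\<close>, not only their noiseless counterparts; this identifies
    the limit calibration with the one in \<open>Ext\<close>.\<close>
  have second: "pk_limsup (\<lambda>n. suppD (u n)) \<subseteq> Ext f" if e: "(\<lambda>n. L2norm (w n) / lam n) \<longlonglongrightarrow> 0"
  proof (rule pk_limsup_suppD_subset_Ext[OF f_L2 cal v0 _ r0 small])
    show "(\<lambda>n. L2norm (\<lambda>x. V n x - v0 x)) \<longlonglongrightarrow> 0"
    proof (rule Lim_null_comparison)
      show "(\<lambda>n. L2norm (w n) / lam n + L2norm (\<lambda>x. z n x - v0 x)) \<longlonglongrightarrow> 0"
        using tendsto_add[OF e zlim] by simp
      show "\<forall>\<^sub>F n in sequentially. norm (L2norm (\<lambda>x. V n x - v0 x)) \<le> L2norm (w n) / lam n + L2norm (\<lambda>x. z n x - v0 x)"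
      proof (rule always_eventually, rule allI)
        fix n
        have "L2norm (\<lambda>x. V n x - v0 x) = norm ((to_l2 (V n) - to_l2 (z n)) + (to_l2 (z n) - to_l2 v0))"
          by (simp add: norm_to_l2[symmetric] L2_diff VL v0L to_l2_diff)
        also have "\<dots> \<le> norm (to_l2 (V n) - to_l2 (z n)) + norm (to_l2 (z n) - to_l2 v0)" by (rule norm_triangle_ineq)
        also have "\<dots> = L2norm (\<lambda>x. V n x - z n x) + L2norm (\<lambda>x. z n x - v0 x)"
          by (simp add: norm_to_l2[symmetric] L2_diff VL v0L zL to_l2_diff)
        finally show "norm (L2norm (\<lambda>x. V n x - v0 x)) \<le> L2norm (w n) / lam n + L2norm (\<lambda>x. z n x - v0 x)"
          using Vz[of n] by (simp add: L2norm_def)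
      qed
    qed
  qed
  show ?thesis
    using first second suppD_subset_pk_liminf[OF f_L2 uL ulim] pk_liminf_subset_limsup strict_mono_id by blast
qed

end
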